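(* Let $n\ge2$ and assume: (A1) $H\in C(\mathbb{R}^n\times\mathbb{R}^n)$ and for each $p$ the map $y\mapsto H(y,p)$ is $\mathbb{Z}^n$-periodic; (A2) $\lim_{|p|\to\infty}\inf_{y\in\mathbb{R}^n}H(y,p)=+\infty$; (A3) for each $y$ the map $p\mapsto H(y,p)$ is convex; (A4) $g:\mathbb{R}^n\to\mathbb{R}$ is bounded, uniformly continuous and Lipschitz; (A5) for each $y\in\mathbb{R}^n$, $\min_{p\in\mathbb{R}^n}H(y,p)=H(y,0)=0$. Let $D\Subset\left(-\frac12,\frac12\right)^n$ be an open connected set containing $0$ with connected $C^1$ boundary, and let $\eta:\left[0,\frac12\right)\to\left[0,\frac12\right)$ satisfy $\lim_{\varepsilon\to0}\eta(\varepsilon)=0$. For $\varepsilon\in\left(0,\frac12\right)$ let $$\Omega^{\eta(\varepsilon)}=\mathbb{R}^n\setminus\bigcup_{m\in\mathbb{Z}^n}\left(m+\eta(\varepsilon)\overline{D}\right),\qquad \Omega_\varepsilon=\varepsilon\,\Omega^{\eta(\varepsilon)}.$$ For $\varepsilon\in(0,\frac12)$ let $u^\varepsilon$ be the viscosity solution of the state-constraint problem $$u^\varepsilon_t+H\left(\tfrac{x}{\varepsilon},Du^\varepsilon\right)\le 0\ \text{ in }\Omega_\varepsilon\times(0,\infty),\quad u^\varepsilon_t+H\left(\tfrac{x}{\varepsilon},Du^\varepsilon\right)\ge 0\ \text{ on }\overline{\Omega}_\varepsilon\times(0,\infty),\quad u^\varepsilon(\cdot,0)=g\ \text{ on }\overline{\Omega}_\varepsilon,$$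 let $\tilde u^\varepsilon$ be the viscosity solution of $$\tilde u^\varepsilon_t+H\left(\tfrac{x}{\varepsilon},D\tilde u^\varepsilon\right)=0\ \text{ in }\mathbb{R}^n\times(0,\infty),\qquad \tilde u^\varepsilon(\cdot,0)=g\ \text{ on }\mathbb{R}^n,$$ and let $\tilde u$ be the viscosity solution of $$\tilde u_t+\overline{H}_0(D\tilde u)=0\ \text{ in }\mathbb{R}^n\times(0,\infty),\qquad \tilde u(\cdot,0)=g\ \text{ on }\mathbb{R}^n,$$ where $\overline{H}_0$ is the effective Hamiltonian of $H$ in the whole space. Then there exists a constant $C>0$ depending only on $n$, $\partial D$, $H$ and $\|Dg\|_{L^\infty(\mathbb{R}^n)}$ such that, for all $\varepsilon\in\left(0,\frac12\right)$ and $(x,t)\in\overline{\Omega}_\varepsilon\times[0,\infty)$, $$\tilde u(x,t)-C\varepsilon\le\tilde u^\varepsilon(x,t)\le u^\varepsilon(x,t)\le\tilde u^\varepsilon(x,t)+C(\varepsilon+\eta(\varepsilon)t)\le\tilde u(x,t)+C(\varepsilon+\eta(\varepsilon)t).$$ In particular, for all $\varepsilon\in(0,\frac12)$ and $(x,t)\in\overline{\Omega}_\varepsilon\times[0,\infty)$, $|u^\varepsilon(x,t)-\tilde u(x,t)|\le C(\varepsilon+\eta(\varepsilon)t)$.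
   Context: State-constraint viscosity solutions: $u^\varepsilon$, continuous on $\overline{\Omega}_\varepsilon\times[0,\infty)$, is a viscosity subsolution in the open set $\Omega_\varepsilon\times(0,\infty)$ in the usual sense and a supersolution on $\overline{\Omega}_\varepsilon\times(0,\infty)$: whenever $\varphi$ is $C^1$ and $u^\varepsilon-\varphi$ has a local minimum relative to $\overline{\Omega}_\varepsilon\times(0,\infty)$ at $(x_0,t_0)$, one has $\varphi_t(x_0,t_0)+H(x_0/\varepsilon,D\varphi(x_0,t_0))\ge0$. The problems are well posed; $u^\varepsilon$, $\tilde u^\varepsilon$, $\tilde u$ denote the unique (globally Lipschitz) viscosity solutions. Effective Hamiltonian in the whole space: for $p\in\mathbb{R}^n$, $\overline{H}_0(p)$ is the unique constant for which $H(y,p+Dv_0(y))=\overline{H}_0(p)$ in $\mathbb{R}^n$ has a $\mathbb{Z}^n$-periodic viscosity solution $v_0$.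
   Formalization: In the last inequality of the chain the right-most C is a possibly larger constant C' with the same dependence, since with equal constants it would say ũ^ε ≤ ũ, which fails e.g. for H = a(y₁)|p| with a non-constant; all other bounds hold with one C. *)

theory Defs
  imports "HOL-Analysis.Analysis" "HOL-Probability.Essential_Supremum"
begin

definition integer_points :: "(real ^ 'n) set" where
  "integer_points = {m. \<forall>i. m $ i \<in> \<int>}"

definition integer_periodic :: "(real ^ 'n \<Rightarrow> real) \<Rightarrow> bool" where
  "integer_periodic f \<longleftrightarrow> (\<forall>m\<in>integer_points. \<forall>y. f (y + m) = f y)"

text \<open>The function \<open>g\<close> is meant to be Lipschitz, so it is differentiable almost everywhere
  and the value at points of non-differentiability is irrelevant.\<close>
definition grad_Linf_norm :: "(real ^ 'n \<Rightarrow> real) \<Rightarrow> ereal" where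
  "grad_Linf_norm g = esssup lebesgue
     (\<lambda>x. if g differentiable (at x) then ereal (onorm (frechet_derivative g (at x))) else 0)"

definition C1_with_gradient :: "'a::euclidean_space set \<Rightarrow> ('a \<Rightarrow> real) \<Rightarrow> ('a \<Rightarrow> 'a) \<Rightarrow> bool" where
  "C1_with_gradient S \<phi> G \<longleftrightarrow> (\<forall>z\<in>S. GDERIV \<phi> z :> G z) \<and> continuous_on S G"

text \<open>Locally, after a rotation of the coordinate axes, the set is the part of a ball lying
  strictly above the graph of a \<open>C\<^sup>1\<close> function. The unit vector \<open>e\<close> is the vertical direction,
  and \<open>\<gamma>\<close> is evaluated only at points of the hyperplane orthogonal to \<open>e\<close>.\<close>
definition has_C1_boundary :: "'a::euclidean_space set \<Rightarrow> bool" where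
  "has_C1_boundary D \<longleftrightarrow>
     (\<forall>x0\<in>frontier D. \<exists>r>0. \<exists>e \<gamma> G. norm e = 1 \<and> C1_with_gradient UNIV \<gamma> G \<and>
        D \<inter> ball x0 r = {x \<in> ball x0 r. x \<bullet> e > \<gamma> (x - (x \<bullet> e) *\<^sub>R e)})"

text \<open>Viscosity inequalities for \<open>F(z, Du(z)) = 0\<close>, with test functions touching \<open>u\<close> relative
  to \<open>S\<close>. Since \<open>S\<close> need not be open, the supersolution notion on a closed set is the
  state-constraint one. Test functions are \<open>C\<^sup>1\<close> on the whole space; as only their germ at the
  touching point matters, this is no restriction.\<close>
definition viscosity_subsolution_on ::
    "'a::euclidean_space set \<Rightarrow> ('a \<Rightarrow> 'a \<Rightarrow> real) \<Rightarrow> ('a \<Rightarrow> real) \<Rightarrow> bool" where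
  "viscosity_subsolution_on S F u \<longleftrightarrow>
     (\<forall>\<phi> G. \<forall>z0\<in>S. C1_with_gradient UNIV \<phi> G \<longrightarrow>
        (\<forall>\<^sub>F z in at z0 within S. u z - \<phi> z \<le> u z0 - \<phi> z0) \<longrightarrow> F z0 (G z0) \<le> 0)"

definition viscosity_supersolution_on ::
    "'a::euclidean_space set \<Rightarrow> ('a \<Rightarrow> 'a \<Rightarrow> real) \<Rightarrow> ('a \<Rightarrow> real) \<Rightarrow> bool" where
  "viscosity_supersolution_on S F u \<longleftrightarrow>
     (\<forall>\<phi> G. \<forall>z0\<in>S. C1_with_gradient UNIV \<phi> G \<longrightarrow>
        (\<forall>\<^sub>F z in at z0 within S. u z - \<phi> z \<ge> u z0 - \<phi> z0) \<longrightarrow> F z0 (G z0) \<ge> 0)"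

text \<open>The operator \<open>u\<^sub>t + F(x, Du)\<close>: a point is \<open>z = (x, t)\<close>, a space-time gradient is \<open>q = (Du, u\<^sub>t)\<close>.\<close>
definition evolution_operator ::
    "(real ^ 'n \<Rightarrow> real ^ 'n \<Rightarrow> real) \<Rightarrow> ((real ^ 'n) \<times> real) \<Rightarrow> ((real ^ 'n) \<times> real) \<Rightarrow> real" where
  "evolution_operator F z q = snd q + F (fst z) (fst q)"

text \<open>Both Cauchy problems are well posed in the class of globally Lipschitz functions, and the
  solutions are understood in this class. The subsolution inequality is required only in the
  open set \<open>\<Omega>\<close>, the supersolution inequality up to its boundary.\<close>
definition state_constraint_solution ::
    "(real ^ 'n) set \<Rightarrow> (real ^ 'n \<Rightarrow> real ^ 'n \<Rightarrow> real) \<Rightarrow> (real ^ 'n \<Rightarrow> real)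
      \<Rightarrow> ((real ^ 'n) \<times> real \<Rightarrow> real) \<Rightarrow> bool" where
  "state_constraint_solution \<Omega> F g u \<longleftrightarrow>
     continuous_on (closure \<Omega> \<times> {0..}) u \<and>
     (\<exists>L. L-lipschitz_on (closure \<Omega> \<times> {0..}) u) \<and>
     viscosity_subsolution_on (\<Omega> \<times> {0<..}) (evolution_operator F) u \<and>
     viscosity_supersolution_on (closure \<Omega> \<times> {0<..}) (evolution_operator F) u \<and>
     (\<forall>x\<in>closure \<Omega>. u (x, 0) = g x)"

definition cauchy_solution ::
    "(real ^ 'n \<Rightarrow> real ^ 'n \<Rightarrow> real) \<Rightarrow> (real ^ 'n \<Rightarrow> real) \<Rightarrow> ((real ^ 'n) \<times> real \<Rightarrow> real) \<Rightarrow> bool" where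
  "cauchy_solution F g u \<longleftrightarrow>
     continuous_on (UNIV \<times> {0..}) u \<and>
     (\<exists>L. L-lipschitz_on (UNIV \<times> {0..}) u) \<and>
     viscosity_subsolution_on (UNIV \<times> {0<..}) (evolution_operator F) u \<and>
     viscosity_supersolution_on (UNIV \<times> {0<..}) (evolution_operator F) u \<and>
     (\<forall>x. u (x, 0) = g x)"

definition cell_solution ::
    "(real ^ 'n \<Rightarrow> real ^ 'n \<Rightarrow> real) \<Rightarrow> real ^ 'n \<Rightarrow> real \<Rightarrow> (real ^ 'n \<Rightarrow> real) \<Rightarrow> bool" where
  "cell_solution H p c v \<longleftrightarrow>
     continuous_on UNIV v \<and> integer_periodic v \<and>
     viscosity_subsolution_on UNIV (\<lambda>y q. H y (p + q) - c) v \<and>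
     viscosity_supersolution_on UNIV (\<lambda>y q. H y (p + q) - c) v"

text \<open>\<open>Hbar p\<close> is the unique constant for which the cell problem has a periodic solution.\<close>
definition is_effective_hamiltonian ::
    "(real ^ 'n \<Rightarrow> real ^ 'n \<Rightarrow> real) \<Rightarrow> (real ^ 'n \<Rightarrow> real) \<Rightarrow> bool" where
  "is_effective_hamiltonian H Hbar \<longleftrightarrow>
     (\<forall>p. (\<exists>v. cell_solution H p (Hbar p) v) \<and>
          (\<forall>c. (\<exists>v. cell_solution H p c v) \<longrightarrow> c = Hbar p))"

definition perforated_space :: "(real ^ 'n) set \<Rightarrow> real \<Rightarrow> (real ^ 'n) set" where
  "perforated_space D r = UNIV - (\<Union>m\<in>integer_points. (\<lambda>x. m + r *\<^sub>R x) ` closure D)"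

definition perforated_domain :: "(real ^ 'n) set \<Rightarrow> (real \<Rightarrow> real) \<Rightarrow> real \<Rightarrow> (real ^ 'n) set" where
  "perforated_domain D \<eta> \<epsilon> = (\<lambda>x. \<epsilon> *\<^sub>R x) ` perforated_space D (\<eta> \<epsilon>)"

text \<open>A remark on constants in a chain
  \<open>v\<^sub>\<epsilon> \<le> u\<^sub>\<epsilon> \<le> v\<^sub>\<epsilon> + C (\<epsilon> + \<eta> t) \<le> v + C (\<epsilon> + \<eta> t)\<close>, where \<open>v\<^sub>\<epsilon>\<close> solves the oscillatory and \<open>v\<close> the
  effective whole-space problem. With literally equal constants the last inequality would say
  \<open>v\<^sub>\<epsilon> \<le> v\<close>, which fails already for \<open>H(y, p) = a(y\<^sub>1) |p|\<close> with \<open>a\<close> positive, periodic and not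
  constant, and \<open>g\<close> a truncation of \<open>x\<^sub>1\<close>: for small \<open>t\<close> one has \<open>v\<^sub>\<epsilon> > v\<close> where \<open>a(x\<^sub>1/\<epsilon>)\<close> is smaller than
  the harmonic mean of \<open>a\<close>. Hence the constant \<open>C\<close> at that one place is generic, i.e. a possibly
  larger \<open>C'\<close> with the same dependencies; every other bound, including the one for
  \<open>|u\<^sub>\<epsilon> - v|\<close>, holds with one constant.\<close>

end

theory Submission
  imports Defs
begin

text \<open>The solution \<open>v\<^sub>\<epsilon>\<close> of the oscillatory whole-space problem is the infimum of \<open>g y + C\<close> over polygonal
  paths from \<open>(y, 0)\<close> to \<open>(x, t)\<close> of action at most \<open>C\<close>. Correctors bound the action from below by the
  effective one, so \<open>v - C \<epsilon> \<le> v\<^sub>\<epsilon>\<close>. In the opposite direction, cutting and regluing the blocks of a path gives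
  \<open>v\<^sub>\<epsilon> \<le> v\<^bsub>\<epsilon>/2\<^esub> + C \<epsilon>\<close>; summing over \<open>\<epsilon> / 2\<^sup>k\<close>, the solutions are up to \<open>C \<epsilon>\<close> below their limit, which is a
  subsolution of the effective problem. State constraints make \<open>u\<^sub>\<epsilon>\<close> a supersolution up to the
  boundary, whence \<open>v\<^sub>\<epsilon> \<le> u\<^sub>\<epsilon>\<close>. For \<open>u\<^sub>\<epsilon> \<le> v\<^sub>\<epsilon> + C (\<epsilon> + \<eta> t)\<close> a nearly optimal path is followed outside of
  cubes of side \<open>\<epsilon> \<eta>\<close> around the holes: it visits at most \<open>C (1 + t / \<epsilon>)\<close> of them, and each is bypassed
  along its surface at the expense of \<open>C \<epsilon> \<eta>\<close>. That \<open>g\<close> has Lipschitz constant \<open>\<parallel>Dg\<parallel>\<^sub>\<infinity>\<close> is Rademacher's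
  theorem.\<close>

text \<open>Coercivity and convexity guarantee only linear growth of \<open>H\<close>, so its
  Lagrangian may be infinite. This is why paths are polygonal, momenta are cut off at
  \<open>norm p \<le> R\<close>, and gaps between pieces of a path are closed at speeds at most
  \<open>a\<close>, where the action rate is at most \<open>b\<close>. The cutoff \<open>R\<close>
  has to exceed the Lipschitz constants of the given solutions, for which no bound in terms of the
  data is assumed; every rate is therefore derived from \<open>a\<close>, \<open>b\<close>,
  \<open>m\<close>, \<open>K\<close>, the dimension and the geometry of \<open>D\<close>, while
  \<open>R\<close> serves qualitative purposes only. The rate \<epsilon> rests on halving paths with
  an error that does not depend on their length; the errors then form a geometric series. A detour
  around a hole makes a path late. Since the order of events cannot be changed, the lateness is
  repaid in advance: the path starts before time \<open>0\<close>, where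
  \<open>g x - m K * t\<close> continues the solution. The price is \<open>m K\<close> per unit of
  lag. The number of detours is controlled because the action of a nearly optimal path bounds its
  length, and distinct holes are a distance of order \<epsilon> apart.\<close>

section \<open>Splitting signed necklaces\<close>

text \<open>When ordered by absolute value, the labels of the elements of \<open>A\<close> are distinct and of alternating
  signs; the smallest one is positive iff \<open>s\<close>.\<close>
definition alternating :: "('a \<Rightarrow> int) \<Rightarrow> bool \<Rightarrow> 'a set \<Rightarrow> bool" where
  "alternating l s A \<longleftrightarrow> inj_on (\<lambda>x. \<bar>l x\<bar>) A \<and>
     (\<forall>y\<in>A. (l y > 0 \<longleftrightarrow> s) \<longleftrightarrow> even (card {x\<in>A. \<bar>l x\<bar> < \<bar>l y\<bar>}))"

text \<open>\<open>q\<close> tells whether \<open>h\<close> keeps all signs or reverses all of them.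
  The first case exchanges two elements with equal labels, the second one passes to the
  antipode.\<close>

lemma alternating_bij_betw:
  assumes b: "bij_betw h A B" and l: "\<And>x. x \<in> A \<Longrightarrow> \<bar>l (h x)\<bar> = \<bar>l x\<bar>"
    "\<And>x. x \<in> A \<Longrightarrow> (l (h x) > 0) = (l x > 0 \<longleftrightarrow> q)" and a: "alternating l (s = q) B"
  shows "alternating l s A"
  unfolding alternating_def
proof (intro conjI ballI)
  have inj: "inj_on h A" and im: "h ` A = B" using b by (auto simp: bij_betw_def)
  have "inj_on (\<lambda>x. \<bar>l (h x)\<bar>) A"
    using a inj im unfolding alternating_def inj_on_def by blast
  then show "inj_on (\<lambda>x. \<bar>l x\<bar>) A" using l(1) by (simp add: inj_on_def)
  fix y assume y: "y \<in> A"
  have "h ` {x\<in>A. \<bar>l x\<bar> < \<bar>l y\<bar>} = {x\<in>B. \<bar>l x\<bar> < \<bar>l (h y)\<bar>}"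
    using im l(1) y by auto
  moreover have "card (h ` {x\<in>A. \<bar>l x\<bar> < \<bar>l y\<bar>}) = card {x\<in>A. \<bar>l x\<bar> < \<bar>l y\<bar>}"
    by (rule card_image, rule inj_on_subset[OF inj]) auto
  ultimately have "card {x\<in>A. \<bar>l x\<bar> < \<bar>l y\<bar>} = card {x\<in>B. \<bar>l x\<bar> < \<bar>l (h y)\<bar>}"
    by simp
  moreover have "((0 < l (h y)) = (s = q)) = even (card {x\<in>B. \<bar>l x\<bar> < \<bar>l (h y)\<bar>})"
  proof -
    have "\<forall>y\<in>B. ((0 < l y) = (s = q)) = even (card {x\<in>B. \<bar>l x\<bar> < \<bar>l y\<bar>})"
      using a by (simp add: alternating_def)
    then show ?thesis using im y by blast
  qed
  ultimately show "((0 < l y) = s) = even (card {x \<in> A. \<bar>l x\<bar> < \<bar>l y\<bar>})"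
    using l(2)[OF y] by argo
qed

text \<open>The value of \<open>e\<close> at the position \<open>k\<close> itself is unconstrained.
  A constant \<open>e\<close> leaves one position, at one end; a block of true values followed by a
  block of false ones leaves the two positions next to the switch; any other pattern leaves
  none.\<close>

lemma odd_card_cut_positions:
  fixes e :: "nat \<Rightarrow> bool"
  shows "odd (card {k. k \<le> m \<and> (\<forall>i<k. e i) \<and> (\<forall>i. k < i \<and> i \<le> m \<longrightarrow> \<not> e i)}) \<longleftrightarrow>
     (\<forall>i\<le>m. e i) \<or> (\<forall>i\<le>m. \<not> e i)" (is "odd (card ?S) \<longleftrightarrow> _")
proof -
  consider (all) "\<forall>i\<le>m. e i" | (none) "\<forall>i\<le>m. \<not> e i"
    | (mix) "\<not> (\<forall>i\<le>m. e i)" "\<not> (\<forall>i\<le>m. \<not> e i)" by blast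
  then show ?thesis
  proof cases
    case all
    then have "k = m" if "k \<in> ?S" for k using that
      by simp (metis le_neq_implies_less order_refl)
    then have "?S = {m}" using all by auto
    then have "card ?S = 1" by (metis is_singletonI is_singleton_altdef)
    then show ?thesis using all by simp
  next
    case none
    then have "k = 0" if "k \<in> ?S" for k using that by (metis (mono_tags, lifting) le0 mem_Collect_eq not_gr_zero)
    then have "?S = {0}" using none by auto
    then have "card ?S = 1" by (metis is_singletonI is_singleton_altdef)
    then show ?thesis using none by simp
  next
    case mix
    define j where "j = (LEAST i. \<not> e i)"
    have j: "\<not> e j" "\<And>i. i < j \<Longrightarrow> e i"
      using mix(1) unfolding j_def by (metis LeastI, metis not_less_Least)
    have jm: "j \<le> m" using mix(1) unfolding j_def by (metis Least_le order_trans)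
    have sub: "k = j \<or> (j > 0 \<and> k = j - 1)" if "k \<in> ?S" for k
    proof -
      have "k \<le> j" using that j(1) by (metis (mono_tags, lifting) mem_Collect_eq not_le_imp_less)
      moreover have "\<not> k < j - 1" using that j jm by fastforce
      ultimately show ?thesis by linarith
    qed
    show ?thesis
    proof (cases "\<forall>i. j < i \<and> i \<le> m \<longrightarrow> \<not> e i")
      case True
      then have "j > 0" using mix j by (metis gr0I linorder_neqE_nat not_less_zero)
      then have "j - 1 \<in> ?S" "j \<in> ?S" using True j jm
        by auto (metis Suc_lessI Suc_pred linorder_neqE_nat not_less_eq)
      then have "?S = {j - 1, j}" using sub by auto
      moreover have "j - 1 \<noteq> j" using \<open>j > 0\<close> by simp
      ultimately have "card ?S = 2" by (metis card_2_iff)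
      then show ?thesis using mix by simp
    next
      case False
      have "?S = {}"
      proof (rule equals0I)
        fix k assume k: "k \<in> ?S"
        then have "k \<le> j" using sub by fastforce
        moreover have "\<forall>i. k < i \<and> i \<le> m \<longrightarrow> \<not> e i" using k by simp
        ultimately show False using False by (meson order.strict_trans1)
      qed
      then have 0: "card ?S = 0" by (metis card.empty)
      show ?thesis unfolding 0 using mix by simp
    qed
  qed
qed

text \<open>Deleting \<open>x\<close> lowers all later ranks by one and so reverses the sign
  expected there. Hence the facet alternates iff the signs fit before \<open>x\<close> and misfit
  after it, and \<open>odd_card_cut_positions\<close> counts such \<open>x\<close>. If two labels
  have the same absolute value, they are equal, and good facets come in pairs.\<close>

lemma odd_card_alternating_facets:
  assumes fin: "finite A" and ne: "A \<noteq> {}"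
    and comp: "\<And>x y. x \<in> A \<Longrightarrow> y \<in> A \<Longrightarrow> l x \<noteq> - l y"
  shows "odd (card {x\<in>A. alternating l True (A - {x})}) \<longleftrightarrow> (\<exists>s. alternating l s A)"
proof (cases "inj_on (\<lambda>x. \<bar>l x\<bar>) A")
  case inj: True
  define r where "r x = card {y\<in>A. \<bar>l y\<bar> < \<bar>l x\<bar>}" for x
  define m where "m = card A - 1"
  have mA: "card A = Suc m" using fin ne by (simp add: m_def card_gt_0_iff)
  have less: "r x < r y \<longleftrightarrow> \<bar>l x\<bar> < \<bar>l y\<bar>" if "x \<in> A" "y \<in> A" for x y
  proof -
    have *: "r x < r y" if "\<bar>l x\<bar> < \<bar>l y\<bar>" "x \<in> A" for x y
      unfolding r_def by (rule psubset_card_mono) (use that fin in auto)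
    have "r x = r y" if "\<bar>l x\<bar> = \<bar>l y\<bar>" using that by (simp add: r_def)
    then show ?thesis using * that by (metis linorder_less_linear order_less_asym)
  qed
  have injr: "inj_on r A"
    by (rule inj_onI) (metis inj inj_onD less linorder_less_linear order_less_irrefl)
  have rle: "r x \<le> m" if "x \<in> A" for x
  proof -
    have "r x < card A" unfolding r_def by (rule psubset_card_mono) (use fin that in auto)
    then show ?thesis using mA by simp
  qed
  have imr: "r ` A = {..m}"
    by (rule card_subset_eq) (use rle mA injr in \<open>auto simp: card_image\<close>)
  \<comment> \<open>\<open>e i\<close> holds if the element of rank \<open>i\<close> carries the
    sign required by an alternation that starts positively.\<close>
  define e where "e i \<longleftrightarrow> (l (inv_into A r i) > 0 \<longleftrightarrow> even i)" for i
  have e: "e (r y) \<longleftrightarrow> (l y > 0 \<longleftrightarrow> even (r y))" if "y \<in> A" for y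
    using that injr by (simp add: e_def)
  have alt: "alternating l True (A - {x}) \<longleftrightarrow>
      (\<forall>i<r x. e i) \<and> (\<forall>i. r x < i \<and> i \<le> m \<longrightarrow> \<not> e i)" if x: "x \<in> A" for x
  proof -
    have c: "card {z \<in> A - {x}. \<bar>l z\<bar> < \<bar>l y\<bar>} = (if r x < r y then r y - 1 else r y)" if "y \<in> A" for y
    proof -
      have "{z \<in> A - {x}. \<bar>l z\<bar> < \<bar>l y\<bar>} = {z \<in> A. \<bar>l z\<bar> < \<bar>l y\<bar>} - {x}" by auto
      then show ?thesis using less[OF x that] x fin by (simp add: r_def)
    qed
    have "alternating l True (A - {x}) \<longleftrightarrow>
        (\<forall>y\<in>A-{x}. (l y > 0) = even (card {z \<in> A - {x}. \<bar>l z\<bar> < \<bar>l y\<bar>}))"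
      unfolding alternating_def using inj by (auto intro: inj_on_subset)
    also have "\<dots> \<longleftrightarrow> (\<forall>y\<in>A-{x}. if r x < r y then \<not> e (r y) else e (r y))"
    proof (rule ball_cong[OF refl])
      fix y assume y: "y \<in> A - {x}"
      have "odd (r y - 1) = even (r y)" if "r x < r y" using that by (cases "r y") auto
      then show "((l y > 0) = even (card {z \<in> A - {x}. \<bar>l z\<bar> < \<bar>l y\<bar>})) = (if r x < r y then \<not> e (r y) else e (r y))"
        using y c[of y] e[of y] by auto
    qed
    also have "\<dots> \<longleftrightarrow> (\<forall>i\<in>{..m}. i \<noteq> r x \<longrightarrow> (if r x < i then \<not> e i else e i))"
      unfolding imr[symmetric] using injr x by (auto simp: inj_on_def)
    also have "\<dots> \<longleftrightarrow> (\<forall>i<r x. e i) \<and> (\<forall>i. r x < i \<and> i \<le> m \<longrightarrow> \<not> e i)"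
      using rle[OF x] by (auto simp: not_less order.strict_implies_order)
    finally show ?thesis .
  qed
  have "r ` {x\<in>A. P (r x)} = {k. k \<le> m \<and> P k}" for P
    using imr by auto
  from this[of "\<lambda>k. (\<forall>i<k. e i) \<and> (\<forall>i. k < i \<and> i \<le> m \<longrightarrow> \<not> e i)"]
  have "r ` {x\<in>A. alternating l True (A - {x})} =
      {k. k \<le> m \<and> (\<forall>i<k. e i) \<and> (\<forall>i. k < i \<and> i \<le> m \<longrightarrow> \<not> e i)}"
    using alt by (simp cong: conj_cong)
  moreover have "card (r ` {x\<in>A. alternating l True (A - {x})}) = card {x\<in>A. alternating l True (A - {x})}"
    by (rule card_image, rule inj_on_subset[OF injr]) auto
  ultimately have "card {x\<in>A. alternating l True (A - {x})} =
     card {k. k \<le> m \<and> (\<forall>i<k. e i) \<and> (\<forall>i. k < i \<and> i \<le> m \<longrightarrow> \<not> e i)}"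
    by simp
  then have "odd (card {x\<in>A. alternating l True (A - {x})}) \<longleftrightarrow> (\<forall>i\<le>m. e i) \<or> (\<forall>i\<le>m. \<not> e i)"
    using odd_card_cut_positions[of m e] by simp
  also have "\<dots> \<longleftrightarrow> (\<forall>y\<in>A. e (r y)) \<or> (\<forall>y\<in>A. \<not> e (r y))"
    using ball_simps(9)[of r A e] ball_simps(9)[of r A "\<lambda>i. \<not> e i"] unfolding imr by (simp add: Ball_def)
  also have "\<dots> \<longleftrightarrow> alternating l True A \<or> alternating l False A"
    unfolding alternating_def using inj e by (auto simp: r_def)
  also have "\<dots> \<longleftrightarrow> (\<exists>s. alternating l s A)" by (metis (full_types))
  finally show ?thesis .
next
  case False
  then obtain x y where xy: "x \<in> A" "y \<in> A" "x \<noteq> y" "\<bar>l x\<bar> = \<bar>l y\<bar>" by (auto simp: inj_on_def)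
  then have lxy: "l x = l y" using comp[of x y] by (auto simp: abs_if split: if_splits)
  have sub: "z = x \<or> z = y" if "alternating l True (A - {z})" for z
    using that xy unfolding alternating_def inj_on_def by auto
  \<comment> \<open>Since \<open>x\<close> and \<open>y\<close> have the same label, they can
    replace each other in a facet.\<close>
  have imp: "alternating l True (A - {x})" if "alternating l True (A - {y})" "x \<in> A" "y \<in> A" "x \<noteq> y" "l x = l y" for x y
  proof (rule alternating_bij_betw[where h = "id(y := x)" and q = True])
    show "bij_betw (id(y := x)) (A - {x}) (A - {y})"
      unfolding bij_betw_def inj_on_def using that by (auto simp: image_iff)
  qed (use that in auto)
  have "{z\<in>A. alternating l True (A - {z})} = {} \<or> {z\<in>A. alternating l True (A - {z})} = {x, y}"
    using sub imp[of y x] imp[of x y] xy lxy by auto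
  then have "even (card {z\<in>A. alternating l True (A - {z})})"
    using xy(3) by (auto simp only: card.empty) auto
  moreover have "\<not> alternating l s A" for s using False by (auto simp: alternating_def)
  ultimately show ?thesis by blast
qed

section \<open>Flags of faces of the cross-polytope\<close>

definition signed_sets :: "nat \<Rightarrow> (nat \<times> bool) set set" where
  "signed_sets N = {X. X \<noteq> {} \<and> X \<subseteq> {..<N} \<times> UNIV \<and> (\<forall>i. \<not> ((i, True) \<in> X \<and> (i, False) \<in> X))}"

text \<open>Simplices of the barycentric subdivision; \<open>k\<close> counts vertices, so the
  dimension is \<open>k - 1\<close>.\<close>

definition signed_chains :: "nat \<Rightarrow> nat \<Rightarrow> (nat \<times> bool) set set set" where
  "signed_chains N k = {\<sigma>. \<sigma> \<subseteq> signed_sets N \<and> card \<sigma> = k \<and> (\<forall>X\<in>\<sigma>. \<forall>Y\<in>\<sigma>. X \<subseteq> Y \<or> Y \<subseteq> X)}"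

definition opposite :: "(nat \<times> bool) set \<Rightarrow> (nat \<times> bool) set" where
  "opposite X = (\<lambda>(i, b). (i, \<not> b)) ` X"

lemma mem_opposite [simp]: "(i, b) \<in> opposite X \<longleftrightarrow> (i, \<not> b) \<in> X"
  unfolding opposite_def by force

lemma opposite_opposite [simp]: "opposite (opposite X) = X"
  by auto

lemma opposite_subset [simp]: "opposite X \<subseteq> opposite Y \<longleftrightarrow> X \<subseteq> Y"
  by auto (metis mem_opposite opposite_opposite subsetD)+

lemma inj_opposite: "inj opposite"
  by (metis injI opposite_opposite)

lemma opposite_signed_sets [simp]: "opposite X \<in> signed_sets N \<longleftrightarrow> X \<in> signed_sets N"
proof -
  have "opposite X \<in> signed_sets N" if "X \<in> signed_sets N" for X
    using that unfolding signed_sets_def opposite_def by fastforce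
  then show ?thesis by (metis opposite_opposite)
qed

lemma finite_signed_sets: "finite (signed_sets N)"
  by (rule finite_subset[of _ "Pow ({..<N} \<times> UNIV)"]) (auto simp: signed_sets_def)

lemma signed_sets_mono: "signed_sets N \<subseteq> signed_sets (Suc N)"
  unfolding signed_sets_def by fastforce

lemma signed_sets_subset: "X \<in> signed_sets N \<Longrightarrow> Y \<subseteq> X \<Longrightarrow> Y \<noteq> {} \<Longrightarrow> Y \<in> signed_sets N"
  unfolding signed_sets_def by blast

lemma signed_sets_finite: "X \<in> signed_sets N \<Longrightarrow> finite X"
  by (rule finite_subset[of _ "{..<N} \<times> UNIV"]) (auto simp: signed_sets_def)

lemma signed_sets_inj_fst: "X \<in> signed_sets N \<Longrightarrow> inj_on fst X"
  unfolding signed_sets_def by (auto simp: inj_on_def) (metis (full_types))+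

lemma signed_sets_card: assumes "X \<in> signed_sets N" shows "1 \<le> card X" "card X \<le> N"
proof -
  show "1 \<le> card X" using assms signed_sets_finite[OF assms] by (auto simp: signed_sets_def Suc_le_eq card_gt_0_iff)
  have "card X = card (fst ` X)" using signed_sets_inj_fst[OF assms] by (simp add: card_image)
  also have "\<dots> \<le> card {..<N}" by (rule card_mono) (use assms in \<open>auto simp: signed_sets_def\<close>)
  finally show "card X \<le> N" by simp
qed

lemma signed_chains_finite: "\<sigma> \<in> signed_chains N k \<Longrightarrow> finite \<sigma>"
  unfolding signed_chains_def using finite_subset[OF _ finite_signed_sets] by auto

lemma finite_signed_chains: "finite (signed_chains N k)"
  by (rule finite_subset[of _ "Pow (signed_sets N)"]) (auto simp: signed_chains_def finite_signed_sets)

lemma signed_chain_card_inj: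
  assumes "X \<in> signed_sets N" "Y \<in> signed_sets N" "X \<subseteq> Y \<or> Y \<subseteq> X" "card X = card Y"
  shows "X = Y"
  using assms by (metis card_subset_eq signed_sets_finite)

lemma signed_chain_card_less:
  assumes "X \<in> signed_sets N" "Y \<in> signed_sets N" "X \<subseteq> Y \<or> Y \<subseteq> X" "card X \<le> card Y"
  shows "X \<subseteq> Y"
  using assms by (metis card_seteq signed_sets_finite subset_refl)

text \<open>Vertices of the closed half of the sphere on which the last coordinate is not negative;
  those on its equator are \<open>signed_sets N\<close>.\<close>

definition hemisphere :: "nat \<Rightarrow> (nat \<times> bool) set set" where
  "hemisphere N = {X \<in> signed_sets (Suc N). (N, False) \<notin> X}"

text \<open>The chain omits exactly one cardinality \<open>k\<close> between \<open>1\<close> and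
  \<open>N + 1\<close>. If \<open>k \<le> N\<close>, the missing set lies between neighbours
  \<open>L\<close> and \<open>U\<close> that differ by two elements, which gives two choices. If
  \<open>k = N + 1\<close>, the largest set \<open>L\<close> lacks one coordinate \<open>j\<close>;
  both signs can be added, except that for \<open>j = N\<close> the hemisphere admits only the
  positive one. The last case is that of a chain on the equator.\<close>

lemma card_chain_extensions:
  assumes \<tau>: "\<tau> \<in> signed_chains (Suc N) N" and B: "\<tau> \<subseteq> hemisphere N"
  shows "card {X \<in> hemisphere N - \<tau>. \<forall>Y\<in>\<tau>. X \<subseteq> Y \<or> Y \<subseteq> X} = (if \<tau> \<subseteq> signed_sets N then 1 else 2)"
    (is "card ?E = _")
proof -
  have sub: "\<tau> \<subseteq> signed_sets (Suc N)" and cN: "card \<tau> = N"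
    and ch: "\<And>X Y. X \<in> \<tau> \<Longrightarrow> Y \<in> \<tau> \<Longrightarrow> X \<subseteq> Y \<or> Y \<subseteq> X"
    using \<tau> unfolding signed_chains_def by auto
  have fin: "finite \<tau>" using \<tau> by (rule signed_chains_finite)
  have "inj_on card \<tau>" using sub ch signed_chain_card_inj by (meson inj_onI subsetD)
  then have "card (card ` \<tau>) = N" using cN by (simp add: card_image)
  moreover have cs: "card ` \<tau> \<subseteq> {1..Suc N}" using sub signed_sets_card by fastforce
  ultimately have "card ({1..Suc N} - card ` \<tau>) = 1" using fin by (simp add: card_Diff_subset)
  then obtain k where k: "{1..Suc N} - card ` \<tau> = {k}" by (rule card_1_singletonE)
  then have k1: "1 \<le> k" "k \<le> Suc N" and kn: "k \<notin> card ` \<tau>" by auto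
  have has: "\<exists>Y\<in>\<tau>. card Y = i" if "1 \<le> i" "i \<le> Suc N" "i \<noteq> k" for i
    using k that by (metis Diff_iff atLeastAtMost_iff imageE singletonD)
  obtain L where L: "card L = k - 1" "L = {} \<or> L \<in> \<tau>" "finite L"
  proof (cases "k = 1")
    case True then show ?thesis using that[of "{}"] by simp
  next
    case False
    then have "1 \<le> k - 1" "k - 1 \<le> Suc N" "k - 1 \<noteq> k" using k1 by auto
    then obtain Y where "Y \<in> \<tau>" "card Y = k - 1" using has by blast
    then show ?thesis using that sub signed_sets_finite by blast
  qed
  have Lbelow: "Y \<subseteq> L" if "Y \<in> \<tau>" "card Y < k" for Y
  proof -
    have "card Y \<ge> 1" using that sub signed_sets_card by blast
    then have "L \<noteq> {}" using that L(1) by auto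
    then have "L \<in> \<tau>" using L(2) by simp
    moreover have "card Y \<le> card L" using that L(1) by simp
    ultimately show ?thesis using that sub ch[of Y L] signed_chain_card_less[of Y "Suc N" L] by blast
  qed
  have Ecard: "card X = k" if "X \<in> ?E" for X
  proof (rule ccontr)
    assume "card X \<noteq> k"
    moreover have "X \<in> signed_sets (Suc N)" using that by (auto simp: hemisphere_def)
    ultimately obtain Y where "Y \<in> \<tau>" "card Y = card X" using has[of "card X"] signed_sets_card by metis
    then show False using that signed_chain_card_inj[OF \<open>X \<in> signed_sets (Suc N)\<close>, of Y] sub by auto
  qed
  have EL: "L \<subseteq> X" if "X \<in> ?E" for X
    using L(2)
  proof
    assume "L \<in> \<tau>"
    then show ?thesis using signed_chain_card_less[of L "Suc N" X] that L(1) Ecard[OF that] sub k1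
      by (auto simp: hemisphere_def)
  qed simp
  have notE: "X \<notin> \<tau>" if "card X = k" for X using that kn by blast
  have ins: "\<exists>x. x \<notin> L \<and> X = insert x L" if "L \<subseteq> X" "card X = k" for X
  proof -
    have "finite X" using that k1 by (metis card.infinite not_one_le_zero)
    then have "card (X - L) = 1" using that L k1 by (simp add: card_Diff_subset)
    then obtain x where "X - L = {x}" by (rule card_1_singletonE)
    then show ?thesis using that by blast
  qed
  show ?thesis
  proof (cases "k = Suc N")
    case False
    then have kN: "k \<le> N" using k1 by simp
    obtain U where U: "U \<in> \<tau>" "card U = Suc k" using has[of "Suc k"] kN by auto
    have Us: "U \<in> signed_sets (Suc N)" using U sub by blast
    have Uabove: "U \<subseteq> Y" if "Y \<in> \<tau>" "k < card Y" for Y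
      using signed_chain_card_less[of U "Suc N" Y] that U sub ch by auto
    have "L \<subseteq> U"
      using L(2)
    proof
      assume "L \<in> \<tau>"
      from signed_chain_card_less[OF subsetD[OF sub this] subsetD[OF sub U(1)] ch[OF this U(1)]]
      show ?thesis using U(2) L(1) by simp
    qed simp
    then have "card (U - L) = 2" using U L k1 by (simp add: card_Diff_subset)
    then obtain p q where pq: "U - L = {p, q}" "p \<noteq> q" by (meson card_2_iff)
    have "?E = {insert p L, insert q L}"
    proof
      show "?E \<subseteq> {insert p L, insert q L}"
      proof
        fix X assume X: "X \<in> ?E"
        then obtain x where x: "x \<notin> L" "X = insert x L" using ins EL Ecard by blast
        have "X \<subseteq> U" using signed_chain_card_less[of X "Suc N" U] X U Us Ecard[OF X] by (auto simp: hemisphere_def)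
        then have "x \<in> U - L" using x by simp
        then show "X \<in> {insert p L, insert q L}" using x(2) unfolding pq(1) by auto
      qed
      show "{insert p L, insert q L} \<subseteq> ?E"
      proof
        fix X assume "X \<in> {insert p L, insert q L}"
        then obtain x where x: "X = insert x L" "x \<in> U" "x \<notin> L" using pq by blast
        then have c: "card X = k" using L k1 by simp
        have "X \<subseteq> U" using x \<open>L \<subseteq> U\<close> by simp
        then have "X \<in> signed_sets (Suc N)" using Us signed_sets_subset x(1) by blast
        moreover have "(N, False) \<notin> X" using \<open>X \<subseteq> U\<close> U B by (auto simp: hemisphere_def)
        moreover have "X \<subseteq> Y \<or> Y \<subseteq> X" if "Y \<in> \<tau>" for Y
          using Lbelow[OF that] Uabove[OF that] \<open>X \<subseteq> U\<close> x(1) kn that by (metis image_eqI linorder_neqE_nat subset_insertI2 subset_trans)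
        ultimately show "X \<in> ?E" using notE[OF c] by (simp add: hemisphere_def)
      qed
    qed
    moreover have "insert p L \<noteq> insert q L" using pq by blast
    ultimately have "card ?E = 2" by (metis card_2_iff)
    moreover have "\<not> \<tau> \<subseteq> signed_sets N"
      using has[of "Suc N"] False signed_sets_card(2) by (metis Suc_n_not_le_n le_add1 order_refl plus_1_eq_Suc subsetD)
    ultimately show ?thesis by simp
  next
    case True
    have Lall: "Y \<subseteq> L" if "Y \<in> \<tau>" for Y
      using Lbelow[OF that] True cs that by (metis atLeastAtMost_iff image_subset_iff kn image_eqI le_neq_implies_less)
    have LN: "card L = N" using L True by simp
    have Ls: "L \<subseteq> {..<Suc N} \<times> UNIV" "\<And>i. \<not> ((i, True) \<in> L \<and> (i, False) \<in> L)" "(N, False) \<notin> L"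
      using L(2) sub B by (auto simp: signed_sets_def hemisphere_def)
    have "inj_on fst L" using L(2) sub signed_sets_inj_fst by (metis inj_on_empty subsetD)
    then have "card (fst ` L) = N" using LN by (simp add: card_image)
    then have "card ({..<Suc N} - fst ` L) = 1" using Ls(1) L(3) by (subst card_Diff_subset) auto
    then obtain j where j: "{..<Suc N} - fst ` L = {j}" by (rule card_1_singletonE)
    have jN: "j \<le> N" "j \<notin> fst ` L" using j by auto
    have mem: "insert (j, b) L \<in> ?E" if "\<not> (j = N \<and> \<not> b)" for b
    proof -
      have jb: "(j, c) \<notin> L" for c using jN(2) by force
      have "insert (j, b) L \<in> hemisphere N" using Ls jN that jb by (auto simp: hemisphere_def signed_sets_def)
      moreover have "card (insert (j, b) L) = k" using jb L LN True by simp
      ultimately show ?thesis using notE Lall by auto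
    qed
    have E: "\<exists>b. X = insert (j, b) L \<and> \<not> (j = N \<and> \<not> b)" if X: "X \<in> ?E" for X
    proof -
      obtain x where x: "x \<notin> L" "X = insert x L" using ins EL[OF X] Ecard[OF X] by blast
      obtain i b where ib: "x = (i, b)" by fastforce
      have Xs: "X \<in> signed_sets (Suc N)" "(N, False) \<notin> X" using X by (auto simp: hemisphere_def)
      have "i \<notin> fst ` L" using signed_sets_inj_fst[OF Xs(1)] x ib unfolding inj_on_def by force
      moreover have "i < Suc N" using Xs x ib by (auto simp: signed_sets_def)
      ultimately have "i = j" using j by blast
      then show ?thesis using x ib Xs(2) by (cases b) auto
    qed
    have lt: "\<tau> \<subseteq> signed_sets N \<longleftrightarrow> j = N"
    proof
      assume t: "\<tau> \<subseteq> signed_sets N"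
      have "L \<subseteq> {..<N} \<times> UNIV" using L(2) t by (auto simp: signed_sets_def)
      then have "N \<notin> fst ` L" by auto
      then show "j = N" using j by (metis Diff_iff lessThan_iff lessI singletonD)
    next
      assume "j = N"
      have "i < N" if "(i, b) \<in> L" for i b
      proof -
        have "i < Suc N" using that Ls(1) by auto
        moreover have "i \<noteq> N" using jN(2) that \<open>j = N\<close> by force
        ultimately show ?thesis by simp
      qed
      then have "L \<subseteq> {..<N} \<times> UNIV" by auto
      then show "\<tau> \<subseteq> signed_sets N" using Lall sub by (fastforce simp: signed_sets_def)
    qed
    show ?thesis
    proof (cases "j = N")
      case True
      then have "?E = {insert (j, True) L}" using E mem[of True] by blast
      then have "card ?E = 1" by (metis is_singletonI is_singleton_altdef)
      then show ?thesis using lt True by simp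
    next
      case False
      have pair: "A = {a, b}" if "a \<in> A" "b \<in> A" "\<And>x. x \<in> A \<Longrightarrow> x = a \<or> x = b" for A and a b :: "(nat \<times> bool) set"
        using that by blast
      have "?E = {insert (j, True) L, insert (j, False) L}"
      proof (rule pair)
        show "insert (j, True) L \<in> ?E" "insert (j, False) L \<in> ?E"
          by (rule mem, use False in simp)+
        show "X = insert (j, True) L \<or> X = insert (j, False) L" if XE: "X \<in> ?E" for X
        proof -
          obtain b where "X = insert (j, b) L" using E[OF XE] by blast
          then show ?thesis by (cases b) auto
        qed
      qed
      moreover have "(j, False) \<notin> L" using jN(2) by force
      then have "insert (j, True) L \<noteq> insert (j, False) L" by auto
      ultimately have "card ?E = 2" by (metis card_2_iff)
      then show ?thesis using lt False by simp
    qed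
  qed
qed

text \<open>Ky Fan's parity theorem for the barycentric subdivision of the octahedral sphere, whose vertices are
  the signed sets. The induction counts alternating chains of a hemisphere by their facets; the
  boundary of the hemisphere is the sphere of one dimension less.\<close>
theorem odd_card_alternating_chains:
  assumes anti: "\<And>X. X \<in> signed_sets N \<Longrightarrow> l (opposite X) = - l X"
    and comp: "\<And>X Y. X \<in> signed_sets N \<Longrightarrow> Y \<in> signed_sets N \<Longrightarrow> X \<subseteq> Y \<Longrightarrow> l X \<noteq> - l Y"
  shows "odd (card {\<sigma> \<in> signed_chains N N. alternating l True \<sigma>})"
  using assms
proof (induction N)
  case 0
  have "signed_chains 0 0 = {{}}" by (auto simp: signed_chains_def signed_sets_def)
  then have "{\<sigma> \<in> signed_chains 0 0. alternating l True \<sigma>} = {{}}" by (auto simp: alternating_def)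
  then show ?case by simp
next
  case (Suc N)
  note anti = Suc.prems(1) and comp = Suc.prems(2)
  have IH: "odd (card {\<sigma> \<in> signed_chains N N. alternating l True \<sigma>})"
    using Suc.IH anti comp signed_sets_mono by (meson subsetD)
  let ?F = "{\<sigma> \<in> signed_chains (Suc N) (Suc N). \<sigma> \<subseteq> hemisphere N}"
  let ?T = "{\<tau> \<in> signed_chains (Suc N) N. \<tau> \<subseteq> hemisphere N \<and> alternating l True \<tau>}"
  let ?R = "\<lambda>\<sigma> \<tau>. \<tau> \<subseteq> \<sigma>"
  have finF: "finite ?F" and finT: "finite ?T" using finite_signed_chains by auto
  have comp': "l X \<noteq> - l Y" if "\<sigma> \<in> signed_chains (Suc N) k" "X \<in> \<sigma>" "Y \<in> \<sigma>" for \<sigma> k X Y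
    using that comp[of X Y] comp[of Y X] unfolding signed_chains_def by fastforce
  \<comment> \<open>Incident pairs are counted twice modulo 2: over chains of the hemisphere the odd
    summands belong to alternating chains of either sign, over facets they belong to facets on the
    equator, which the induction hypothesis counts.\<close>
  have "(\<Sum>\<sigma>\<in>?F. card {\<tau>\<in>?T. \<tau> \<subseteq> \<sigma>}) = (\<Sum>\<tau>\<in>?T. card {\<sigma>\<in>?F. \<tau> \<subseteq> \<sigma>})"
    using sum_card_image sum.swap_restrict[OF finF finT, of "\<lambda>_ _. 1::nat" ?R] by simp
  moreover have "odd (card {\<tau>\<in>?T. \<tau> \<subseteq> \<sigma>}) \<longleftrightarrow> (\<exists>s. alternating l s \<sigma>)" if s: "\<sigma> \<in> ?F" for \<sigma>
  proof -
    have fin: "finite \<sigma>" using s signed_chains_finite by blast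
    have c: "card \<sigma> = Suc N" using s by (simp add: signed_chains_def)
    have "{\<tau>\<in>?T. \<tau> \<subseteq> \<sigma>} = (\<lambda>x. \<sigma> - {x}) ` {x\<in>\<sigma>. alternating l True (\<sigma> - {x})}" (is "?l = ?r")
    proof
      show "?l \<subseteq> ?r"
      proof
        fix \<tau> assume t: "\<tau> \<in> ?l"
        then have "card \<tau> = N" by (auto simp: signed_chains_def)
        then have "card (\<sigma> - \<tau>) = 1" using t fin c by (subst card_Diff_subset) (auto intro: finite_subset)
        then obtain x where "\<sigma> - \<tau> = {x}" by (rule card_1_singletonE)
        then have "\<tau> = \<sigma> - {x}" "x \<in> \<sigma>" using t by auto
        then show "\<tau> \<in> ?r" using t by auto
      qed
      show "?r \<subseteq> ?l" using s c fin by (auto simp: signed_chains_def)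
    qed
    moreover have "inj_on (\<lambda>x. \<sigma> - {x}) \<sigma>" by (auto simp: inj_on_def)
    ultimately have "card {\<tau>\<in>?T. \<tau> \<subseteq> \<sigma>} = card {x\<in>\<sigma>. alternating l True (\<sigma> - {x})}"
      by (simp add: card_image inj_on_def)
    then show ?thesis using odd_card_alternating_facets[OF fin, of l] c comp' s by fastforce
  qed
  moreover have "odd (card {\<sigma>\<in>?F. \<tau> \<subseteq> \<sigma>}) \<longleftrightarrow> \<tau> \<subseteq> signed_sets N" if t: "\<tau> \<in> ?T" for \<tau>
  proof -
    have fin: "finite \<tau>" using t signed_chains_finite by blast
    have c: "card \<tau> = N" using t by (simp add: signed_chains_def)
    have "{\<sigma>\<in>?F. \<tau> \<subseteq> \<sigma>} = (\<lambda>X. insert X \<tau>) ` {X \<in> hemisphere N - \<tau>. \<forall>Y\<in>\<tau>. X \<subseteq> Y \<or> Y \<subseteq> X}" (is "?l = ?r")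
    proof
      show "?l \<subseteq> ?r"
      proof
        fix \<sigma> assume s: "\<sigma> \<in> ?l"
        then have "finite \<sigma>" using signed_chains_finite by blast
        moreover have "card \<sigma> = Suc N" using s by (simp add: signed_chains_def)
        ultimately have "card (\<sigma> - \<tau>) = 1" using s fin c by (subst card_Diff_subset) auto
        then obtain X where "\<sigma> - \<tau> = {X}" by (rule card_1_singletonE)
        then have "\<sigma> = insert X \<tau>" "X \<notin> \<tau>" "X \<in> \<sigma>" using s by auto
        then show "\<sigma> \<in> ?r" using s by (auto simp: signed_chains_def)
      qed
      show "?r \<subseteq> ?l" using t c fin by (auto simp: signed_chains_def hemisphere_def)
    qed
    moreover have "inj_on (\<lambda>X. insert X \<tau>) {X \<in> hemisphere N - \<tau>. \<forall>Y\<in>\<tau>. X \<subseteq> Y \<or> Y \<subseteq> X}"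
      by (auto simp: inj_on_def)
    ultimately have "card {\<sigma>\<in>?F. \<tau> \<subseteq> \<sigma>} = card {X \<in> hemisphere N - \<tau>. \<forall>Y\<in>\<tau>. X \<subseteq> Y \<or> Y \<subseteq> X}"
      by (simp add: card_image)
    then show ?thesis using card_chain_extensions[of \<tau> N] t by auto
  qed
  ultimately have "odd (card {\<sigma>\<in>?F. \<exists>s. alternating l s \<sigma>}) \<longleftrightarrow> odd (card {\<tau>\<in>?T. \<tau> \<subseteq> signed_sets N})"
    using even_sum_iff[OF finF, of "\<lambda>\<sigma>. card {\<tau>\<in>?T. \<tau> \<subseteq> \<sigma>}"]
      even_sum_iff[OF finT, of "\<lambda>\<tau>. card {\<sigma>\<in>?F. \<tau> \<subseteq> \<sigma>}"] by (simp cong: conj_cong)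
  moreover have "{\<tau>\<in>?T. \<tau> \<subseteq> signed_sets N} = {\<sigma> \<in> signed_chains N N. alternating l True \<sigma>}"
    using signed_sets_mono by (auto simp: signed_chains_def hemisphere_def signed_sets_def)
  ultimately have odd1: "odd (card {\<sigma>\<in>?F. \<exists>s. alternating l s \<sigma>})" using IH by simp
  have ne: "\<sigma> \<noteq> {}" if "\<sigma> \<in> signed_chains (Suc N) (Suc N)" for \<sigma> using that by (auto simp: signed_chains_def)
  have excl: "\<not> (alternating l True \<sigma> \<and> alternating l False \<sigma>)" if "\<sigma> \<noteq> {}" for \<sigma>
    using that by (auto simp: alternating_def)
  have "{\<sigma>\<in>?F. \<exists>s. alternating l s \<sigma>} = {\<sigma>\<in>?F. alternating l True \<sigma>} \<union> {\<sigma>\<in>?F. alternating l False \<sigma>}"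
    by auto (metis (full_types))
  then have c1: "card {\<sigma>\<in>?F. \<exists>s. alternating l s \<sigma>} = card {\<sigma>\<in>?F. alternating l True \<sigma>} + card {\<sigma>\<in>?F. alternating l False \<sigma>}"
    using excl ne finite_signed_chains by (subst card_Un_disjoint[symmetric]) auto
  let ?G = "{\<sigma> \<in> signed_chains (Suc N) (Suc N). \<not> \<sigma> \<subseteq> hemisphere N}"
  have flip: "(opposite ` \<sigma>) \<in> signed_chains (Suc N) (Suc N)" if "\<sigma> \<in> signed_chains (Suc N) (Suc N)" for \<sigma>
    using that inj_opposite by (auto simp: signed_chains_def card_image inj_on_subset)
  \<comment> \<open>A maximal chain ends in a set with full support, and the sign of its last
    coordinate decides in which hemisphere the whole chain lies.\<close>
  have dich: "opposite ` \<sigma> \<subseteq> hemisphere N \<longleftrightarrow> \<not> \<sigma> \<subseteq> hemisphere N" if s: "\<sigma> \<in> signed_chains (Suc N) (Suc N)" for \<sigma>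
  proof -
    have sub: "\<sigma> \<subseteq> signed_sets (Suc N)" and ch: "\<And>X Y. X \<in> \<sigma> \<Longrightarrow> Y \<in> \<sigma> \<Longrightarrow> X \<subseteq> Y \<or> Y \<subseteq> X"
      and cN: "card \<sigma> = Suc N" using s by (auto simp: signed_chains_def)
    have "inj_on card \<sigma>" using sub ch signed_chain_card_inj by (meson inj_onI subsetD)
    then have "card (card ` \<sigma>) = Suc N" using cN by (simp add: card_image)
    moreover have "card ` \<sigma> \<subseteq> {1..Suc N}" using sub signed_sets_card by fastforce
    ultimately have "card ` \<sigma> = {1..Suc N}" by (intro card_subset_eq) auto
    then obtain M where M: "M \<in> \<sigma>" "card M = Suc N" by (metis atLeastAtMost_iff imageE le_add1 order_refl plus_1_eq_Suc)
    have Ms: "M \<in> signed_sets (Suc N)" using M sub by blast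
    have top: "X \<subseteq> M" if "X \<in> \<sigma>" for X
      using signed_chain_card_less[of X "Suc N" M] that M sub ch signed_sets_card(2) by fastforce
    have "fst ` M = {..<Suc N}"
      by (rule card_subset_eq) (use Ms M signed_sets_inj_fst[OF Ms] in \<open>auto simp: card_image signed_sets_def\<close>)
    then have "N \<in> fst ` M" by simp
    then have "(N, False) \<in> M \<longleftrightarrow> (N, True) \<notin> M" using Ms by (auto simp: signed_sets_def) (metis (full_types))
    moreover have "\<sigma> \<subseteq> hemisphere N \<longleftrightarrow> (N, False) \<notin> M" using top M sub by (auto simp: hemisphere_def)
    moreover have "opposite ` \<sigma> \<subseteq> hemisphere N \<longleftrightarrow> (N, True) \<notin> M"
      using M sub subsetD[OF top] by (auto simp: hemisphere_def)
    ultimately show ?thesis by simp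
  qed
  have alt_flip: "alternating l s (opposite ` \<sigma>)" if "alternating l (\<not> s) \<sigma>" "\<sigma> \<in> signed_chains (Suc N) (Suc N)" for s \<sigma>
  proof (rule alternating_bij_betw[where h = opposite and q = False])
    show "bij_betw opposite (opposite ` \<sigma>) \<sigma>"
      using inj_opposite by (auto simp: bij_betw_def inj_on_def image_image)
    have l: "l (opposite X) = - l X \<and> l X \<noteq> 0" if X: "X \<in> opposite ` \<sigma>" for X
    proof -
      have "X \<in> signed_sets (Suc N)" using flip[OF \<open>\<sigma> \<in> signed_chains (Suc N) (Suc N)\<close>] X by (auto simp: signed_chains_def)
      then show ?thesis using anti comp[of X X] by auto
    qed
    show "\<bar>l (opposite x)\<bar> = \<bar>l x\<bar>" if "x \<in> opposite ` \<sigma>" for x using l[OF that] by simp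
    show "(0 < l (opposite x)) = ((0 < l x) = False)" if "x \<in> opposite ` \<sigma>" for x using l[OF that] by auto
    show "alternating l (s = False) \<sigma>" using that by simp
  qed
  \<comment> \<open>Negative alternating chains in the hemisphere correspond to positive ones
    outside of it, so the odd number found for both signs is the number of positive ones in the
    whole sphere.\<close>
  have "bij_betw (image opposite) {\<sigma>\<in>?G. alternating l True \<sigma>} {\<sigma>\<in>?F. alternating l False \<sigma>}"
  proof (rule bij_betw_byWitness[where f' = "image opposite"])
    show "image opposite ` {\<sigma>\<in>?G. alternating l True \<sigma>} \<subseteq> {\<sigma>\<in>?F. alternating l False \<sigma>}"
      using flip dich alt_flip[of False] by auto
    show "image opposite ` {\<sigma>\<in>?F. alternating l False \<sigma>} \<subseteq> {\<sigma>\<in>?G. alternating l True \<sigma>}"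
      using flip dich alt_flip[of True] by (auto simp: image_image)
  qed (auto simp: image_image)
  then have c2: "card {\<sigma>\<in>?G. alternating l True \<sigma>} = card {\<sigma>\<in>?F. alternating l False \<sigma>}" by (rule bij_betw_same_card)
  have "{\<sigma> \<in> signed_chains (Suc N) (Suc N). alternating l True \<sigma>} =
      {\<sigma>\<in>?F. alternating l True \<sigma>} \<union> {\<sigma>\<in>?G. alternating l True \<sigma>}" by auto
  then have "card {\<sigma> \<in> signed_chains (Suc N) (Suc N). alternating l True \<sigma>} =
      card {\<sigma>\<in>?F. alternating l True \<sigma>} + card {\<sigma>\<in>?G. alternating l True \<sigma>}"
    using finite_signed_chains by (subst card_Un_disjoint[symmetric]) auto
  then show ?case using c1 c2 odd1 by simp
qed

text \<open>An alternating chain of \<open>N\<close> sets has \<open>N\<close> distinct absolute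
  labels in \<open>{1..m}\<close>; the label \<open>0\<close> is excluded by the case
  \<open>X = Y\<close> of \<open>comp\<close>.\<close>

corollary octahedral_tucker:
  assumes anti: "\<And>X. X \<in> signed_sets N \<Longrightarrow> l (opposite X) = - l X"
    and comp: "\<And>X Y. X \<in> signed_sets N \<Longrightarrow> Y \<in> signed_sets N \<Longrightarrow> X \<subseteq> Y \<Longrightarrow> l X \<noteq> - l Y"
    and bound: "\<And>X. X \<in> signed_sets N \<Longrightarrow> \<bar>l X\<bar> \<le> int m"
  shows "N \<le> m"
proof -
  have "{\<sigma> \<in> signed_chains N N. alternating l True \<sigma>} \<noteq> {}"
    using odd_card_alternating_chains[of N l, OF anti comp] by (metis card.empty even_zero)
  then obtain \<sigma> where s: "\<sigma> \<in> signed_chains N N" "alternating l True \<sigma>" by blast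
  have sub: "\<sigma> \<subseteq> signed_sets N" and c: "card \<sigma> = N" using s by (auto simp: signed_chains_def)
  have "(\<lambda>x. \<bar>l x\<bar>) ` \<sigma> \<subseteq> {1..int m}" using sub bound comp[of x x for x] by force
  then have "card ((\<lambda>x. \<bar>l x\<bar>) ` \<sigma>) \<le> card {1..int m}" by (intro card_mono) auto
  then show ?thesis using s(2) c by (simp add: alternating_def card_image)
qed

section \<open>Alternating sign vectors and necklaces\<close>

definition alternates :: "(nat \<times> bool) set \<Rightarrow> bool \<Rightarrow> nat set \<Rightarrow> bool" where
  "alternates X s J \<longleftrightarrow> J \<subseteq> fst ` X \<and> (\<forall>j\<in>J. ((j, True) \<in> X \<longleftrightarrow> s) \<longleftrightarrow> even (card {i\<in>J. i < j}))"

lemma alternates_subset: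
  assumes "X \<in> signed_sets N" "alternates X s J" shows "J \<subseteq> {..<N}"
proof -
  have "fst ` X \<subseteq> {..<N}" using assms(1) by (auto simp: signed_sets_def)
  then show ?thesis using assms(2) unfolding alternates_def by blast
qed

text \<open>Of the two sequences, one starts with the sign opposite to that of the first index
  \<open>f\<close> of the support. It cannot contain \<open>f\<close>, so \<open>f\<close> can be
  put in front. Consequently all alternating sequences of maximal length start with the same
  sign.\<close>

lemma alternates_extend:
  assumes X: "X \<in> signed_sets N" and a: "alternates X True J" "alternates X False J'" "card J = card J'"
  shows "\<exists>s J''. alternates X s J'' \<and> card J'' = Suc (card J)"
proof -
  define f where "f = Min (fst ` X)"
  have fin: "finite (fst ` X)" using X signed_sets_finite by blast
  have "fst ` X \<noteq> {}" using X by (auto simp: signed_sets_def)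
  then have f: "f \<in> fst ` X" "\<And>j. j \<in> fst ` X \<Longrightarrow> f \<le> j" using fin by (auto simp: f_def)
  define b where "b \<longleftrightarrow> (f, True) \<in> X"
  obtain K where K: "alternates X (\<not> b) K" "card K = card J" using a by (cases b) auto
  have finK: "finite K" using K fin finite_subset by (auto simp: alternates_def)
  have fl: "f \<le> j" if "j \<in> K" for j using f(2)[of j] K(1) that unfolding alternates_def by blast
  have "f \<notin> K"
  proof
    assume fK: "f \<in> K"
    have "{i\<in>K. i < f} = {}" using fl by force
    then have "even (card {i\<in>K. i < f})" by (metis card.empty even_zero)
    then show False using K(1) fK unfolding alternates_def b_def by blast
  qed
  then have flt: "f < j" if "j \<in> K" for j using fl[OF that] that by (metis le_neq_implies_less)
  have "alternates X b (insert f K)"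
    unfolding alternates_def
  proof (intro conjI ballI)
    show "insert f K \<subseteq> fst ` X" using f K by (auto simp: alternates_def)
    fix j assume "j \<in> insert f K"
    then consider "j = f" | "j \<in> K" by blast
    then show "((j, True) \<in> X \<longleftrightarrow> b) \<longleftrightarrow> even (card {i\<in>insert f K. i < j})"
    proof cases
      case 1
      have "{i\<in>insert f K. i < f} = {}" using fl by force
      then show ?thesis unfolding 1 b_def by (metis card.empty even_zero)
    next
      case 2
      have "{i\<in>insert f K. i < j} = insert f {i\<in>K. i < j}" using flt[OF 2] by auto
      then have "card {i\<in>insert f K. i < j} = Suc (card {i\<in>K. i < j})" using \<open>f \<notin> K\<close> finK by simp
      moreover have "((j, True) \<in> X \<longleftrightarrow> \<not> b) \<longleftrightarrow> even (card {i\<in>K. i < j})" using K 2 by (simp add: alternates_def)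
      ultimately show ?thesis by auto
    qed
  qed
  moreover have "card (insert f K) = Suc (card J)" using \<open>f \<notin> K\<close> finK K by simp
  ultimately show ?thesis by blast
qed

lemma alternates_mono:
  assumes "alternates X s J" "X \<subseteq> Y" "Y \<in> signed_sets N" shows "alternates Y s J"
  unfolding alternates_def
proof (intro conjI ballI)
  show "J \<subseteq> fst ` Y" using assms(1) image_mono[OF assms(2), of fst] unfolding alternates_def by blast
  fix j assume j: "j \<in> J"
  then obtain b where "(j, b) \<in> X" using assms by (auto simp: alternates_def)
  then have "(j, True) \<in> X \<longleftrightarrow> (j, True) \<in> Y" using assms(2,3) by (cases b) (auto simp: signed_sets_def)
  moreover have "((j, True) \<in> X \<longleftrightarrow> s) \<longleftrightarrow> even (card {i\<in>J. i < j})"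
    using assms(1) j unfolding alternates_def by blast
  ultimately show "((j, True) \<in> Y \<longleftrightarrow> s) \<longleftrightarrow> even (card {i\<in>J. i < j})" by simp
qed

lemma fst_opposite: "fst ` opposite X = fst ` X"
  unfolding opposite_def by force

lemma alternates_opposite:
  assumes "X \<in> signed_sets N" "alternates X s J" shows "alternates (opposite X) (\<not> s) J"
  unfolding alternates_def fst_opposite
proof (intro conjI ballI)
  show "J \<subseteq> fst ` X" using assms by (auto simp: alternates_def)
  fix j assume j: "j \<in> J"
  then obtain b where "(j, b) \<in> X" using assms by (auto simp: alternates_def)
  then have "(j, False) \<in> X \<longleftrightarrow> (j, True) \<notin> X" using assms(1) by (cases b) (auto simp: signed_sets_def)
  then show "((j, True) \<in> opposite X \<longleftrightarrow> \<not> s) \<longleftrightarrow> even (card {i\<in>J. i < j})"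
    using assms(2) j unfolding alternates_def by auto
qed

lemma sum_alternating_signs:
  fixes J :: "nat set"
  assumes "finite J"
  shows "(\<Sum>j\<in>J. if even (card {i\<in>J. i < j}) then 1 else - 1) = (if even (card J) then 0 else (1::real))"
  using assms
proof (induction J rule: finite_linorder_max_induct)
  case empty then show ?case by simp
next
  case (insert b A)
  have "{i \<in> insert b A. i < b} = A" using insert.hyps by auto
  moreover have "{i \<in> insert b A. i < j} = {i \<in> A. i < j}" if "j \<in> A" for j using insert.hyps that by auto
  moreover have "b \<notin> A" using insert.hyps by auto
  ultimately show ?case using insert by (simp cong: sum.cong)
qed

text \<open>Left ends of the maximal runs of consecutive indices. Their number is the number of
  pieces that have to be glued together later.\<close>

definition block_starts :: "nat set \<Rightarrow> nat set" where
  "block_starts S = {j\<in>S. j = 0 \<or> j - 1 \<notin> S}"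

text \<open>Discretized Hobby--Rice theorem. Weights of arbitrary sign are made nonnegative by passing to
  \<open>1 + (- 1) ^ j * \<mu> i j\<close>, so that a nearly constant signing turns into a nearly alternating one.\<close>
theorem signed_necklace_splitting:
  fixes \<mu> :: "nat \<Rightarrow> nat \<Rightarrow> real"
  assumes \<mu>: "\<And>i j. i < d \<Longrightarrow> j < N \<Longrightarrow> \<bar>\<mu> i j\<bar> \<le> 1"
  obtains P Q where "P \<inter> Q = {}" "P \<union> Q \<subseteq> {..<N}" "card ({..<N} - (P \<union> Q)) \<le> d"
    "card (block_starts P) \<le> d + 1" "card (block_starts Q) \<le> d + 1"
    "\<And>i. i < d \<Longrightarrow> \<bar>sum (\<mu> i) P - sum (\<mu> i) Q\<bar> \<le> 2 * real d + 1"
proof (cases "N \<le> d")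
  case True
  then show ?thesis using that[of "{}" "{}"] by (simp add: block_starts_def)
next
  case False
  define \<nu> where "\<nu> i j = 1 + (- 1) ^ j * \<mu> i j" for i j
  have \<nu>: "0 \<le> \<nu> i j" "\<nu> i j \<le> 2" if "i < d" "j < N" for i j
    using \<mu>[OF that] by (cases "even j"; simp add: \<nu>_def)+
  define part where "part X b = {j. (j, b) \<in> X}" for X :: "(nat \<times> bool) set" and b
  \<comment> \<open>The side \<open>b\<close> of \<open>X\<close> carries more than half of the
    total weight of the \<open>i\<close>-th measure. This can happen for one side only and persists
    when \<open>X\<close> grows.\<close>
  define dec where "dec X i b \<longleftrightarrow> sum (\<nu> i) (part X b) > sum (\<nu> i) {..<N} / 2" for X i b
  define undecided where "undecided X \<longleftrightarrow> (\<forall>i<d. \<forall>b. \<not> dec X i b)" for X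
  define lead where "lead X = (LEAST i. i < d \<and> (\<exists>b. dec X i b))" for X
  define alt where "alt X = (GREATEST k. \<exists>s J. alternates X s J \<and> card J = k)" for X
  \<comment> \<open>A Tucker labelling: a measure with a majority gives one of the labels
    \<open>1\<close>, ..., \<open>d\<close> up to sign, and otherwise the maximal alternation length
    is placed above \<open>d\<close>. The shift by \<open>Suc\<close> avoids the label
    \<open>0\<close>. Comparable sets with labels of the same absolute value have the same sign, by
    \<open>dec_mono\<close> and \<open>alternates_mono\<close>.\<close>
  define l where "l X = (if undecided X
      then (if \<exists>J. alternates X True J \<and> card J = alt X then int (d + alt X) else - int (d + alt X))
      else (if dec X (lead X) True then int (Suc (lead X)) else - int (Suc (lead X))))" for X
  have part: "part X b \<subseteq> {..<N}" "part X True \<inter> part X False = {}" if "X \<in> signed_sets N" for X b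
    using that by (auto simp: part_def signed_sets_def)
  have finp: "finite (part X b)" if "X \<in> signed_sets N" for X b using part(1)[OF that] finite_subset by blast
  have dec_excl: "\<not> (dec X i True \<and> dec X i False)" if X: "X \<in> signed_sets N" and i: "i < d" for X i
  proof -
    have "sum (\<nu> i) (part X True) + sum (\<nu> i) (part X False) = sum (\<nu> i) (part X True \<union> part X False)"
      using part[OF X] finp[OF X] by (simp add: sum.union_disjoint)
    also have "\<dots> \<le> sum (\<nu> i) {..<N}" by (rule sum_mono2) (use part[OF X] \<nu> i in auto)
    finally show ?thesis unfolding dec_def by linarith
  qed
  have dec_mono: "dec Y i b" if "dec X i b" "X \<subseteq> Y" "Y \<in> signed_sets N" "i < d" for X Y i b
  proof -
    have "sum (\<nu> i) (part X b) \<le> sum (\<nu> i) (part Y b)"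
      by (rule sum_mono2[OF finp[OF that(3)]])
        (use that(2) in \<open>force simp: part_def\<close>, use \<nu>(1)[OF that(4)] part(1)[OF that(3)] in blast)
    then show ?thesis using that(1) by (simp add: dec_def)
  qed
  have dec_opp: "dec (opposite X) i b \<longleftrightarrow> dec X i (\<not> b)" for X i b by (simp add: dec_def part_def)
  have lead: "lead X < d \<and> (\<exists>b. dec X (lead X) b)" if "\<not> undecided X" for X
    using that LeastI_ex[of "\<lambda>i. i < d \<and> (\<exists>b. dec X i b)"] unfolding lead_def[symmetric] undecided_def by blast
  have cardJ: "card J \<le> N" "finite J" if "X \<in> signed_sets N" "alternates X s J" for X s J
  proof -
    have "J \<subseteq> {..<N}" using alternates_subset that by blast
    then show "card J \<le> N" "finite J" using card_mono[of "{..<N}" J] finite_subset by auto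
  qed
  have alt: "\<exists>s J. alternates X s J \<and> card J = alt X" if "X \<in> signed_sets N" for X
  proof -
    have "alternates X True {}" by (simp add: alternates_def)
    then have "\<exists>k s J. alternates X s J \<and> card J = k" by blast
    moreover have "\<forall>k. (\<exists>s J. alternates X s J \<and> card J = k) \<longrightarrow> k \<le> N" using cardJ(1)[OF that] by blast
    ultimately show ?thesis
      using GreatestI_ex_nat[of "\<lambda>k. \<exists>s J. alternates X s J \<and> card J = k" N] unfolding alt_def by blast
  qed
  have alt_ge: "card J \<le> alt X" if "X \<in> signed_sets N" "alternates X s J" for X s J
    using Greatest_le_nat[of "\<lambda>k. \<exists>s J. alternates X s J \<and> card J = k" "card J" N] cardJ(1)[OF that(1)] that(2)
    unfolding alt_def by blast
  have alt_excl: "\<not> ((\<exists>J. alternates X True J \<and> card J = alt X) \<and> (\<exists>J. alternates X False J \<and> card J = alt X))"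
    if X: "X \<in> signed_sets N" for X
  proof
    assume "(\<exists>J. alternates X True J \<and> card J = alt X) \<and> (\<exists>J. alternates X False J \<and> card J = alt X)"
    then obtain J J' where "alternates X True J" "alternates X False J'" "card J = alt X" "card J' = alt X" by blast
    then obtain s J'' where "alternates X s J''" "card J'' = Suc (alt X)"
      using alternates_extend[OF X, of J J'] by auto
    then show False using alt_ge[OF X, of s J''] by simp
  qed
  have alt_pos: "alt X > 0" if X: "X \<in> signed_sets N" for X
  proof -
    obtain j b where jb: "(j, b) \<in> X" using X by (auto simp: signed_sets_def)
    have "alternates X ((j, True) \<in> X) {j}" unfolding alternates_def
    proof (intro conjI ballI)
      show "{j} \<subseteq> fst ` X" using jb by force
      fix i assume i: "i \<in> {j}"
      then have "{k \<in> {j}. k < i} = {}" by auto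
      then have "even (card {k \<in> {j}. k < i})" by (metis card.empty even_zero)
      then show "((i, True) \<in> X \<longleftrightarrow> (j, True) \<in> X) \<longleftrightarrow> even (card {k \<in> {j}. k < i})" using i by blast
    qed
    then show ?thesis using alt_ge[OF X, of _ "{j}"] by force
  qed
  have alternates_opp: "alternates (opposite X) s J \<longleftrightarrow> alternates X (\<not> s) J" if "X \<in> signed_sets N" for X s J
    using alternates_opposite[of X N "\<not> s" J] alternates_opposite[of "opposite X" N s J] that by auto
  \<comment> \<open>If all labels were at most \<open>N - 1\<close>, Tucker's lemma would give
    \<open>N \<le> N - 1\<close>. A label of size \<open>N > d\<close> comes from an undecided
    \<open>X\<close> with an alternating sequence that misses at most \<open>d\<close>
    indices.\<close>
  have "\<exists>X\<in>signed_sets N. \<bar>l X\<bar> \<ge> int N"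
  proof (rule ccontr)
    assume *: "\<not> ?thesis"
    have "N \<le> N - 1"
    proof (rule octahedral_tucker)
      fix X assume X: "X \<in> signed_sets N"
      show "\<bar>l X\<bar> \<le> int (N - 1)" using * X by force
      have ex_flip: "(\<exists>b. R (\<not> b)) \<longleftrightarrow> (\<exists>b. R b)" for R
      proof
        assume "\<exists>b. R b"
        then obtain b where "R b" ..
        then have "R (\<not> \<not> b)" by simp
        then show "\<exists>b. R (\<not> b)" ..
      qed blast
      have u: "undecided (opposite X) \<longleftrightarrow> undecided X"
        using ex_flip[of "dec X i" for i] unfolding undecided_def dec_opp by metis
      have le: "lead (opposite X) = lead X"
        unfolding lead_def dec_opp ex_flip ..
      have a: "alt (opposite X) = alt X"
        using ex_flip[of "\<lambda>s. \<exists>J. alternates X s J \<and> card J = k" for k]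
        unfolding alt_def alternates_opp[OF X] by simp
      show "l (opposite X) = - l X"
      proof (cases "undecided X")
        case True
        have "(\<exists>J. alternates X False J \<and> card J = alt X) \<longleftrightarrow> \<not> (\<exists>J. alternates X True J \<and> card J = alt X)"
          using alt[OF X] alt_excl[OF X] by (metis (full_types))
        moreover have "l X = (if \<exists>J. alternates X True J \<and> card J = alt X then int (d + alt X) else - int (d + alt X))"
          "l (opposite X) = (if \<exists>J. alternates X False J \<and> card J = alt X then int (d + alt X) else - int (d + alt X))"
          using True unfolding l_def u a alternates_opp[OF X] by simp_all
        ultimately show ?thesis by (cases "\<exists>J. alternates X True J \<and> card J = alt X") (simp_all only: if_True if_False not_True_eq_False not_False_eq_True minus_minus)
      next
        case False
        then have "dec X (lead X) False \<longleftrightarrow> \<not> dec X (lead X) True"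
          using lead[OF False] dec_excl[OF X] by (metis (full_types))
        then show ?thesis using False by (simp add: l_def u le dec_opp)
      qed
    next
      fix X Y assume XY: "X \<in> signed_sets N" "Y \<in> signed_sets N" "X \<subseteq> Y"
      show "l X \<noteq> - l Y"
      proof
        assume eq: "l X = - l Y"
        have absu: "\<bar>l Z\<bar> = int (d + alt Z)" if "undecided Z" for Z using that by (simp add: l_def)
        have absd: "\<bar>l Z\<bar> = int (Suc (lead Z))" "lead Z < d" if "\<not> undecided Z" for Z using that lead[OF that] by (simp_all add: l_def)
        have ab: "\<bar>l X\<bar> = \<bar>l Y\<bar>" using eq by simp
        consider "undecided X" "undecided Y" | "\<not> undecided X" "\<not> undecided Y"
          using absu absd ab alt_pos XY by (smt (verit) of_nat_add of_nat_0_less_iff Suc_leI of_nat_le_iff)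
        then show False
        proof cases
          case 1
          then have a: "alt X = alt Y" using absu ab by simp
          obtain s J where J: "alternates X s J" "card J = alt X" using alt[OF XY(1)] by blast
          then have "alternates Y s J" using alternates_mono XY by blast
          then show False using eq 1 a J alt_excl[OF XY(1)] alt_excl[OF XY(2)] alt_pos[OF XY(1)]
            by (cases s) (auto simp: l_def split: if_splits)
        next
          case 2
          then have a: "lead X = lead Y" using absd ab by simp
          show False using eq 2 a dec_mono[OF _ XY(3,2)] lead[OF 2(1)] lead[OF 2(2)] dec_excl[OF XY(2), of "lead X"] dec_excl[OF XY(1), of "lead X"]
            by (simp add: l_def split: if_splits) (metis (full_types))+
        qed
      qed
    qed
    then show False using False by simp
  qed
  then obtain X where X: "X \<in> signed_sets N" and big: "\<bar>l X\<bar> \<ge> int N" by blast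
  have und: "undecided X"
  proof (rule ccontr)
    assume "\<not> undecided X"
    then show False using lead[of X] big False by (simp add: l_def split: if_splits)
  qed
  then have "N \<le> d + alt X" using big by (simp add: l_def split: if_splits)
  then obtain s J where J: "alternates X s J" and cJ: "N \<le> d + card J" using alt[OF X] by metis
  have Jsub: "J \<subseteq> {..<N}" using alternates_subset X J by blast
  have finJ: "finite J" using Jsub finite_subset by blast
  have cZ: "card ({..<N} - J) \<le> d" using cJ Jsub finJ by (simp add: card_Diff_subset)
  define x where "x j = (if (j, True) \<in> X then 1 else - 1 :: real)" for j
  \<comment> \<open>Signs are read relative to the parity of the index. Between neighbours in
    \<open>J\<close> both the sign and the parity flip, so the class changes only across gaps of
    \<open>J\<close>.\<close>
  define P where "P = {j\<in>J. (j, True) \<in> X \<longleftrightarrow> even j}"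
  define Q where "Q = {j\<in>J. (j, True) \<in> X \<longleftrightarrow> odd j}"
  have PQ: "P \<union> Q = J" "P \<inter> Q = {}" "finite P" "finite Q" using finJ by (auto simp: P_def Q_def)
  have switch: "(j, True) \<in> X \<longleftrightarrow> (j - 1, True) \<notin> X" if "j \<in> J" "j - 1 \<in> J" "j > 0" for j
  proof -
    have "{i\<in>J. i < j} = insert (j - 1) {i\<in>J. i < j - 1}" using that by auto
    then have "card {i\<in>J. i < j} = Suc (card {i\<in>J. i < j - 1})" using finJ by simp
    moreover have "((j, True) \<in> X \<longleftrightarrow> s) \<longleftrightarrow> even (card {i\<in>J. i < j})"
      "((j - 1, True) \<in> X \<longleftrightarrow> s) \<longleftrightarrow> even (card {i\<in>J. i < j - 1})"
      using J that by (simp_all add: alternates_def)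
    ultimately show ?thesis by auto
  qed
  have split: "J = (part X True \<inter> J) \<union> (part X False \<inter> J)"
  proof -
    have "j \<in> part X True \<union> part X False" if "j \<in> J" for j
    proof -
      have "j \<in> fst ` X" using J that unfolding alternates_def by blast
      then obtain b where "(j, b) \<in> X" by auto
      then show ?thesis by (cases b) (auto simp: part_def)
    qed
    then show ?thesis by blast
  qed
  \<comment> \<open>A block starts at \<open>0\<close> or just after one of the at most
    \<open>d\<close> indices outside \<open>J\<close>.\<close>
  have bs: "card (block_starts S) \<le> d + 1" if S: "S = P \<or> S = Q" for S
  proof -
    have "block_starts S \<subseteq> insert 0 (Suc ` ({..<N} - J))"
    proof
      fix j assume j: "j \<in> block_starts S"
      show "j \<in> insert 0 (Suc ` ({..<N} - J))"
      proof (cases "j = 0")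
        case False
        have jJ: "j \<in> J" using j S by (auto simp: block_starts_def P_def Q_def)
        have "j - 1 \<notin> S" using j False by (auto simp: block_starts_def)
        then have "j - 1 \<notin> J" using switch[OF jJ] j S False jJ by (auto simp: block_starts_def P_def Q_def)
        moreover have "j - 1 < N" using jJ Jsub by auto
        ultimately show ?thesis using False by (auto simp: image_iff intro!: bexI[of _ "j - 1"])
      qed simp
    qed
    then have "card (block_starts S) \<le> card (insert 0 (Suc ` ({..<N} - J)))" by (intro card_mono) auto
    also have "\<dots> \<le> Suc (card (Suc ` ({..<N} - J)))" by (rule card_insert_le_m1) simp_all
    also have "\<dots> \<le> d + 1" using cZ by (simp add: card_image)
    finally show ?thesis .
  qed
  have main: "\<bar>sum (\<mu> i) P - sum (\<mu> i) Q\<bar> \<le> 2 * real d + 1" if i: "i < d" for i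
  proof -
    define T where "T = {..<N} - J"
    define A where "A = sum (\<nu> i) (part X True)"
    define B where "B = sum (\<nu> i) (part X False)"
    have sJ: "(\<Sum>j\<in>J. x j * \<nu> i j) = sum (\<nu> i) (part X True \<inter> J) - sum (\<nu> i) (part X False \<inter> J)"
    proof -
      have e: "J = (part X True \<inter> J) \<union> (part X False \<inter> J)" by (rule split)
      have "(\<Sum>j\<in>J. x j * \<nu> i j) = (\<Sum>j\<in>part X True \<inter> J. x j * \<nu> i j) + (\<Sum>j\<in>part X False \<inter> J. x j * \<nu> i j)"
        by (subst e, rule sum.union_disjoint) (use part[OF X] finJ in auto)
      also have "(\<Sum>j\<in>part X True \<inter> J. x j * \<nu> i j) = sum (\<nu> i) (part X True \<inter> J)"
        by (rule sum.cong) (auto simp: x_def part_def)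
      also have "(\<Sum>j\<in>part X False \<inter> J. x j * \<nu> i j) = (\<Sum>j\<in>part X False \<inter> J. - \<nu> i j)"
        by (rule sum.cong) (use X in \<open>auto simp: x_def part_def signed_sets_def\<close>)
      finally show ?thesis by (simp add: sum_negf)
    qed
    have half: "sum (\<nu> i) (part X b) \<le> sum (\<nu> i) {..<N} / 2" for b
      using und i by (auto simp: undecided_def dec_def not_less)
    have T: "sum (\<nu> i) T \<le> 2 * real d"
    proof -
      have "sum (\<nu> i) T \<le> real (card T) * 2" by (rule sum_bounded_above) (use \<nu> i in \<open>auto simp: T_def\<close>)
      then show ?thesis using cZ by (simp add: T_def)
    qed
    have part_le: "sum (\<nu> i) (part X b \<inter> J) \<le> sum (\<nu> i) (part X b)" for b
      by (rule sum_mono2[OF finp[OF X]]) (use part(1)[OF X] \<nu>(1)[OF i] in blast)+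
    have tot: "sum (\<nu> i) {..<N} = sum (\<nu> i) (part X True \<inter> J) + sum (\<nu> i) (part X False \<inter> J) + sum (\<nu> i) T"
    proof -
      have e: "J = (part X True \<inter> J) \<union> (part X False \<inter> J)" by (rule split)
      have "sum (\<nu> i) J = sum (\<nu> i) (part X True \<inter> J) + sum (\<nu> i) (part X False \<inter> J)"
        by (subst e, rule sum.union_disjoint) (use part[OF X] finJ in auto)
      then show ?thesis unfolding T_def using Jsub by (simp add: sum.subset_diff[of J "{..<N}"])
    qed
    \<comment> \<open>Both sides carry at most half of the weight, so the imbalance on
      \<open>J\<close> is at most the weight of the omitted indices, which is at most
      \<open>2\<close> for each of the \<open>d\<close> of them.\<close>
    have "\<bar>\<Sum>j\<in>J. x j * \<nu> i j\<bar> \<le> 2 * real d"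
      using half[of True] half[of False] T part_le[of True] part_le[of False] tot unfolding sJ by linarith
    \<comment> \<open>On \<open>P\<close> the product \<open>x j * (- 1) ^ j\<close> is
      \<open>1\<close>, on \<open>Q\<close> it is \<open>- 1\<close>. The constant \<open>1\<close>
      in \<open>\<nu>\<close> contributes \<open>sum x J\<close>, an alternating sum of absolute
      value at most \<open>1\<close>; this is the last summand in
      \<open>2 * real d + 1\<close>.\<close>
    moreover have "(\<Sum>j\<in>J. x j * \<nu> i j) = sum x J + (sum (\<mu> i) P - sum (\<mu> i) Q)"
    proof -
      have "sum (\<mu> i) P - sum (\<mu> i) Q = (\<Sum>j\<in>P. x j * (- 1) ^ j * \<mu> i j) + (\<Sum>j\<in>Q. x j * (- 1) ^ j * \<mu> i j)"
      proof -
        have "(\<Sum>j\<in>P. x j * (- 1) ^ j * \<mu> i j) = sum (\<mu> i) P" by (rule sum.cong) (auto simp: x_def P_def)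
        moreover have "(\<Sum>j\<in>Q. x j * (- 1) ^ j * \<mu> i j) = (\<Sum>j\<in>Q. - \<mu> i j)" by (rule sum.cong) (auto simp: x_def Q_def)
        ultimately show ?thesis by (simp add: sum_negf)
      qed
      also have "\<dots> = (\<Sum>j\<in>J. x j * (- 1) ^ j * \<mu> i j)" using PQ by (simp add: sum.union_disjoint[symmetric])
      finally show ?thesis by (simp add: \<nu>_def algebra_simps sum.distrib)
    qed
    moreover have "\<bar>sum x J\<bar> \<le> 1"
    proof -
      have "sum x J = (\<Sum>j\<in>J. (if s then 1 else - 1) * (if even (card {i\<in>J. i < j}) then 1 else - 1))"
        by (rule sum.cong) (use J in \<open>auto simp: x_def alternates_def\<close>)
      also have "\<dots> = (if s then 1 else - 1) * (if even (card J) then 0 else 1)"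
        using sum_alternating_signs[OF finJ] by (simp flip: sum_distrib_left)
      finally show ?thesis by auto
    qed
    ultimately show ?thesis by linarith
  qed
  show ?thesis
    by (rule that[of P Q]) (use PQ Jsub cZ bs main in auto)
qed

section \<open>Rademacher's theorem\<close>

lemma negligible_if_not_density_point:
  fixes S :: "'a::euclidean_space set"
  assumes S: "S \<in> sets lebesgue" and c: "0 \<le> c" "c < 1"
    and small: "\<And>x e. x \<in> S \<Longrightarrow> 0 < e \<Longrightarrow> \<exists>a r. 0 < r \<and> r < e \<and> x \<in> cball a r \<and>
       emeasure lebesgue (S \<inter> cball a r) \<le> ennreal c * emeasure lebesgue (cball a r)"
  shows "negligible S"
proof -
  have bounded_case: "negligible S" if S: "S \<in> lmeasurable" and
     small: "\<And>x e. x \<in> S \<Longrightarrow> 0 < e \<Longrightarrow> \<exists>a r. 0 < r \<and> r < e \<and> x \<in> cball a r \<and>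
       emeasure lebesgue (S \<inter> cball a r) \<le> ennreal c * emeasure lebesgue (cball a r)" for S :: "'a set"
  proof (rule ccontr)
    assume neg: "\<not> negligible S"
    define m where "m = measure lebesgue S"
    have em: "emeasure lebesgue S = ennreal m" using S by (simp add: m_def emeasure_eq_measure2)
    have "m \<noteq> 0" using neg S by (metis m_def negligible_iff_measure0)
    then have m: "m > 0" using measure_nonneg[of lebesgue S] unfolding m_def by linarith
    \<comment> \<open>With this excess, \<open>c * (m + d)\<close> falls short of \<open>m\<close>
      by \<open>(1 - c) * (1 - c) * m\<close>.\<close>
    define d where "d = (1 - c) * m"
    have d: "d > 0" using c m by (simp add: d_def)
    obtain U where U: "open U" "S \<subseteq> U" "U - S \<in> lmeasurable" "emeasure lebesgue (U - S) < ennreal d"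
      using sets_lebesgue_outer_open[OF fmeasurableD[OF S] d] by blast
    have eU: "emeasure lebesgue U < ennreal m + ennreal d"
    proof -
      have "U = S \<union> (U - S)" using U by blast
      then have "emeasure lebesgue U \<le> emeasure lebesgue S + emeasure lebesgue (U - S)"
        using emeasure_subadditive[of S lebesgue "U - S"] S U by (metis fmeasurableD)
      also have "\<dots> < ennreal m + ennreal d" using U(4) unfolding em by (simp add: ennreal_add_left_cancel_less)
      finally show ?thesis .
    qed
    define K where "K = {(a, r). 0 < r \<and> cball a r \<subseteq> U \<and>
       emeasure lebesgue (S \<inter> cball a r) \<le> ennreal c * emeasure lebesgue (cball a r)}"
    have rK: "\<And>i. i \<in> K \<Longrightarrow> 0 < snd i" by (auto simp: K_def)
    have v: "\<exists>i. i \<in> K \<and> x \<in> cball (fst i) (snd i) \<and> snd i < e" if x: "x \<in> S" and e: "0 < e" for x e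
    proof -
      obtain s where s: "s > 0" "ball x s \<subseteq> U" using U x by (meson openE subsetD)
      obtain a r where ar: "0 < r" "r < min e (s / 2)" "x \<in> cball a r"
         "emeasure lebesgue (S \<inter> cball a r) \<le> ennreal c * emeasure lebesgue (cball a r)"
        using small[OF x, of "min e (s / 2)"] e s by auto
      have "cball a r \<subseteq> ball x s"
      proof
        fix y assume "y \<in> cball a r"
        then have "dist x y \<le> r + r" using ar(3) dist_triangle[of x y a] by (simp add: dist_commute)
        then show "y \<in> ball x s" using ar(2) by simp
      qed
      then have "(a, r) \<in> K" using ar s by (auto simp: K_def)
      then show ?thesis using ar by (intro exI[of _ "(a, r)"]) auto
    qed
    have "\<exists>C. countable C \<and> C \<subseteq> K \<and> pairwise (\<lambda>i j. disjnt (cball (fst i) (snd i)) (cball (fst j) (snd j))) C \<and>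
        negligible (S - (\<Union>i\<in>C. cball (fst i) (snd i)))"
      by (rule Vitali_covering_theorem_cballs[of K snd S fst]) (use rK v in blast)+
    then obtain C where C: "countable C" "C \<subseteq> K"
       "pairwise (\<lambda>i j. disjnt (cball (fst i) (snd i)) (cball (fst j) (snd j))) C"
       "negligible (S - (\<Union>i\<in>C. cball (fst i) (snd i)))" by blast
    let ?B = "\<lambda>i. cball (fst i) (snd i :: real)"
    have disj: "disjoint_family_on ?B C" "disjoint_family_on (\<lambda>i. S \<inter> ?B i) C"
      using C(3) unfolding disjoint_family_on_def pairwise_def disjnt_def by blast+
    have "emeasure lebesgue S \<le> emeasure lebesgue ((\<Union>i\<in>C. S \<inter> ?B i) \<union> (S - (\<Union>i\<in>C. ?B i)))"
      by (rule emeasure_mono) (use S C in \<open>auto intro!: sets.countable_UN' sets.Un sets.Diff\<close>)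
    also have "\<dots> \<le> emeasure lebesgue (\<Union>i\<in>C. S \<inter> ?B i) + emeasure lebesgue (S - (\<Union>i\<in>C. ?B i))"
      by (rule emeasure_subadditive) (use S C in \<open>auto intro!: sets.countable_UN' sets.Un sets.Diff\<close>)
    also have "emeasure lebesgue (S - (\<Union>i\<in>C. ?B i)) = 0" using C(4) by (simp add: negligible_iff_null_sets null_setsD1)
    also have "emeasure lebesgue (\<Union>i\<in>C. S \<inter> ?B i) = (\<integral>\<^sup>+i. emeasure lebesgue (S \<inter> ?B i) \<partial>count_space C)"
      by (rule emeasure_UN_countable) (use C disj S in auto)
    also have "\<dots> \<le> (\<integral>\<^sup>+i. ennreal c * emeasure lebesgue (?B i) \<partial>count_space C)"
      by (rule nn_integral_mono) (use C in \<open>auto simp: K_def\<close>)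
    also have "\<dots> = ennreal c * (\<integral>\<^sup>+i. emeasure lebesgue (?B i) \<partial>count_space C)"
      by (rule nn_integral_cmult) auto
    also have "(\<integral>\<^sup>+i. emeasure lebesgue (?B i) \<partial>count_space C) = emeasure lebesgue (\<Union>i\<in>C. ?B i)"
      by (rule emeasure_UN_countable[symmetric]) (use C disj in auto)
    also have "\<dots> \<le> emeasure lebesgue U"
    proof (rule emeasure_mono)
      show "(\<Union>i\<in>C. ?B i) \<subseteq> U" using C(2) by (fastforce simp: K_def simp del: mem_cball)
    qed (use U in auto)
    finally have "ennreal m \<le> ennreal c * emeasure lebesgue U" by (simp add: em mult_left_mono)
    also have "\<dots> \<le> ennreal c * (ennreal m + ennreal d)" using eU by (intro mult_left_mono) auto
    also have "\<dots> = ennreal (c * (m + d))" using c m d by (simp add: ennreal_mult ennreal_plus)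
    finally have "m \<le> c * (m + d)" using c m d by simp
    moreover have "c * (m + d) < m"
    proof -
      have "m - c * (m + d) = (1 - c) * (1 - c) * m" by (simp add: d_def algebra_simps)
      then show ?thesis using c m by (smt (verit) mult_pos_pos)
    qed
    ultimately show False by simp
  qed
  have "negligible (S \<inter> ball 0 (real n))" for n
  proof (rule bounded_case)
    show "S \<inter> ball 0 (real n) \<in> lmeasurable" 
      by (rule bounded_set_imp_lmeasurable) (use S in auto)
    fix x :: 'a and e :: real assume x: "x \<in> S \<inter> ball 0 (real n)" and e: "0 < e"
    obtain a r where ar: "0 < r" "r < e" "x \<in> cball a r"
       "emeasure lebesgue (S \<inter> cball a r) \<le> ennreal c * emeasure lebesgue (cball a r)"
      using small[of x e] x e by blast
    have "emeasure lebesgue (S \<inter> ball 0 (real n) \<inter> cball a r) \<le> emeasure lebesgue (S \<inter> cball a r)"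
      by (rule emeasure_mono) (use S in auto)
    then show "\<exists>a r. 0 < r \<and> r < e \<and> x \<in> cball a r \<and>
       emeasure lebesgue (S \<inter> ball 0 (real n) \<inter> cball a r) \<le> ennreal c * emeasure lebesgue (cball a r)"
      using ar order_trans by blast
  qed
  then have "negligible (\<Union>n. S \<inter> ball 0 (real n))" by (rule negligible_Union_nat)
  moreover have "S \<subseteq> (\<Union>n. S \<inter> ball 0 (real n))"
    by (auto simp: reals_Archimedean2)
  ultimately show ?thesis using negligible_subset by blast
qed

text \<open>Vitali's theorem covers almost all of \<open>G\<close> by disjoint intervals in which
  \<open>F\<close> rises by at least \<open>k\<close> times their length. Countably many increments
  are added up by means of the Stieltjes measure of \<open>F\<close>.\<close>

lemma increment_ge_measure_slope:
  fixes F :: "real \<Rightarrow> real"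
  assumes mono: "\<And>x y. x \<le> y \<Longrightarrow> F x \<le> F y" and cont: "continuous_on UNIV F" and ab: "a < b" and k: "0 \<le> k"
    and G: "G \<in> sets lebesgue" "G \<subseteq> {a<..<b}"
    and slope: "\<And>x e. x \<in> G \<Longrightarrow> 0 < e \<Longrightarrow> \<exists>c r. 0 < r \<and> r < e \<and> x \<in> cball c r \<and> F (c + r) - F (c - r) \<ge> k * (2 * r)"
  shows "k * measure lebesgue G \<le> F b - F a"
proof -
  define K where "K = {(c, r). 0 < r \<and> cball c r \<subseteq> {a<..<b} \<and> F (c + r) - F (c - r) \<ge> k * (2 * r)}"
  have rK: "\<And>i. i \<in> K \<Longrightarrow> 0 < snd i" by (auto simp: K_def)
  have v: "\<exists>i. i \<in> K \<and> x \<in> cball (fst i) (snd i) \<and> snd i < e" if x: "x \<in> G" and e: "0 < e" for x e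
  proof -
    have xab: "a < x" "x < b" using x G by auto
    define s where "s = min (x - a) (b - x)"
    obtain c r where cr: "0 < r" "r < min e (s / 2)" "x \<in> cball c r" "F (c + r) - F (c - r) \<ge> k * (2 * r)"
      using slope[OF x, of "min e (s / 2)"] xab e by (auto simp: s_def)
    have "r < (x - a) / 2" "r < (b - x) / 2" using cr(2) by (auto simp: s_def)
    moreover have "\<bar>c - x\<bar> \<le> r" using cr(3) by (simp add: dist_real_def)
    ultimately have "cball c r \<subseteq> {a<..<b}" unfolding cball_eq_atLeastAtMost by auto
    then have "(c, r) \<in> K" using cr by (auto simp: K_def)
    then show ?thesis using cr by (intro exI[of _ "(c, r)"]) auto
  qed
  have "\<exists>C. countable C \<and> C \<subseteq> K \<and> pairwise (\<lambda>i j. disjnt (cball (fst i) (snd i)) (cball (fst j) (snd j))) C \<and>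
      negligible (G - (\<Union>i\<in>C. cball (fst i) (snd i)))"
    by (rule Vitali_covering_theorem_cballs[of K snd G fst]) (use rK v in blast)+
  then obtain C where C: "countable C" "C \<subseteq> K"
     "pairwise (\<lambda>i j. disjnt (cball (fst i) (snd i)) (cball (fst j) (snd j))) C"
     "negligible (G - (\<Union>i\<in>C. cball (fst i) (snd i)))" by blast
  let ?B = "\<lambda>i. cball (fst i) (snd i :: real)"
  have disj: "disjoint_family_on ?B C"
    using C(3) unfolding disjoint_family_on_def pairwise_def disjnt_def by blast
  let ?M = "interval_measure F"
  have Ioc: "emeasure ?M {u<..v} = ennreal (F v - F u)" if "u \<le> v" for u v
  proof (rule emeasure_interval_measure_Ioc[OF that mono])
    show "continuous (at_right x) F" for x
      using cont by (simp add: continuous_on_eq_continuous_at continuous_at_imp_continuous_at_within)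
  qed
  have G_fin: "emeasure lebesgue G = ennreal (measure lebesgue G)"
  proof (rule emeasure_eq_ennreal_measure)
    have "emeasure lebesgue G \<le> emeasure lebesgue {a<..<b}" by (rule emeasure_mono) (use G in auto)
    then show "emeasure lebesgue G \<noteq> top" using ab by (auto simp: top_unique)
  qed
  have "emeasure lebesgue G \<le> emeasure lebesgue ((\<Union>i\<in>C. ?B i) \<union> (G - (\<Union>i\<in>C. ?B i)))"
    by (rule emeasure_mono) (use G C in \<open>auto intro!: sets.countable_UN' sets.Un sets.Diff\<close>)
  also have "\<dots> \<le> emeasure lebesgue (\<Union>i\<in>C. ?B i) + emeasure lebesgue (G - (\<Union>i\<in>C. ?B i))"
    by (rule emeasure_subadditive) (use G C in \<open>auto intro!: sets.countable_UN' sets.Un sets.Diff\<close>)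
  also have "emeasure lebesgue (G - (\<Union>i\<in>C. ?B i)) = 0" using C(4) by (simp add: negligible_iff_null_sets null_setsD1)
  finally have "ennreal k * emeasure lebesgue G \<le> ennreal k * emeasure lebesgue (\<Union>i\<in>C. ?B i)"
    by (simp add: mult_left_mono)
  also have "emeasure lebesgue (\<Union>i\<in>C. ?B i) = (\<integral>\<^sup>+i. emeasure lebesgue (?B i) \<partial>count_space C)"
    by (rule emeasure_UN_countable) (use C disj in auto)
  also have "ennreal k * \<dots> = (\<integral>\<^sup>+i. ennreal k * emeasure lebesgue (?B i) \<partial>count_space C)"
    by (rule nn_integral_cmult[symmetric]) auto
  also have "\<dots> \<le> (\<integral>\<^sup>+i. emeasure ?M (?B i) \<partial>count_space C)"
  proof (rule nn_integral_mono)
    fix i assume "i \<in> space (count_space C)"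
    then have i: "0 < snd i" "F (fst i + snd i) - F (fst i - snd i) \<ge> k * (2 * snd i)" using C(2) by (auto simp: K_def)
    have "ennreal k * emeasure lebesgue (?B i) = ennreal (k * (2 * snd i))"
      using i k by (simp add: cball_eq_atLeastAtMost ennreal_mult[symmetric])
    also have "\<dots> \<le> ennreal (F (fst i + snd i) - F (fst i - snd i))" using i by (intro ennreal_leI) auto
    also have "\<dots> = emeasure ?M {fst i - snd i<..fst i + snd i}" using i by (subst Ioc) auto
    also have "\<dots> \<le> emeasure ?M (?B i)" by (rule emeasure_mono) (auto simp: cball_eq_atLeastAtMost)
    finally show "ennreal k * emeasure lebesgue (?B i) \<le> emeasure ?M (?B i)" .
  qed
  also have "\<dots> = emeasure ?M (\<Union>i\<in>C. ?B i)"
    by (rule emeasure_UN_countable[symmetric]) (use C disj in auto)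
  also have "\<dots> \<le> emeasure ?M {a<..b}"
  proof (rule emeasure_mono)
    show "(\<Union>i\<in>C. ?B i) \<subseteq> {a<..b}" using C(2) by (fastforce simp: K_def)
  qed simp
  also have "\<dots> = ennreal (F b - F a)" using Ioc ab by simp
  finally have "ennreal (k * measure lebesgue G) \<le> ennreal (F b - F a)" by (simp add: G_fin k ennreal_mult)
  then show ?thesis using mono[of a b] ab by (simp add: ennreal_le_iff)
qed

text \<open>Treats difference quotients with steps of both signs at once, by writing the interval
  between \<open>x\<close> and \<open>x + h\<close> as a ball around its midpoint.\<close>

lemma slope_interval:
  fixes f :: "real \<Rightarrow> real" assumes "h \<noteq> 0"
  shows "f ((x + h / 2) + \<bar>h\<bar> / 2) - f ((x + h / 2) - \<bar>h\<bar> / 2) = (f (x + h) - f x) / h * \<bar>h\<bar>"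
    and "x \<in> cball (x + h / 2) (\<bar>h\<bar> / 2)"
proof -
  have "x + h / 2 + \<bar>h\<bar> / 2 = (if h > 0 then x + h else x)" "x + h / 2 - \<bar>h\<bar> / 2 = (if h > 0 then x else x + h)"
    by (auto simp: abs_if field_simps)
  then show "f ((x + h / 2) + \<bar>h\<bar> / 2) - f ((x + h / 2) - \<bar>h\<bar> / 2) = (f (x + h) - f x) / h * \<bar>h\<bar>"
    using assms by (cases "h > 0") (auto simp: add.commute)
  show "x \<in> cball (x + h / 2) (\<bar>h\<bar> / 2)" by (simp add: dist_real_def)
qed

section \<open>Existence of directional derivatives almost everywhere\<close>

lemma open_difference_quotient:
  fixes g :: "'a::real_normed_vector \<Rightarrow> real"
  assumes "continuous_on UNIV g"
  shows "open {x. (g (x + h *\<^sub>R v) - g x) / h < p}" "open {x. (g (x + h *\<^sub>R v) - g x) / h > p}"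
proof -
  have "continuous_on UNIV (\<lambda>x. (g (x + h *\<^sub>R v) - g x) / h)"
    unfolding divide_inverse by (intro continuous_intros continuous_on_compose2[OF assms]) auto
  then show "open {x. (g (x + h *\<^sub>R v) - g x) / h < p}" "open {x. (g (x + h *\<^sub>R v) - g x) / h > p}"
    by (auto intro: open_Collect_less continuous_on_const)
qed

text \<open>Arbitrarily small steps are expressed by \<open>1 / Suc n\<close>, which makes the set a
  countable intersection of open sets if \<open>g\<close> is continuous.\<close>

definition oscillating_quotient :: "('a::real_normed_vector \<Rightarrow> real) \<Rightarrow> 'a \<Rightarrow> real \<Rightarrow> real \<Rightarrow> 'a set" where
  "oscillating_quotient g v p q = {x. \<forall>n. (\<exists>h. 0 < \<bar>h\<bar> \<and> \<bar>h\<bar> < 1 / Suc n \<and> (g (x + h *\<^sub>R v) - g x) / h < p) \<and>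
      (\<exists>h. 0 < \<bar>h\<bar> \<and> \<bar>h\<bar> < 1 / Suc n \<and> (g (x + h *\<^sub>R v) - g x) / h > q)}"

lemma oscillating_quotient_borel:
  fixes g :: "'a::euclidean_space \<Rightarrow> real"
  assumes "continuous_on UNIV g" shows "oscillating_quotient g v p q \<in> sets borel"
proof -
  let ?A = "\<lambda>n. \<Union>h\<in>{h. 0 < \<bar>h\<bar> \<and> \<bar>h\<bar> < 1 / Suc n}. {x. (g (x + h *\<^sub>R v) - g x) / h < p}"
  let ?B = "\<lambda>n. \<Union>h\<in>{h. 0 < \<bar>h\<bar> \<and> \<bar>h\<bar> < 1 / Suc n}. {x. (g (x + h *\<^sub>R v) - g x) / h > q}"
  have "oscillating_quotient g v p q = (\<Inter>n. ?A n \<inter> ?B n)" by (auto simp: oscillating_quotient_def)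
  moreover have "open (?A n)" "open (?B n)" for n using open_difference_quotient[OF assms] by auto
  ultimately show ?thesis by auto
qed

text \<open>Near each of its points there is a short interval over which \<open>f\<close> has slope
  below \<open>p\<close>. After adding \<open>L * y\<close> the function is nondecreasing, rises
  there by at most \<open>p + L\<close> times the length, and has slopes above \<open>q + L\<close>
  at all points of the set. By \<open>increment_ge_measure_slope\<close> the set fills at most the
  fraction \<open>(p + L) / (q + L)\<close> of the interval, so it has no density points.\<close>

lemma negligible_oscillating_real:
  fixes f :: "real \<Rightarrow> real"
  assumes L: "L-lipschitz_on UNIV f" and pq: "p < q"
  shows "negligible (oscillating_quotient f 1 p q)" (is "negligible ?S")
proof (cases "?S = {}")
  case False
  have cont: "continuous_on UNIV f" using L lipschitz_on_continuous_on by blast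
  have quot: "\<bar>(f (x + h) - f x) / h\<bar> \<le> L" if "h \<noteq> 0" for x h
  proof -
    have "\<bar>f (x + h) - f x\<bar> \<le> L * \<bar>h\<bar>" using lipschitz_onD[OF L, of "x + h" x] by (simp add: dist_real_def)
    then show ?thesis using that by (simp add: abs_divide divide_le_eq)
  qed
  obtain x where "x \<in> ?S" using False by blast
  then obtain h where h: "0 < \<bar>h\<bar>" "(f (x + h) - f x) / h < p" unfolding oscillating_quotient_def by force
  then have "h \<noteq> 0" by simp
  from quot[OF this, of x] have "- L \<le> (f (x + h) - f x) / h" by linarith
  then have p: "- L < p" using h(2) by linarith
  define c where "c = (p + L) / (q + L)"
  have c: "0 \<le> c" "c < 1" using p pq by (auto simp: c_def)
  have Sm: "?S \<in> sets lebesgue" using oscillating_quotient_borel[OF cont] by auto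
  show ?thesis
  proof (rule negligible_if_not_density_point[OF Sm c])
    fix x e :: real assume x: "x \<in> ?S" and e: "0 < e"
    obtain n where n: "1 / Suc n < e" using e nat_approx_posE by blast
    obtain h where h: "0 < \<bar>h\<bar>" "\<bar>h\<bar> < 1 / Suc n" "(f (x + h) - f x) / h < p"
      using x unfolding oscillating_quotient_def by force
    define a r where "a = x + h / 2" and "r = \<bar>h\<bar> / 2"
    have r: "0 < r" "r < e" using h n by (auto simp: r_def)
    have fr: "f (a + r) - f (a - r) \<le> p * (2 * r)"
    proof -
      have "(f (x + h) - f x) / h * \<bar>h\<bar> \<le> p * \<bar>h\<bar>" using h by (intro mult_right_mono) auto
      then show ?thesis unfolding a_def r_def using slope_interval(1)[of h f x] h by simp
    qed
    define G where "G = ?S \<inter> {a - r<..<a + r}"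
    define F where "F y = f y + L * y" for y
    have G: "G \<in> sets lebesgue" using Sm by (auto simp: G_def)
    have "(q + L) * measure lebesgue G \<le> F (a + r) - F (a - r)"
    proof (rule increment_ge_measure_slope[where F = F])
      show "F y \<le> F z" if "y \<le> z" for y z
        using lipschitz_onD[OF L, of y z] that by (simp add: F_def dist_real_def algebra_simps abs_if split: if_splits)
      show "continuous_on UNIV F" unfolding F_def by (intro continuous_intros cont)
      fix y d assume y: "y \<in> G" and d: "(0::real) < d"
      obtain m where m: "1 / Suc m < d" using d nat_approx_posE by blast
      obtain k where k: "0 < \<bar>k\<bar>" "\<bar>k\<bar> < 1 / Suc m" "(f (y + k) - f y) / k > q"
        using y unfolding G_def oscillating_quotient_def by force
      show "\<exists>c r. 0 < r \<and> r < d \<and> y \<in> cball c r \<and> F (c + r) - F (c - r) \<ge> (q + L) * (2 * r)"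
      proof (intro exI conjI)
        show "y \<in> cball (y + k / 2) (\<bar>k\<bar> / 2)" using slope_interval(2) k by auto
        have "q * \<bar>k\<bar> \<le> (f (y + k) - f y) / k * \<bar>k\<bar>" using k by (intro mult_right_mono) auto
        then show "(q + L) * (2 * (\<bar>k\<bar> / 2)) \<le> F (y + k / 2 + \<bar>k\<bar> / 2) - F (y + k / 2 - \<bar>k\<bar> / 2)"
          using slope_interval(1)[of k f y] k by (simp add: F_def algebra_simps)
      qed (use k m in auto)
    qed (use r p pq G in \<open>auto simp: G_def\<close>)
    also have "\<dots> \<le> (p + L) * (2 * r)" using fr by (simp add: F_def algebra_simps)
    finally have mG: "measure lebesgue G \<le> c * (2 * r)" using p pq by (simp add: c_def field_simps)
    have "emeasure lebesgue (?S \<inter> cball a r) \<le> emeasure lebesgue (G \<union> {a - r, a + r})"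
      by (rule emeasure_mono[OF _ sets.Un[OF G]]) (auto simp: G_def cball_eq_atLeastAtMost)
    also have "\<dots> \<le> emeasure lebesgue G + emeasure lebesgue {a - r, a + r}"
      by (rule emeasure_subadditive) (use G in auto)
    also have "emeasure lebesgue {a - r, a + r} = 0"
    proof -
      have "negligible {a - r, a + r}" by (rule negligible_finite) simp
      then show ?thesis by (simp only: negligible_iff_null_sets null_setsD1)
    qed
    also have "emeasure lebesgue G = ennreal (measure lebesgue G)"
    proof (rule emeasure_eq_ennreal_measure)
      have "emeasure lebesgue G \<le> emeasure lebesgue {a - r<..<a + r}" by (rule emeasure_mono) (auto simp: G_def)
      then show "emeasure lebesgue G \<noteq> top" using r by (auto simp: top_unique)
    qed
    also have "ennreal (measure lebesgue G) + 0 \<le> ennreal (c * (2 * r))" using mG by (simp add: ennreal_leI)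
    also have "\<dots> = ennreal c * emeasure lebesgue (cball a r)"
      using r c by (simp add: cball_eq_atLeastAtMost ennreal_mult)
    finally show "\<exists>a r. 0 < r \<and> r < e \<and> x \<in> cball a r \<and>
        emeasure lebesgue (?S \<inter> cball a r) \<le> ennreal c * emeasure lebesgue (cball a r)"
      using r slope_interval(2)[of h x] h unfolding a_def r_def by (intro exI conjI) auto
  qed
qed simp

text \<open>Averaging over the translations by \<open>t *\<^sub>R v\<close> with \<open>t\<close> in
  the unit interval and applying Fubini reaches lines in an arbitrary direction without a change of
  coordinates.\<close>

lemma emeasure_eq_integral_lines:
  fixes N :: "'a::euclidean_space set" and v :: 'a
  assumes N: "N \<in> sets borel"
  shows "emeasure lborel N = (\<integral>\<^sup>+x. (\<integral>\<^sup>+t. indicator {0..1} t * indicator N (x + t *\<^sub>R v) \<partial>lborel) \<partial>lborel)"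
proof -
  have trans: "(\<integral>\<^sup>+x. indicator N (x + t *\<^sub>R v) \<partial>lborel) = emeasure lborel N" for t
  proof -
    have "(\<integral>\<^sup>+x. indicator N x \<partial>lborel) = (\<integral>\<^sup>+x. indicator N x \<partial>(distr lborel borel ((+) (t *\<^sub>R v))))"
      by (simp add: lborel_distr_plus)
    also have "\<dots> = (\<integral>\<^sup>+x. indicator N (t *\<^sub>R v + x) \<partial>lborel)"
      by (rule nn_integral_distr) (use N in auto)
    finally show ?thesis using N by (simp add: add.commute)
  qed
  have m: "(\<lambda>(x, t). indicator {0..1} t * indicator N (x + t *\<^sub>R v) :: ennreal) \<in> borel_measurable (lborel \<Otimes>\<^sub>M (lborel :: real measure))"
    using N by measurable
  have "(\<integral>\<^sup>+x. (\<integral>\<^sup>+t. indicator {0..1} t * indicator N (x + t *\<^sub>R v) \<partial>lborel) \<partial>lborel) =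
      (\<integral>\<^sup>+t. (\<integral>\<^sup>+x. indicator {0..1} t * indicator N (x + t *\<^sub>R v) \<partial>lborel) \<partial>(lborel :: real measure))"
    by (rule lborel_pair.Fubini'[OF m, symmetric])
  also have "\<dots> = (\<integral>\<^sup>+t. indicator {0..1} t * emeasure lborel N \<partial>(lborel :: real measure))"
    using N by (subst nn_integral_cmult) (auto simp: trans)
  also have "\<dots> = emeasure lborel N" by (subst nn_integral_multc) auto
  finally show ?thesis by simp
qed

lemma null_sets_lborel_if_null_on_lines:
  fixes N :: "'a::euclidean_space set" and v :: 'a
  assumes N: "N \<in> sets borel" and lines: "\<And>x. {t::real. x + t *\<^sub>R v \<in> N} \<in> null_sets lebesgue"
  shows "N \<in> null_sets lborel"
proof -
  have "(\<integral>\<^sup>+t. indicator {0..1} t * indicator N (x + t *\<^sub>R v) \<partial>lborel) = 0" for x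
  proof -
    have "AE t in lebesgue. x + t *\<^sub>R v \<notin> N" using AE_not_in[OF lines[of x]] by simp
    moreover have "{t. x + t *\<^sub>R v \<in> N} \<in> sets borel"
    proof -
      have "(\<lambda>t. x + t *\<^sub>R v) -` N \<inter> space borel \<in> sets borel"
        by (rule measurable_sets[OF _ N]) measurable
      then show ?thesis by (simp add: vimage_def)
    qed
    ultimately have "AE t in lborel. x + t *\<^sub>R v \<notin> N" by (simp add: AE_completion_iff)
    then show ?thesis by (subst nn_integral_0_iff_AE) (use N in \<open>auto elim: eventually_mono\<close>)
  qed
  then have "emeasure lborel N = 0" using emeasure_eq_integral_lines[OF N, of v] by simp
  then show ?thesis using N by (simp add: null_setsI)
qed

lemma negligible_oscillating_quotient:
  fixes g :: "'a::euclidean_space \<Rightarrow> real"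
  assumes L: "L-lipschitz_on UNIV g" and pq: "p < q"
  shows "oscillating_quotient g v p q \<in> null_sets lborel" (is "?N \<in> _")
proof (rule null_sets_lborel_if_null_on_lines)
  have cont: "continuous_on UNIV g" using L lipschitz_on_continuous_on by blast
  show "?N \<in> sets borel" by (rule oscillating_quotient_borel[OF cont])
  fix x
  define f where "f t = g (x + t *\<^sub>R v)" for t
  have "(L * norm v)-lipschitz_on UNIV f"
  proof (rule lipschitz_onI)
    show "dist (f s) (f t) \<le> L * norm v * dist s t" for s t
      using lipschitz_onD[OF L, of "x + s *\<^sub>R v" "x + t *\<^sub>R v"]
      by (simp add: f_def dist_norm mult.assoc mult.commute[of "norm v"] flip: scaleR_diff_left)
  qed (use lipschitz_on_nonneg[OF L] in auto)
  then have "negligible (oscillating_quotient f 1 p q)" using negligible_oscillating_real pq by blast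
  moreover have "oscillating_quotient f 1 p q = {t. x + t *\<^sub>R v \<in> ?N}"
    unfolding oscillating_quotient_def f_def by (simp add: scaleR_add_left add.assoc)
  ultimately show "{t. x + t *\<^sub>R v \<in> ?N} \<in> null_sets lebesgue" by (simp add: negligible_iff_null_sets)
qed

text \<open>The Lipschitz bound makes the lower and the upper limit finite. If they differ, two
  rationals fit strictly between them.\<close>

lemma oscillating_quotient_if_no_limit:
  fixes g :: "'a::real_normed_vector \<Rightarrow> real"
  assumes L: "L-lipschitz_on UNIV g" and no: "\<And>d. \<not> ((\<lambda>h. (g (x + h *\<^sub>R v) - g x) / h) \<longlongrightarrow> d) (at 0)"
  shows "\<exists>p\<in>\<rat>. \<exists>q\<in>\<rat>. p < q \<and> x \<in> oscillating_quotient g v p q"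
proof -
  let ?s = "\<lambda>h. (g (x + h *\<^sub>R v) - g x) / h"
  let ?l = "Liminf (at 0) (\<lambda>h. ereal (?s h))" and ?u = "Limsup (at 0) (\<lambda>h. ereal (?s h))"
  have bd: "- (L * norm v) \<le> ?s h \<and> ?s h \<le> L * norm v" if "h \<noteq> 0" for h
  proof -
    have "\<bar>g (x + h *\<^sub>R v) - g x\<bar> \<le> L * norm v * \<bar>h\<bar>"
      using lipschitz_onD[OF L, of "x + h *\<^sub>R v" x] by (simp add: dist_norm mult.assoc mult.commute[of "norm v"])
    then have "\<bar>?s h\<bar> \<le> L * norm v" using that by (simp add: abs_divide divide_le_eq)
    then show ?thesis by linarith
  qed
  have ne: "at (0::real) \<noteq> bot" by simp
  have lu: "?l \<le> ?u" by (rule Liminf_le_Limsup[OF ne])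
  have ev: "\<forall>\<^sub>F h in at 0. - (L * norm v) \<le> ?s h \<and> ?s h \<le> L * norm v" using bd by (auto simp: eventually_at_filter)
  have l1: "ereal (- (L * norm v)) \<le> ?l" by (rule Liminf_bounded) (use ev in \<open>auto elim: eventually_mono\<close>)
  have u1: "?u \<le> ereal (L * norm v)" by (rule Limsup_bounded) (use ev in \<open>auto elim: eventually_mono\<close>)
  have "?l \<noteq> ?u"
  proof
    assume eq: "?l = ?u"
    obtain d where d: "?u = ereal d" using l1 u1 lu by (cases ?u) auto
    have "((\<lambda>h. ereal (?s h)) \<longlongrightarrow> ereal d) (at 0)" by (rule Liminf_eq_Limsup[OF ne]) (use eq d in auto)
    then show False using no by (simp add: lim_ereal)
  qed
  then have "?l < ?u" using lu by simp
  then obtain a where a: "?l < ereal a" "ereal a < ?u" using ereal_dense2 by blast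
  then obtain b where b: "ereal a < ereal b" "ereal b < ?u" using ereal_dense2 by blast
  obtain q where q: "q \<in> \<rat>" "a < q" "q < b" using b Rats_dense_in_real[of a b] by auto
  obtain p where p: "p \<in> \<rat>" "a < p" "p < q" using q Rats_dense_in_real[of a q] by auto
  have fr: "\<exists>\<^sub>F h in at 0. ?s h < p" "\<exists>\<^sub>F h in at 0. ?s h > q"
  proof -
    have "\<not> (\<forall>\<^sub>F h in at 0. ?s h \<ge> p)"
    proof
      assume "\<forall>\<^sub>F h in at 0. ?s h \<ge> p"
      then have "ereal p \<le> ?l" by (intro Liminf_bounded) (auto elim: eventually_mono)
      then have "ereal p < ereal a" using a(1) by (rule le_less_trans)
      then show False using p by simp
    qed
    then show "\<exists>\<^sub>F h in at 0. ?s h < p" by (simp add: frequently_def not_less)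
    have "\<not> (\<forall>\<^sub>F h in at 0. ?s h \<le> q)"
    proof
      assume "\<forall>\<^sub>F h in at 0. ?s h \<le> q"
      then have "?u \<le> ereal q" by (intro Limsup_bounded) (auto elim: eventually_mono)
      also have "\<dots> < ereal b" using q by simp
      finally show False using b by simp
    qed
    then show "\<exists>\<^sub>F h in at 0. ?s h > q" by (simp add: frequently_def not_less)
  qed
  have "\<exists>h. 0 < \<bar>h\<bar> \<and> \<bar>h\<bar> < 1 / Suc n \<and> R h" if "\<exists>\<^sub>F h in at 0. R h" for R and n :: nat
  proof -
    have "\<forall>\<^sub>F h in at (0::real). h \<noteq> 0 \<and> \<bar>h\<bar> < 1 / Suc n"
      unfolding eventually_at by (rule exI[of _ "1 / Suc n"]) (auto simp: dist_real_def)
    from frequently_eventually_frequently[OF that this] show ?thesis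
      using frequently_ex by fastforce
  qed
  then have "x \<in> oscillating_quotient g v p q" using fr unfolding oscillating_quotient_def by blast
  then show ?thesis using p q by blast
qed

lemma AE_directional_derivative:
  fixes g :: "'a::euclidean_space \<Rightarrow> real"
  assumes L: "L-lipschitz_on UNIV g"
  shows "AE x in lborel. \<exists>d. ((\<lambda>h. (g (x + h *\<^sub>R v) - g x) / h) \<longlongrightarrow> d) (at 0)"
proof -
  let ?R = "{(p, q). p \<in> \<rat> \<and> q \<in> \<rat> \<and> p < (q::real)}"
  have "?R \<subseteq> \<rat> \<times> \<rat>" by auto
  then have "countable ?R" by (rule countable_subset) (intro countable_SIGMA countable_rat)
  then have "(\<Union>(p, q)\<in>?R. oscillating_quotient g v p q) \<in> null_sets lborel"
    by (intro null_sets_UN') (use negligible_oscillating_quotient[OF L] in auto)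
  then show ?thesis
  proof (rule AE_I')
    show "{x \<in> space lborel. \<not> (\<exists>d. ((\<lambda>h. (g (x + h *\<^sub>R v) - g x) / h) \<longlongrightarrow> d) (at 0))}
      \<subseteq> (\<Union>(p, q)\<in>?R. oscillating_quotient g v p q)"
    proof
      fix x assume "x \<in> {x \<in> space lborel. \<not> (\<exists>d. ((\<lambda>h. (g (x + h *\<^sub>R v) - g x) / h) \<longlongrightarrow> d) (at 0))}"
      then obtain p q where "p \<in> \<rat>" "q \<in> \<rat>" "p < q" "x \<in> oscillating_quotient g v p q"
        using oscillating_quotient_if_no_limit[OF L, of x v] by blast
      then show "x \<in> (\<Union>(p, q)\<in>?R. oscillating_quotient g v p q)" by blast
    qed
  qed
qed

section \<open>Additivity of directional derivatives and total differentiability\<close>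

definition nonadditive_set :: "('a::euclidean_space \<Rightarrow> real) \<Rightarrow> 'a \<Rightarrow> 'a \<Rightarrow> real \<Rightarrow> real \<Rightarrow> real \<Rightarrow> real \<Rightarrow> 'a set" where
  "nonadditive_set g u v p q e d =
    {x. (\<forall>s. 0 < \<bar>s\<bar> \<and> \<bar>s\<bar> < d \<longrightarrow> \<bar>g (x + s *\<^sub>R u) - g x - s * p\<bar> \<le> e * \<bar>s\<bar>) \<and>
        (\<forall>s. 0 < \<bar>s\<bar> \<and> \<bar>s\<bar> < d \<longrightarrow> \<bar>g (x + s *\<^sub>R v) - g x - s * q\<bar> \<le> e * \<bar>s\<bar>) \<and>
        (\<forall>n. \<exists>t. 0 < \<bar>t\<bar> \<and> \<bar>t\<bar> < 1 / Suc n \<and> \<bar>g (x + t *\<^sub>R (u + v)) - g x - t * (p + q)\<bar> > 4 * e * \<bar>t\<bar>)}"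

text \<open>The set is porous: near each of its points \<open>x\<close> it misses a ball around \<open>x + t u\<close> of radius
  comparable to \<open>t\<close>, because there the increments along \<open>u\<close> and \<open>v\<close> would add up.\<close>
lemma nonadditive_set_null:
  fixes g :: "'a::euclidean_space \<Rightarrow> real"
  assumes L: "L-lipschitz_on UNIV g" and e: "0 < e" and d: "0 < d"
  shows "nonadditive_set g u v p q e d \<in> null_sets lborel" (is "?P \<in> _")
proof -
  have cont: "continuous_on UNIV g" using L lipschitz_on_continuous_on by blast
  have c: "continuous_on UNIV (\<lambda>x. \<bar>g (x + t *\<^sub>R w) - g x - b\<bar>)" for t w b
    by (intro continuous_intros continuous_on_compose2[OF cont]) auto
  have cl: "closed {x. \<bar>g (x + t *\<^sub>R w) - g x - b\<bar> \<le> a}" for t w b a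
    by (rule closed_Collect_le[OF c]) simp
  have op: "open {x. \<bar>g (x + t *\<^sub>R w) - g x - b\<bar> > a}" for t w b a
    by (rule open_Collect_less[OF _ c]) simp
  have "?P = (\<Inter>s\<in>{s. 0 < \<bar>s\<bar> \<and> \<bar>s\<bar> < d}. {x. \<bar>g (x + s *\<^sub>R u) - g x - s * p\<bar> \<le> e * \<bar>s\<bar>}) \<inter>
     (\<Inter>s\<in>{s. 0 < \<bar>s\<bar> \<and> \<bar>s\<bar> < d}. {x. \<bar>g (x + s *\<^sub>R v) - g x - s * q\<bar> \<le> e * \<bar>s\<bar>}) \<inter>
     (\<Inter>n. \<Union>t\<in>{t. 0 < \<bar>t\<bar> \<and> \<bar>t\<bar> < 1 / Suc n}. {x. \<bar>g (x + t *\<^sub>R (u + v)) - g x - t * (p + q)\<bar> > 4 * e * \<bar>t\<bar>})"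
    (is "_ = ?A \<inter> ?B \<inter> (\<Inter>n. ?C n)")
    by (auto simp: nonadditive_set_def)
  moreover have "closed ?A" "closed ?B" by (intro closed_INT ballI cl)+
  moreover have "open (?C n)" for n by (intro open_UN ballI op)
  ultimately have Pb: "?P \<in> sets borel" by simp
  have L0: "0 \<le> L" using L lipschitz_on_nonneg by blast
  \<comment> \<open>Over a distance \<open>k * \<bar>t\<bar>\<close> the function changes by at most
    \<open>e * \<bar>t\<bar>\<close>.\<close>
  define k where "k = e / (L + 1)"
  have k: "0 < k" "L * k \<le> e" using e L0 by (auto simp: k_def field_simps)
  define R where "R = norm u + k"
  have R: "0 < R" "k \<le> R" using k by (auto simp: R_def add_nonneg_pos)
  \<comment> \<open>The fraction of a ball of radius \<open>R * \<bar>t\<bar>\<close> that is left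
    after removing one of radius \<open>k * \<bar>t\<bar>\<close>.\<close>
  define c where "c = 1 - (k / R) ^ DIM('a)"
  have c: "0 \<le> c" "c < 1" using k R by (auto simp: c_def power_le_one)
  have "negligible ?P"
  proof (rule negligible_if_not_density_point[OF _ c])
    show "?P \<in> sets lebesgue" using Pb by auto
    fix x and a :: real assume x: "x \<in> ?P" and a: "0 < a"
    have "0 < min d (a / R)" using a d R by simp
    then obtain n where n: "1 / Suc n < min d (a / R)" using nat_approx_posE by blast
    obtain t where t: "0 < \<bar>t\<bar>" "\<bar>t\<bar> < 1 / Suc n"
       "\<bar>g (x + t *\<^sub>R (u + v)) - g x - t * (p + q)\<bar> > 4 * e * \<bar>t\<bar>"
      using x unfolding nonadditive_set_def by blast
    have td: "\<bar>t\<bar> < d" and "\<bar>t\<bar> < a / R" using t n by auto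
    then have ta: "R * \<bar>t\<bar> < a" using R by (simp add: field_simps)
    have sub: "ball (x + t *\<^sub>R u) (k * \<bar>t\<bar>) \<subseteq> cball x (R * \<bar>t\<bar>)"
    proof
      fix y assume "y \<in> ball (x + t *\<^sub>R u) (k * \<bar>t\<bar>)"
      moreover have "dist x y \<le> dist x (x + t *\<^sub>R u) + dist (x + t *\<^sub>R u) y" by (rule dist_triangle)
      moreover have "dist x (x + t *\<^sub>R u) = \<bar>t\<bar> * norm u" by (simp add: dist_norm)
      ultimately show "y \<in> cball x (R * \<bar>t\<bar>)" by (simp add: R_def algebra_simps)
    qed
    have disj: "y \<notin> ?P" if y: "y \<in> ball (x + t *\<^sub>R u) (k * \<bar>t\<bar>)" for y
    proof
      assume yP: "y \<in> ?P"
      have Ld: "\<bar>g a - g b\<bar> \<le> e * \<bar>t\<bar>" if "dist a b \<le> k * \<bar>t\<bar>" for a b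
      proof -
        have "\<bar>g a - g b\<bar> \<le> L * dist a b" using lipschitz_onD[OF L, of a b] by (simp add: dist_real_def)
        also have "\<dots> \<le> L * (k * \<bar>t\<bar>)" using that L0 by (intro mult_left_mono) auto
        also have "\<dots> \<le> e * \<bar>t\<bar>" using mult_right_mono[OF k(2), of "\<bar>t\<bar>"] by (simp add: mult.assoc)
        finally show ?thesis .
      qed
      have 1: "\<bar>g (x + t *\<^sub>R u) - g y\<bar> \<le> e * \<bar>t\<bar>" by (rule Ld) (use y in simp)
      have 2: "\<bar>g (x + t *\<^sub>R (u + v)) - g (y + t *\<^sub>R v)\<bar> \<le> e * \<bar>t\<bar>"
        by (rule Ld) (use y in \<open>simp add: dist_norm algebra_simps\<close>)
      have 3: "\<bar>g (x + t *\<^sub>R u) - g x - t * p\<bar> \<le> e * \<bar>t\<bar>" using x t td unfolding nonadditive_set_def by blast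
      have 4: "\<bar>g (y + t *\<^sub>R v) - g y - t * q\<bar> \<le> e * \<bar>t\<bar>" using yP t td unfolding nonadditive_set_def by blast
      have "t * (p + q) = t * p + t * q" by (simp add: algebra_simps)
      \<comment> \<open>Two Lipschitz errors and two errors of difference quotients, each at most
        \<open>e * \<bar>t\<bar>\<close>, use up the tolerance \<open>4 * e\<close>.\<close>
      then show False using 1 2 3 4 t(3) by linarith
    qed
    have fin: "emeasure lebesgue (ball (x + t *\<^sub>R u) (k * \<bar>t\<bar>)) \<noteq> \<infinity>"
      using emeasure_ball[of "k * \<bar>t\<bar>" "x + t *\<^sub>R u"] k by simp
    have "emeasure lebesgue (?P \<inter> cball x (R * \<bar>t\<bar>)) \<le> emeasure lebesgue (cball x (R * \<bar>t\<bar>) - ball (x + t *\<^sub>R u) (k * \<bar>t\<bar>))"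
      by (rule emeasure_mono) (use disj in auto)
    also have "\<dots> = emeasure lebesgue (cball x (R * \<bar>t\<bar>)) - emeasure lebesgue (ball (x + t *\<^sub>R u) (k * \<bar>t\<bar>))"
      by (rule emeasure_Diff[OF fin]) (use sub in auto)
    also have "\<dots> = ennreal (unit_ball_vol DIM('a) * (R * \<bar>t\<bar>) ^ DIM('a) - unit_ball_vol DIM('a) * (k * \<bar>t\<bar>) ^ DIM('a))"
      using emeasure_ball[of "k * \<bar>t\<bar>" "x + t *\<^sub>R u"] emeasure_cball[of "R * \<bar>t\<bar>" x] k R by (simp add: ennreal_minus)
    also have "unit_ball_vol DIM('a) * (R * \<bar>t\<bar>) ^ DIM('a) - unit_ball_vol DIM('a) * (k * \<bar>t\<bar>) ^ DIM('a) =
       c * (unit_ball_vol DIM('a) * (R * \<bar>t\<bar>) ^ DIM('a))"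
      using R by (simp add: c_def power_mult_distrib power_divide algebra_simps)
    also have "ennreal \<dots> = ennreal c * emeasure lebesgue (cball x (R * \<bar>t\<bar>))"
      using emeasure_cball[of "R * \<bar>t\<bar>" x] R c by (simp add: ennreal_mult)
    finally have "emeasure lebesgue (?P \<inter> cball x (R * \<bar>t\<bar>)) \<le> ennreal c * emeasure lebesgue (cball x (R * \<bar>t\<bar>))" .
    moreover have "0 < R * \<bar>t\<bar>" "x \<in> cball x (R * \<bar>t\<bar>)" using R t by auto
    ultimately show "\<exists>b r. 0 < r \<and> r < a \<and> x \<in> cball b r \<and>
        emeasure lebesgue (?P \<inter> cball b r) \<le> ennreal c * emeasure lebesgue (cball b r)" using ta by blast
  qed
  then show ?thesis using Pb by (simp add: negligible_iff_null_sets null_sets_completion_iff)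
qed

text \<open>Countably many parameters suffice: if \<open>c \<noteq> a + b\<close>, take
  \<open>e\<close> below an eighth of the gap and rational \<open>p\<close>, \<open>q\<close> within
  \<open>e / 2\<close> of \<open>a\<close>, \<open>b\<close>. The increment along
  \<open>u + v\<close> still misses \<open>p + q\<close> by more than \<open>4 * e\<close>.\<close>

lemma AE_additive_directional_derivative:
  fixes g :: "'a::euclidean_space \<Rightarrow> real"
  assumes L: "L-lipschitz_on UNIV g"
  shows "AE x in lborel. \<forall>a b c. ((\<lambda>h. (g (x + h *\<^sub>R u) - g x) / h) \<longlongrightarrow> a) (at 0) \<longrightarrow>
     ((\<lambda>h. (g (x + h *\<^sub>R v) - g x) / h) \<longlongrightarrow> b) (at 0) \<longrightarrow>
     ((\<lambda>h. (g (x + h *\<^sub>R (u + v)) - g x) / h) \<longlongrightarrow> c) (at 0) \<longrightarrow> c = a + b"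
    (is "AE x in lborel. ?Q x")
proof -
  let ?N = "\<Union>i\<in>UNIV \<times> UNIV \<times> \<rat> \<times> \<rat>. case i of (k, m, p, q) \<Rightarrow> nonadditive_set g u v p q (1 / Suc k) (1 / Suc m)"
  have "?N \<in> null_sets lborel"
    by (intro null_sets_UN' countable_SIGMA countable_rat)
      (auto intro!: nonadditive_set_null[OF L] countableI_type simp: split_beta)
  then show ?thesis
  proof (rule AE_I')
    show "{x \<in> space lborel. \<not> ?Q x} \<subseteq> ?N"
    proof
      fix x assume "x \<in> {x \<in> space lborel. \<not> ?Q x}"
      then obtain a b c where lim: "((\<lambda>h. (g (x + h *\<^sub>R u) - g x) / h) \<longlongrightarrow> a) (at 0)"
         "((\<lambda>h. (g (x + h *\<^sub>R v) - g x) / h) \<longlongrightarrow> b) (at 0)"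
         "((\<lambda>h. (g (x + h *\<^sub>R (u + v)) - g x) / h) \<longlongrightarrow> c) (at 0)" and ne: "c \<noteq> a + b" by blast
      have "0 < \<bar>c - (a + b)\<bar> / 8" using ne by simp
      then obtain k where k: "1 / Suc k < \<bar>c - (a + b)\<bar> / 8" using nat_approx_posE by blast
      define e where "e = 1 / real (Suc k)"
      have e: "0 < e" "8 * e < \<bar>c - (a + b)\<bar>" using k by (auto simp: e_def)
      obtain p where p: "p \<in> \<rat>" "a < p" "p < a + e / 2" using Rats_dense_in_real[of a "a + e / 2"] e by auto
      obtain q where q: "q \<in> \<rat>" "b < q" "q < b + e / 2" using Rats_dense_in_real[of b "b + e / 2"] e by auto
      have quot: "\<exists>d>0. \<forall>s. 0 < \<bar>s\<bar> \<and> \<bar>s\<bar> < d \<longrightarrow> \<bar>g (x + s *\<^sub>R w) - g x - s * l\<bar> < e / 2 * \<bar>s\<bar>"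
        if lm: "((\<lambda>h. (g (x + h *\<^sub>R w) - g x) / h) \<longlongrightarrow> l) (at 0)" for w l
      proof -
        have "0 < e / 2" using e by simp
        then obtain d where d: "d > 0" "\<And>s. s \<noteq> 0 \<Longrightarrow> \<bar>s\<bar> < d \<Longrightarrow> \<bar>(g (x + s *\<^sub>R w) - g x) / s - l\<bar> < e / 2"
          using tendstoD[OF lm \<open>0 < e / 2\<close>] unfolding eventually_at dist_real_def by auto
        have "\<bar>g (x + s *\<^sub>R w) - g x - s * l\<bar> < e / 2 * \<bar>s\<bar>" if "0 < \<bar>s\<bar>" "\<bar>s\<bar> < d" for s
        proof -
          have "g (x + s *\<^sub>R w) - g x - s * l = s * ((g (x + s *\<^sub>R w) - g x) / s - l)" using that by (simp add: field_simps)
          then have "\<bar>g (x + s *\<^sub>R w) - g x - s * l\<bar> = \<bar>s\<bar> * \<bar>(g (x + s *\<^sub>R w) - g x) / s - l\<bar>" by (simp add: abs_mult)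
          also have "\<dots> < \<bar>s\<bar> * (e / 2)" using that d(2)[of s] by (intro mult_strict_left_mono) auto
          finally show ?thesis by (simp add: mult.commute)
        qed
        then show ?thesis using d(1) by blast
      qed
      obtain d1 where d1: "d1 > 0" "\<And>s. 0 < \<bar>s\<bar> \<Longrightarrow> \<bar>s\<bar> < d1 \<Longrightarrow> \<bar>g (x + s *\<^sub>R u) - g x - s * a\<bar> < e / 2 * \<bar>s\<bar>"
        using quot[OF lim(1)] by blast
      obtain d2 where d2: "d2 > 0" "\<And>s. 0 < \<bar>s\<bar> \<Longrightarrow> \<bar>s\<bar> < d2 \<Longrightarrow> \<bar>g (x + s *\<^sub>R v) - g x - s * b\<bar> < e / 2 * \<bar>s\<bar>"
        using quot[OF lim(2)] by blast
      obtain d3 where d3: "d3 > 0" "\<And>s. 0 < \<bar>s\<bar> \<Longrightarrow> \<bar>s\<bar> < d3 \<Longrightarrow> \<bar>g (x + s *\<^sub>R (u + v)) - g x - s * c\<bar> < e / 2 * \<bar>s\<bar>"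
        using quot[OF lim(3)] by blast
      have "0 < min d1 d2" using d1 d2 by simp
      then obtain m where m: "1 / Suc m < min d1 d2" using nat_approx_posE by blast
      have shift: "\<bar>y - s * p'\<bar> \<le> e * \<bar>s\<bar>" if "\<bar>y - s * a'\<bar> < e / 2 * \<bar>s\<bar>" "a' < p'" "p' < a' + e / 2" for y s a' p' :: real
      proof -
        have "\<bar>s * a' - s * p'\<bar> = \<bar>s\<bar> * \<bar>a' - p'\<bar>" by (simp add: abs_mult flip: right_diff_distrib)
        also have "\<dots> \<le> \<bar>s\<bar> * (e / 2)" using that by (intro mult_left_mono) auto
        finally have "\<bar>s * a' - s * p'\<bar> \<le> e / 2 * \<bar>s\<bar>" by (simp add: mult.commute)
        moreover have "e * \<bar>s\<bar> = e / 2 * \<bar>s\<bar> + e / 2 * \<bar>s\<bar>" by simp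
        ultimately show ?thesis using that(1) by linarith
      qed
      have "x \<in> nonadditive_set g u v p q e (1 / Suc m)"
        unfolding nonadditive_set_def
      proof (intro CollectI conjI allI impI)
        show "\<bar>g (x + s *\<^sub>R u) - g x - s * p\<bar> \<le> e * \<bar>s\<bar>" if "0 < \<bar>s\<bar> \<and> \<bar>s\<bar> < 1 / Suc m" for s
          by (rule shift[OF d1(2) p(2,3)]) (use that m in auto)
        show "\<bar>g (x + s *\<^sub>R v) - g x - s * q\<bar> \<le> e * \<bar>s\<bar>" if "0 < \<bar>s\<bar> \<and> \<bar>s\<bar> < 1 / Suc m" for s
          by (rule shift[OF d2(2) q(2,3)]) (use that m in auto)
        fix n :: nat
        define t where "t = min d3 (1 / Suc n) / 2"
        have half: "0 < min a b / 2 \<and> min a b / 2 < a \<and> min a b / 2 < b" if "0 < a" "0 < b" for a b :: real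
          using that by (auto simp: min_def)
        have t: "0 < t" "t < d3" "t < 1 / Suc n" using half[of d3 "1 / Suc n"] d3(1) by (auto simp: t_def)
        have "\<bar>g (x + t *\<^sub>R (u + v)) - g x - t * c\<bar> < e / 2 * t" using d3(2)[of t] t by simp
        moreover have "\<bar>t * c - t * (p + q)\<bar> \<ge> 7 * e * t"
        proof -
          have "\<bar>c - (p + q)\<bar> \<ge> 7 * e" using e p q by linarith
          then have "t * \<bar>c - (p + q)\<bar> \<ge> t * (7 * e)" using t by (intro mult_left_mono) auto
          moreover have "t * c - t * (p + q) = t * (c - (p + q))" by (simp add: algebra_simps)
          ultimately show ?thesis using t by (simp add: abs_mult mult.commute mult.left_commute)
        qed
        moreover have "e * t > 0" using e t by simp
        ultimately have "\<bar>g (x + t *\<^sub>R (u + v)) - g x - t * (p + q)\<bar> > 4 * e * t" by linarith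
        then show "\<exists>t. 0 < \<bar>t\<bar> \<and> \<bar>t\<bar> < 1 / Suc n \<and> \<bar>g (x + t *\<^sub>R (u + v)) - g x - t * (p + q)\<bar> > 4 * e * \<bar>t\<bar>"
          using t by (intro exI[of _ t]) auto
      qed
      then show "x \<in> ?N" using p q unfolding e_def by (intro UN_I[of "(k, m, p, q)"]) auto
    qed
  qed
qed

text \<open>Outside a null set the directional derivatives exist and add up for the countably many
  rational directions, where they agree with a linear map \<open>T\<close>. A finite net of such
  directions on the unit sphere and the Lipschitz bound make the approximation uniform in all
  directions.\<close>

theorem rademacher:
  fixes g :: "'a::euclidean_space \<Rightarrow> real"
  assumes L: "L-lipschitz_on UNIV g"
  shows "AE x in lborel. g differentiable (at x)"
proof -
  \<comment> \<open>Besides being dense, \<open>Q\<close> contains the partial sums of the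
    coordinate expansion of each of its elements, so additivity can be applied one coordinate at a
    time.\<close>
  define Q where "Q = {w::'a. \<forall>b\<in>Basis. w \<bullet> b \<in> \<rat>}"
  have "Q \<subseteq> (\<lambda>c. \<Sum>b\<in>Basis. c b *\<^sub>R b) ` (PiE Basis (\<lambda>_. \<rat>))"
  proof
    fix w assume "w \<in> Q"
    then have "restrict (\<lambda>b. w \<bullet> b) Basis \<in> PiE Basis (\<lambda>_. \<rat>)" by (auto simp: Q_def)
    moreover have "w = (\<Sum>b\<in>Basis. restrict (\<lambda>b. w \<bullet> b) Basis b *\<^sub>R b)" by (simp add: euclidean_representation)
    ultimately show "w \<in> (\<lambda>c. \<Sum>b\<in>Basis. c b *\<^sub>R b) ` (PiE Basis (\<lambda>_. \<rat>))" by blast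
  qed
  moreover have "countable (PiE (Basis::'a set) (\<lambda>_. \<rat> :: real set))" by (intro countable_PiE) (auto simp: countable_rat)
  ultimately have Qc: "countable Q" using countable_subset[OF _ countable_image] by blast
  let ?dd = "\<lambda>x w d. ((\<lambda>h. (g (x + h *\<^sub>R w) - g x) / h) \<longlongrightarrow> d) (at 0)"
  have ex: "AE x in lborel. \<forall>w\<in>Q. \<exists>d. ?dd x w d"
    unfolding AE_ball_countable[OF Qc] using AE_directional_derivative[OF L] by blast
  have add: "AE x in lborel. \<forall>u\<in>Q. \<forall>v\<in>Q. \<forall>a b c. ?dd x u a \<longrightarrow> ?dd x v b \<longrightarrow> ?dd x (u + v) c \<longrightarrow> c = a + b"
    unfolding AE_ball_countable[OF Qc] using AE_additive_directional_derivative[OF L] by blast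
  show ?thesis
    using ex add
  proof eventually_elim
    case (elim x)
    define D where "D b = (SOME d. ?dd x b d)" for b
    have QB: "b \<in> Q" if "b \<in> Basis" for b using that by (auto simp: Q_def inner_Basis)
    have D: "?dd x b (D b)" if "b \<in> Basis" for b
      unfolding D_def using elim(1) QB[OF that] by (meson someI_ex)
    define T where "T w = (\<Sum>b\<in>Basis. (w \<bullet> b) * D b)" for w
    have blT: "bounded_linear T" unfolding T_def
      by (intro bounded_linear_sum bounded_linear_mult_left[THEN bounded_linear_compose] bounded_linear_inner_left)
    have scale: "?dd x (c *\<^sub>R b) (c * D b)" if "b \<in> Basis" for c b
    proof (cases "c = 0")
      case False
      have "filterlim (\<lambda>h. h * c) (at 0) (at 0)"
        using False by (auto simp: filterlim_at eventually_at_filter intro!: tendsto_eq_intros)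
      from filterlim_compose[OF D[OF that] this]
      have "((\<lambda>h. (g (x + (h * c) *\<^sub>R b) - g x) / (h * c)) \<longlongrightarrow> D b) (at 0)" .
      from tendsto_mult_left[OF this, of c]
      have "((\<lambda>h. c * ((g (x + (h * c) *\<^sub>R b) - g x) / (h * c))) \<longlongrightarrow> c * D b) (at 0)" .
      moreover have "c * ((g (x + (h * c) *\<^sub>R b) - g x) / (h * c)) = (g (x + h *\<^sub>R c *\<^sub>R b) - g x) / h" for h
        using False by (cases "h = 0") (auto simp: field_simps)
      ultimately show ?thesis by simp
    qed simp
    have lin: "?dd x (\<Sum>b\<in>B. (w \<bullet> b) *\<^sub>R b) (\<Sum>b\<in>B. (w \<bullet> b) * D b)" if w: "w \<in> Q" and "finite B" "B \<subseteq> Basis" for w B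
      using that(2,3)
    proof (induction B rule: finite_induct)
      case (insert b B)
      have inQ: "(\<Sum>b\<in>B'. (w \<bullet> b) *\<^sub>R b) \<in> Q" if "B' \<subseteq> Basis" "finite B'" for B'
      proof -
        have "(\<Sum>b\<in>B'. (w \<bullet> b) *\<^sub>R b) \<bullet> i \<in> \<rat>" if i: "i \<in> Basis" for i
        proof -
          have "(\<Sum>b\<in>B'. (w \<bullet> b) *\<^sub>R b) \<bullet> i = (\<Sum>b\<in>B'. (w \<bullet> b) * (b \<bullet> i))" by (simp add: inner_sum_left)
          also have "\<dots> = (\<Sum>b\<in>B'. if b = i then w \<bullet> b else 0)"
            by (rule sum.cong) (use \<open>B' \<subseteq> Basis\<close> i in \<open>auto simp: inner_Basis\<close>)
          also have "\<dots> \<in> \<rat>" using w i \<open>finite B'\<close> by (simp add: Q_def)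
          finally show ?thesis .
        qed
        then show ?thesis by (simp add: Q_def)
      qed
      have bQ: "(w \<bullet> b) *\<^sub>R b \<in> Q" using inQ[of "{b}"] insert.prems by simp
      have rest: "?dd x (\<Sum>b\<in>B. (w \<bullet> b) *\<^sub>R b) (\<Sum>b\<in>B. (w \<bullet> b) * D b)" using insert by simp
      have "(\<Sum>b\<in>insert b B. (w \<bullet> b) *\<^sub>R b) \<in> Q" using inQ[of "insert b B"] insert by simp
      then obtain c where c: "?dd x (\<Sum>b\<in>insert b B. (w \<bullet> b) *\<^sub>R b) c" using elim(1) by blast
      have "c = (w \<bullet> b) * D b + (\<Sum>b\<in>B. (w \<bullet> b) * D b)"
        using elim(2) bQ inQ[of B] scale[of b "w \<bullet> b"] rest c insert by (auto simp: sum.insert)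
      then show ?case using c insert.hyps by (simp add: sum.insert)
    qed simp
    have DQ: "?dd x w (T w)" if "w \<in> Q" for w
      using lin[OF that finite_Basis order_refl] by (simp add: T_def euclidean_representation)
    have dense: "\<exists>w\<in>Q. norm (z - w) < e" if e0: "0 < e" for z e
    proof -
      obtain a b where ab: "\<forall>i\<in>Basis. a \<bullet> i \<in> \<rat> \<and> b \<bullet> i \<in> \<rat>" "z \<in> box a b" "box a b \<subseteq> ball z (e / 2)"
        using rational_boxes[of "e / 2" z] e0 by auto
      have "closure (box a b) \<subseteq> closure (ball z (e / 2))" using ab(3) by (rule closure_mono)
      moreover have "box a b \<noteq> {}" using ab(2) by blast
      ultimately have "cbox a b \<subseteq> cball z (e / 2)" using e0 by (simp only: closure_box closure_ball half_gt_zero not_False_eq_True)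
      moreover have "a \<in> cbox a b" using ab(2) by (force simp: mem_box)
      ultimately have "dist z a \<le> e / 2" by auto
      then have "dist z a < e" using e0 by simp
      then show ?thesis using ab(1) by (auto simp: Q_def dist_norm)
    qed
    obtain M where M: "M > 0" "\<And>w. norm (T w) \<le> norm w * M" using bounded_linear.pos_bounded[OF blT] by blast
    have L0: "0 \<le> L" using L lipschitz_on_nonneg by blast
    have "(g has_derivative T) (at x)"
      unfolding has_derivative_at_alt
    proof (intro conjI allI impI blT)
      fix e :: real assume e: "0 < e"
      \<comment> \<open>Replacing a unit vector by a direction of the net at distance below
        \<open>r\<close> costs \<open>e / 3\<close> in \<open>g\<close> and \<open>e / 3\<close> in
        \<open>T\<close>; the last third is the error along the net.\<close>
      define r where "r = e / (3 * (L + M))"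
      have r: "0 < r" "L * r \<le> e / 3" "M * r \<le> e / 3" using e M L0 by (auto simp: r_def field_simps)
      have "compact (sphere (0::'a) 1)" by simp
      moreover have "sphere 0 1 \<subseteq> (\<Union>w\<in>Q. ball w r)"
        using dense[OF r(1)] by (force simp: dist_norm norm_minus_commute)
      ultimately obtain W where W: "W \<subseteq> Q" "finite W" "sphere 0 1 \<subseteq> (\<Union>w\<in>W. ball w r)"
        using compactE_image[of "sphere (0::'a) 1" Q "\<lambda>w. ball w r"] by (metis open_ball)
      have "\<exists>d>0. \<forall>h. 0 < h \<and> h < d \<longrightarrow> \<bar>g (x + h *\<^sub>R w) - g x - h * T w\<bar> \<le> e / 3 * h" if w: "w \<in> W" for w
      proof -
        have "?dd x w (T w)" using DQ W w by blast
        from tendstoD[OF this, of "e / 3"] e obtain d where d: "d > 0"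
          "\<And>h. h \<noteq> 0 \<Longrightarrow> \<bar>h\<bar> < d \<Longrightarrow> \<bar>(g (x + h *\<^sub>R w) - g x) / h - T w\<bar> < e / 3"
          unfolding eventually_at dist_real_def by auto
        have "\<bar>g (x + h *\<^sub>R w) - g x - h * T w\<bar> \<le> e / 3 * h" if "0 < h" "h < d" for h
        proof -
          have "g (x + h *\<^sub>R w) - g x - h * T w = h * ((g (x + h *\<^sub>R w) - g x) / h - T w)" using that by (simp add: field_simps)
          then have "\<bar>g (x + h *\<^sub>R w) - g x - h * T w\<bar> = h * \<bar>(g (x + h *\<^sub>R w) - g x) / h - T w\<bar>" using that by (simp add: abs_mult)
          also have "\<dots> \<le> h * (e / 3)" using that d(2)[of h] by (intro mult_left_mono) auto
          finally show ?thesis by (simp add: mult.commute)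
        qed
        then show ?thesis using d(1) by blast
      qed
      then obtain d where d: "\<And>w. w \<in> W \<Longrightarrow> d w > 0"
        "\<And>w h. w \<in> W \<Longrightarrow> 0 < h \<Longrightarrow> h < d w \<Longrightarrow> \<bar>g (x + h *\<^sub>R w) - g x - h * T w\<bar> \<le> e / 3 * h" by metis
      define d0 where "d0 = Min (insert 1 (d ` W))"
      have d0: "0 < d0" "\<And>w. w \<in> W \<Longrightarrow> d0 \<le> d w" using W d(1) by (auto simp: d0_def)
      show "\<exists>d>0. \<forall>y. norm (y - x) < d \<longrightarrow> norm (g y - g x - T (y - x)) \<le> e * norm (y - x)"
      proof (intro exI[of _ d0] conjI allI impI d0)
        fix y assume y: "norm (y - x) < d0"
        show "norm (g y - g x - T (y - x)) \<le> e * norm (y - x)"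
        proof (cases "y = x")
          case True then show ?thesis using blT by (simp add: linear_simps)
        next
          case False
          define h where "h = norm (y - x)"
          have h: "0 < h" using False by (simp add: h_def)
          define z where "z = (y - x) /\<^sub>R h"
          have "z \<in> sphere 0 1" using h by (simp add: z_def h_def)
          then obtain w where w: "w \<in> W" "dist w z < r" using W(3) by auto
          have yz: "y = x + h *\<^sub>R z" using h by (simp add: z_def)
          have "\<bar>g y - g (x + h *\<^sub>R w)\<bar> \<le> L * dist (x + h *\<^sub>R z) (x + h *\<^sub>R w)"
            using lipschitz_onD[OF L UNIV_I UNIV_I, of "x + h *\<^sub>R z" "x + h *\<^sub>R w"] unfolding yz dist_real_def .
          also have "dist (x + h *\<^sub>R z) (x + h *\<^sub>R w) = h * dist w z" using h by (simp add: dist_norm norm_minus_commute flip: scaleR_diff_right)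
          also have "L * (h * dist w z) \<le> L * (h * r)" using w h L0 by (intro mult_left_mono) auto
          also have "\<dots> \<le> e / 3 * h" using mult_right_mono[OF r(2), of h] h by (simp add: mult.commute mult.left_commute)
          finally have 1: "\<bar>g y - g (x + h *\<^sub>R w)\<bar> \<le> e / 3 * h" .
          have 2: "\<bar>g (x + h *\<^sub>R w) - g x - h * T w\<bar> \<le> e / 3 * h" using d(2)[OF w(1) h] d0(2)[OF w(1)] y by (simp add: h_def)
          have "h * T w - T (y - x) = T (h *\<^sub>R (w - z))"
            using yz blT by (simp add: linear_simps algebra_simps)
          then have "\<bar>h * T w - T (y - x)\<bar> \<le> h * dist w z * M" using M(2)[of "h *\<^sub>R (w - z)"] h by (simp add: dist_norm)
          also have "\<dots> \<le> h * r * M" using w h M by (intro mult_right_mono mult_left_mono) auto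
          also have "\<dots> \<le> e / 3 * h" using mult_right_mono[OF r(3), of h] h by (simp add: mult.commute mult.left_commute)
          finally have 3: "\<bar>h * T w - T (y - x)\<bar> \<le> e / 3 * h" .
          have "\<bar>g y - g x - T (y - x)\<bar> \<le> e * h" using 1 2 3 by linarith
          then show ?thesis by (simp add: h_def)
        qed
      qed
    qed
    then show ?case by (rule differentiableI)
  qed
qed

section \<open>Lipschitz constants from gradients almost everywhere\<close>

lemma increment_le_if_AE_derivative_le:
  fixes f :: "real \<Rightarrow> real"
  assumes L: "L-lipschitz_on UNIV f"
    and ae: "AE t in lebesgue. t \<in> {0<..<1} \<longrightarrow> (\<exists>d\<le>k. (f has_real_derivative d) (at t))"
  shows "f 1 - f 0 \<le> k"
proof (rule field_le_epsilon)
  fix e :: real assume e: "0 < e"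
  obtain N where N0: "\<And>t. t \<in> space lebesgue - N \<Longrightarrow> t \<in> {0<..<1} \<longrightarrow> (\<exists>d\<le>k. (f has_real_derivative d) (at t))"
     "N \<in> null_sets lebesgue" by (rule AE_E3[OF ae]) (rule that)
  then have N: "N \<in> null_sets lebesgue" "\<And>t. t \<notin> N \<Longrightarrow> t \<in> {0<..<1} \<Longrightarrow> \<exists>d\<le>k. (f has_real_derivative d) (at t)"
    by simp_all
  \<comment> \<open>\<open>L \<le> M\<close> makes \<open>F t = M * t - f t\<close> nondecreasing,
    and \<open>k + e \<le> M\<close> makes its slopes \<open>M - (k + e)\<close> nonnegative, as
    \<open>increment_ge_measure_slope\<close> requires. Since these slopes occur almost everywhere,
    \<open>F\<close> rises by at least this much on the unit interval.\<close>
  define M where "M = max L (k + e)"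
  define F where "F t = M * t - f t" for t
  have M: "L \<le> M" "0 \<le> M - (k + e)" "0 \<le> M" using lipschitz_on_nonneg[OF L] by (auto simp: M_def)
  have "(M - (k + e)) * measure lebesgue ({0<..<1} - N) \<le> F 1 - F 0"
  proof (rule increment_ge_measure_slope[where F = F])
    show "F y \<le> F z" if "y \<le> z" for y z
    proof -
      have "f z - f y \<le> L * (z - y)" using lipschitz_onD[OF L, of z y] that by (simp add: dist_real_def)
      also have "\<dots> \<le> M * (z - y)" using M that by (intro mult_right_mono) auto
      finally show ?thesis by (simp add: F_def algebra_simps)
    qed
    show "continuous_on UNIV F" unfolding F_def by (intro continuous_intros lipschitz_on_continuous_on[OF L])
    show "{0<..<1} - N \<in> sets lebesgue" using N by auto
    fix x r :: real assume x: "x \<in> {0<..<1} - N" and r: "0 < r"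
    obtain d where d: "d \<le> k" "(f has_real_derivative d) (at x)" using N(2)[of x] x by blast
    have "((\<lambda>h. (f (x + h) - f x) / h) \<longlongrightarrow> d) (at 0)" using d(2) by (simp add: has_field_derivative_def DERIV_def[symmetric])
    from tendstoD[OF this e] obtain s where s: "s > 0" "\<And>h. h \<noteq> 0 \<Longrightarrow> \<bar>h\<bar> < s \<Longrightarrow> \<bar>(f (x + h) - f x) / h - d\<bar> < e"
      unfolding eventually_at dist_real_def by auto
    define h where "h = min s r / 2"
    have h: "0 < h" "h < s" "h < r" using s r by (auto simp: h_def min_def)
    have "(f (x + h) - f x) / h \<le> k + e" using s(2)[of h] h d by auto
    then have "f (x + h) - f x \<le> (k + e) * h" using h by (simp add: field_simps)
    moreover have "x + h / 2 + h / 2 = x + h" "x + h / 2 - h / 2 = x" by auto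
    ultimately show "\<exists>c s. 0 < s \<and> s < r \<and> x \<in> cball c s \<and> (M - (k + e)) * (2 * s) \<le> F (c + s) - F (c - s)"
      using h by (intro exI[of _ "x + h / 2"] exI[of _ "h / 2"]) (auto simp: F_def dist_real_def algebra_simps)
  qed (use M in auto)
  moreover have "measure lebesgue ({0<..<1} - N) = 1"
    using N(1) measure_Diff_null_set[of "{0<..<1::real}" lebesgue N] by simp
  ultimately show "f 1 - f 0 \<le> k + e" by (simp add: F_def)
qed

text \<open>A given segment may lie in the exceptional null set. By Fubini this does not affect
  almost every translate of it, so the increment bound holds for almost every starting point, and by
  continuity for all.\<close>

theorem lipschitz_if_AE_onorm_le:
  fixes g :: "'a::euclidean_space \<Rightarrow> real"
  assumes L: "L-lipschitz_on UNIV g"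
    and ae: "AE x in lebesgue. g differentiable (at x) \<longrightarrow> onorm (frechet_derivative g (at x)) \<le> K"
  shows "K-lipschitz_on UNIV g"
proof -
  have cont: "continuous_on UNIV g" using L lipschitz_on_continuous_on by blast
  have "AE x in lebesgue. g differentiable (at x)" using AE_completion[OF rademacher[OF L]] .
  then have "AE x in lebesgue. g differentiable (at x) \<and> onorm (frechet_derivative g (at x)) \<le> K"
    using ae by eventually_elim simp
  then have "AE x in lebesgue. \<exists>T. (g has_derivative T) (at x) \<and> onorm T \<le> K"
    by eventually_elim (use frechet_derivative_works in blast)
  then have "AE x in lborel. \<exists>T. (g has_derivative T) (at x) \<and> onorm T \<le> K"
    by (simp only: AE_completion_iff)
  then obtain N where "\<And>x. x \<in> space lborel - N \<Longrightarrow> \<exists>T. (g has_derivative T) (at x) \<and> onorm T \<le> K"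
    "N \<in> null_sets lborel" by (rule AE_E3) (rule that)
  then have N: "N \<in> null_sets lborel" "\<And>x. x \<notin> N \<Longrightarrow> \<exists>T. (g has_derivative T) (at x) \<and> onorm T \<le> K"
    by simp_all
  have Nb: "N \<in> sets borel" using N by auto
  have incr: "g (x + v) - g x \<le> K * norm v" for x v
  proof -
    have m: "(\<lambda>x. \<integral>\<^sup>+t. indicator {0..1} t * indicator N (x + t *\<^sub>R v) \<partial>lborel) \<in> borel_measurable lborel"
      using Nb by measurable
    have "(\<integral>\<^sup>+x. \<integral>\<^sup>+t. indicator {0..1} t * indicator N (x + t *\<^sub>R v) \<partial>lborel \<partial>lborel) = 0"
      using emeasure_eq_integral_lines[OF Nb, of v] N(1) by auto
    then have "AE x in lborel. (\<integral>\<^sup>+t. indicator {0..1} t * indicator N (x + t *\<^sub>R v) \<partial>lborel) = 0"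
      by (rule nn_integral_0_iff_AE[OF m, THEN iffD1])
    then have "AE x in lborel. g (x + v) - g x \<le> K * norm v"
    proof eventually_elim
      case (elim x)
      define f where "f t = g (x + t *\<^sub>R v)" for t
      have m': "(\<lambda>t. indicator {0..1} t * indicator N (x + t *\<^sub>R v) :: ennreal) \<in> borel_measurable lborel"
        using Nb by measurable
      have "AE t in lborel. indicator {0..1} t * indicator N (x + t *\<^sub>R v) = (0::ennreal)"
        using nn_integral_0_iff_AE[OF m'] elim by blast
      then have "AE t in lborel. t \<in> {0<..<1} \<longrightarrow> (\<exists>d\<le>K * norm v. (f has_real_derivative d) (at t))"
      proof eventually_elim
        case (elim t)
        show ?case
        proof
          assume "t \<in> {0<..<1}"
          then have "x + t *\<^sub>R v \<notin> N" using elim by (auto simp: indicator_def split: if_splits)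
          then obtain T where T: "(g has_derivative T) (at (x + t *\<^sub>R v))" "onorm T \<le> K" using N(2) by blast
          have "((\<lambda>t. x + t *\<^sub>R v) has_derivative (\<lambda>h. h *\<^sub>R v)) (at t)" by (auto intro!: derivative_eq_intros)
          from has_derivative_compose[OF this T(1)] have "(f has_derivative (\<lambda>h. T (h *\<^sub>R v))) (at t)"
            unfolding f_def .
          moreover have "T (h *\<^sub>R v) = h * T v" for h
            using has_derivative_bounded_linear[OF T(1)] by (simp add: linear_simps)
          ultimately have "(f has_real_derivative T v) (at t)" by (simp add: has_field_derivative_def mult_commute_abs)
          moreover have "T v \<le> K * norm v"
          proof -
            have "norm (T v) \<le> onorm T * norm v" using onorm[OF has_derivative_bounded_linear[OF T(1)]] .
            also have "\<dots> \<le> K * norm v" using T(2) by (intro mult_right_mono) auto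
            finally show ?thesis by simp
          qed
          ultimately show "\<exists>d\<le>K * norm v. (f has_real_derivative d) (at t)" by blast
        qed
      qed
      then have "AE t in lebesgue. t \<in> {0<..<1} \<longrightarrow> (\<exists>d\<le>K * norm v. (f has_real_derivative d) (at t))"
        by (rule AE_completion)
      moreover have "(L * norm v)-lipschitz_on UNIV f"
      proof (rule lipschitz_onI)
        show "dist (f s) (f t) \<le> L * norm v * dist s t" for s t
          using lipschitz_onD[OF L, of "x + s *\<^sub>R v" "x + t *\<^sub>R v"]
          by (simp add: f_def dist_norm mult.assoc mult.commute[of "norm v"] flip: scaleR_diff_left)
      qed (use lipschitz_on_nonneg[OF L] in auto)
      ultimately have "f 1 - f 0 \<le> K * norm v" using increment_le_if_AE_derivative_le by blast
      then show ?case by (simp add: f_def)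
    qed
    then have neg: "negligible {x. \<not> g (x + v) - g x \<le> K * norm v}"
      using AE_completion[of "\<lambda>x. g (x + v) - g x \<le> K * norm v" lborel]
      by (simp add: negligible_iff_null_sets AE_iff_null_sets completion.AE_iff_null_sets flip: Collect_neg_eq)
    moreover have "open {x. g (x + v) - g x > K * norm v}"
    proof (rule open_Collect_less)
      show "continuous_on UNIV (\<lambda>x. g (x + v) - g x)" by (intro continuous_intros continuous_on_compose2[OF cont]) auto
    qed simp
    then have "open {x. \<not> g (x + v) - g x \<le> K * norm v}" by (simp add: not_le)
    ultimately have "{x. \<not> g (x + v) - g x \<le> K * norm v} = {}" using open_not_negligible by blast
    then show ?thesis by blast
  qed
  have K: "0 \<le> K"
  proof -
    obtain v :: 'a where v: "norm v = 1" using vector_choose_size[of 1] by auto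
    then show ?thesis using incr[of 0 v] incr[of v "- v"] by simp
  qed
  show ?thesis
  proof (rule lipschitz_onI[OF _ K])
    fix x y
    show "dist (g x) (g y) \<le> K * dist x y"
      using incr[of x "y - x"] incr[of y "x - y"] by (simp add: dist_real_def dist_norm norm_minus_commute abs_le_iff)
  qed
qed

section \<open>Doubling of variables and comparison\<close>

lemma C1_with_gradient_const: "C1_with_gradient UNIV (\<lambda>z. c) (\<lambda>z. 0)"
  by (auto simp: C1_with_gradient_def gderiv_def)

lemma C1_with_gradient_add:
  "C1_with_gradient S f F \<Longrightarrow> C1_with_gradient S g G \<Longrightarrow> C1_with_gradient S (\<lambda>z. f z + g z) (\<lambda>z. F z + G z)"
  unfolding C1_with_gradient_def gderiv_def
  by (auto intro!: derivative_eq_intros continuous_intros simp: inner_add_right)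

lemma C1_with_gradient_uminus:
  "C1_with_gradient S f F \<Longrightarrow> C1_with_gradient S (\<lambda>z. - f z) (\<lambda>z. - F z)"
  unfolding C1_with_gradient_def gderiv_def
  by (auto intro!: derivative_eq_intros continuous_intros)

lemma C1_with_gradient_diff:
  "C1_with_gradient S f F \<Longrightarrow> C1_with_gradient S g G \<Longrightarrow> C1_with_gradient S (\<lambda>z. f z - g z) (\<lambda>z. F z - G z)"
  using C1_with_gradient_add[OF _ C1_with_gradient_uminus] by fastforce

lemma C1_with_gradient_cmult:
  "C1_with_gradient S f F \<Longrightarrow> C1_with_gradient S (\<lambda>z. c * f z) (\<lambda>z. c *\<^sub>R F z)"
  unfolding C1_with_gradient_def gderiv_def
  by (auto intro!: derivative_eq_intros continuous_intros)

lemma C1_with_gradient_inner: "C1_with_gradient S (\<lambda>z. z \<bullet> a) (\<lambda>z. a)"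
  unfolding C1_with_gradient_def gderiv_def
  by (auto intro!: derivative_eq_intros continuous_intros)

lemma C1_with_gradient_dist_square:
  fixes a :: "'a::euclidean_space"
  shows "C1_with_gradient S (\<lambda>z. (norm (z - a))\<^sup>2) (\<lambda>z. 2 *\<^sub>R (z - a))"
  unfolding C1_with_gradient_def gderiv_def power2_norm_eq_inner
  by (auto intro!: derivative_eq_intros continuous_intros simp: inner_commute algebra_simps)

lemma C1_with_gradient_has_derivative:
  "C1_with_gradient UNIV f G \<Longrightarrow> (f has_derivative (\<lambda>h. h \<bullet> G z)) (at z)"
  by (simp add: C1_with_gradient_def gderiv_def)

lemma C1_with_gradient_continuous:
  assumes "C1_with_gradient UNIV f G" shows "continuous_on A f" "continuous_on A G"
proof -
  show "continuous_on A f"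
    using assms C1_with_gradient_has_derivative[OF assms] has_derivative_continuous
    by (metis continuous_at_imp_continuous_on)
  show "continuous_on A G" using assms unfolding C1_with_gradient_def by (metis continuous_on_subset subset_UNIV)
qed

text \<open>First-order maximum principle: the penalty \<open>\<zeta>\<close> is put on the side of the supersolution, so that
  only the Lipschitz bound of \<open>u\<close> is needed to control the doubled variables.\<close>
lemma viscosity_doubling:
  fixes u v :: "'a::euclidean_space \<Rightarrow> real"
  assumes X: "compact X" and S: "closed S" and ne: "X \<inter> S \<noteq> {}"
    and u: "L-lipschitz_on X u" and v: "continuous_on (X \<inter> S) v"
    and \<zeta>: "C1_with_gradient UNIV \<zeta> Z"
    and F: "continuous_on UNIV (\<lambda>(z, q). F z q)" and F': "continuous_on UNIV (\<lambda>(z, q). F' z q)"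
    and sub: "viscosity_subsolution_on U F u" and super: "viscosity_supersolution_on V F' v"
    and V: "V \<subseteq> S"
    and good: "\<And>z. z \<in> X \<inter> S \<Longrightarrow> (\<And>y. y \<in> X \<inter> S \<Longrightarrow> u y - v y - \<zeta> y \<le> u z - v z - \<zeta> z) \<Longrightarrow>
       \<exists>e>0. ball z e \<subseteq> X \<inter> U \<and> ball z e \<inter> S \<subseteq> V"
  obtains z p where "z \<in> X \<inter> S" "\<And>y. y \<in> X \<inter> S \<Longrightarrow> u y - v y - \<zeta> y \<le> u z - v z - \<zeta> z"
    "norm p \<le> 2 * L" "F z p \<le> 0" "F' z (p - Z z) \<ge> 0"
proof -
  have XS: "compact (X \<inter> S)" using X S by (simp add: compact_Int_closed)
  have L0: "0 \<le> L" using u lipschitz_on_nonneg by blast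
  have cu: "continuous_on X u" using u lipschitz_on_continuous_on by blast
  have c\<zeta>: "continuous_on A \<zeta>" for A using C1_with_gradient_continuous[OF \<zeta>] by blast
  define \<Phi> where "\<Phi> n w = u (fst w) - v (snd w) - \<zeta> (snd w) - real (Suc n) * (norm (fst w - snd w))\<^sup>2" for n w
  have "\<exists>w\<in>X \<times> (X \<inter> S). \<forall>w'\<in>X \<times> (X \<inter> S). \<Phi> n w' \<le> \<Phi> n w" for n
  proof (rule continuous_attains_sup)
    show "compact (X \<times> (X \<inter> S))" using X XS by (rule compact_Times)
    show "X \<times> (X \<inter> S) \<noteq> {}" using ne by auto
    show "continuous_on (X \<times> (X \<inter> S)) (\<Phi> n)"
      unfolding \<Phi>_def
      by (intro continuous_intros continuous_on_compose2[OF cu] continuous_on_compose2[OF v]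
          continuous_on_compose2[OF c\<zeta>[of UNIV]]) auto
  qed
  then obtain w where w: "\<And>n. w n \<in> X \<times> (X \<inter> S)" "\<And>n w'. w' \<in> X \<times> (X \<inter> S) \<Longrightarrow> \<Phi> n w' \<le> \<Phi> n (w n)"
    by metis
  define a b where "a n = fst (w n)" and "b n = snd (w n)" for n
  have ab: "a n \<in> X" "b n \<in> X \<inter> S" for n using w(1)[of n] by (auto simp: a_def b_def)
  define p where "p n = (2 * real (Suc n)) *\<^sub>R (a n - b n)" for n
  \<comment> \<open>Comparing the maximum with the diagonal point \<open>(b n, b n)\<close> bounds
    the penalty by the Lipschitz constant of \<open>u\<close>. Hence the gradients
    \<open>p n\<close> stay in a compact set and a limit can be extracted.\<close>
  have close: "real (Suc n) * norm (a n - b n) \<le> L" for n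
  proof (cases "a n = b n")
    case False
    have "\<Phi> n (b n, b n) \<le> \<Phi> n (w n)" using w(2) ab by auto
    then have "real (Suc n) * (norm (a n - b n))\<^sup>2 \<le> u (a n) - u (b n)" by (simp add: \<Phi>_def a_def b_def)
    also have "\<dots> \<le> L * norm (a n - b n)"
      using lipschitz_onD[OF u, of "a n" "b n"] ab by (simp add: dist_norm)
    finally show ?thesis using False by (simp add: power2_eq_square)
  qed (simp add: L0)
  have pbound: "norm (p n) \<le> 2 * L" for n
  proof -
    have "norm (p n) = 2 * (real (Suc n) * norm (a n - b n))" unfolding p_def norm_scaleR by simp
    then show ?thesis using close[of n] by linarith
  qed
  have cpt: "compact ((X \<inter> S) \<times> cball (0::'a) (2 * L))" by (intro compact_Times XS compact_cball)
  have inK: "\<forall>n. (b n, p n) \<in> (X \<inter> S) \<times> cball 0 (2 * L)" using ab pbound by simp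
  obtain l r where l: "l \<in> (X \<inter> S) \<times> cball 0 (2 * L)" and r: "strict_mono (r :: nat \<Rightarrow> nat)"
     "((\<lambda>n. (b n, p n)) \<circ> r) \<longlonglongrightarrow> l"
    by (rule seq_compactE[OF compact_imp_seq_compact[OF cpt] inK]) (rule that)
  define z q where "z = fst l" and "q = snd l"
  have zq: "z \<in> X \<inter> S" "norm q \<le> 2 * L" using l by (auto simp: z_def q_def)
  have bz: "(\<lambda>n. b (r n)) \<longlonglongrightarrow> z" and pq: "(\<lambda>n. p (r n)) \<longlonglongrightarrow> q"
    using tendsto_fst[OF r(2)] tendsto_snd[OF r(2)] by (simp_all add: comp_def z_def q_def)
  have "(\<lambda>n. a n - b n) \<longlonglongrightarrow> 0"
  proof (rule Lim_null_comparison)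
    show "\<forall>\<^sub>F n in sequentially. norm (a n - b n) \<le> L * inverse (real (Suc n))"
      using close by (intro always_eventually allI) (simp add: field_simps)
    show "(\<lambda>n. L * inverse (real (Suc n))) \<longlonglongrightarrow> 0"
      using tendsto_mult_right_zero[OF LIMSEQ_inverse_real_of_nat] by blast
  qed
  then have "(\<lambda>n. a (r n) - b (r n)) \<longlonglongrightarrow> 0" using LIMSEQ_subseq_LIMSEQ[OF _ r(1)] by (fastforce simp: comp_def)
  then have az: "(\<lambda>n. a (r n)) \<longlonglongrightarrow> z" using tendsto_add[OF _ bz, of "\<lambda>n. a (r n) - b (r n)" 0] by simp
  have max: "u y - v y - \<zeta> y \<le> u z - v z - \<zeta> z" if y: "y \<in> X \<inter> S" for y
  proof (rule LIMSEQ_le_const)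
    have lim: "(\<lambda>n. f (c n)) \<longlonglongrightarrow> f z" if "continuous_on A f" "\<And>n. c n \<in> A" "c \<longlonglongrightarrow> z" "z \<in> A" for f :: "'a \<Rightarrow> real" and A c
      using continuous_on_tendsto_compose[OF that(1,3,4)] that(2) by simp
    show "(\<lambda>n. u (a (r n)) - v (b (r n)) - \<zeta> (b (r n))) \<longlonglongrightarrow> u z - v z - \<zeta> z"
      by (intro tendsto_diff lim[OF cu _ az] lim[OF v _ bz] lim[OF c\<zeta>[of UNIV] _ bz]) (use ab zq in auto)
    have "u y - v y - \<zeta> y \<le> u (a n) - v (b n) - \<zeta> (b n)" for n
    proof -
      have "\<Phi> n (y, y) \<le> \<Phi> n (w n)" using w(2) y by auto
      then have "u y - v y - \<zeta> y \<le> u (a n) - v (b n) - \<zeta> (b n) - real (Suc n) * (norm (a n - b n))\<^sup>2"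
        by (simp add: \<Phi>_def a_def b_def)
      moreover have "0 \<le> real (Suc n) * (norm (a n - b n))\<^sup>2" by simp
      ultimately show ?thesis by linarith
    qed
    then show "\<exists>N. \<forall>n\<ge>N. u y - v y - \<zeta> y \<le> u (a (r n)) - v (b (r n)) - \<zeta> (b (r n))" by blast
  qed
  \<comment> \<open>The limit point maximizes \<open>u - v - \<zeta>\<close>, so \<open>good\<close>
    applies: near it the subsolution is tested in a full neighbourhood and the supersolution
    relative to \<open>S\<close>, and neither meets the boundary of the auxiliary set
    \<open>X\<close>.\<close>
  obtain e where e: "e > 0" "ball z e \<subseteq> X \<inter> U" "ball z e \<inter> S \<subseteq> V" using good[OF zq(1) max] by blast
  have ev: "\<forall>\<^sub>F n in sequentially. a (r n) \<in> ball z e \<and> b (r n) \<in> ball z e"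
    using eventually_conj[OF tendstoD[OF az e(1)] tendstoD[OF bz e(1)]] by (simp add: dist_commute)
  have opn: "\<forall>\<^sub>F y in at c within A. y \<in> ball z e" if "c \<in> ball z e" for c A
    using that by (intro eventually_at_topological[THEN iffD2] exI[of _ "ball z e"]) auto
  have evF: "\<forall>\<^sub>F n in sequentially. F (a (r n)) (p (r n)) \<le> 0"
    using ev
  proof eventually_elim
    case (elim n)
    let ?a = "a (r n)" and ?b = "b (r n)" and ?k = "real (Suc (r n))"
    have "C1_with_gradient UNIV (\<lambda>y. ?k * (norm (y - ?b))\<^sup>2) (\<lambda>y. ?k *\<^sub>R (2 *\<^sub>R (y - ?b)))"
      by (intro C1_with_gradient_cmult C1_with_gradient_dist_square)
    moreover have "\<forall>\<^sub>F y in at ?a within U. u y - ?k * (norm (y - ?b))\<^sup>2 \<le> u ?a - ?k * (norm (?a - ?b))\<^sup>2"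
      using opn[OF conjunct1[OF elim], of U]
    proof (rule eventually_mono)
      fix y assume "y \<in> ball z e"
      then have "(y, ?b) \<in> X \<times> (X \<inter> S)" using e(2) ab by auto
      from w(2)[OF this, of "r n"] show "u y - ?k * (norm (y - ?b))\<^sup>2 \<le> u ?a - ?k * (norm (?a - ?b))\<^sup>2"
        by (simp add: \<Phi>_def a_def b_def)
    qed
    moreover have "?a \<in> U" using elim e(2) by auto
    ultimately have "F ?a (?k *\<^sub>R (2 *\<^sub>R (?a - ?b))) \<le> 0" using sub unfolding viscosity_subsolution_on_def by blast
    then show ?case by (simp add: p_def mult.commute)
  qed
  have evF': "\<forall>\<^sub>F n in sequentially. F' (b (r n)) (p (r n) - Z (b (r n))) \<ge> 0"
    using ev
  proof eventually_elim
    case (elim n)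
    let ?a = "a (r n)" and ?b = "b (r n)" and ?k = "real (Suc (r n))"
    have "C1_with_gradient UNIV (\<lambda>y. - \<zeta> y - ?k * (norm (y - ?a))\<^sup>2) (\<lambda>y. - Z y - ?k *\<^sub>R (2 *\<^sub>R (y - ?a)))"
      by (intro C1_with_gradient_diff C1_with_gradient_uminus C1_with_gradient_cmult C1_with_gradient_dist_square \<zeta>)
    moreover have "\<forall>\<^sub>F y in at ?b within V. v y - (- \<zeta> y - ?k * (norm (y - ?a))\<^sup>2) \<ge> v ?b - (- \<zeta> ?b - ?k * (norm (?b - ?a))\<^sup>2)"
    proof -
      have "\<forall>\<^sub>F y in at ?b within V. y \<in> ball z e \<and> y \<in> V"
        using opn[of ?b V] elim eventually_at_filter[of "\<lambda>y. y \<in> V" ?b V] by (auto intro: eventually_conj)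
      then show ?thesis
      proof (rule eventually_mono)
        fix y assume "y \<in> ball z e \<and> y \<in> V"
        then have "(?a, y) \<in> X \<times> (X \<inter> S)" using e(2) ab V by auto
        from w(2)[OF this, of "r n"] show "v y - (- \<zeta> y - ?k * (norm (y - ?a))\<^sup>2) \<ge> v ?b - (- \<zeta> ?b - ?k * (norm (?b - ?a))\<^sup>2)"
          by (simp add: \<Phi>_def a_def b_def norm_minus_commute)
      qed
    qed
    moreover have "?b \<in> V" using elim e(3) ab by auto
    ultimately have "F' ?b (- Z ?b - ?k *\<^sub>R (2 *\<^sub>R (?b - ?a))) \<ge> 0" using super unfolding viscosity_supersolution_on_def by blast
    moreover have "- Z ?b - ?k *\<^sub>R (2 *\<^sub>R (?b - ?a)) = p (r n) - Z ?b"
      by (simp add: p_def algebra_simps)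
    ultimately show ?case by (simp only:)
  qed
  have cont: "(\<lambda>n. f (c n) (d n)) \<longlonglongrightarrow> f c' d'" if f: "continuous_on UNIV (\<lambda>(z, q). f z q)" and "c \<longlonglongrightarrow> c'" "d \<longlonglongrightarrow> d'"
    for f :: "'a \<Rightarrow> 'a \<Rightarrow> real" and c d c' d'
    using continuous_on_tendsto_compose[OF f tendsto_Pair[OF that(2,3)]] by simp
  have "F z q \<le> 0"
    by (rule tendsto_upperbound[OF cont[OF F az pq] evF]) simp
  moreover have "F' z (q - Z z) \<ge> 0"
  proof (rule tendsto_lowerbound[OF _ evF'])
    have "(\<lambda>n. Z (b (r n))) \<longlonglongrightarrow> Z z"
      using continuous_on_tendsto_compose[OF C1_with_gradient_continuous(2)[OF \<zeta>, of UNIV] bz] by simp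
    then show "(\<lambda>n. F' (b (r n)) (p (r n) - Z (b (r n)))) \<longlonglongrightarrow> F' z (q - Z z)"
      by (intro cont[OF F' bz] tendsto_diff pq)
  qed simp
  ultimately show ?thesis using that zq max by blast
qed

lemma continuous_evolution_operator:
  assumes "continuous_on UNIV (\<lambda>(x, p). F x p)"
  shows "continuous_on UNIV (\<lambda>(z, q). evolution_operator F z q)"
proof -
  have "continuous_on UNIV (\<lambda>w. snd (snd w) + (\<lambda>(x, p). F x p) (fst (fst w), fst (snd w)))"
    by (intro continuous_intros continuous_on_compose2[OF assms]) auto
  then show ?thesis by (simp add: evolution_operator_def split_beta)
qed

lemma derivative_along_line:
  assumes "C1_with_gradient UNIV \<phi> G"
  shows "((\<lambda>r. \<phi> (z + r *\<^sub>R w)) has_real_derivative (w \<bullet> G z)) (at 0)"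
proof -
  have "((\<lambda>r. z + r *\<^sub>R w) has_derivative (\<lambda>r. r *\<^sub>R w)) (at 0)"
    by (auto intro!: derivative_eq_intros)
  from has_derivative_compose[OF this, of \<phi> "\<lambda>h. h \<bullet> G z"] C1_with_gradient_has_derivative[OF assms, of z]
  show ?thesis by (simp add: has_field_derivative_def mult_commute_abs)
qed

text \<open>Converts touching along a single ray into an inequality for the gradient. Only the ray
  has to lie in \<open>U\<close>, so this also works at boundary points and on sets such as a
  segment.\<close>

lemma touching_slope:
  assumes \<phi>: "C1_with_gradient UNIV \<phi> G" and w: "w \<noteq> 0"
    and touch: "\<forall>\<^sub>F z in at z0 within U. P z" and d: "0 < d"
    and inU: "\<And>r. 0 < r \<Longrightarrow> r < d \<Longrightarrow> z0 + r *\<^sub>R w \<in> U"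
    and imp: "\<And>r. 0 < r \<Longrightarrow> r < d \<Longrightarrow> P (z0 + r *\<^sub>R w) \<Longrightarrow> \<phi> z0 + r * k \<le> \<phi> (z0 + r *\<^sub>R w)"
  shows "k \<le> w \<bullet> G z0"
proof (rule ccontr)
  assume "\<not> k \<le> w \<bullet> G z0"
  then have neg: "w \<bullet> G z0 - k < 0" by simp
  have "((\<lambda>r. \<phi> (z0 + r *\<^sub>R w) - r * k) has_real_derivative (w \<bullet> G z0 - k)) (at 0)"
    using derivative_along_line[OF \<phi>, of z0 w] by (auto intro!: derivative_eq_intros)
  from has_real_derivative_neg_dec_right[OF this neg] obtain e where
    e: "e > 0" "\<And>h. 0 < h \<Longrightarrow> h < e \<Longrightarrow> \<phi> (z0 + h *\<^sub>R w) - h * k < \<phi> z0" by auto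
  obtain s where s: "s > 0" "\<And>z. z \<in> U \<Longrightarrow> z \<noteq> z0 \<Longrightarrow> dist z z0 < s \<Longrightarrow> P z"
    using touch unfolding eventually_at by blast
  define r where "r = min (min d e) (s / norm w) / 2"
  have half: "0 < min (min a b) c / 2 \<and> min (min a b) c / 2 < a \<and> min (min a b) c / 2 < b \<and> min (min a b) c / 2 < c"
    if "0 < a" "0 < b" "0 < c" for a b c :: real using that by (auto simp: min_def)
  have r: "0 < r" "r < d" "r < e" "r < s / norm w" using half[of d e "s / norm w"] d e(1) s(1) w by (auto simp: r_def)
  have "dist (z0 + r *\<^sub>R w) z0 < s" using r w by (simp add: dist_norm field_simps)
  then have "P (z0 + r *\<^sub>R w)" using s(2) inU r w by simp
  then show False using imp[OF r(1,2)] e(2)[OF r(1,3)] by simp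
qed

text \<open>The domain is unbounded in space and time. The penalty has three parts: the linear one
  in time makes the inequality strict, the quadratic one in time bounds the time of the maximum
  because \<open>u - v\<close> grows at most linearly, and the quadratic one in space localizes with
  an arbitrarily small gradient.\<close>

lemma comparison_principle:
  fixes F :: "real ^ 'n \<Rightarrow> real ^ 'n \<Rightarrow> real" and u v :: "(real ^ 'n) \<times> real \<Rightarrow> real"
  assumes F: "continuous_on UNIV (\<lambda>(x, p). F x p)"
    and UC: "\<And>B e. 0 < e \<Longrightarrow> \<exists>d>0. \<forall>x p q. norm p \<le> B \<longrightarrow> norm (q - p) \<le> d \<longrightarrow> \<bar>F x q - F x p\<bar> \<le> e"
    and S: "closed S"
    and u: "L-lipschitz_on (UNIV \<times> {0..}) u" and v: "M-lipschitz_on (S \<times> {0..}) v"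
    and sub: "viscosity_subsolution_on (UNIV \<times> {0<..}) (evolution_operator F) u"
    and super: "viscosity_supersolution_on (S \<times> {0<..}) (evolution_operator F) v"
    and init: "\<And>x. x \<in> S \<Longrightarrow> u (x, 0) \<le> v (x, 0)"
    and x: "x \<in> S" and t: "0 \<le> t"
  shows "u (x, t) \<le> v (x, t)"
proof (rule ccontr)
  assume "\<not> ?thesis"
  then have pos: "u (x, t) - v (x, t) > 0" by simp
  then have t0: "t > 0" using init[OF x] t by (cases "t = 0") auto
  have LM: "0 \<le> L" "0 \<le> M" using u v lipschitz_on_nonneg by blast+
  \<comment> \<open>A quarter of the assumed gap: each of the three penalties is at most
    \<open>\<theta>\<close> at \<open>(x, t)\<close>, so the value there remains at least
    \<open>\<theta>\<close>.\<close>
  define \<theta> where "\<theta> = (u (x, t) - v (x, t)) / 4"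
  have th: "\<theta> > 0" using pos by (simp add: \<theta>_def)
  define k0 \<mu> where "k0 = \<theta> / t" and "\<mu> = \<theta> / t\<^sup>2"
  have lm: "k0 > 0" "\<mu> > 0" "k0 * t = \<theta>" "\<mu> * t\<^sup>2 = \<theta>" using th t0 by (auto simp: k0_def \<mu>_def)
  \<comment> \<open>From \<open>u - v \<le> (L + M) * s\<close> and a nonnegative maximum one gets
    \<open>\<mu> * s \<le> L + M\<close>.\<close>
  define T where "T = (L + M) / \<mu>"
  define C where "C = (L + M) * T"
  have TC: "0 \<le> T" "0 \<le> C" using LM lm by (auto simp: T_def C_def)
  obtain d where d: "d > 0" "\<And>x p q. norm p \<le> 2 * L \<Longrightarrow> norm (q - p) \<le> d \<Longrightarrow> \<bar>F x q - F x p\<bar> \<le> k0 / 2"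
    using UC[of "k0 / 2" "2 * L"] lm by auto
  \<comment> \<open>The first bound keeps the penalty at \<open>x\<close> below
    \<open>\<theta>\<close>; the second one makes the spatial gradient of the penalty at most
    \<open>d\<close> at the maximum, which changes the Hamiltonian by at most
    \<open>k0 / 2\<close>.\<close>
  define \<alpha> where "\<alpha> = min (\<theta> / ((norm x)\<^sup>2 + 1)) (d\<^sup>2 / (4 * (C + 1)))"
  have x1: "(norm x)\<^sup>2 + 1 > 0" by (simp add: add_nonneg_pos)
  have al: "\<alpha> > 0" "\<alpha> * (norm x)\<^sup>2 \<le> \<theta>" "4 * \<alpha> * C \<le> d\<^sup>2"
  proof -
    show "\<alpha> > 0" using th d TC x1 by (auto simp: \<alpha>_def)
    have "\<alpha> * (norm x)\<^sup>2 \<le> \<theta> / ((norm x)\<^sup>2 + 1) * (norm x)\<^sup>2" by (intro mult_right_mono) (auto simp: \<alpha>_def)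
    also have "\<dots> \<le> \<theta>" using th x1 by (simp add: field_simps)
    finally show "\<alpha> * (norm x)\<^sup>2 \<le> \<theta>" .
    have "4 * \<alpha> * C \<le> 4 * (d\<^sup>2 / (4 * (C + 1))) * C" using TC by (intro mult_right_mono mult_left_mono) (auto simp: \<alpha>_def)
    also have "\<dots> \<le> d\<^sup>2" using TC d by (simp add: field_simps)
    finally show "4 * \<alpha> * C \<le> d\<^sup>2" .
  qed
  define \<zeta> where "\<zeta> z = k0 * snd z + \<mu> * (snd z)\<^sup>2 + \<alpha> * (norm (fst z))\<^sup>2" for z :: "(real ^ 'n) \<times> real"
  define Z where "Z z = ((2 * \<alpha>) *\<^sub>R fst z, k0 + 2 * \<mu> * snd z)" for z :: "(real ^ 'n) \<times> real"
  have \<zeta>: "C1_with_gradient UNIV \<zeta> Z"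
    unfolding C1_with_gradient_def gderiv_def \<zeta>_def Z_def power2_norm_eq_inner
    by (auto intro!: derivative_eq_intros continuous_intros simp: inner_prod_def inner_commute algebra_simps power2_eq_square)
  define X where "X = cball (0 :: real ^ 'n) (sqrt (C / \<alpha>) + norm x + 1) \<times> {0..T + t + 1}"
  let ?S = "S \<times> (UNIV :: real set)"
  have xt: "(x, t) \<in> X \<inter> ?S" using x t TC al by (auto simp: X_def)
  have big: "u (x, t) - v (x, t) - \<zeta> (x, t) \<ge> \<theta>" using lm al by (simp add: \<zeta>_def \<theta>_def)
  have bound: "0 < snd z \<and> snd z \<le> T \<and> \<alpha> * (norm (fst z))\<^sup>2 \<le> C"
    if z: "z \<in> X \<inter> ?S" "u z - v z - \<zeta> z \<ge> \<theta>" for z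
  proof -
    obtain y s where ys: "z = (y, s)" by fastforce
    have y: "y \<in> S" "0 \<le> s" using z(1) ys by (auto simp: X_def)
    have "u z - u (y, 0) \<le> L * s" using lipschitz_onD[OF u, of z "(y, 0)"] y ys by (simp add: dist_Pair_Pair dist_real_def)
    moreover have "v (y, 0) - v z \<le> M * s" using lipschitz_onD[OF v, of "(y, 0)" z] y ys by (simp add: dist_Pair_Pair dist_real_def)
    ultimately have uv: "u z - v z \<le> (L + M) * s" using init[OF y(1)] by (simp add: algebra_simps)
    have z1: "\<zeta> z = k0 * s + \<mu> * s\<^sup>2 + \<alpha> * (norm y)\<^sup>2" by (simp add: \<zeta>_def ys)
    have nn: "0 \<le> k0 * s" "0 \<le> \<mu> * s\<^sup>2" "0 \<le> \<alpha> * (norm y)\<^sup>2" using lm al y by auto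
    have s0: "s > 0" using uv z(2) z1 nn th y(2) by (cases "s = 0") auto
    have "\<mu> * s\<^sup>2 \<le> (L + M) * s" using uv z(2) z1 nn th by linarith
    then have "\<mu> * s \<le> L + M" using s0 by (simp add: power2_eq_square)
    then have sT: "s \<le> T" using lm by (simp add: T_def field_simps)
    have "\<alpha> * (norm y)\<^sup>2 \<le> (L + M) * s" using uv z(2) z1 nn th by linarith
    also have "\<dots> \<le> C" unfolding C_def using sT LM by (intro mult_left_mono) auto
    finally show ?thesis using s0 sT ys by simp
  qed
  show False
  proof (rule viscosity_doubling[where X = X and S = ?S and u = u and v = v and \<zeta> = \<zeta> and Z = Z and L = L
        and F = "evolution_operator F" and F' = "evolution_operator F" and U = "UNIV \<times> {0<..}" and V = "S \<times> {0<..}"])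
    show "compact X" unfolding X_def by (intro compact_Times compact_cball compact_Icc)
    show "closed ?S" using S by (intro closed_Times closed_UNIV)
    show "X \<inter> ?S \<noteq> {}" using xt by blast
    show "L-lipschitz_on X u" using u by (rule lipschitz_on_subset) (auto simp: X_def)
    show "continuous_on (X \<inter> ?S) v"
      by (rule continuous_on_subset[OF lipschitz_on_continuous_on[OF v]]) (auto simp: X_def)
    show "continuous_on UNIV (\<lambda>(z, q). evolution_operator F z q)" by (rule continuous_evolution_operator[OF F])
    then show "continuous_on UNIV (\<lambda>(z, q). evolution_operator F z q)" .
  next
    fix z assume z: "z \<in> X \<inter> ?S" and max: "\<And>y. y \<in> X \<inter> ?S \<Longrightarrow> u y - v y - \<zeta> y \<le> u z - v z - \<zeta> z"
    have b: "0 < snd z" "snd z \<le> T" "\<alpha> * (norm (fst z))\<^sup>2 \<le> C" using bound[OF z] max[OF xt] big by auto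
    have nz: "norm (fst z) \<le> sqrt (C / \<alpha>)" using b al by (intro real_le_rsqrt) (simp add: field_simps)
    define e where "e = min 1 (snd z)"
    have "y \<in> X \<inter> UNIV \<times> {0<..}" if "y \<in> ball z e" for y
    proof -
      have "dist (fst z) (fst y) \<le> dist z y" "dist (snd z) (snd y) \<le> dist z y" by (auto simp: dist_fst_le dist_snd_le)
      then have dd: "dist (fst z) (fst y) < 1" "\<bar>snd z - snd y\<bar> < 1" "\<bar>snd z - snd y\<bar> < snd z"
        using that by (auto simp: e_def dist_real_def)
      have "norm (fst y) \<le> norm (fst z) + dist (fst z) (fst y)"
        by (metis dist_norm norm_minus_commute norm_triangle_sub)
      then have "norm (fst y) \<le> sqrt (C / \<alpha>) + norm x + 1" using dd nz norm_ge_zero[of x] by linarith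
      moreover have "0 < snd y" "snd y \<le> T + t + 1" using dd b t by linarith+
      ultimately show ?thesis by (cases y) (auto simp: X_def)
    qed
    then have "ball z e \<subseteq> X \<inter> UNIV \<times> {0<..}" "ball z e \<inter> ?S \<subseteq> S \<times> {0<..}" by auto
    moreover have "e > 0" using b by (simp add: e_def)
    ultimately show "\<exists>e>0. ball z e \<subseteq> X \<inter> UNIV \<times> {0<..} \<and> ball z e \<inter> ?S \<subseteq> S \<times> {0<..}" by blast
  next
    fix z p assume z: "z \<in> X \<inter> ?S" and max: "\<And>y. y \<in> X \<inter> ?S \<Longrightarrow> u y - v y - \<zeta> y \<le> u z - v z - \<zeta> z"
      and p: "norm p \<le> 2 * L" and 1: "evolution_operator F z p \<le> 0" and 2: "0 \<le> evolution_operator F z (p - Z z)"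
    have b: "0 < snd z" "snd z \<le> T" "\<alpha> * (norm (fst z))\<^sup>2 \<le> C" using bound[OF z] max[OF xt] big by auto
    have "norm (fst p) \<le> 2 * L" using p norm_fst_le[of "fst p" "snd p"] by simp
    moreover have "norm (fst (p - Z z) - fst p) \<le> d"
    proof -
      have "norm (fst (p - Z z) - fst p) = 2 * \<alpha> * norm (fst z)" using al by (simp add: Z_def)
      moreover have "(2 * \<alpha> * norm (fst z))\<^sup>2 = 4 * \<alpha> * (\<alpha> * (norm (fst z))\<^sup>2)" by (simp add: power2_eq_square)
      then have "(2 * \<alpha> * norm (fst z))\<^sup>2 \<le> d\<^sup>2"
        using mult_left_mono[OF b(3), of "4 * \<alpha>"] al by linarith
      then have "2 * \<alpha> * norm (fst z) \<le> d" by (rule power2_le_imp_le) (use d in simp)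
      ultimately show ?thesis by simp
    qed
    ultimately have "\<bar>F (fst z) (fst (p - Z z)) - F (fst z) (fst p)\<bar> \<le> k0 / 2" by (rule d(2))
    moreover have "0 \<le> \<mu> * snd z" using lm b by simp
    ultimately show False using 1 2 lm by (simp add: evolution_operator_def Z_def)
  qed (use sub super \<zeta> in auto)
qed

section \<open>Subsolutions and the action of segments\<close>

lemma touching_gradient_bound:
  fixes u :: "(real ^ 'n) \<times> real \<Rightarrow> real"
  assumes \<Omega>: "open \<Omega>" and R: "0 \<le> R" and lip: "\<And>x y t. x \<in> \<Omega> \<Longrightarrow> y \<in> \<Omega> \<Longrightarrow> 0 \<le> t \<Longrightarrow> \<bar>u (x, t) - u (y, t)\<bar> \<le> R * norm (x - y)"
    and \<phi>: "C1_with_gradient UNIV \<phi> G" and z0: "z0 \<in> \<Omega> \<times> {0<..}"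
    and touch: "\<forall>\<^sub>F z in at z0 within (\<Omega> \<times> {0<..}). u z - \<phi> z \<le> u z0 - \<phi> z0"
  shows "norm (fst (G z0)) \<le> R"
proof (cases "fst (G z0) = 0")
  case True then show ?thesis using R by simp
next
  case False
  define g where "g = fst (G z0)"
  have g: "g \<noteq> 0" using False by (simp add: g_def)
  obtain x t where z: "z0 = (x, t)" by fastforce
  have x: "x \<in> \<Omega>" "0 < t" using z0 z by auto
  obtain e where e: "e > 0" "ball x e \<subseteq> \<Omega>" using \<Omega> x openE by blast
  have inO: "x - r *\<^sub>R g \<in> \<Omega>" if "0 < r" "r < e / norm g" for r
  proof -
    have "dist x (x - r *\<^sub>R g) < e" using that g by (simp add: dist_norm field_simps)
    then show ?thesis using e(2) by auto
  qed
  \<comment> \<open>Going against its own spatial gradient, a test function that touches from above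
    cannot fall faster than \<open>u\<close> does.\<close>
  have "- (R * norm g) \<le> (- g, 0) \<bullet> G z0"
  proof (rule touching_slope[OF \<phi> _ touch, where d = "e / norm g"])
    show "(- g, 0 :: real) \<noteq> 0" using g by (simp add: zero_prod_def)
    show "0 < e / norm g" using e g by simp
    fix r assume r: "0 < r" "r < e / norm g"
    have zr: "z0 + r *\<^sub>R (- g, 0) = (x - r *\<^sub>R g, t)" by (simp add: z)
    show "z0 + r *\<^sub>R (- g, 0) \<in> \<Omega> \<times> {0<..}" unfolding zr using inO[OF r] x by simp
    assume "u (z0 + r *\<^sub>R (- g, 0)) - \<phi> (z0 + r *\<^sub>R (- g, 0)) \<le> u z0 - \<phi> z0"
    moreover have "\<bar>u (x - r *\<^sub>R g, t) - u (x, t)\<bar> \<le> R * norm (x - r *\<^sub>R g - x)" using lip[of "x - r *\<^sub>R g" x t] inO[OF r] x by simp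
    then have "u z0 - u (z0 + r *\<^sub>R (- g, 0)) \<le> r * (R * norm g)" using r unfolding zr z by (simp add: mult.left_commute)
    ultimately show "\<phi> z0 + r * - (R * norm g) \<le> \<phi> (z0 + r *\<^sub>R (- g, 0))" by simp
  qed
  then have "norm g * norm g \<le> R * norm g" by (simp add: inner_prod_def g_def power2_norm_eq_inner[symmetric] power2_eq_square)
  then show ?thesis using g by (simp add: g_def)
qed

text \<open>The action per unit of time along the segment is at most \<open>l\<close>. Momenta are restricted to \<open>norm p \<le> R\<close>,
  which keeps the Lagrangian finite and is harmless for functions with Lipschitz constant \<open>R\<close>.\<close>
definition segment_cost :: "('a::euclidean_space \<Rightarrow> 'a \<Rightarrow> real) \<Rightarrow> real \<Rightarrow> 'a \<Rightarrow> 'a \<Rightarrow> real \<Rightarrow> real \<Rightarrow> bool" where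
  "segment_cost F R x v h l \<longleftrightarrow> (\<forall>r\<in>{0..h}. \<forall>p. norm p \<le> R \<longrightarrow> p \<bullet> v - F (x + r *\<^sub>R v) p \<le> l)"

text \<open>The supersolution compared with \<open>u\<close> lives only on the space-time segment, where the
  affine function of time with slope \<open>l\<close> satisfies \<open>v \<bullet> Dw + w\<^sub>t = l\<close>.\<close>
lemma subsolution_along_segment_pos:
  fixes F :: "real ^ 'n \<Rightarrow> real ^ 'n \<Rightarrow> real" and u :: "(real ^ 'n) \<times> real \<Rightarrow> real"
  assumes F: "continuous_on UNIV (\<lambda>(x, p). F x p)" and \<Omega>: "open \<Omega>" and R: "0 \<le> R"
    and u: "L-lipschitz_on (\<Omega> \<times> {0..}) u"
    and lip: "\<And>x y t. x \<in> \<Omega> \<Longrightarrow> y \<in> \<Omega> \<Longrightarrow> 0 \<le> t \<Longrightarrow> \<bar>u (x, t) - u (y, t)\<bar> \<le> R * norm (x - y)"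
    and sub: "viscosity_subsolution_on (\<Omega> \<times> {0<..}) (evolution_operator F) u"
    and seg: "segment_cost F R x v h l" and inO: "\<And>r. 0 \<le> r \<Longrightarrow> r \<le> h \<Longrightarrow> x + r *\<^sub>R v \<in> \<Omega>"
    and h: "0 < h" and t0: "0 < t0"
  shows "u (x + h *\<^sub>R v, t0 + h) \<le> u (x, t0) + h * l"
proof (rule field_le_epsilon)
  fix e :: real assume "0 < e"
  define k where "k = e / h"
  have k: "0 < k" "k * h = e" using \<open>0 < e\<close> h by (auto simp: k_def)
  define \<gamma> where "\<gamma> r = (x + r *\<^sub>R v, t0 + r)" for r
  define S where "S = \<gamma> ` {0..h}"
  have S: "compact S" unfolding S_def \<gamma>_def by (intro compact_continuous_image continuous_intros) auto
  have SO: "S \<subseteq> \<Omega> \<times> {0<..}" using inO t0 by (auto simp: S_def \<gamma>_def)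
  have "open (\<Omega> \<times> {0::real<..})" using \<Omega> by (intro open_Times) auto
  from compact_in_open_separated[OF _ S this SO] obtain d where d: "d > 0" "{z. infdist z S \<le> d} \<subseteq> \<Omega> \<times> {0<..}"
    using h by (auto simp: S_def)
  define X where "X = {z. infdist z S \<le> d}"
  have Sne: "S \<noteq> {}" using h by (auto simp: S_def)
  have X: "compact X" unfolding X_def by (rule compact_infdist_le[OF Sne S d(1)])
  have XO: "X \<subseteq> \<Omega> \<times> {0<..}" using d by (simp add: X_def)
  have SX: "S \<subseteq> X" using d by (auto simp: X_def)
  define w where "w z = (l + k) * (snd z - t0)" for z :: "(real ^ 'n) \<times> real"
  \<comment> \<open>The maximum builds the bound on touching gradients into the equation, so the
    momentum delivered by the doubling obeys \<open>norm (fst p) \<le> R\<close> and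
    \<open>segment_cost\<close> applies to it.\<close>
  define F1 where "F1 z q = max (evolution_operator F z q) (norm (fst q) - R)" for z q :: "(real ^ 'n) \<times> real"
  define F2 where "F2 z q = q \<bullet> (v, 1) - (l + k)" for z q :: "(real ^ 'n) \<times> real"
  \<comment> \<open>The inequality for \<open>w\<close> is tested by going backwards along the
    segment, which is impossible at its start. There \<open>u - w\<close> is not maximal, by
    \<open>gt\<close>; the final point is included.\<close>
  define V where "V = S - {\<gamma> 0}"
  have cF1: "continuous_on UNIV (\<lambda>(z, q). F1 z q)"
  proof -
    have "continuous_on UNIV (\<lambda>w. max ((\<lambda>(z, q). evolution_operator F z q) w) (norm (fst (snd w)) - R))"
      by (intro continuous_intros continuous_evolution_operator[OF F])
    then show ?thesis by (simp add: F1_def split_beta)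
  qed
  have cF2: "continuous_on UNIV (\<lambda>(z, q). F2 z q)"
    unfolding F2_def split_beta by (intro continuous_intros)
  have sub1: "viscosity_subsolution_on (\<Omega> \<times> {0<..}) F1 u"
    unfolding viscosity_subsolution_on_def
  proof (intro allI ballI impI)
    fix \<phi> G z0 assume z0: "z0 \<in> \<Omega> \<times> {0<..}" and \<phi>: "C1_with_gradient UNIV \<phi> G"
      and touch: "\<forall>\<^sub>F z in at z0 within \<Omega> \<times> {0<..}. u z - \<phi> z \<le> u z0 - \<phi> z0"
    have "evolution_operator F z0 (G z0) \<le> 0" using sub z0 \<phi> touch unfolding viscosity_subsolution_on_def by blast
    moreover have "norm (fst (G z0)) \<le> R" by (rule touching_gradient_bound[OF \<Omega> R lip \<phi> z0 touch])
    ultimately show "F1 z0 (G z0) \<le> 0" by (simp add: F1_def)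
  qed
  have super2: "viscosity_supersolution_on V F2 w"
    unfolding viscosity_supersolution_on_def
  proof (intro allI ballI impI)
    fix \<phi> G z0 assume z0: "z0 \<in> V" and \<phi>: "C1_with_gradient UNIV \<phi> G"
      and touch: "\<forall>\<^sub>F z in at z0 within V. w z - \<phi> z \<ge> w z0 - \<phi> z0"
    obtain s where s: "0 \<le> s" "s \<le> h" "z0 = \<gamma> s" using z0 by (auto simp: V_def S_def)
    have s0: "0 < s" using s z0 by (cases "s = 0") (auto simp: V_def)
    have "l + k \<le> (- (v, 1)) \<bullet> (- G z0)"
    proof (rule touching_slope[OF C1_with_gradient_uminus[OF \<phi>] _ touch s0])
      show "- (v, 1 :: real) \<noteq> 0" by (simp add: zero_prod_def)
      fix r assume r: "0 < r" "r < s"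
      have zr: "z0 + r *\<^sub>R (- (v, 1)) = \<gamma> (s - r)" by (simp add: s \<gamma>_def algebra_simps)
      show "z0 + r *\<^sub>R (- (v, 1)) \<in> V" unfolding zr V_def S_def using r s by (auto simp: \<gamma>_def)
      assume "w (z0 + r *\<^sub>R (- (v, 1))) - \<phi> (z0 + r *\<^sub>R (- (v, 1))) \<ge> w z0 - \<phi> z0"
      moreover have "w (z0 + r *\<^sub>R (- (v, 1))) = w z0 + r * - (l + k)" unfolding zr by (simp add: w_def s \<gamma>_def algebra_simps)
      ultimately show "- \<phi> z0 + r * (l + k) \<le> - \<phi> (z0 + r *\<^sub>R (- (v, 1)))" by linarith
    qed
    then have "l + k \<le> (v, 1) \<bullet> G z0" by (simp only: inner_minus_left inner_minus_right minus_minus)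
    then show "F2 z0 (G z0) \<ge> 0" by (simp add: F2_def inner_commute)
  qed
  show "u (x + h *\<^sub>R v, t0 + h) \<le> u (x, t0) + h * l + e"
  proof (rule ccontr)
    assume "\<not> ?thesis"
    then have gt: "u (\<gamma> 0) - w (\<gamma> 0) < u (\<gamma> h) - w (\<gamma> h)" using k by (simp add: w_def \<gamma>_def algebra_simps)
    have gh: "\<gamma> h \<in> X \<inter> S" using SX h by (auto simp: S_def)
    show False
    proof (rule viscosity_doubling[where X = X and S = S and u = u and v = w and \<zeta> = "\<lambda>z. 0" and Z = "\<lambda>z. 0" and L = L
          and F = F1 and F' = F2 and U = "\<Omega> \<times> {0<..}" and V = V])
      show "X \<inter> S \<noteq> {}" using gh by blast
      show "L-lipschitz_on X u" using u by (rule lipschitz_on_subset) (use XO in auto)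
      show "continuous_on (X \<inter> S) w" unfolding w_def by (intro continuous_intros)
    next
      fix z assume z: "z \<in> X \<inter> S" and max: "\<And>y. y \<in> X \<inter> S \<Longrightarrow> u y - w y - 0 \<le> u z - w z - 0"
      have "z \<noteq> \<gamma> 0" using max[OF gh] gt by auto
      then have "dist z (\<gamma> 0) > 0" by simp
      moreover have "ball z d \<subseteq> X"
      proof
        fix y assume "y \<in> ball z d"
        then have "infdist y S \<le> d" using infdist_le[of z S y] z by (simp add: dist_commute)
        then show "y \<in> X" by (simp add: X_def)
      qed
      ultimately show "\<exists>e>0. ball z e \<subseteq> X \<inter> \<Omega> \<times> {0<..} \<and> ball z e \<inter> S \<subseteq> V"
        using d(1) XO by (intro exI[of _ "min d (dist z (\<gamma> 0))"]) (auto simp: V_def)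
    next
      fix z p assume z: "z \<in> X \<inter> S" and 1: "F1 z p \<le> 0" and 2: "0 \<le> F2 z (p - 0)"
      obtain r where r: "r \<in> {0..h}" "z = \<gamma> r" using z by (auto simp: S_def)
      have "fst p \<bullet> v - F (x + r *\<^sub>R v) (fst p) \<le> l" using seg r 1 by (auto simp: segment_cost_def F1_def)
      moreover have "snd p + F (x + r *\<^sub>R v) (fst p) \<le> 0" using 1 r by (simp add: F1_def evolution_operator_def \<gamma>_def)
      moreover have "l + k \<le> fst p \<bullet> v + snd p" using 2 by (simp add: F2_def inner_prod_def)
      ultimately show False using k by linarith
    qed (use X S cF1 cF2 sub1 super2 in \<open>auto simp: V_def compact_imp_closed C1_with_gradient_const\<close>)
  qed
qed

text \<open>A start at time \<open>0\<close> is the limit of starts at small positive times, by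
  Lipschitz continuity in time.\<close>

lemma subsolution_along_segment:
  fixes F :: "real ^ 'n \<Rightarrow> real ^ 'n \<Rightarrow> real" and u :: "(real ^ 'n) \<times> real \<Rightarrow> real"
  assumes F: "continuous_on UNIV (\<lambda>(x, p). F x p)" and \<Omega>: "open \<Omega>" and R: "0 \<le> R"
    and u: "L-lipschitz_on (\<Omega> \<times> {0..}) u"
    and lip: "\<And>x y t. x \<in> \<Omega> \<Longrightarrow> y \<in> \<Omega> \<Longrightarrow> 0 \<le> t \<Longrightarrow> \<bar>u (x, t) - u (y, t)\<bar> \<le> R * norm (x - y)"
    and sub: "viscosity_subsolution_on (\<Omega> \<times> {0<..}) (evolution_operator F) u"
    and seg: "segment_cost F R x v h l" and inO: "\<And>r. 0 \<le> r \<Longrightarrow> r \<le> h \<Longrightarrow> x + r *\<^sub>R v \<in> \<Omega>"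
    and h: "0 < h" and t0: "0 \<le> t0"
  shows "u (x + h *\<^sub>R v, t0 + h) \<le> u (x, t0) + h * l"
proof (rule field_le_epsilon)
  fix e :: real assume e: "0 < e"
  have L0: "0 \<le> L" using u lipschitz_on_nonneg by blast
  define s where "s = e / (2 * (L + 1))"
  have s: "0 < s" "2 * (L * s) \<le> e" using e L0 by (auto simp: s_def field_simps)
  have shift: "\<bar>u (y, t + s) - u (y, t)\<bar> \<le> L * s" if "y \<in> \<Omega>" "0 \<le> t" for y t
    using lipschitz_onD[OF u, of "(y, t + s)" "(y, t)"] that s by (simp add: dist_Pair_Pair dist_real_def)
  have "u (x + h *\<^sub>R v, (t0 + s) + h) \<le> u (x, t0 + s) + h * l"
    by (rule subsolution_along_segment_pos[OF F \<Omega> R u lip sub seg inO h]) (use t0 s in auto)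
  moreover have "\<bar>u (x + h *\<^sub>R v, (t0 + h) + s) - u (x + h *\<^sub>R v, t0 + h)\<bar> \<le> L * s"
    by (rule shift) (use inO[of h] h t0 in auto)
  moreover have "\<bar>u (x, t0 + s) - u (x, t0)\<bar> \<le> L * s" by (rule shift) (use inO[of 0] h t0 in auto)
  ultimately show "u (x + h *\<^sub>R v, t0 + h) \<le> u (x, t0) + h * l + e" using s(2) by (simp add: add_ac)
qed

text \<open>The strict epigraph is separated from the point \<open>(q, f q)\<close>. The hyperplane
  is not vertical, because the epigraph lies over the whole space.\<close>

lemma convex_on_subgradient:
  fixes f :: "'a::euclidean_space \<Rightarrow> real"
  assumes f: "convex_on UNIV f"
  obtains v where "\<And>p. f p \<ge> f q + v \<bullet> (p - q)"
proof -
  let ?S = "{z. f (fst z) < snd z}" and ?T = "{(q, f q)}"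
  have "convex ?S"
  proof (rule convexI)
    fix x y :: "'a \<times> real" and a b :: real
    assume xy: "x \<in> ?S" "y \<in> ?S" and ab: "0 \<le> a" "0 \<le> b" "a + b = 1"
    have "f (a *\<^sub>R fst x + b *\<^sub>R fst y) \<le> a * f (fst x) + b * f (fst y)"
      using f ab unfolding convex_on_def by simp
    also have "\<dots> < a * snd x + b * snd y"
    proof (cases "a = 0")
      case False
      then have "a * f (fst x) < a * snd x" using xy ab by simp
      moreover have "b * f (fst y) \<le> b * snd y" using xy ab by (intro mult_left_mono) auto
      ultimately show ?thesis by linarith
    qed (use xy ab in simp)
    finally show "a *\<^sub>R x + b *\<^sub>R y \<in> ?S" by simp
  qed
  moreover have "(q, f q + 1) \<in> ?S" by simp
  then have "?S \<noteq> {}" by blast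
  moreover have "?S \<inter> ?T = {}" by auto
  ultimately have "\<exists>w c. w \<noteq> 0 \<and> (\<forall>z\<in>?S. w \<bullet> z \<le> c) \<and> (\<forall>z\<in>?T. w \<bullet> z \<ge> c)"
    by (intro separating_hyperplane_sets) auto
  then obtain w c where w: "w \<noteq> 0" "\<And>z. z \<in> ?S \<Longrightarrow> w \<bullet> z \<le> c" "\<And>z. z \<in> ?T \<Longrightarrow> w \<bullet> z \<ge> c"
    by blast
  obtain a \<beta> where ab: "w = (a, \<beta>)" by fastforce
  have ineq: "a \<bullet> p + \<beta> * r \<le> a \<bullet> q + \<beta> * f q" if "f p < r" for p r
    using w(2)[of "(p, r)"] w(3)[of "(q, f q)"] that by (simp add: ab)
  have b0: "\<beta> \<le> 0" using ineq[of q "f q + 1"] by (simp add: algebra_simps)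
  have "\<beta> \<noteq> 0"
  proof
    assume b: "\<beta> = 0"
    have "a \<bullet> (q + a) \<le> a \<bullet> q" using ineq[of "q + a" "f (q + a) + 1"] b by simp
    then have "a \<bullet> a \<le> 0" by (simp add: inner_add_right)
    then have "a = 0" by (metis inner_gt_zero_iff not_le)
    then show False using w(1) ab b by (simp add: zero_prod_def)
  qed
  then have bn: "\<beta> < 0" using b0 by simp
  have "f p \<ge> f q + ((- 1 / \<beta>) *\<^sub>R a) \<bullet> (p - q)" for p
  proof (rule field_le_epsilon)
    fix e :: real assume "0 < e"
    then have "a \<bullet> p + \<beta> * (f p + e) \<le> a \<bullet> q + \<beta> * f q" by (intro ineq) simp
    then have "a \<bullet> (p - q) \<le> (- \<beta>) * (f p + e - f q)" by (simp add: inner_diff_right algebra_simps)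
    then have "(a \<bullet> (p - q)) / (- \<beta>) \<le> f p + e - f q" using bn by (subst pos_divide_le_eq) (auto simp: mult.commute)
    then show "f q + ((- 1 / \<beta>) *\<^sub>R a) \<bullet> (p - q) \<le> f p + e" by simp
  qed
  then show ?thesis by (rule that)
qed

text \<open>The segment that arrives at the touching point with a subgradient \<open>v\<close> of
  \<open>F x\<close> at the touching momentum \<open>q\<close> is used. By convexity its action rate
  is \<open>v \<bullet> q - F x q\<close> up to a small error from moving \<open>x\<close>, and this
  is the equality case of the Legendre transform.\<close>

lemma subsolution_if_segment_bound:
  fixes F :: "real ^ 'n \<Rightarrow> real ^ 'n \<Rightarrow> real" and u :: "(real ^ 'n) \<times> real \<Rightarrow> real"
  assumes F: "continuous_on UNIV (\<lambda>(x, p). F x p)" and conv: "\<And>x. convex_on UNIV (F x)"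
    and seg: "\<And>x t v h l. 0 < h \<Longrightarrow> h \<le> t \<Longrightarrow> segment_cost F R x v h l \<Longrightarrow> u (x + h *\<^sub>R v, t) \<le> u (x, t - h) + h * l"
  shows "viscosity_subsolution_on (UNIV \<times> {0<..}) (evolution_operator F) u"
  unfolding viscosity_subsolution_on_def
proof (intro allI ballI impI)
  fix \<phi> :: "(real ^ 'n) \<times> real \<Rightarrow> real" and G z0 assume z0: "z0 \<in> UNIV \<times> {0<..}" and \<phi>: "C1_with_gradient UNIV \<phi> G"
    and touch: "\<forall>\<^sub>F z in at z0 within UNIV \<times> {0<..}. u z - \<phi> z \<le> u z0 - \<phi> z0"
  obtain x t where z: "z0 = (x, t)" by fastforce
  have t: "0 < t" using z0 z by simp
  define q where "q = fst (G z0)"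
  obtain v where v: "\<And>p. F x p \<ge> F x q + v \<bullet> (p - q)" using convex_on_subgradient[OF conv] by blast
  have "snd (G z0) + F x q \<le> 0"
  proof (rule field_le_epsilon)
    fix e :: real assume e: "0 < e"
    have "uniformly_continuous_on (cball x 1 \<times> cball 0 R) (\<lambda>(x, p). F x p)"
      by (intro compact_uniformly_continuous continuous_on_subset[OF F] compact_Times compact_cball) auto
    then obtain d where d: "d > 0" "\<And>w w'. w \<in> cball x 1 \<times> cball 0 R \<Longrightarrow> w' \<in> cball x 1 \<times> cball 0 R \<Longrightarrow> dist w' w < d \<Longrightarrow>
        dist ((\<lambda>(x, p). F x p) w') ((\<lambda>(x, p). F x p) w) < e"
      using e unfolding uniformly_continuous_on_def by meson
    have Fx: "F x p - e \<le> F y p" if "dist y x < min 1 d" "norm p \<le> R" for y p :: "real ^ 'n"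
      using d(2)[of "(x, p)" "(y, p)"] that by (simp add: dist_Pair_Pair dist_real_def dist_commute)
    define l where "l = v \<bullet> q - F x q + e"
    define h0 where "h0 = min t (min 1 d / (norm v + 1))"
    have nv: "norm v + 1 > 0" by (simp add: add_nonneg_pos)
    have h0: "0 < h0" using t d nv by (simp add: h0_def)
    have "- l \<le> (- (v, 1)) \<bullet> G z0"
    proof (rule touching_slope[OF \<phi> _ touch h0])
      show "- (v, 1 :: real) \<noteq> 0" by (simp add: zero_prod_def)
      fix r assume r: "0 < r" "r < h0"
      have zr: "z0 + r *\<^sub>R (- (v, 1)) = (x - r *\<^sub>R v, t - r)" by (simp add: z)
      have rt: "r < t" and rd: "r < min 1 d / (norm v + 1)" using r by (auto simp: h0_def)
      show "z0 + r *\<^sub>R (- (v, 1)) \<in> UNIV \<times> {0<..}" unfolding zr using rt by simp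
      have "segment_cost F R (x - r *\<^sub>R v) v r l"
        unfolding segment_cost_def
      proof (intro ballI allI impI)
        fix s and p :: "real ^ 'n" assume s: "s \<in> {0..r}" and p: "norm p \<le> R"
        have "dist (x - r *\<^sub>R v + s *\<^sub>R v) x = (r - s) * norm v"
        proof -
          have "x - r *\<^sub>R v + s *\<^sub>R v - x = (s - r) *\<^sub>R v" by (simp add: algebra_simps)
          then show ?thesis using s by (simp add: dist_norm)
        qed
        also have "\<dots> \<le> r * (norm v + 1)" using s r by (intro mult_mono) auto
        also have "\<dots> < min 1 d" using rd nv by (simp add: field_simps)
        finally have "F x p - e \<le> F (x - r *\<^sub>R v + s *\<^sub>R v) p" using Fx p by blast
        then show "p \<bullet> v - F (x - r *\<^sub>R v + s *\<^sub>R v) p \<le> l" using v[of p] by (simp add: l_def inner_diff_right inner_commute)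
      qed
      from seg[OF r(1) _ this, of t] have "u (x, t) \<le> u (x - r *\<^sub>R v, t - r) + r * l" using rt by simp
      moreover assume "u (z0 + r *\<^sub>R (- (v, 1))) - \<phi> (z0 + r *\<^sub>R (- (v, 1))) \<le> u z0 - \<phi> z0"
      ultimately show "\<phi> z0 + r * - l \<le> \<phi> (z0 + r *\<^sub>R (- (v, 1)))" unfolding zr z by simp
    qed
    then have "(v, 1) \<bullet> G z0 \<le> l" unfolding inner_minus_left by linarith
    then show "snd (G z0) + F x q \<le> 0 + e" by (simp add: l_def inner_prod_def q_def)
  qed
  then show "evolution_operator F z0 (G z0) \<le> 0" by (simp add: evolution_operator_def q_def z)
qed

section \<open>The value function\<close>

text \<open>A polygonal path from \<open>x\<close> to \<open>y\<close> in time \<open>T\<close>;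
  \<open>C\<close> adds up the action bounds chosen for its segments, so it is an upper bound of the
  action and not its exact value.\<close>

inductive reach :: "('a::euclidean_space \<Rightarrow> 'a \<Rightarrow> real) \<Rightarrow> real \<Rightarrow> 'a \<Rightarrow> real \<Rightarrow> 'a \<Rightarrow> real \<Rightarrow> bool"
  for F R x where
  reach_refl: "reach F R x 0 x 0"
| reach_step: "reach F R x T z C \<Longrightarrow> 0 < h \<Longrightarrow> segment_cost F R z v h l \<Longrightarrow> reach F R x (T + h) (z + h *\<^sub>R v) (C + h * l)"

lemma reach_segment_cost: "0 < h \<Longrightarrow> segment_cost F R z v h l \<Longrightarrow> reach F R z h (z + h *\<^sub>R v) (h * l)"
  using reach_step[OF reach_refl] by fastforce

lemma reach_trans: assumes "reach F R x T y C" "reach F R y S z D" shows "reach F R x (T + S) z (C + D)"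
  using assms(2)
proof induction
  case reach_refl then show ?case using assms(1) by simp
next
  case (reach_step S z D h v l)
  then show ?case using reach.reach_step[OF reach_step.IH] by (simp add: add.assoc)
qed

lemma reach_time_nonneg: "reach F R x T y C \<Longrightarrow> 0 \<le> T"
  by (induction rule: reach.induct) auto

lemma reach_time_zero: "reach F R x 0 y C \<Longrightarrow> y = x \<and> C = 0"
  by (cases rule: reach.cases) (use reach_time_nonneg in \<open>fastforce+\<close>)

lemma segment_cost_split:
  fixes F :: "'a::euclidean_space \<Rightarrow> 'a \<Rightarrow> real"
  assumes "segment_cost F R z v h l" "0 \<le> s" "s \<le> h"
  shows "segment_cost F R z v s l" "segment_cost F R (z + s *\<^sub>R v) v (h - s) l"
proof -
  show "segment_cost F R z v s l" using assms by (auto simp: segment_cost_def)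
  show "segment_cost F R (z + s *\<^sub>R v) v (h - s) l"
    unfolding segment_cost_def
  proof (intro ballI allI impI)
    fix r and p :: 'a assume "r \<in> {0..h - s}" "norm p \<le> R"
    then have "p \<bullet> v - F (z + (s + r) *\<^sub>R v) p \<le> l" using assms unfolding segment_cost_def by (metis add_nonneg_nonneg atLeastAtMost_iff le_diff_eq add.commute)
    then show "p \<bullet> v - F (z + s *\<^sub>R v + r *\<^sub>R v) p \<le> l" by (simp add: scaleR_add_left add.assoc)
  qed
qed

text \<open>Segments can be subdivided. The factor \<open>norm v + 1\<close> makes both the
  displacement and the duration of a step small.\<close>

lemma reach_short_induct:
  assumes "reach F R x T y C" and \<epsilon>: "0 < \<epsilon>" and refl: "P x 0 0"
    and step: "\<And>z T C v h l. P z T C \<Longrightarrow> reach F R x T z C \<Longrightarrow> 0 < h \<Longrightarrow> segment_cost F R z v h l \<Longrightarrow> h * (norm v + 1) \<le> \<epsilon>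
       \<Longrightarrow> P (z + h *\<^sub>R v) (T + h) (C + h * l)"
  shows "P y T C"
  using assms(1)
proof induction
  case reach_refl
  show ?case by (rule refl)
next
  case (reach_step T z C h v l)
  obtain M :: nat where M: "h * (norm v + 1) / \<epsilon> < real M" using reals_Archimedean2 by blast
  moreover have "0 \<le> h * (norm v + 1) / \<epsilon>" using reach_step.hyps(2) \<epsilon> by simp
  ultimately have M0: "0 < real M" by linarith
  define s where "s = h / real M"
  have s: "0 < s" "real M * s = h" using reach_step.hyps(2) M0 by (auto simp: s_def)
  have "s * (norm v + 1) \<le> \<epsilon>" using M M0 \<epsilon> by (simp add: s_def field_simps)
  have "i \<le> M \<Longrightarrow> P (z + (real i * s) *\<^sub>R v) (T + real i * s) (C + real i * s * l) \<and>
     reach F R x (T + real i * s) (z + (real i * s) *\<^sub>R v) (C + real i * s * l)" for i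
  proof (induction i)
    case 0 then show ?case using reach_step by simp
  next
    case (Suc i)
    have i0: "0 \<le> real i * s" "real i * s + s \<le> h"
      using s(1) Suc.prems mult_right_mono[of "real (Suc i)" "real M" s] s(2) by (auto simp: algebra_simps)
    have "segment_cost F R (z + (real i * s) *\<^sub>R v) v (h - real i * s) l"
      by (rule segment_cost_split(2)[OF reach_step.hyps(3)]) (use i0 s in auto)
    then have seg: "segment_cost F R (z + (real i * s) *\<^sub>R v) v s l"
      by (rule segment_cost_split(1)) (use i0 s in auto)
    have IH: "P (z + (real i * s) *\<^sub>R v) (T + real i * s) (C + real i * s * l)"
      "reach F R x (T + real i * s) (z + (real i * s) *\<^sub>R v) (C + real i * s * l)" using Suc by auto
    have eq: "z + (real i * s) *\<^sub>R v + s *\<^sub>R v = z + (real (Suc i) * s) *\<^sub>R v" "T + real i * s + s = T + real (Suc i) * s"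
      "C + real i * s * l + s * l = C + real (Suc i) * s * l" by (simp_all add: algebra_simps)
    show ?case using step[OF IH s(1) seg \<open>s * (norm v + 1) \<le> \<epsilon>\<close>] reach.reach_step[OF IH(2) s(1) seg] unfolding eq by blast
  qed
  from this[of M] show ?case using s by simp
qed

lemma reach_split:
  assumes "reach F R x T z C" "0 \<le> S" "S \<le> T"
  shows "\<exists>y C1 C2. reach F R x S y C1 \<and> reach F R y (T - S) z C2 \<and> C = C1 + C2"
  using assms
proof (induction arbitrary: rule: reach.induct)
  case reach_refl
  then have "S = 0" by simp
  then show ?case using reach.reach_refl[of F R x] by fastforce
next
  case (reach_step T z C h v l)
  show ?case
  proof (cases "S \<le> T")
    case True
    then obtain y C1 C2 where y: "reach F R x S y C1" "reach F R y (T - S) z C2" "C = C1 + C2"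
      using reach_step by blast
    have "reach F R y (T - S + h) (z + h *\<^sub>R v) (C2 + h * l)"
      using reach.reach_step[OF y(2) reach_step.hyps(2,3)] .
    moreover have "T - S + h = T + h - S" by simp
    ultimately show ?thesis using y by (intro exI[of _ y] exI[of _ C1] exI[of _ "C2 + h * l"]) auto
  next
    case False
    define s where "s = S - T"
    have s: "0 < s" "s \<le> h" using False reach_step.prems by (auto simp: s_def)
    have 1: "reach F R x S (z + s *\<^sub>R v) (C + s * l)"
      using reach.reach_step[OF reach_step.hyps(1) s(1) segment_cost_split(1)[OF reach_step.hyps(3)]] s by (simp add: s_def)
    have "reach F R (z + s *\<^sub>R v) (h - s) (z + h *\<^sub>R v) ((h - s) * l)"
    proof (cases "s = h")
      case True then show ?thesis using reach_refl by (metis diff_self mult_zero_left)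
    next
      case False
      then have "reach F R (z + s *\<^sub>R v) (h - s) (z + s *\<^sub>R v + (h - s) *\<^sub>R v) ((h - s) * l)"
        using s reach_step.hyps(3) by (intro reach_segment_cost segment_cost_split(2)) auto
      then show ?thesis by (simp add: algebra_simps)
    qed
    moreover have "h - s = T + h - S" by (simp add: s_def)
    ultimately show ?thesis using 1
      by (intro exI[of _ "z + s *\<^sub>R v"] exI[of _ "C + s * l"] exI[of _ "(h - s) * l"]) (auto simp: algebra_simps)
  qed
qed

text \<open>Scaling space and time by the same factor preserves velocities and action rates.\<close>

lemma reach_scale:
  fixes F :: "'a::euclidean_space \<Rightarrow> 'a \<Rightarrow> real"
  assumes "reach F R x T y C" "0 < c"
  shows "reach (\<lambda>x p. F (x /\<^sub>R c) p) R (c *\<^sub>R x) (c * T) (c *\<^sub>R y) (c * C)"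
  using assms(1)
proof induction
  case reach_refl then show ?case using reach.reach_refl by fastforce
next
  case (reach_step T z C h v l)
  have "segment_cost (\<lambda>x p. F (x /\<^sub>R c) p) R (c *\<^sub>R z) v (c * h) l"
    unfolding segment_cost_def
  proof (intro ballI allI impI)
    fix r and p :: 'a assume r: "r \<in> {0..c * h}" and p: "norm p \<le> R"
    have "r / c \<in> {0..h}" using r assms(2) by (simp add: field_simps)
    then have "p \<bullet> v - F (z + (r / c) *\<^sub>R v) p \<le> l" using reach_step.hyps(3) p by (auto simp: segment_cost_def)
    moreover have "(c *\<^sub>R z + r *\<^sub>R v) /\<^sub>R c = z + (r / c) *\<^sub>R v"
      using assms(2) by (simp add: scaleR_add_right divide_inverse mult.commute)
    ultimately show "p \<bullet> v - F ((c *\<^sub>R z + r *\<^sub>R v) /\<^sub>R c) p \<le> l" by simp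
  qed
  from reach.reach_step[OF reach_step.IH _ this] show ?case using reach_step.hyps(2) assms(2) by (simp add: algebra_simps)
qed

lemma reach_translate:
  fixes F :: "'a::euclidean_space \<Rightarrow> 'a \<Rightarrow> real"
  assumes "reach F R x T y C" and per: "\<And>z p. F (z + k) p = F z p"
  shows "reach F R (x + k) T (y + k) C"
  using assms(1)
proof induction
  case reach_refl then show ?case using reach.reach_refl by fastforce
next
  case (reach_step T z C h v l)
  have "segment_cost F R (z + k) v h l"
    unfolding segment_cost_def
  proof (intro ballI allI impI)
    fix r and p :: 'a assume "r \<in> {0..h}" "norm p \<le> R"
    moreover have "F (z + k + r *\<^sub>R v) p = F (z + r *\<^sub>R v) p" using per[of "z + r *\<^sub>R v"] by (simp add: add_ac)
    ultimately show "p \<bullet> v - F (z + k + r *\<^sub>R v) p \<le> l" using reach_step.hyps(3) by (auto simp: segment_cost_def)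
  qed
  from reach.reach_step[OF reach_step.IH reach_step.hyps(2) this] show ?case by (simp add: add_ac)
qed

lemma subsolution_along_reach:
  fixes F :: "real ^ 'n \<Rightarrow> real ^ 'n \<Rightarrow> real" and u :: "(real ^ 'n) \<times> real \<Rightarrow> real"
  assumes F: "continuous_on UNIV (\<lambda>(x, p). F x p)" and R: "0 \<le> R"
    and u: "L-lipschitz_on (UNIV \<times> {0..}) u"
    and lip: "\<And>x y t. 0 \<le> t \<Longrightarrow> \<bar>u (x, t) - u (y, t)\<bar> \<le> R * norm (x - y)"
    and sub: "viscosity_subsolution_on (UNIV \<times> {0<..}) (evolution_operator F) u"
    and r: "reach F R x T y C" and t0: "0 \<le> t0"
  shows "u (y, t0 + T) \<le> u (x, t0) + C"
  using r
proof induction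
  case (reach_step T z C h v l)
  have "u (z + h *\<^sub>R v, (t0 + T) + h) \<le> u (z, t0 + T) + h * l"
    by (rule subsolution_along_segment[OF F _ R u lip sub reach_step.hyps(3) _ reach_step.hyps(2)])
      (use reach_time_nonneg[OF reach_step.hyps(1)] t0 in auto)
  then show ?case using reach_step.IH by (simp add: add.assoc)
qed simp

lemma lipschitz_in_space:
  fixes u :: "(real ^ 'n) \<times> real \<Rightarrow> real"
  assumes "L-lipschitz_on (S \<times> {0..}) u" "L \<le> R" "x \<in> S" "y \<in> S" "0 \<le> t"
  shows "\<bar>u (x, t) - u (y, t)\<bar> \<le> R * norm (x - y)"
proof -
  have "\<bar>u (x, t) - u (y, t)\<bar> \<le> L * norm (x - y)"
    using lipschitz_onD[OF assms(1), of "(x, t)" "(y, t)"] assms by (simp add: dist_Pair_Pair dist_norm)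
  also have "\<dots> \<le> R * norm (x - y)" using assms by (intro mult_right_mono) auto
  finally show ?thesis .
qed

text \<open>The Hopf-Lax infimum with momenta cut off at \<open>R\<close>. For nonnegative times and
  data with Lipschitz constant at most \<open>R\<close> the set is nonempty, because one may wait,
  and bounded below, by \<open>payoff_lower\<close>.\<close>

definition value_function :: "('a::euclidean_space \<Rightarrow> 'a \<Rightarrow> real) \<Rightarrow> real \<Rightarrow> ('a \<Rightarrow> real) \<Rightarrow> 'a \<times> real \<Rightarrow> real" where
  "value_function F R g z = Inf {g y + C |y C. reach F R y (snd z) (fst z) C}"

text \<open>\<open>a\<close> is a speed available everywhere at action rate \<open>b\<close>, and
  \<open>m B\<close> bounds \<open>F\<close> on momenta of norm at most \<open>B\<close>. All bounds
  are uniform in \<open>x\<close>, so \<open>F (x /\<^sub>R e) p\<close> satisfies them with the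
  same constants.\<close>

locale hamiltonian =
  fixes F :: "real ^ 'n \<Rightarrow> real ^ 'n \<Rightarrow> real" and a b :: real and m :: "real \<Rightarrow> real"
  assumes cont: "continuous_on UNIV (\<lambda>(x, p). F x p)"
    and zero: "F x 0 = 0" and nonneg: "0 \<le> F x p" and conv: "convex_on UNIV (F x)"
    and UC: "0 < e \<Longrightarrow> \<exists>d>0. \<forall>x p q. norm p \<le> B \<longrightarrow> norm (q - p) \<le> d \<longrightarrow> \<bar>F x q - F x p\<bar> \<le> e"
    and upper: "norm p \<le> B \<Longrightarrow> F x p \<le> m B"
    and lower: "a * norm p - b \<le> F x p" and a: "0 < a" and b: "0 \<le> b"
begin

lemma m_nonneg: "0 \<le> B \<Longrightarrow> 0 \<le> m B"
  using upper[of 0 B] by (simp add: zero)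

lemma reach_cost_nonneg: "reach F R x T y C \<Longrightarrow> 0 \<le> R \<Longrightarrow> 0 \<le> C"
proof (induction rule: reach.induct)
  case (reach_step T z C h v l)
  then have "0 \<bullet> v - F (z + 0 *\<^sub>R v) 0 \<le> l" unfolding segment_cost_def by (metis atLeastAtMost_iff less_imp_le norm_zero order_refl)
  then have "0 \<le> l" by (simp add: zero)
  then show ?case using reach_step by simp
qed simp

text \<open>The momentum of norm \<open>B\<close> parallel to the velocity is inserted into the
  bound of each segment.\<close>

lemma reach_cost_lower:
  assumes "reach F R x T y C" "0 \<le> B" "B \<le> R" shows "B * norm (y - x) \<le> C + m B * T"
  using assms(1)
proof induction
  case (reach_step T z C h v l)
  have l: "B * norm v \<le> l + m B"
  proof (cases "v = 0")
    case True
    have "0 \<bullet> v - F (z + 0 *\<^sub>R v) 0 \<le> l" using reach_step assms unfolding segment_cost_def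
      by (metis atLeastAtMost_iff less_imp_le norm_zero order_refl order_trans)
    then show ?thesis using m_nonneg[OF assms(2)] True by (simp add: zero)
  next
    case False
    let ?p = "(B / norm v) *\<^sub>R v"
    have n: "norm ?p = B" using False assms by simp
    have "?p \<bullet> v - F (z + 0 *\<^sub>R v) ?p \<le> l"
      using reach_step n assms unfolding segment_cost_def by (metis atLeastAtMost_iff less_imp_le order_refl)
    moreover have "?p \<bullet> v = B * norm v" using False by (simp add: dot_square_norm power2_eq_square)
    moreover have "F (z + 0 *\<^sub>R v) ?p \<le> m B" using n by (intro upper) simp
    ultimately show ?thesis by linarith
  qed
  have "norm (z + h *\<^sub>R v - x) \<le> norm (z - x) + h * norm v"
    using norm_triangle_ineq[of "z - x" "h *\<^sub>R v"] reach_step.hyps(2) by (simp add: algebra_simps)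
  then have "B * norm (z + h *\<^sub>R v - x) \<le> B * norm (z - x) + h * (B * norm v)"
    using mult_left_mono[OF _ assms(2)] by (fastforce simp: algebra_simps)
  also have "h * (B * norm v) \<le> h * (l + m B)" using l reach_step.hyps(2) by (intro mult_left_mono) auto
  finally show ?case using reach_step.IH by (simp add: algebra_simps)
qed simp

lemma reach_wait: "0 \<le> h \<Longrightarrow> reach F R x h x 0"
proof (cases "h = 0")
  case True then show ?thesis by (simp add: reach_refl)
next
  case False
  assume "0 \<le> h"
  then have "reach F R x h (x + h *\<^sub>R 0) (h * 0)"
    using False by (intro reach_segment_cost) (auto simp: segment_cost_def nonneg)
  then show ?thesis by simp
qed

lemma segment_cost_slow: assumes "norm v \<le> a" shows "segment_cost F R x v h b"
  unfolding segment_cost_def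
proof (intro ballI allI impI)
  fix r and p :: "real ^ 'n"
  have "p \<bullet> v \<le> norm p * norm v" by (rule norm_cauchy_schwarz)
  also have "\<dots> \<le> norm p * a" using assms by (intro mult_left_mono) auto
  finally show "p \<bullet> v - F (x + r *\<^sub>R v) p \<le> b" using lower[of p "x + r *\<^sub>R v"] by (simp add: mult.commute)
qed

lemma reach_slow:
  assumes "norm (y - x) \<le> a * h" "0 < h" shows "reach F R x h y (b * h)"
proof -
  define v where "v = (y - x) /\<^sub>R h"
  have "norm v = norm (y - x) / h" using assms(2) unfolding v_def norm_scaleR by (simp add: divide_inverse)
  then have v: "norm v \<le> a" using assms by (simp add: pos_divide_le_eq)
  from reach_segment_cost[OF assms(2) segment_cost_slow[OF v], of R x] show ?thesis using assms(2) by (simp add: v_def mult.commute)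
qed

text \<open>This action depends on the cutoff \<open>R\<close>. It serves the qualitative Lipschitz
  bound in space; the quantitative estimates use \<open>reach_slow\<close>.\<close>

lemma reach_unit_speed: assumes "0 \<le> R" shows "reach F R x (norm (y - x)) y (R * norm (y - x))"
proof (cases "y = x")
  case True then show ?thesis by (simp add: reach_refl)
next
  case False
  define h where "h = norm (y - x)"
  have h: "0 < h" using False by (simp add: h_def)
  define v where "v = (y - x) /\<^sub>R h"
  have v: "norm v = 1" using h by (simp add: v_def h_def)
  have "segment_cost F R x v h R"
    unfolding segment_cost_def
  proof (intro ballI allI impI)
    fix r and p :: "real ^ 'n" assume "norm p \<le> R"
    moreover have "p \<bullet> v \<le> norm p * norm v" by (rule norm_cauchy_schwarz)
    ultimately show "p \<bullet> v - F (x + r *\<^sub>R v) p \<le> R" using nonneg[of "x + r *\<^sub>R v" p] v by simp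
  qed
  from reach_segment_cost[OF h this] show ?thesis using h by (simp add: v_def h_def mult.commute)
qed

context
  fixes g :: "real ^ 'n \<Rightarrow> real" and K R :: real
  assumes g: "K-lipschitz_on UNIV g" and KR: "K \<le> R"
begin

lemma K0: "0 \<le> K" and R0: "0 \<le> R"
  using lipschitz_on_nonneg[OF g] KR by auto

lemma g_diff: "g x - g y \<le> K * norm (x - y)"
  using lipschitz_onD[OF g, of x y] by (simp add: dist_norm)

lemma payoff_lower: assumes "reach F R y t x C" shows "g x - m K * t \<le> g y + C"
  using reach_cost_lower[OF assms K0 KR] g_diff[of x y] by simp

lemma value_set_bdd: "bdd_below {g y + C |y C. reach F R y t x C}"
  using payoff_lower by (intro bdd_belowI[of _ "g x - m K * t"]) blast

lemma value_le: "reach F R y t x C \<Longrightarrow> value_function F R g (x, t) \<le> g y + C"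
  unfolding value_function_def using value_set_bdd by (intro cInf_lower) auto

lemma value_ge:
  assumes "0 \<le> t" "\<And>y C. reach F R y t x C \<Longrightarrow> c \<le> g y + C"
  shows "c \<le> value_function F R g (x, t)"
  unfolding value_function_def
proof (rule cInf_greatest)
  show "{g y + C |y C. reach F R y (snd (x, t)) (fst (x, t)) C} \<noteq> {}" using reach_wait[OF assms(1)] by auto
qed (use assms(2) in auto)

lemma value_lower: "0 \<le> t \<Longrightarrow> g x - m K * t \<le> value_function F R g (x, t)"
  by (rule value_ge) (use payoff_lower in auto)

lemma value_upper: "0 \<le> t \<Longrightarrow> value_function F R g (x, t) \<le> g x"
  using value_le[OF reach_wait] by simp

lemma value_init: "value_function F R g (x, 0) = g x"
  using value_lower[of 0 x] value_upper[of 0 x] by simp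

lemma value_dpp: "reach F R y s x C \<Longrightarrow> 0 \<le> t \<Longrightarrow> value_function F R g (x, t + s) \<le> value_function F R g (y, t) + C"
proof -
  assume r: "reach F R y s x C" and t: "0 \<le> t"
  have "value_function F R g (x, t + s) - C \<le> value_function F R g (y, t)"
  proof (rule value_ge[OF t])
    fix z D assume "reach F R z t y D"
    from value_le[OF reach_trans[OF this r]] show "value_function F R g (x, t + s) - C \<le> g z + D" by simp
  qed
  then show ?thesis by simp
qed

lemma value_time_mono: "0 \<le> t \<Longrightarrow> 0 \<le> s \<Longrightarrow> value_function F R g (x, t + s) \<le> value_function F R g (x, t)"
  using value_dpp[OF reach_wait] by simp

text \<open>The first part of the path, of duration \<open>s\<close>, is cut off; by
  \<open>payoff_lower\<close> this changes the payoff by at most \<open>m K * s\<close>.\<close>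

lemma value_time_lipschitz:
  assumes "0 \<le> t" "0 \<le> s" shows "value_function F R g (x, t) \<le> value_function F R g (x, t + s) + m K * s"
proof -
  have "value_function F R g (x, t) - m K * s \<le> value_function F R g (x, t + s)"
  proof (rule value_ge)
    fix y C assume "reach F R y (t + s) x C"
    from reach_split[OF this, of s] assms obtain z C1 C2 where
      z: "reach F R y s z C1" "reach F R z t x C2" "C = C1 + C2" by auto
    show "value_function F R g (x, t) - m K * s \<le> g y + C" using value_le[OF z(2)] payoff_lower[OF z(1)] z(3) by simp
  qed (use assms in simp)
  then show ?thesis by simp
qed

lemma value_space_lipschitz:
  assumes "0 \<le> t" shows "value_function F R g (x, t) \<le> value_function F R g (y, t) + (R + m K) * norm (x - y)"
  using value_dpp[OF reach_unit_speed[OF R0, of y x] assms] value_time_lipschitz[OF assms norm_ge_zero, of x "x - y"]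
  by (simp add: algebra_simps)

lemma value_lipschitz: "(R + 2 * m K)-lipschitz_on (UNIV \<times> {0..}) (value_function F R g)"
proof (rule lipschitz_onI)
  have mK: "0 \<le> m K" using m_nonneg K0 by blast
  then show "0 \<le> R + 2 * m K" using R0 by simp
  have *: "value_function F R g (x, t) - value_function F R g (y, s) \<le> (R + m K) * norm (x - y) + m K * \<bar>t - s\<bar>"
    if ts: "0 \<le> t" "0 \<le> s" for x y t s
  proof -
    have "value_function F R g (x, t) \<le> value_function F R g (x, s) + m K * \<bar>t - s\<bar>"
    proof (cases "t \<le> s")
      case True then show ?thesis using value_time_lipschitz[of t "s - t" x] ts by simp
    next
      case False
      then have "value_function F R g (x, t) \<le> value_function F R g (x, s)" using value_time_mono[of s "t - s" x] ts by simp
      moreover have "0 \<le> m K * \<bar>t - s\<bar>" using mK by simp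
      ultimately show ?thesis by linarith
    qed
    then show ?thesis using value_space_lipschitz[OF ts(2), of x y] by linarith
  qed
  fix z w :: "(real ^ 'n) \<times> real" assume zw: "z \<in> UNIV \<times> {0..}" "w \<in> UNIV \<times> {0..}"
  obtain x t where z: "z = (x, t)" by fastforce
  obtain y s where w: "w = (y, s)" by fastforce
  have ts: "0 \<le> t" "0 \<le> s" using zw z w by auto
  have d: "norm (x - y) \<le> dist z w" "\<bar>t - s\<bar> \<le> dist z w"
    using dist_fst_le[of z w] dist_snd_le[of z w] by (auto simp: z w dist_norm)
  have "(R + m K) * norm (x - y) + m K * \<bar>t - s\<bar> \<le> (R + m K) * dist z w + m K * dist z w"
    using d mK R0 by (intro add_mono mult_left_mono) auto
  also have "\<dots> = (R + 2 * m K) * dist z w" by (simp add: algebra_simps)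
  finally show "dist (value_function F R g z) (value_function F R g w) \<le> (R + 2 * m K) * dist z w"
    using *[OF ts, of x y] *[OF ts(2,1), of y x] by (simp add: z w dist_real_def abs_le_iff norm_minus_commute abs_minus_commute)
qed

lemma value_subsolution: "viscosity_subsolution_on (UNIV \<times> {0<..}) (evolution_operator F) (value_function F R g)"
proof (rule subsolution_if_segment_bound[OF cont conv])
  fix x t v h l assume "0 < h" "h \<le> t" "segment_cost F R x v h l"
  then show "value_function F R g (x + h *\<^sub>R v, t) \<le> value_function F R g (x, t - h) + h * l"
    using value_dpp[OF reach_segment_cost[of h F R x v l], of "t - h"] by simp
qed

lemma value_le_supersolution:
  assumes S: "closed S" and v: "M-lipschitz_on (S \<times> {0..}) v"
    and super: "viscosity_supersolution_on (S \<times> {0<..}) (evolution_operator F) v"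
    and init: "\<And>x. x \<in> S \<Longrightarrow> g x \<le> v (x, 0)" and x: "x \<in> S" and t: "0 \<le> t"
  shows "value_function F R g (x, t) \<le> v (x, t)"
  by (rule comparison_principle[OF cont UC S value_lipschitz v value_subsolution super _ x t])
    (use init value_init in auto)

text \<open>Together with \<open>value_le_supersolution\<close> this identifies a solution with the
  value function as soon as \<open>R\<close> is at least its Lipschitz constant.\<close>

lemma subsolution_le_value:
  assumes u: "L-lipschitz_on (UNIV \<times> {0..}) u" and LR: "L \<le> R"
    and sub: "viscosity_subsolution_on (UNIV \<times> {0<..}) (evolution_operator F) u"
    and init: "\<And>x. u (x, 0) \<le> g x" and t: "0 \<le> t"
  shows "u (x, t) \<le> value_function F R g (x, t)"
proof (rule value_ge[OF t])
  fix y C assume "reach F R y t x C"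
  from subsolution_along_reach[OF cont R0 u _ sub this order_refl] lipschitz_in_space[OF u LR]
  have "u (x, 0 + t) \<le> u (y, 0) + C" by blast
  then show "u (x, t) \<le> g y + C" using init[of y] by simp
qed

end

end

section \<open>Cutting and gluing of paths\<close>

text \<open>Blocks of duration and displacement at most \<open>1\<close>: all their increments are
  then admissible weights for \<open>signed_necklace_splitting\<close>.\<close>

inductive fine_chain :: "('a::euclidean_space \<Rightarrow> 'a \<Rightarrow> real) \<Rightarrow> real \<Rightarrow> 'a \<Rightarrow> real \<Rightarrow> 'a \<Rightarrow> real \<Rightarrow> bool"
  for F R x where
  fine_refl: "fine_chain F R x 0 x 0"
| fine_step: "fine_chain F R x T z C \<Longrightarrow> reach F R z h y k \<Longrightarrow> norm (y - z) \<le> 1 \<Longrightarrow> h \<le> 1 \<Longrightarrow> fine_chain F R x (T + h) y (C + k)"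

lemma reach_fine_chain: assumes "reach F R x T y C" shows "fine_chain F R x T y C"
  using assms zero_less_one fine_refl
proof (rule reach_short_induct[where P = "\<lambda>y T C. fine_chain F R x T y C"])
  fix z T C v h l
  assume f: "fine_chain F R x T z C" and h: "0 < h" "segment_cost F R z v h l" "h * (norm v + 1) \<le> 1"
  have "0 \<le> h * norm v" using h(1) by simp
  moreover have "h * norm v + h \<le> 1" using h(3) by (simp add: distrib_left)
  ultimately have "h * norm v \<le> 1" "h \<le> 1" using h(1) by linarith+
  then show "fine_chain F R x (T + h) (z + h *\<^sub>R v) (C + h * l)"
    using h(1) by (intro fine_step[OF f reach_segment_cost[OF h(1,2)]]) simp_all
qed

lemma fine_chain_sequences:
  assumes "fine_chain F R x T y C"
  shows "\<exists>(N::nat) z h k. z 0 = x \<and> z N = y \<and> (\<Sum>j<N. h j) = T \<and> (\<Sum>j<N. k j) = C \<and>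
     (\<forall>j<N. reach F R (z j) (h j) (z (Suc j)) (k j) \<and> norm (z (Suc j) - z j) \<le> 1 \<and> h j \<le> 1)"
  using assms
proof induction
  case fine_refl
  show ?case by (rule exI[of _ 0], rule exI[of _ "\<lambda>_. x"]) auto
next
  case (fine_step T z C h y k)
  then obtain N zs hs ks where *: "zs 0 = x" "zs N = z" "(\<Sum>j<N. hs j) = T" "(\<Sum>j<N. ks j) = C"
     "\<forall>j<N. reach F R (zs j) (hs j) (zs (Suc j)) (ks j) \<and> norm (zs (Suc j) - zs j) \<le> 1 \<and> hs j \<le> (1::real)" by blast
  show ?case
  proof (intro exI conjI allI impI)
    show "(zs(Suc N := y)) 0 = x" "(zs(Suc N := y)) (Suc N) = y" using * by auto
    show "(\<Sum>j<Suc N. (hs(N := h)) j) = T + h" "(\<Sum>j<Suc N. (ks(N := k)) j) = C + k" using * by simp_all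
    fix j assume "j < Suc N"
    then consider "j = N" | "j < N" by linarith
    then have "reach F R ((zs(Suc N := y)) j) ((hs(N := h)) j) ((zs(Suc N := y)) (Suc j)) ((ks(N := k)) j) \<and>
        norm ((zs(Suc N := y)) (Suc j) - (zs(Suc N := y)) j) \<le> 1 \<and> (hs(N := h)) j \<le> 1"
      by cases (use * fine_step.hyps in auto)
    then show "reach F R ((zs(Suc N := y)) j) ((hs(N := h)) j) ((zs(Suc N := y)) (Suc j)) ((ks(N := k)) j)"
      "norm ((zs(Suc N := y)) (Suc j) - (zs(Suc N := y)) j) \<le> 1" "(hs(N := h)) j \<le> 1" by auto
  qed
qed

lemma integer_points_translate: "\<exists>k\<in>integer_points. norm (z + k - q) \<le> real CARD('n)" for z q :: "real ^ 'n"
proof -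
  define k :: "real ^ 'n" where "k = (\<chi> i. of_int \<lfloor>q $ i - z $ i\<rfloor>)"
  have "norm (z + k - q) \<le> (\<Sum>i\<in>UNIV. \<bar>(z + k - q) $ i\<bar>)" by (rule norm_le_l1_cart)
  also have "\<dots> \<le> (\<Sum>i\<in>(UNIV::'n set). 1)"
  proof (rule sum_mono)
    fix i
    have "of_int \<lfloor>q $ i - z $ i\<rfloor> \<le> q $ i - z $ i" "q $ i - z $ i < of_int \<lfloor>q $ i - z $ i\<rfloor> + 1" by linarith+
    then show "\<bar>(z + k - q) $ i\<bar> \<le> 1" unfolding abs_le_iff by (simp add: k_def) linarith
  qed
  finally have "norm (z + k - q) \<le> real CARD('n)" by simp
  moreover have "k \<in> integer_points" by (simp add: integer_points_def k_def)
  ultimately show ?thesis by blast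
qed

text \<open>The action bound can be raised only on a segment of positive duration, hence the strict
  inequality for the times.\<close>

lemma (in hamiltonian) reach_slack:
  assumes "reach F R x T y C" "T < T'" "C \<le> C'" shows "reach F R x T' y C'"
proof -
  define l where "l = (C' - C) / (T' - T)"
  have l: "0 \<le> l" "(T' - T) * l = C' - C" using assms by (auto simp: l_def)
  have "segment_cost F R y 0 (T' - T) l"
    using l nonneg by (auto simp: segment_cost_def) (smt (verit) nonneg)
  from reach_step[OF assms(1) _ this] show ?thesis using assms l by simp
qed

locale periodic_hamiltonian = hamiltonian F a b m
  for F :: "real ^ 'n \<Rightarrow> real ^ 'n \<Rightarrow> real" and a b m +
  assumes per: "k \<in> integer_points \<Longrightarrow> F (x + k) p = F x p"
begin

text \<open>Within a run of consecutive blocks one integer translate of the original path is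
  followed. At the start of each run the path moves at speed \<open>a\<close> to the closest integer
  translate of the next block; this takes time \<open>\<tau>\<close> and action
  \<open>b * \<tau>\<close>, and displaces by at most the dimension.\<close>

lemma reach_glue_blocks:
  fixes z :: "nat \<Rightarrow> real ^ 'n" and h k :: "nat \<Rightarrow> real"
  assumes R: "0 \<le> R"
    and chain: "\<And>j. j < N \<Longrightarrow> reach F R (z j) (h j) (z (Suc j)) (k j)" and S: "S \<subseteq> {..<N}"
  defines "\<tau> \<equiv> real CARD('n) / a"
  shows "\<exists>q T C. reach F R y T q C \<and> T \<le> sum h S + real (card (block_starts S)) * \<tau> \<and>
     C \<le> sum k S + real (card (block_starts S)) * (b * \<tau>) \<and>
     norm (q - y - (\<Sum>j\<in>S. z (Suc j) - z j)) \<le> real (card (block_starts S)) * real CARD('n)"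
proof -
  let ?n = "real CARD('n)"
  have n: "0 < ?n" by simp
  have \<tau>: "0 < \<tau>" "a * \<tau> = ?n" using a n by (auto simp: \<tau>_def)
  let ?S = "\<lambda>j. {i\<in>S. i < j}" and ?B = "\<lambda>j. real (card {i\<in>block_starts S. i < j})"
  have finS: "finite S" using S finite_subset by blast
  have finB: "finite (block_starts S)" by (rule finite_subset[OF _ finS]) (auto simp: block_starts_def)
  \<comment> \<open>The last clause is what lets a run continue: if the preceding block was used,
    the current point is an integer translate of \<open>z j\<close>.\<close>
  have "j \<le> N \<Longrightarrow> \<exists>q T C. reach F R y T q C \<and> T \<le> sum h (?S j) + ?B j * \<tau> \<and>
     C \<le> sum k (?S j) + ?B j * (b * \<tau>) \<and> norm (q - y - (\<Sum>j\<in>?S j. z (Suc j) - z j)) \<le> ?B j * ?n \<and>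
     (0 < j \<and> j - 1 \<in> S \<longrightarrow> q - z j \<in> integer_points)" for j
  proof (induction j)
    case 0
    show ?case
    proof (intro exI conjI)
      show "reach F R y 0 y 0" by (rule reach_refl)
    qed simp_all
  next
    case (Suc j)
    then obtain q T C where q: "reach F R y T q C" "T \<le> sum h (?S j) + ?B j * \<tau>"
      "C \<le> sum k (?S j) + ?B j * (b * \<tau>)" "norm (q - y - (\<Sum>j\<in>?S j. z (Suc j) - z j)) \<le> ?B j * ?n"
      "0 < j \<and> j - 1 \<in> S \<longrightarrow> q - z j \<in> integer_points" by auto
    show ?case
    proof (cases "j \<in> S")
      case False
      have "?S (Suc j) = ?S j" using False by (auto simp: less_Suc_eq)
      moreover have "{i\<in>block_starts S. i < Suc j} = {i\<in>block_starts S. i < j}" using False by (auto simp: less_Suc_eq block_starts_def)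
      moreover have "0 < Suc j \<and> Suc j - 1 \<in> S \<longrightarrow> q - z (Suc j) \<in> integer_points" using False by simp
      ultimately show ?thesis using q(1-4) by (simp only:) blast
    next
      case True
      have Sj: "?S (Suc j) = insert j (?S j)" using True by (auto simp: less_Suc_eq)
      have sums: "sum f (?S (Suc j)) = f j + sum f (?S j)" for f :: "nat \<Rightarrow> 'c::comm_monoid_add"
        unfolding Sj using finS by (subst sum.insert) auto
      have step: "reach F R (z j + c) (h j) (z (Suc j) + c) (k j)" if "c \<in> integer_points" for c
        by (rule reach_translate[OF chain]) (use per that Suc.prems in auto)
      show ?thesis
      proof (cases "j \<in> block_starts S")
        case False
        then have "0 < j" "j - 1 \<in> S" using True by (auto simp: block_starts_def)
        then have "q - z j \<in> integer_points" using q(5) by simp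
        from step[OF this] have "reach F R q (h j) (q + (z (Suc j) - z j)) (k j)" by (simp add: algebra_simps)
        from reach_trans[OF q(1) this] have "reach F R y (T + h j) (q + (z (Suc j) - z j)) (C + k j)" .
        moreover have "{i\<in>block_starts S. i < Suc j} = {i\<in>block_starts S. i < j}" using False by (auto simp: less_Suc_eq)
        then have B: "?B (Suc j) = ?B j" by (simp only:)
        have "q + (z (Suc j) - z j) - z (Suc j) \<in> integer_points" using \<open>q - z j \<in> integer_points\<close> by (simp add: algebra_simps)
        moreover have "q + (z (Suc j) - z j) - y - (\<Sum>j\<in>?S (Suc j). z (Suc j) - z j) = q - y - (\<Sum>j\<in>?S j. z (Suc j) - z j)"
          unfolding sums by (simp add: algebra_simps)
        then have "norm (q + (z (Suc j) - z j) - y - (\<Sum>j\<in>?S (Suc j). z (Suc j) - z j)) \<le> ?B (Suc j) * ?n"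
          unfolding B using q(4) by (simp only:)
        moreover have "T + h j \<le> sum h (?S (Suc j)) + ?B (Suc j) * \<tau>" "C + k j \<le> sum k (?S (Suc j)) + ?B (Suc j) * (b * \<tau>)"
          unfolding sums B using q(2,3) by simp_all
        ultimately show ?thesis by blast
      next
        case bs: True
        obtain c where c: "c \<in> integer_points" "norm (z j + c - q) \<le> ?n" using integer_points_translate by blast
        have "reach F R q \<tau> (z j + c) (b * \<tau>)" by (rule reach_slow) (use c \<tau> in auto)
        from reach_trans[OF reach_trans[OF q(1) this] step[OF c(1)]]
        have r: "reach F R y (T + \<tau> + h j) (z (Suc j) + c) (C + b * \<tau> + k j)" .
        have "{i\<in>block_starts S. i < Suc j} = insert j {i\<in>block_starts S. i < j}" using bs by (auto simp: less_Suc_eq)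
        then have B: "?B (Suc j) = ?B j + 1" using finB by simp
        have "z (Suc j) + c - y - (\<Sum>j\<in>?S (Suc j). z (Suc j) - z j) = (z j + c - q) + (q - y - (\<Sum>j\<in>?S j. z (Suc j) - z j))"
          unfolding sums by (simp add: algebra_simps)
        from this have "norm (z (Suc j) + c - y - (\<Sum>j\<in>?S (Suc j). z (Suc j) - z j)) \<le> ?B (Suc j) * ?n"
        proof (rule ssubst)
          show "norm ((z j + c - q) + (q - y - (\<Sum>j\<in>?S j. z (Suc j) - z j))) \<le> ?B (Suc j) * ?n"
            using norm_triangle_ineq[of "z j + c - q" "q - y - (\<Sum>j\<in>?S j. z (Suc j) - z j)"] c(2) q(4)
            unfolding B by (simp only: distrib_right mult_1)
        qed
        moreover have "T + \<tau> + h j \<le> sum h (?S (Suc j)) + ?B (Suc j) * \<tau>"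
          "C + b * \<tau> + k j \<le> sum k (?S (Suc j)) + ?B (Suc j) * (b * \<tau>)"
          unfolding sums B using q(2,3) by (simp_all add: algebra_simps)
        moreover have "z (Suc j) + c - z (Suc j) \<in> integer_points" using c(1) by simp
        ultimately show ?thesis using r by blast
      qed
    qed
  qed
  from this[of N] have "\<exists>q T C. reach F R y T q C \<and> T \<le> sum h (?S N) + ?B N * \<tau> \<and>
     C \<le> sum k (?S N) + ?B N * (b * \<tau>) \<and> norm (q - y - (\<Sum>j\<in>?S N. z (Suc j) - z j)) \<le> ?B N * ?n" by blast
  moreover have "?S N = S" using S by auto
  moreover have "{i\<in>block_starts S. i < N} = block_starts S" using S by (auto simp: block_starts_def)
  ultimately show ?thesis by simp
qed

text \<open>With \<open>d = n + 1\<close> balanced quantities, the summands are the imbalance of the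
  durations, the jumps at the at most \<open>d + 1\<close> block starts, the final correction of the
  displacement, and \<open>1\<close> for the strict slack in \<open>reach_slack\<close>.\<close>

definition glue_time :: real where
  "glue_time = (let n = real CARD('n); d = n + 1 in (2 * d + 1) + (d + 1) * (n / a) + ((2 * d + 1) * n + (d + 1) * n) / a + 1)"

definition glue_cost :: real where
  "glue_cost = (let n = real CARD('n); d = n + 1 in (d + 1) * (b * (n / a)) + b * (((2 * d + 1) * n + (d + 1) * n) / a))"

text \<open>Burago's curve-cutting argument: by the discrete Hobby--Rice theorem boundedly many blocks of the path
  carry half of its displacement and half of its duration, up to a bounded error, and of this family
  of blocks and the complementary one the cheaper is glued together by integer translations.\<close>
theorem reach_halve:
  assumes R: "0 \<le> R" and r: "reach F R Y T X C" and xy: "x - y = (1 / 2) *\<^sub>R (X - Y)"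
  shows "reach F R y (T / 2 + glue_time) x (C / 2 + glue_cost)"
proof -
  let ?n = "CARD('n)"
  define n d where "n = real ?n" and "d = real ?n + 1"
  have nd: "0 < n" "real (?n + 1) = d" "0 < d" by (auto simp: n_def d_def)
  obtain N z h k where ch: "z 0 = Y" "z N = X" "(\<Sum>j<N. h j) = T" "(\<Sum>j<N. k j) = C"
    "\<And>j. j < N \<Longrightarrow> reach F R (z j) (h j) (z (Suc j)) (k j)" "\<And>j. j < N \<Longrightarrow> norm (z (Suc j) - z j) \<le> 1" "\<And>j. j < N \<Longrightarrow> h j \<le> 1"
    using fine_chain_sequences[OF reach_fine_chain[OF r]] by blast
  have h0: "0 \<le> h j" "0 \<le> k j" if "j < N" for j
    using reach_time_nonneg[OF ch(5)[OF that]] reach_cost_nonneg[OF ch(5)[OF that] R] .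
  obtain e :: "nat \<Rightarrow> 'n" where e: "bij_betw e {..<?n} UNIV"
    using ex_bij_betw_nat_finite[of "UNIV :: 'n set"] by (auto simp: atLeast0LessThan)
  \<comment> \<open>The balanced quantities are the coordinates of the displacement and, as the last
    one, the duration.\<close>
  define \<mu> where "\<mu> i j = (if i < ?n then (z (Suc j) - z j) $ e i else h j)" for i j
  have \<mu>1: "\<bar>\<mu> i j\<bar> \<le> 1" if "j < N" for i j
    using h0[OF that] ch(6,7)[OF that] component_le_norm_cart[of "z (Suc j) - z j" "e i"] by (auto simp: \<mu>_def)
  obtain P Q where PQ: "P \<inter> Q = {}" "P \<union> Q \<subseteq> {..<N}" "card ({..<N} - (P \<union> Q)) \<le> ?n + 1"
    "card (block_starts P) \<le> (?n + 1) + 1" "card (block_starts Q) \<le> (?n + 1) + 1"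
    "\<And>i. i < ?n + 1 \<Longrightarrow> \<bar>sum (\<mu> i) P - sum (\<mu> i) Q\<bar> \<le> 2 * real (?n + 1) + 1"
    using signed_necklace_splitting[of "?n + 1" N \<mu>] \<mu>1 by blast
  have fin: "finite P" "finite Q" using PQ(2) finite_subset by auto
  have split: "sum f {..<N} = sum f P + sum f Q + sum f ({..<N} - (P \<union> Q))" for f :: "nat \<Rightarrow> real"
    using sum.subset_diff[OF PQ(2), of f] sum.union_disjoint[OF fin PQ(1), of f] by simp
  have rest: "\<bar>sum (\<mu> i) ({..<N} - (P \<union> Q))\<bar> \<le> d" for i
  proof -
    have "\<bar>sum (\<mu> i) ({..<N} - (P \<union> Q))\<bar> \<le> (\<Sum>j\<in>{..<N} - (P \<union> Q). \<bar>\<mu> i j\<bar>)" by (rule sum_abs)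
    also have "\<dots> \<le> real (card ({..<N} - (P \<union> Q))) * 1" by (rule sum_bounded_above) (use \<mu>1 in auto)
    also have "\<dots> \<le> d" using PQ(3) nd(2) by simp
    finally show ?thesis .
  qed
  \<comment> \<open>The two families differ by at most \<open>2 * d + 1\<close> and omit at most
    \<open>d\<close>, so each one differs from half of the total by no more than half of the sum of
    these errors.\<close>
  have half: "\<bar>sum (\<mu> i) S - sum (\<mu> i) {..<N} / 2\<bar> \<le> 2 * d + 1" if S: "S = P \<or> S = Q" and i: "i < ?n + 1" for S i
  proof -
    have f: "\<bar>sum (\<mu> i) P - sum (\<mu> i) Q\<bar> \<le> 2 * d + 1" using PQ(6)[OF i] unfolding nd(2) .
    show ?thesis
    proof (cases "S = P")
      case True
      show ?thesis unfolding True using f split[of "\<mu> i"] rest[of i] nd(3) by linarith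
    next
      case False
      then have SQ: "S = Q" using S by simp
      show ?thesis unfolding SQ using f split[of "\<mu> i"] rest[of i] nd(3) by linarith
    qed
  qed
  have "sum k P + sum k Q \<le> C"
    unfolding ch(4)[symmetric] split[of k] using h0 by (auto intro!: sum_nonneg)
  \<comment> \<open>The action does not have to be balanced, since only an upper bound is wanted:
    the cheaper family carries at most half of it.\<close>
  then obtain S where S: "S = P \<or> S = Q" "sum k S \<le> C / 2" by (metis add_mono_thms_linordered_field(5) field_sum_of_halves linorder_not_le)
  have SN: "S \<subseteq> {..<N}" and bS: "real (card (block_starts S)) \<le> d + 1" using S PQ(2,4,5) nd(2) by (auto simp: d_def)
  have timeS: "sum h S \<le> T / 2 + (2 * d + 1)"
  proof -
    have "\<mu> ?n = h" by (auto simp: \<mu>_def)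
    then show ?thesis using half[OF S(1), of ?n] ch(3) by (simp add: abs_le_iff)
  qed
  have dispS: "norm ((\<Sum>j\<in>S. z (Suc j) - z j) - (x - y)) \<le> n * (2 * d + 1)"
  proof -
    have tel: "(\<Sum>j<N. z (Suc j) - z j) = X - Y" using ch(1,2) by (simp add: sum_lessThan_telescope)
    have "norm ((\<Sum>j\<in>S. z (Suc j) - z j) - (x - y)) \<le> (\<Sum>i\<in>UNIV. \<bar>((\<Sum>j\<in>S. z (Suc j) - z j) - (x - y)) $ i\<bar>)"
      by (rule norm_le_l1_cart)
    also have "\<dots> \<le> (\<Sum>i\<in>(UNIV::'n set). 2 * d + 1)"
    proof (rule sum_mono)
      fix i :: 'n
      obtain i' where i': "i' < ?n" "e i' = i" using e by (metis UNIV_I bij_betw_imp_surj_on image_iff lessThan_iff)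
      have cmp: "sum (\<mu> i') A = (\<Sum>j\<in>A. z (Suc j) - z j) $ i" for A using i' by (simp add: \<mu>_def sum_component)
      have "sum (\<mu> i') {..<N} = (X - Y) $ i" unfolding cmp tel ..
      moreover have "((\<Sum>j\<in>S. z (Suc j) - z j) - (x - y)) $ i = sum (\<mu> i') S - (X - Y) $ i / 2"
        unfolding cmp xy by simp
      ultimately show "\<bar>((\<Sum>j\<in>S. z (Suc j) - z j) - (x - y)) $ i\<bar> \<le> 2 * d + 1"
        using half[OF S(1), of i'] i'(1) by simp
    qed
    finally show ?thesis by (simp add: n_def)
  qed
  obtain q T' C' where q: "reach F R y T' q C'" "T' \<le> sum h S + real (card (block_starts S)) * (n / a)"
     "C' \<le> sum k S + real (card (block_starts S)) * (b * (n / a))"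
     "norm (q - y - (\<Sum>j\<in>S. z (Suc j) - z j)) \<le> real (card (block_starts S)) * n"
    using reach_glue_blocks[where N = N and z = z and h = h and k = k and S = S and y = y, OF R ch(5) SN]
    unfolding n_def by blast
  define D where "D = (2 * d + 1) * n + (d + 1) * n"
  have D0: "0 < D" unfolding D_def using nd(1,3) by (intro add_pos_pos mult_pos_pos) auto
  let ?A = "q - y - (\<Sum>j\<in>S. z (Suc j) - z j)" and ?B = "(\<Sum>j\<in>S. z (Suc j) - z j) - (x - y)"
  have "x - q = - (?A + ?B)" by simp
  then have "norm (x - q) = norm (?A + ?B)" by (simp only: norm_minus_cancel)
  also have "\<dots> \<le> norm ?A + norm ?B" by (rule norm_triangle_ineq)
  also have "\<dots> \<le> (d + 1) * n + n * (2 * d + 1)"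
    using q(4) dispS mult_right_mono[OF bS, of n] nd(1) by linarith
  also have "\<dots> = a * (D / a)" using a by (simp add: D_def)
  finally have "norm (x - q) \<le> a * (D / a)" .
  from reach_trans[OF q(1) reach_slow[OF this]] D0 a
  have "reach F R y (T' + D / a) x (C' + b * (D / a))" by simp
  moreover have "T' + D / a < T / 2 + glue_time"
  proof -
    have "T' \<le> T / 2 + (2 * d + 1) + (d + 1) * (n / a)"
      using q(2) timeS mult_right_mono[OF bS, of "n / a"] nd a by (simp only: divide_nonneg_pos) (smt (verit) divide_nonneg_pos)
    then show ?thesis by (simp add: glue_time_def Let_def D_def d_def n_def)
  qed
  moreover have "C' + b * (D / a) \<le> C / 2 + glue_cost"
  proof -
    have "0 \<le> b * (n / a)" using nd a b by simp
    then have "C' \<le> C / 2 + (d + 1) * (b * (n / a))"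
      using q(3) S(2) mult_right_mono[OF bS, of "b * (n / a)"] by linarith
    then show ?thesis by (simp add: glue_cost_def Let_def D_def d_def n_def)
  qed
  ultimately show ?thesis by (rule reach_slack)
qed

end

lemma (in hamiltonian) hamiltonian_scaled:
  assumes "0 < e" shows "hamiltonian (\<lambda>x p. F (x /\<^sub>R e) p) a b m"
proof
  have "continuous_on UNIV (\<lambda>w. (\<lambda>(x, p). F x p) (fst w /\<^sub>R e, snd w))"
    by (intro continuous_on_compose2[OF cont] continuous_intros) auto
  then show "continuous_on UNIV (\<lambda>(x, p). F (x /\<^sub>R e) p)" by (simp add: split_beta)
  show "\<exists>d>0. \<forall>x p q. norm p \<le> B \<longrightarrow> norm (q - p) \<le> d \<longrightarrow> \<bar>F (x /\<^sub>R e) q - F (x /\<^sub>R e) p\<bar> \<le> c" if "0 < c" for c B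
    using UC[OF that, of B] by blast
qed (use zero nonneg conv upper lower a b in auto)

context periodic_hamiltonian
begin

definition "scaled e = (\<lambda>x p. F (x /\<^sub>R e) p)"

text \<open>A path of scale \<open>e / 2\<close> is blown up by \<open>2 / e\<close> to unit scale,
  halved there, and shrunk by \<open>e\<close>. It has its old endpoints again, but now in the
  medium of scale \<open>e\<close>; the excess duration \<open>e * glue_time\<close> is removed by
  the Lipschitz bound in time.\<close>

lemma value_halve:
  assumes g: "K-lipschitz_on UNIV g" and KR: "K \<le> R" and e: "0 < e" and t: "0 \<le> t"
  shows "value_function (scaled e) R g (x, t) \<le> value_function (scaled (e / 2)) R g (x, t) + (glue_cost + m K * glue_time) * e"
proof -
  interpret s1: hamiltonian "scaled e" a b m unfolding scaled_def using hamiltonian_scaled[OF e] .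
  interpret s2: hamiltonian "scaled (e / 2)" a b m unfolding scaled_def using hamiltonian_scaled[of "e / 2"] e by simp
  have R: "0 \<le> R" using lipschitz_on_nonneg[OF g] KR by linarith
  have T0: "0 \<le> glue_time" using a by (simp add: glue_time_def Let_def)
  have "value_function (scaled e) R g (x, t) - (glue_cost + m K * glue_time) * e \<le> value_function (scaled (e / 2)) R g (x, t)"
  proof (rule s2.value_ge[OF g KR t])
    fix y C assume r: "reach (scaled (e / 2)) R y t x C"
    have "0 < 2 / e" using e by simp
    have "(x /\<^sub>R (2 / e)) /\<^sub>R (e / 2) = x" for x :: "real ^ 'n" using e by simp
    with reach_scale[OF r \<open>0 < 2 / e\<close>] have r1: "reach F R ((2 / e) *\<^sub>R y) (2 / e * t) ((2 / e) *\<^sub>R x) (2 / e * C)"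
      unfolding scaled_def by simp
    have "reach F R (y /\<^sub>R e) (2 / e * t / 2 + glue_time) (x /\<^sub>R e) (2 / e * C / 2 + glue_cost)"
    proof (rule reach_halve[OF R r1])
      have "(1 / 2) *\<^sub>R ((2 / e) *\<^sub>R x - (2 / e) *\<^sub>R y) = (1 / 2 * (2 / e)) *\<^sub>R (x - y)"
        by (simp only: scaleR_diff_right scaleR_scaleR)
      moreover have "1 / 2 * (2 / e) = inverse e" by (simp add: inverse_eq_divide)
      ultimately show "x /\<^sub>R e - y /\<^sub>R e = (1 / 2) *\<^sub>R ((2 / e) *\<^sub>R x - (2 / e) *\<^sub>R y)"
        by (simp only: scaleR_diff_right)
    qed
    from reach_scale[OF this e]
    have "reach (scaled e) R (e *\<^sub>R (y /\<^sub>R e)) (e * (2 / e * t / 2 + glue_time)) (e *\<^sub>R (x /\<^sub>R e)) (e * (2 / e * C / 2 + glue_cost))"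
      by (simp add: scaled_def)
    moreover have "e *\<^sub>R (y /\<^sub>R e) = y" "e *\<^sub>R (x /\<^sub>R e) = x" using e by simp_all
    moreover have "e * (2 / e * t / 2 + glue_time) = t + e * glue_time" "e * (2 / e * C / 2 + glue_cost) = C + e * glue_cost"
      using e by (simp_all add: distrib_left)
    ultimately have "reach (scaled e) R y (t + e * glue_time) x (C + e * glue_cost)" by (simp only:)
    from s1.value_le[OF g KR this] s1.value_time_lipschitz[OF g KR t, of "e * glue_time" x]
    show "value_function (scaled e) R g (x, t) - (glue_cost + m K * glue_time) * e \<le> g y + C"
      using e T0 by (simp add: algebra_simps)
  qed
  then show ?thesis by simp
qed

end

section \<open>Homogenization in the whole space\<close>

lemma periodic_bounded_translate:
  fixes v :: "real ^ 'n \<Rightarrow> real"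
  assumes "integer_periodic v" shows "\<exists>z\<in>cball y (real CARD('n)). v z = v x"
proof -
  obtain k where k: "k \<in> integer_points" "norm (x + k - y) \<le> real CARD('n)" using integer_points_translate by blast
  then have "v (x + k) = v x" using assms by (simp add: integer_periodic_def)
  moreover have "x + k \<in> cball y (real CARD('n))" using k(2) by (simp add: dist_norm norm_minus_commute)
  ultimately show ?thesis by blast
qed

lemma periodic_attains:
  fixes v :: "real ^ 'n \<Rightarrow> real"
  assumes c: "continuous_on UNIV v" and per: "integer_periodic v"
  shows "\<exists>y. \<forall>x. v y \<le> v x" "\<exists>y. \<forall>x. v x \<le> v y"
proof -
  let ?B = "cball (0 :: real ^ 'n) (real CARD('n))"
  have cpt: "compact ?B" "?B \<noteq> {}" "continuous_on ?B v" using c continuous_on_subset by auto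
  obtain y where "\<forall>x\<in>?B. v y \<le> v x" using continuous_attains_inf[OF cpt] by blast
  then show "\<exists>y. \<forall>x. v y \<le> v x" using periodic_bounded_translate[OF per] by metis
  obtain y where "\<forall>x\<in>?B. v x \<le> v y" using continuous_attains_sup[OF cpt] by blast
  then show "\<exists>y. \<forall>x. v x \<le> v y" using periodic_bounded_translate[OF per] by metis
qed

text \<open>A cone of slope \<open>N > M\<close> with vertex \<open>y\<close> is put on top of
  \<open>v\<close>. If the contact were away from the vertex, the cone could be replaced by a smooth
  function with gradient of norm \<open>N\<close> there, which is excluded; so the contact is at the
  vertex, which is the Lipschitz estimate.\<close>

lemma lipschitz_if_touching_gradient_bound:
  fixes v :: "'a::euclidean_space \<Rightarrow> real"
  assumes c: "continuous_on UNIV v" and ub: "\<And>x. v x \<le> B" and M: "0 \<le> M"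
    and grad: "\<And>\<phi> G x0. C1_with_gradient UNIV \<phi> G \<Longrightarrow> \<forall>\<^sub>F x in at x0. v x - \<phi> x \<le> v x0 - \<phi> x0 \<Longrightarrow> norm (G x0) \<le> M"
  shows "M-lipschitz_on UNIV v"
proof -
  have main: "v x \<le> v y + N * norm (x - y)" if N: "M < N" for N x y
  proof -
    have N0: "0 < N" using M N by simp
    define f where "f z = v z - N * norm (z - y)" for z
    have cf: "continuous_on A f" for A unfolding f_def
      by (intro continuous_intros continuous_on_subset[OF c]) auto
    define r where "r = (B - v y) / N + 1"
    have r: "0 < r" using ub[of y] N0 by (simp add: r_def add_nonneg_pos)
    obtain x0 where x0: "x0 \<in> cball y r" "\<And>z. z \<in> cball y r \<Longrightarrow> f z \<le> f x0"
      using continuous_attains_sup[of "cball y r" f] cf r by fastforce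
    have max: "f z \<le> f x0" for z
    proof (cases "z \<in> cball y r")
      case False
      then have "N * norm (z - y) \<ge> N * r" using N0 by (intro mult_left_mono) (auto simp: dist_norm norm_minus_commute)
      moreover have "N * r = B - v y + N" using N0 by (simp add: r_def field_simps)
      ultimately have "f z \<le> v y" using ub[of z] N0 unfolding f_def by linarith
      also have "v y = f y" by (simp add: f_def)
      also have "\<dots> \<le> f x0" using x0(2)[of y] r by simp
      finally show ?thesis .
    qed (use x0 in blast)
    have "x0 = y"
    proof (rule ccontr)
      assume ne: "x0 \<noteq> y"
      define s where "s = norm (x0 - y)"
      have s: "0 < s" using ne by (simp add: s_def)
      \<comment> \<open>Up to a constant, this paraboloid lies above the cone and touches it at
        distance \<open>s\<close> from the vertex, in particular at \<open>x0\<close>.\<close>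
      define \<phi> where "\<phi> z = (N / (2 * s)) * (norm (z - y))\<^sup>2" for z
      have \<phi>: "C1_with_gradient UNIV \<phi> (\<lambda>z. (N / (2 * s)) *\<^sub>R (2 *\<^sub>R (z - y)))"
        unfolding \<phi>_def by (intro C1_with_gradient_cmult C1_with_gradient_dist_square)
      have tangent: "N * norm (z - y) \<le> \<phi> z + N * s / 2" for z
      proof -
        have "0 \<le> (N / (2 * s)) * (norm (z - y) - s)\<^sup>2" using N0 s by simp
        also have "\<dots> = \<phi> z + N * s / 2 - N * norm (z - y)" using s by (simp add: \<phi>_def power2_eq_square field_simps)
        finally show ?thesis by simp
      qed
      have eq: "\<phi> x0 + N * s / 2 = N * norm (x0 - y)" using s by (simp add: \<phi>_def s_def[symmetric] power2_eq_square field_simps)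
      have "\<forall>\<^sub>F z in at x0. v z - \<phi> z \<le> v x0 - \<phi> x0"
      proof (intro always_eventually allI)
        fix z show "v z - \<phi> z \<le> v x0 - \<phi> x0" using max[of z] tangent[of z] eq unfolding f_def by linarith
      qed
      from grad[OF \<phi> this] have "norm ((N / (2 * s)) *\<^sub>R (2 *\<^sub>R (x0 - y))) \<le> M" .
      moreover have "norm ((N / (2 * s)) *\<^sub>R (2 *\<^sub>R (x0 - y))) = N" using s N0 by (simp add: s_def)
      ultimately show False using N by simp
    qed
    then show ?thesis using max[of x] by (simp add: f_def)
  qed
  have lip: "v x - v y \<le> M * norm (x - y)" for x y
  proof (rule field_le_epsilon)
    fix e :: real assume e: "0 < e"
    have n1: "0 < norm (x - y) + 1" by (simp add: add_nonneg_pos)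
    have "M < M + e / (norm (x - y) + 1)" using e n1 by simp
    from main[OF this, of x y] have "v x - v y \<le> M * norm (x - y) + e * (norm (x - y) / (norm (x - y) + 1))"
      by (simp add: algebra_simps)
    also have "e * (norm (x - y) / (norm (x - y) + 1)) \<le> e * 1" using e n1 by (intro mult_left_mono) auto
    finally show "v x - v y \<le> M * norm (x - y) + e" by simp
  qed
  show ?thesis
  proof (rule lipschitz_onI[OF _ M])
    show "dist (v x) (v y) \<le> M * dist x y" for x y
      using lip[of x y] lip[of y x] by (simp add: dist_real_def dist_norm abs_le_iff norm_minus_commute)
  qed
qed

section \<open>Planar solutions built from correctors\<close>

lemma touching_separated:
  fixes f :: "'a::euclidean_space \<Rightarrow> real"
  assumes \<phi>: "C1_with_gradient UNIV \<phi> G" and s: "s = 1 \<or> s = - 1" and t0: "0 < t0"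
    and touch: "\<forall>\<^sub>F z in at (x0, t0) within UNIV \<times> {0<..}. s * (f (fst z) - c * snd z - \<phi> z) \<le> s * (f x0 - c * t0 - \<phi> (x0, t0))"
  shows "snd (G (x0, t0)) = - c"
    and "C1_with_gradient UNIV (\<lambda>x. \<phi> (x, t0)) (\<lambda>x. fst (G (x, t0)))"
    and "\<forall>\<^sub>F x in at x0. s * (f x - \<phi> (x, t0)) \<le> s * (f x0 - \<phi> (x0, t0))"
proof -
  define \<psi> where "\<psi> z = s * \<phi> z" for z
  have \<psi>: "C1_with_gradient UNIV \<psi> (\<lambda>z. s *\<^sub>R G z)" unfolding \<psi>_def by (rule C1_with_gradient_cmult[OF \<phi>])
  \<comment> \<open>Time is moved forwards and backwards, so the time derivative of the test
    function is determined exactly. The sign \<open>s\<close> covers touching from above and from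
    below.\<close>
  have dir: "s * (- c * r) \<le> (0 :: 'a, r) \<bullet> (s *\<^sub>R G (x0, t0))" if r: "r \<noteq> 0" for r
  proof (rule touching_slope[OF \<psi> _ touch])
    show "(0 :: 'a, r) \<noteq> 0" using r by (simp add: zero_prod_def)
    show "0 < t0 / \<bar>r\<bar>" using t0 r by simp
    fix q assume q: "0 < q" "q < t0 / \<bar>r\<bar>"
    have "\<bar>q * r\<bar> < t0" using q r by (simp add: abs_mult field_simps)
    then show "(x0, t0) + q *\<^sub>R (0, r) \<in> UNIV \<times> {0<..}" by simp
    assume "s * (f (fst ((x0, t0) + q *\<^sub>R (0, r))) - c * snd ((x0, t0) + q *\<^sub>R (0, r)) - \<phi> ((x0, t0) + q *\<^sub>R (0, r)))
       \<le> s * (f x0 - c * t0 - \<phi> (x0, t0))"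
    then show "\<psi> (x0, t0) + q * (s * (- c * r)) \<le> \<psi> ((x0, t0) + q *\<^sub>R (0, r))"
      by (simp add: \<psi>_def algebra_simps)
  qed
  show "snd (G (x0, t0)) = - c" using dir[of 1] dir[of "- 1"] s by (auto simp: inner_prod_def)
  show "C1_with_gradient UNIV (\<lambda>x. \<phi> (x, t0)) (\<lambda>x. fst (G (x, t0)))"
    unfolding C1_with_gradient_def gderiv_def
  proof (intro conjI ballI)
    fix x :: 'a
    have "((\<lambda>x. (x, t0)) has_derivative (\<lambda>h. (h, 0))) (at x)" by (auto intro!: derivative_eq_intros)
    from has_derivative_compose[OF this C1_with_gradient_has_derivative[OF \<phi>, of "(x, t0)"]]
    show "((\<lambda>x. \<phi> (x, t0)) has_derivative (\<lambda>h. h \<bullet> fst (G (x, t0)))) (at x)" by (simp add: inner_prod_def)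
    show "continuous_on UNIV (\<lambda>x. fst (G (x, t0)))"
      by (intro continuous_intros continuous_on_compose2[OF C1_with_gradient_continuous(2)[OF \<phi>, of UNIV]]) auto
  qed
  obtain d where d: "d > 0" "\<And>z. z \<in> UNIV \<times> {0<..} \<Longrightarrow> z \<noteq> (x0, t0) \<Longrightarrow> dist z (x0, t0) < d \<Longrightarrow>
      s * (f (fst z) - c * snd z - \<phi> z) \<le> s * (f x0 - c * t0 - \<phi> (x0, t0))"
    using touch unfolding eventually_at by blast
  show "\<forall>\<^sub>F x in at x0. s * (f x - \<phi> (x, t0)) \<le> s * (f x0 - \<phi> (x0, t0))"
    unfolding eventually_at
  proof (intro exI[of _ d] conjI ballI impI d(1))
    fix x assume "x \<noteq> x0 \<and> dist x x0 < d"
    then show "s * (f x - \<phi> (x, t0)) \<le> s * (f x0 - \<phi> (x0, t0))"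
      using d(2)[of "(x, t0)"] t0 by (simp add: dist_Pair_Pair algebra_simps)
  qed
qed

lemma touching_rescaled:
  fixes v :: "'a::euclidean_space \<Rightarrow> real"
  assumes \<phi>: "C1_with_gradient UNIV \<phi> G" and e: "0 < e"
    and touch: "\<forall>\<^sub>F x in at x0. s * ((p \<bullet> x + e * v (x /\<^sub>R e)) - \<phi> x) \<le> s * ((p \<bullet> x0 + e * v (x0 /\<^sub>R e)) - \<phi> x0)"
  defines "\<psi> \<equiv> \<lambda>y. (1 / e) * (\<phi> (e *\<^sub>R y) - (e *\<^sub>R y) \<bullet> p)"
  shows "C1_with_gradient UNIV \<psi> (\<lambda>y. G (e *\<^sub>R y) - p)"
    and "\<forall>\<^sub>F y in at (x0 /\<^sub>R e). s * (v y - \<psi> y) \<le> s * (v (x0 /\<^sub>R e) - \<psi> (x0 /\<^sub>R e))"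
proof -
  show "C1_with_gradient UNIV \<psi> (\<lambda>y. G (e *\<^sub>R y) - p)"
    unfolding C1_with_gradient_def gderiv_def
  proof (intro conjI ballI)
    fix y :: 'a
    have "((\<lambda>y. e *\<^sub>R y) has_derivative (\<lambda>h. e *\<^sub>R h)) (at y)" by (auto intro!: derivative_eq_intros)
    from has_derivative_compose[OF this C1_with_gradient_has_derivative[OF C1_with_gradient_diff[OF \<phi> C1_with_gradient_inner[of UNIV p]], of "e *\<^sub>R y"]]
    have "((\<lambda>y. \<phi> (e *\<^sub>R y) - (e *\<^sub>R y) \<bullet> p) has_derivative (\<lambda>h. (e *\<^sub>R h) \<bullet> (G (e *\<^sub>R y) - p))) (at y)" .
    from has_derivative_mult_right[OF this, of "1 / e"]
    show "(\<psi> has_derivative (\<lambda>h. h \<bullet> (G (e *\<^sub>R y) - p))) (at y)" unfolding \<psi>_def using e by simp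
    show "continuous_on UNIV (\<lambda>y. G (e *\<^sub>R y) - p)"
      by (intro continuous_intros continuous_on_compose2[OF C1_with_gradient_continuous(2)[OF \<phi>, of UNIV]]) auto
  qed
  obtain d where d: "d > 0" "\<And>x. x \<noteq> x0 \<Longrightarrow> dist x x0 < d \<Longrightarrow>
      s * ((p \<bullet> x + e * v (x /\<^sub>R e)) - \<phi> x) \<le> s * ((p \<bullet> x0 + e * v (x0 /\<^sub>R e)) - \<phi> x0)"
    using touch unfolding eventually_at by auto
  have id: "e * (v y - \<psi> y) = (p \<bullet> (e *\<^sub>R y) + e * v ((e *\<^sub>R y) /\<^sub>R e)) - \<phi> (e *\<^sub>R y)" for y
    using e by (simp add: \<psi>_def algebra_simps inner_commute)
  show "\<forall>\<^sub>F y in at (x0 /\<^sub>R e). s * (v y - \<psi> y) \<le> s * (v (x0 /\<^sub>R e) - \<psi> (x0 /\<^sub>R e))"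
    unfolding eventually_at
  proof (intro exI[of _ "d / e"] conjI ballI impI)
    show "0 < d / e" using d e by simp
    fix y assume y: "y \<noteq> x0 /\<^sub>R e \<and> dist y (x0 /\<^sub>R e) < d / e"
    have "e *\<^sub>R y - x0 = e *\<^sub>R (y - x0 /\<^sub>R e)" using e by (simp add: scaleR_diff_right)
    then have "dist (e *\<^sub>R y) x0 = e * dist y (x0 /\<^sub>R e)" using e by (simp add: dist_norm)
    then have "dist (e *\<^sub>R y) x0 < d" using y e by (simp add: field_simps)
    moreover have "e *\<^sub>R y \<noteq> x0" using y e by auto
    ultimately have "s * (e * (v y - \<psi> y)) \<le> s * (e * (v (x0 /\<^sub>R e) - \<psi> (x0 /\<^sub>R e)))"
      using d(2)[of "e *\<^sub>R y"] e unfolding id by simp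
    then have "e * (s * (v y - \<psi> y)) \<le> e * (s * (v (x0 /\<^sub>R e) - \<psi> (x0 /\<^sub>R e)))" by (simp only: mult.left_commute)
    then show "s * (v y - \<psi> y) \<le> s * (v (x0 /\<^sub>R e) - \<psi> (x0 /\<^sub>R e))" using e by simp
  qed
qed

text \<open>These planar waves solve the oscillatory evolution exactly and stay within \<epsilon>
  times the oscillation of the corrector of the affine solutions of the effective one.\<close>

lemma corrector_evolution_subsolution:
  fixes v :: "real ^ 'n \<Rightarrow> real"
  assumes sub: "viscosity_subsolution_on UNIV (\<lambda>y q. F y (p + q) - c) v" and e: "0 < e"
  shows "viscosity_subsolution_on (UNIV \<times> {0<..}) (evolution_operator (\<lambda>x p. F (x /\<^sub>R e) p))
     (\<lambda>z. p \<bullet> fst z + e * v (fst z /\<^sub>R e) - c * snd z + k)"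
  unfolding viscosity_subsolution_on_def
proof (intro allI ballI impI)
  fix \<phi> :: "(real ^ 'n) \<times> real \<Rightarrow> real" and G z0
  assume z0: "z0 \<in> UNIV \<times> {0<..}" and \<phi>: "C1_with_gradient UNIV \<phi> G"
    and touch: "\<forall>\<^sub>F z in at z0 within UNIV \<times> {0<..}. (p \<bullet> fst z + e * v (fst z /\<^sub>R e) - c * snd z + k) - \<phi> z
      \<le> (p \<bullet> fst z0 + e * v (fst z0 /\<^sub>R e) - c * snd z0 + k) - \<phi> z0"
  obtain x0 t0 where z: "z0 = (x0, t0)" by fastforce
  have t0: "0 < t0" using z0 z by simp
  have "\<forall>\<^sub>F z in at (x0, t0) within UNIV \<times> {0<..}. 1 * ((p \<bullet> fst z + e * v (fst z /\<^sub>R e)) - c * snd z - \<phi> z)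
      \<le> 1 * ((p \<bullet> x0 + e * v (x0 /\<^sub>R e)) - c * t0 - \<phi> (x0, t0))"
    using touch unfolding z by (rule eventually_mono) simp
  note sep = touching_separated[OF \<phi> disjI1[OF refl] t0 this]
  note res = touching_rescaled[OF sep(2) e sep(3)]
  from res(2) sub res(1) have "F (x0 /\<^sub>R e) (p + (fst (G (e *\<^sub>R (x0 /\<^sub>R e), t0)) - p)) - c \<le> 0"
    unfolding viscosity_subsolution_on_def mult_1 by blast
  then show "evolution_operator (\<lambda>x p. F (x /\<^sub>R e) p) z0 (G z0) \<le> 0"
    using sep(1) e by (simp add: evolution_operator_def z)
qed

lemma corrector_evolution_supersolution:
  fixes v :: "real ^ 'n \<Rightarrow> real"
  assumes super: "viscosity_supersolution_on UNIV (\<lambda>y q. F y (p + q) - c) v" and e: "0 < e"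
  shows "viscosity_supersolution_on (UNIV \<times> {0<..}) (evolution_operator (\<lambda>x p. F (x /\<^sub>R e) p))
     (\<lambda>z. p \<bullet> fst z + e * v (fst z /\<^sub>R e) - c * snd z + k)"
  unfolding viscosity_supersolution_on_def
proof (intro allI ballI impI)
  fix \<phi> :: "(real ^ 'n) \<times> real \<Rightarrow> real" and G z0
  assume z0: "z0 \<in> UNIV \<times> {0<..}" and \<phi>: "C1_with_gradient UNIV \<phi> G"
    and touch: "\<forall>\<^sub>F z in at z0 within UNIV \<times> {0<..}. (p \<bullet> fst z + e * v (fst z /\<^sub>R e) - c * snd z + k) - \<phi> z
      \<ge> (p \<bullet> fst z0 + e * v (fst z0 /\<^sub>R e) - c * snd z0 + k) - \<phi> z0"
  obtain x0 t0 where z: "z0 = (x0, t0)" by fastforce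
  have t0: "0 < t0" using z0 z by simp
  have "\<forall>\<^sub>F z in at (x0, t0) within UNIV \<times> {0<..}. - 1 * ((p \<bullet> fst z + e * v (fst z /\<^sub>R e)) - c * snd z - \<phi> z)
      \<le> - 1 * ((p \<bullet> x0 + e * v (x0 /\<^sub>R e)) - c * t0 - \<phi> (x0, t0))"
    using touch unfolding z by (rule eventually_mono) simp
  note sep = touching_separated[OF \<phi> disjI2[OF refl] t0 this]
  note res = touching_rescaled[OF sep(2) e sep(3)]
  have "\<forall>\<^sub>F y in at (x0 /\<^sub>R e). v y - 1 / e * (\<phi> (e *\<^sub>R y, t0) - (e *\<^sub>R y) \<bullet> p)
      \<ge> v (x0 /\<^sub>R e) - 1 / e * (\<phi> (e *\<^sub>R (x0 /\<^sub>R e), t0) - (e *\<^sub>R (x0 /\<^sub>R e)) \<bullet> p)"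
    using res(2) by (rule eventually_mono) (simp only: mult_minus1 neg_le_iff_le)
  with super res(1) have "F (x0 /\<^sub>R e) (p + (fst (G (e *\<^sub>R (x0 /\<^sub>R e), t0)) - p)) - c \<ge> 0"
    unfolding viscosity_supersolution_on_def by blast
  then show "evolution_operator (\<lambda>x p. F (x /\<^sub>R e) p) z0 (G z0) \<ge> 0"
    using sep(1) e by (simp add: evolution_operator_def z)
qed

lemma lipschitz_corrector_evolution:
  fixes v :: "real ^ 'n \<Rightarrow> real"
  assumes v: "M-lipschitz_on UNIV v" and e: "0 < e"
  shows "\<bar>(p \<bullet> x + e * v (x /\<^sub>R e)) - (p \<bullet> y + e * v (y /\<^sub>R e))\<bar> \<le> (norm p + M) * norm (x - y)"
    and "(norm p + M + \<bar>c\<bar>)-lipschitz_on A (\<lambda>z. p \<bullet> fst z + e * v (fst z /\<^sub>R e) - c * snd z + k)"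
proof -
  have M: "0 \<le> M" using v lipschitz_on_nonneg by blast
  have space: "\<bar>(p \<bullet> x + e * v (x /\<^sub>R e)) - (p \<bullet> y + e * v (y /\<^sub>R e))\<bar> \<le> (norm p + M) * norm (x - y)" for x y
  proof -
    have 1: "\<bar>p \<bullet> x - p \<bullet> y\<bar> \<le> norm p * norm (x - y)"
      using Cauchy_Schwarz_ineq2[of p "x - y"] by (simp only: inner_diff_right)
    have n: "norm (x /\<^sub>R e - y /\<^sub>R e) = norm (x - y) / e"
    proof -
      have "x /\<^sub>R e - y /\<^sub>R e = (x - y) /\<^sub>R e" by (simp only: scaleR_diff_right)
      then show ?thesis using e by (simp add: divide_inverse mult.commute)
    qed
    have "\<bar>v (x /\<^sub>R e) - v (y /\<^sub>R e)\<bar> \<le> M * (norm (x - y) / e)"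
      using lipschitz_onD[OF v, of "x /\<^sub>R e" "y /\<^sub>R e"] unfolding dist_norm n by simp
    then have "e * \<bar>v (x /\<^sub>R e) - v (y /\<^sub>R e)\<bar> \<le> e * (M * (norm (x - y) / e))" using e by (intro mult_left_mono) auto
    also have "\<dots> = M * norm (x - y)" using e by simp
    also have "e * \<bar>v (x /\<^sub>R e) - v (y /\<^sub>R e)\<bar> = \<bar>e * v (x /\<^sub>R e) - e * v (y /\<^sub>R e)\<bar>"
      using e by (simp add: abs_mult flip: right_diff_distrib)
    finally show ?thesis using 1 unfolding distrib_right by linarith
  qed
  then show "\<bar>(p \<bullet> x + e * v (x /\<^sub>R e)) - (p \<bullet> y + e * v (y /\<^sub>R e))\<bar> \<le> (norm p + M) * norm (x - y)" .
  show "(norm p + M + \<bar>c\<bar>)-lipschitz_on A (\<lambda>z. p \<bullet> fst z + e * v (fst z /\<^sub>R e) - c * snd z + k)"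
  proof (rule lipschitz_onI)
    fix z w :: "(real ^ 'n) \<times> real"
    have "(norm p + M) * norm (fst z - fst w) \<le> (norm p + M) * dist z w"
      using dist_fst_le[of z w] M by (intro mult_left_mono) (auto simp: dist_norm)
    moreover have "\<bar>c * snd z - c * snd w\<bar> \<le> \<bar>c\<bar> * dist z w"
      using dist_snd_le[of z w] by (auto simp: dist_real_def abs_mult mult_left_mono simp flip: right_diff_distrib)
    ultimately show "dist (p \<bullet> fst z + e * v (fst z /\<^sub>R e) - c * snd z + k) (p \<bullet> fst w + e * v (fst w /\<^sub>R e) - c * snd w + k)
        \<le> (norm p + M + \<bar>c\<bar>) * dist z w"
      using space[of "fst z" "fst w"] by (simp add: dist_real_def distrib_right)
  qed (use M in simp)
qed

locale homogenized = periodic_hamiltonian F a b m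
  for F :: "real ^ 'n \<Rightarrow> real ^ 'n \<Rightarrow> real" and a b m +
  fixes Hbar :: "real ^ 'n \<Rightarrow> real"
  assumes Hbar: "is_effective_hamiltonian F Hbar"
begin

lemma corrector: obtains v where "cell_solution F p (Hbar p) v"
  using Hbar unfolding is_effective_hamiltonian_def by blast

text \<open>A constant test function touches the corrector at its maximum and at its minimum, where
  the cell problem compares \<open>F y p\<close> with \<open>Hbar p\<close>.\<close>

lemma Hbar_bounds: "0 \<le> Hbar p" "norm p \<le> B \<Longrightarrow> Hbar p \<le> m B"
proof -
  obtain v where v: "continuous_on UNIV v" "integer_periodic v"
    "viscosity_subsolution_on UNIV (\<lambda>y q. F y (p + q) - Hbar p) v"
    "viscosity_supersolution_on UNIV (\<lambda>y q. F y (p + q) - Hbar p) v"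
    using corrector[of p] unfolding cell_solution_def by blast
  obtain y where "\<forall>x. v x \<le> v y" using periodic_attains(2)[OF v(1,2)] by blast
  then have "\<forall>\<^sub>F z in at y within UNIV. v z - 0 \<le> v y - 0" by simp
  then have "F y (p + 0) - Hbar p \<le> 0"
    using v(3) C1_with_gradient_const[of 0] unfolding viscosity_subsolution_on_def by blast
  then show "0 \<le> Hbar p" using nonneg[of y "p + 0"] by linarith
  obtain y where "\<forall>x. v y \<le> v x" using periodic_attains(1)[OF v(1,2)] by blast
  then have "\<forall>\<^sub>F z in at y within UNIV. v z - 0 \<ge> v y - 0" by simp
  then have "F y (p + 0) - Hbar p \<ge> 0"
    using v(4) C1_with_gradient_const[of 0] unfolding viscosity_supersolution_on_def by blast
  then show "Hbar p \<le> m B" if "norm p \<le> B" using upper[of p B y] that by simp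
qed

text \<open>A gradient \<open>q\<close> touching a corrector from above satisfies
  \<open>a * norm (p + q) - b \<le> Hbar p \<le> m B\<close>, which gives this bound for
  \<open>norm q\<close>.\<close>

definition "corrector_lip B = (m B + b) / a + B"

lemma corrector_properties:
  assumes v: "cell_solution F p (Hbar p) v" and p: "norm p \<le> B"
  shows "(corrector_lip B)-lipschitz_on UNIV v" and "v x - v y \<le> corrector_lip B * real CARD('n)"
proof -
  have v': "continuous_on UNIV v" "integer_periodic v"
    "viscosity_subsolution_on UNIV (\<lambda>y q. F y (p + q) - Hbar p) v"
    using v unfolding cell_solution_def by blast+
  have B: "0 \<le> B" using p norm_ge_zero order_trans by blast
  obtain y0 where y0: "\<forall>x. v x \<le> v y0" using periodic_attains(2)[OF v'(1,2)] by blast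
  show lip: "(corrector_lip B)-lipschitz_on UNIV v"
  proof (rule lipschitz_if_touching_gradient_bound[OF v'(1)])
    show "v x \<le> v y0" for x using y0 by blast
    show "0 \<le> corrector_lip B" using m_nonneg[OF B] a b B by (simp add: corrector_lip_def)
    fix \<phi> :: "real ^ 'n \<Rightarrow> real" and G x0 assume \<phi>: "C1_with_gradient UNIV \<phi> G" "\<forall>\<^sub>F x in at x0. v x - \<phi> x \<le> v x0 - \<phi> x0"
    then have "F x0 (p + G x0) - Hbar p \<le> 0" using v'(3) unfolding viscosity_subsolution_on_def by blast
    then have "a * norm (p + G x0) \<le> m B + b" using lower[of "p + G x0" x0] Hbar_bounds(2)[OF p] by linarith
    then have "norm (p + G x0) \<le> (m B + b) / a" using a by (simp add: pos_le_divide_eq mult.commute)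
    then show "norm (G x0) \<le> corrector_lip B"
      using norm_triangle_ineq4[of "p + G x0" p] p by (simp add: corrector_lip_def)
  qed
  obtain z where z: "z \<in> cball y (real CARD('n))" "v z = v x" using periodic_bounded_translate[OF v'(2)] by blast
  have "v z - v y \<le> corrector_lip B * dist z y" using lipschitz_onD[OF lip, of z y] by (simp add: dist_real_def)
  also have "\<dots> \<le> corrector_lip B * real CARD('n)"
    using z(1) lipschitz_on_nonneg[OF lip] by (intro mult_left_mono) (auto simp: dist_commute)
  finally show "v x - v y \<le> corrector_lip B * real CARD('n)" using z(2) by simp
qed

text \<open>If \<open>c1 < c2\<close>, the two planar waves would drift apart linearly in time in
  the wrong order, although they are ordered initially after adding a constant.\<close>

lemma stationary_comparison:
  assumes sub: "viscosity_subsolution_on UNIV (\<lambda>y q. F y (p + q) - c1) v1" and l1: "M1-lipschitz_on UNIV v1"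
    and super: "viscosity_supersolution_on UNIV (\<lambda>y q. F y (p + q) - c2) v2" and l2: "M2-lipschitz_on UNIV v2"
    and bd: "\<And>x y. v1 x - v2 x \<le> k"
  shows "c2 \<le> c1"
proof (rule ccontr)
  assume "\<not> ?thesis"
  then have d: "0 < c2 - c1" by simp
  define k' where "k' = max k (v1 0 - v2 0)"
  define t where "t = (k' - (v1 0 - v2 0) + 1) / (c2 - c1)"
  have t: "0 \<le> t" "(c2 - c1) * t = k' - (v1 0 - v2 0) + 1" using d by (auto simp: t_def k'_def)
  let ?u = "\<lambda>z. p \<bullet> fst z + 1 * v1 (fst z /\<^sub>R 1) - c1 * snd z + 0"
  let ?v = "\<lambda>z. p \<bullet> fst z + 1 * v2 (fst z /\<^sub>R 1) - c2 * snd z + k'"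
  have F1: "(\<lambda>x p. F (x /\<^sub>R 1) p) = F" by simp
  have "?u (0, t) \<le> ?v (0, t)"
  proof (rule comparison_principle[OF cont UC closed_UNIV])
    show "viscosity_subsolution_on (UNIV \<times> {0<..}) (evolution_operator F) ?u"
      using corrector_evolution_subsolution[OF sub zero_less_one, of 0] unfolding F1 .
    show "viscosity_supersolution_on (UNIV \<times> {0<..}) (evolution_operator F) ?v"
      using corrector_evolution_supersolution[OF super zero_less_one, of k'] unfolding F1 .
    show "(norm p + M1 + \<bar>c1\<bar>)-lipschitz_on (UNIV \<times> {0..}) ?u" by (rule lipschitz_corrector_evolution(2)[OF l1 zero_less_one])
    show "(norm p + M2 + \<bar>c2\<bar>)-lipschitz_on (UNIV \<times> {0..}) ?v" by (rule lipschitz_corrector_evolution(2)[OF l2 zero_less_one])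
    show "?u (x, 0) \<le> ?v (x, 0)" for x using bd[of x] by (simp add: k'_def)
  qed (use t in auto)
  then show False using t(2) by (simp add: algebra_simps)
qed

text \<open>Touching momenta of a corrector are bounded, so the corrector of \<open>q\<close> is a
  subsolution of the cell problem of a nearby \<open>p\<close> with constant
  \<open>Hbar q + e\<close>, and \<open>stationary_comparison\<close> applies. Continuity makes the
  comparison principle available for the effective equation.\<close>

lemma Hbar_continuous: "continuous_on UNIV Hbar"
proof -
  have close: "\<exists>d>0. \<forall>p q. norm p \<le> B \<longrightarrow> norm q \<le> B \<longrightarrow> norm (p - q) \<le> d \<longrightarrow> Hbar p \<le> Hbar q + e" if e: "0 < e" for e B
  proof -
    obtain d where d: "d > 0" "\<And>x p q. norm p \<le> B + corrector_lip B \<Longrightarrow> norm (q - p) \<le> d \<Longrightarrow> \<bar>F x q - F x p\<bar> \<le> e"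
      using UC[OF e, of "B + corrector_lip B"] by blast
    have "Hbar p \<le> Hbar q + e" if p: "norm p \<le> B" and q: "norm q \<le> B" and pq: "norm (p - q) \<le> d" for p q
    proof -
      obtain vp where vp: "cell_solution F p (Hbar p) vp" using corrector by blast
      obtain vq where vq: "cell_solution F q (Hbar q) vq" using corrector by blast
      have sub: "viscosity_subsolution_on UNIV (\<lambda>y \<xi>. F y (p + \<xi>) - (Hbar q + e)) vq"
        unfolding viscosity_subsolution_on_def
      proof (intro allI ballI impI)
        fix \<phi> :: "real ^ 'n \<Rightarrow> real" and G x0 assume \<phi>: "C1_with_gradient UNIV \<phi> G" "\<forall>\<^sub>F x in at x0. vq x - \<phi> x \<le> vq x0 - \<phi> x0"
        then have 1: "F x0 (q + G x0) - Hbar q \<le> 0" using vq unfolding cell_solution_def viscosity_subsolution_on_def by blast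
        then have "a * norm (q + G x0) \<le> m B + b" using lower[of "q + G x0" x0] Hbar_bounds(2)[OF q] by linarith
        then have "norm (q + G x0) \<le> (m B + b) / a" using a by (simp add: pos_le_divide_eq mult.commute)
        moreover have "0 \<le> B" using p norm_ge_zero order_trans by blast
        ultimately have "norm (q + G x0) \<le> B + corrector_lip B" by (simp add: corrector_lip_def)
        from d(2)[OF this, of "p + G x0" x0] pq have "\<bar>F x0 (p + G x0) - F x0 (q + G x0)\<bar> \<le> e" by simp
        then show "F x0 (p + G x0) - (Hbar q + e) \<le> 0" using 1 by linarith
      qed
      have super: "viscosity_supersolution_on UNIV (\<lambda>y \<xi>. F y (p + \<xi>) - Hbar p) vp"
        using vp unfolding cell_solution_def by blast
      have "vq x - vp x \<le> (vq 0 - vp 0) + corrector_lip B * real CARD('n) + corrector_lip B * real CARD('n)" for x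
        using corrector_properties(2)[OF vq q, of x 0] corrector_properties(2)[OF vp p, of 0 x] by linarith
      from stationary_comparison[OF sub corrector_properties(1)[OF vq q] super corrector_properties(1)[OF vp p] this]
      show ?thesis .
    qed
    then show ?thesis using d(1) by blast
  qed
  have "isCont Hbar p" for p
    unfolding isCont_def tendsto_iff
  proof (intro allI impI)
    fix e :: real assume e: "0 < e"
    obtain d where d: "d > 0" "\<And>p' q. norm p' \<le> norm p + 1 \<Longrightarrow> norm q \<le> norm p + 1 \<Longrightarrow> norm (p' - q) \<le> d \<Longrightarrow> Hbar p' \<le> Hbar q + e / 2"
      using close[of "e / 2" "norm p + 1"] e by auto
    show "\<forall>\<^sub>F q in at p. dist (Hbar q) (Hbar p) < e"
      unfolding eventually_at
    proof (intro exI[of _ "min 1 d"] conjI ballI impI)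
      fix q assume "q \<noteq> p \<and> dist q p < min 1 d"
      then have q: "norm (q - p) < 1" "norm (q - p) < d" by (auto simp: dist_norm)
      have "norm q \<le> norm p + 1" using norm_triangle_sub[of q p] q by linarith
      then have "Hbar q \<le> Hbar p + e / 2" "Hbar p \<le> Hbar q + e / 2"
        using d(2)[of q p] d(2)[of p q] q by (simp_all add: norm_minus_commute)
      then show "dist (Hbar q) (Hbar p) < e" using e by (simp add: dist_real_def)
    qed (use d in simp)
  qed
  then show ?thesis by (simp add: continuous_at_imp_continuous_on)
qed

lemma Hbar_continuous_pair: "continuous_on UNIV (\<lambda>(x, p). (\<lambda>x p. Hbar p) x p)"
proof -
  have "continuous_on UNIV (\<lambda>z. Hbar (snd z))" by (intro continuous_on_compose2[OF Hbar_continuous] continuous_intros) auto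
  then show ?thesis by (simp add: split_beta)
qed

lemma Hbar_UC:
  assumes "0 < e" shows "\<exists>d>0. \<forall>x p q. norm p \<le> B \<longrightarrow> norm (q - p) \<le> d \<longrightarrow> \<bar>(\<lambda>x p. Hbar p) x q - (\<lambda>x p. Hbar p) x p\<bar> \<le> e"
proof -
  have "uniformly_continuous_on (cball 0 (B + 1)) Hbar"
    by (intro compact_uniformly_continuous continuous_on_subset[OF Hbar_continuous]) auto
  then obtain d where d: "d > 0" "\<And>p q. p \<in> cball 0 (B + 1) \<Longrightarrow> q \<in> cball 0 (B + 1) \<Longrightarrow> dist q p < d \<Longrightarrow> dist (Hbar q) (Hbar p) < e"
    using assms unfolding uniformly_continuous_on_def by meson
  show ?thesis
  proof (intro exI[of _ "min 1 d / 2"] conjI allI impI)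
    fix p q :: "real ^ 'n" assume p: "norm p \<le> B" and pq: "norm (q - p) \<le> min 1 d / 2"
    have "norm (q - p) < d" "norm (q - p) \<le> 1" using pq d(1) by (auto simp: min_def split: if_splits)
    moreover have "norm q \<le> norm p + norm (q - p)" using norm_triangle_sub by blast
    ultimately show "\<bar>Hbar q - Hbar p\<bar> \<le> e" using d(2)[of p q] p by (simp add: dist_norm)
  qed (use d in simp)
qed

text \<open>The effective equation is invariant under translations, so a translate of
  \<open>u\<close>, lowered by \<open>K * norm (x - y)\<close>, can be compared with
  \<open>u\<close>. This replaces the unspecified Lipschitz constant of \<open>u\<close> by
  \<open>K\<close>.\<close>

lemma effective_solution_space_lipschitz:
  assumes u: "cauchy_solution (\<lambda>x p. Hbar p) g u" and g: "K-lipschitz_on UNIV g" and t: "0 \<le> t"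
  shows "\<bar>u (x, t) - u (y, t)\<bar> \<le> K * norm (x - y)"
proof -
  have sub: "viscosity_subsolution_on (UNIV \<times> {0<..}) (evolution_operator (\<lambda>x p. Hbar p)) u"
    and super: "viscosity_supersolution_on (UNIV \<times> {0<..}) (evolution_operator (\<lambda>x p. Hbar p)) u"
    and init: "\<And>x. u (x, 0) = g x" using u unfolding cauchy_solution_def by blast+
  obtain L where L: "L-lipschitz_on (UNIV \<times> {0..}) u" using u unfolding cauchy_solution_def by blast
  have "u (x, t) \<le> u (y, t) + K * norm (x - y)" for x y
  proof -
    define w where "w = (x - y, 0 :: real)"
    define u' where "u' z = u (z + w) - K * norm (x - y)" for z
    have "u' (y, t) \<le> u (y, t)"
    proof (rule comparison_principle[OF Hbar_continuous_pair Hbar_UC closed_UNIV _ L _ super])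
      show "L-lipschitz_on (UNIV \<times> {0..}) u'"
      proof (rule lipschitz_onI)
        fix z z' :: "(real ^ 'n) \<times> real" assume "z \<in> UNIV \<times> {0..}" "z' \<in> UNIV \<times> {0..}"
        then have "z + w \<in> UNIV \<times> {0..}" "z' + w \<in> UNIV \<times> {0..}" by (auto simp: w_def)
        from lipschitz_onD[OF L this] show "dist (u' z) (u' z') \<le> L * dist z z'" by (simp add: u'_def dist_norm)
      qed (use L lipschitz_on_nonneg in blast)
      show "u' (z, 0) \<le> u (z, 0)" for z
        using lipschitz_onD[OF g, of "z + (x - y)" z] by (simp add: u'_def w_def init dist_norm)
      show "viscosity_subsolution_on (UNIV \<times> {0<..}) (evolution_operator (\<lambda>x p. Hbar p)) u'"
        unfolding viscosity_subsolution_on_def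
      proof (intro allI ballI impI)
        fix \<phi> :: "(real ^ 'n) \<times> real \<Rightarrow> real" and G z0
        assume z0: "z0 \<in> UNIV \<times> {0<..}" and \<phi>: "C1_with_gradient UNIV \<phi> G"
          and touch: "\<forall>\<^sub>F z in at z0 within UNIV \<times> {0<..}. u' z - \<phi> z \<le> u' z0 - \<phi> z0"
        define \<psi> where "\<psi> z = \<phi> (z - w)" for z
        have C1: "C1_with_gradient UNIV \<psi> (\<lambda>z. G (z - w))"
          unfolding C1_with_gradient_def gderiv_def
        proof (intro conjI ballI)
          fix z
          have "((\<lambda>z. z - w) has_derivative (\<lambda>h. h)) (at z)" by (auto intro!: derivative_eq_intros)
          from has_derivative_compose[OF this C1_with_gradient_has_derivative[OF \<phi>, of "z - w"]]
          show "(\<psi> has_derivative (\<lambda>h. h \<bullet> G (z - w))) (at z)" unfolding \<psi>_def .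
          show "continuous_on UNIV (\<lambda>z. G (z - w))"
            by (intro continuous_intros continuous_on_compose2[OF C1_with_gradient_continuous(2)[OF \<phi>, of UNIV]]) auto
        qed
        obtain d where d: "d > 0" "\<And>z. z \<in> UNIV \<times> {0<..} \<Longrightarrow> z \<noteq> z0 \<Longrightarrow> dist z z0 < d \<Longrightarrow> u' z - \<phi> z \<le> u' z0 - \<phi> z0"
          using touch unfolding eventually_at by blast
        have ev: "\<forall>\<^sub>F z in at (z0 + w) within UNIV \<times> {0<..}. u z - \<psi> z \<le> u (z0 + w) - \<psi> (z0 + w)"
          unfolding eventually_at
        proof (intro exI[of _ d] conjI ballI impI d(1))
          fix z assume z: "z \<in> UNIV \<times> {0<..}" "z \<noteq> z0 + w \<and> dist z (z0 + w) < d"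
          have "z - w \<in> UNIV \<times> {0<..}" using z(1) by (auto simp: w_def)
          moreover have "z - w \<noteq> z0" using z(2) by (auto simp: algebra_simps)
          moreover have "dist (z - w) z0 < d" using z(2) by (simp add: dist_norm algebra_simps)
          ultimately have "u' (z - w) - \<phi> (z - w) \<le> u' z0 - \<phi> z0" by (rule d(2))
          then show "u z - \<psi> z \<le> u (z0 + w) - \<psi> (z0 + w)" by (simp add: u'_def \<psi>_def)
        qed
        have "z0 + w \<in> UNIV \<times> {0<..}" using z0 by (auto simp: w_def)
        from sub[unfolded viscosity_subsolution_on_def, rule_format, OF this C1 ev]
        have "evolution_operator (\<lambda>x p. Hbar p) (z0 + w) (G (z0 + w - w)) \<le> 0" .
        then show "evolution_operator (\<lambda>x p. Hbar p) z0 (G z0) \<le> 0" by (simp add: evolution_operator_def)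
      qed
    qed (use t in auto)
    then show ?thesis by (simp add: u'_def w_def)
  qed
  from this[of x y] this[of y x] show ?thesis by (simp add: abs_le_iff norm_minus_commute)
qed

text \<open>The planar subsolution is evaluated at both ends of the path. Its cutoff is harmless if
  \<open>R\<close> exceeds its spatial Lipschitz constant, and the corrector contributes
  \<open>e\<close> times its oscillation.\<close>

lemma reach_cost_ge_effective:
  assumes e: "0 < e" and r: "reach (scaled e) R y t x C" and p: "norm p \<le> B" and BR: "B + corrector_lip B \<le> R"
  shows "p \<bullet> (x - y) - t * Hbar p \<le> C + e * (corrector_lip B * real CARD('n))"
proof -
  interpret s: hamiltonian "scaled e" a b m unfolding scaled_def using hamiltonian_scaled[OF e] .
  obtain v where v: "cell_solution F p (Hbar p) v" using corrector by blast
  note vl = corrector_properties[OF v p]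
  let ?u = "\<lambda>z. p \<bullet> fst z + e * v (fst z /\<^sub>R e) - Hbar p * snd z + 0"
  have B: "0 \<le> B" using p norm_ge_zero order_trans by blast
  have "0 \<le> corrector_lip B" using lipschitz_on_nonneg[OF vl(1)] .
  then have R: "0 \<le> R" using B BR by linarith
  have "?u (x, 0 + t) \<le> ?u (y, 0) + C"
  proof (rule subsolution_along_reach[OF s.cont R _ _ _ r])
    show "(norm p + corrector_lip B + \<bar>Hbar p\<bar>)-lipschitz_on (UNIV \<times> {0..}) ?u" by (rule lipschitz_corrector_evolution(2)[OF vl(1) e])
    have "viscosity_subsolution_on UNIV (\<lambda>y q. F y (p + q) - Hbar p) v" using v unfolding cell_solution_def by blast
    from corrector_evolution_subsolution[OF this e, of 0]
    show "viscosity_subsolution_on (UNIV \<times> {0<..}) (evolution_operator (scaled e)) ?u" unfolding scaled_def .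
    fix x y :: "real ^ 'n" and t :: real
    have "(norm p + corrector_lip B) * norm (x - y) \<le> R * norm (x - y)" using p BR by (intro mult_right_mono) auto
    then show "\<bar>?u (x, t) - ?u (y, t)\<bar> \<le> R * norm (x - y)"
      using lipschitz_corrector_evolution(1)[OF vl(1) e, of p x y] by simp
  qed simp
  then have "p \<bullet> (x - y) - t * Hbar p \<le> C + e * (v (y /\<^sub>R e) - v (x /\<^sub>R e))"
    by (simp add: inner_diff_right algebra_simps)
  also have "e * (v (y /\<^sub>R e) - v (x /\<^sub>R e)) \<le> e * (corrector_lip B * real CARD('n))"
    using vl(2) e by (intro mult_left_mono) auto
  finally show ?thesis by simp
qed

text \<open>By \<open>reach_cost_ge_effective\<close> the straight segment with the same ends as the
  path is, for all momenta of norm at most \<open>K\<close>, no more expensive in the effective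
  problem. Momenta up to \<open>K\<close> are enough for the effective solution, which has this
  Lipschitz constant in space.\<close>

lemma effective_le_value:
  assumes e: "0 < e" and u: "cauchy_solution (\<lambda>x p. Hbar p) g u" and g: "K-lipschitz_on UNIV g"
    and KR: "K + corrector_lip K \<le> R" and t: "0 \<le> t"
  shows "u (x, t) \<le> value_function (scaled e) R g (x, t) + corrector_lip K * real CARD('n) * e"
proof -
  interpret s: hamiltonian "scaled e" a b m unfolding scaled_def using hamiltonian_scaled[OF e] .
  have K: "0 \<le> K" using lipschitz_on_nonneg[OF g] .
  have cl: "0 \<le> corrector_lip K" using m_nonneg[OF K] a b K by (simp add: corrector_lip_def)
  obtain L where L: "L-lipschitz_on (UNIV \<times> {0..}) u" using u unfolding cauchy_solution_def by blast
  have sub: "viscosity_subsolution_on (UNIV \<times> {0<..}) (evolution_operator (\<lambda>x p. Hbar p)) u"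
    and init: "\<And>x. u (x, 0) = g x" using u unfolding cauchy_solution_def by blast+
  have KR': "K \<le> R" using KR cl by simp
  have "u (x, t) - corrector_lip K * real CARD('n) * e \<le> value_function (scaled e) R g (x, t)"
  proof (rule s.value_ge[OF g KR' t])
    fix y C assume r: "reach (scaled e) R y t x C"
    show "u (x, t) - corrector_lip K * real CARD('n) * e \<le> g y + C"
    proof (cases "t = 0")
      case True
      then show ?thesis using reach_time_zero[of "scaled e" R y x C] r init cl e by simp
    next
      case False
      then have tp: "0 < t" using t by simp
      define l where "l = (C + e * (corrector_lip K * real CARD('n))) / t"
      have "segment_cost (\<lambda>x p. Hbar p) K y ((x - y) /\<^sub>R t) t l"
        unfolding segment_cost_def
      proof (intro ballI allI impI)
        fix q and p :: "real ^ 'n" assume p: "norm p \<le> K"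
        have "p \<bullet> ((x - y) /\<^sub>R t) - Hbar p = inverse t * (p \<bullet> (x - y)) - Hbar p" by (simp only: inner_scaleR_right)
        also have "\<dots> = (p \<bullet> (x - y) - t * Hbar p) / t" using tp by (simp add: field_simps)
        also have "\<dots> \<le> l" unfolding l_def using reach_cost_ge_effective[OF e r p KR] tp by (intro divide_right_mono) auto
        finally show "p \<bullet> ((x - y) /\<^sub>R t) - Hbar p \<le> l" .
      qed
      from subsolution_along_segment[OF Hbar_continuous_pair open_UNIV K L effective_solution_space_lipschitz[OF u g] sub this _ tp order_refl]
      have "u (y + t *\<^sub>R ((x - y) /\<^sub>R t), 0 + t) \<le> u (y, 0) + t * l" by simp
      moreover have "t * l = C + e * (corrector_lip K * real CARD('n))" using tp by (simp add: l_def)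
      ultimately show ?thesis using tp init by (simp add: algebra_simps)
    qed
  qed
  then show ?thesis by simp
qed

end

text \<open>Perturbed test function method: \<open>w k\<close> is compared with \<open>p \<bullet> x + \<epsilon>\<^sub>k v(x / \<epsilon>\<^sub>k) - t Hbar p\<close>, where
  \<open>p\<close> is the spatial gradient of the test function and \<open>v\<close> a corrector.\<close>
lemma (in homogenized) limit_subsolution:
  fixes w :: "nat \<Rightarrow> (real ^ 'n) \<times> real \<Rightarrow> real"
  assumes eps: "\<And>k. 0 < eps k" "eps \<longlonglongrightarrow> 0"
    and lip: "\<And>k. L-lipschitz_on (UNIV \<times> {0..}) (w k)"
    and sub: "\<And>k. viscosity_subsolution_on (UNIV \<times> {0<..}) (evolution_operator (scaled (eps k))) (w k)"
    and conv: "\<And>z. z \<in> UNIV \<times> {0<..} \<Longrightarrow> (\<lambda>k. w k z) \<longlonglongrightarrow> W z"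
    and up: "\<And>k z. z \<in> UNIV \<times> {0<..} \<Longrightarrow> w k z \<le> W z + c * eps k"
  shows "viscosity_subsolution_on (UNIV \<times> {0<..}) (evolution_operator (\<lambda>x p. Hbar p)) W"
  unfolding viscosity_subsolution_on_def
proof (intro allI ballI impI)
  fix \<phi> :: "(real ^ 'n) \<times> real \<Rightarrow> real" and G z0
  assume z0: "z0 \<in> UNIV \<times> {0<..}" and \<phi>: "C1_with_gradient UNIV \<phi> G"
    and touch: "\<forall>\<^sub>F z in at z0 within UNIV \<times> {0<..}. W z - \<phi> z \<le> W z0 - \<phi> z0"
  obtain x0 t0 where z0': "z0 = (x0, t0)" by fastforce
  have t0: "0 < t0" using z0 z0' by simp
  define p q where "p = fst (G z0)" and "q = snd (G z0)"
  show "evolution_operator (\<lambda>x p. Hbar p) z0 (G z0) \<le> 0"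
  proof (rule ccontr)
    assume "\<not> ?thesis"
    then have pos: "0 < q + Hbar p" by (simp add: evolution_operator_def p_def q_def)
    define \<theta> where "\<theta> = (q + Hbar p) / 3"
    have th: "0 < \<theta>" "q + Hbar p = 3 * \<theta>" using pos by (auto simp: \<theta>_def)
    obtain d where d: "d > 0" "\<And>x p q. norm p \<le> 2 * L \<Longrightarrow> norm (q - p) \<le> d \<Longrightarrow> \<bar>F x q - F x p\<bar> \<le> \<theta>"
      using UC[OF th(1), of "2 * L"] by blast
    \<comment> \<open>The gradient of the quadratic penalty on \<open>X\<close> is at most
      \<open>4 * \<kappa>\<close>, so it changes the Hamiltonian and the time derivative by at most
      \<open>\<theta>\<close> each, against the strict gap \<open>3 * \<theta>\<close>.\<close>
    define \<kappa> where "\<kappa> = min d \<theta> / 4"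
    have ka: "0 < \<kappa>" "4 * \<kappa> \<le> d" "4 * \<kappa> \<le> \<theta>" using d th by (auto simp: \<kappa>_def)
    obtain d1 where d1: "d1 > 0" "\<And>z. z \<in> UNIV \<times> {0<..} \<Longrightarrow> z \<noteq> z0 \<Longrightarrow> dist z z0 < d1 \<Longrightarrow> W z - \<phi> z \<le> W z0 - \<phi> z0"
      using touch unfolding eventually_at by blast
    obtain d2 where d2: "d2 > 0" "\<And>z. norm (z - z0) < d2 \<Longrightarrow> \<bar>\<phi> z - \<phi> z0 - (z - z0) \<bullet> G z0\<bar> \<le> \<kappa> * norm (z - z0)"
      using C1_with_gradient_has_derivative[OF \<phi>, of z0] ka(1) unfolding has_derivative_at_alt real_norm_def by meson
    define r where "r = min (min d1 d2) t0 / 2"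
    have third: "0 < min (min a b) c / 2 \<and> min (min a b) c / 2 < a \<and> min (min a b) c / 2 < b \<and> min (min a b) c / 2 < c"
      if "0 < a" "0 < b" "0 < c" for a b c :: real using that by (auto simp: min_def)
    have r: "0 < r" "r < d1" "r < d2" "r < t0" using third[OF d1(1) d2(1) t0] by (auto simp: r_def)
    define A where "A = 2 * \<kappa> / r"
    have A: "0 < A" "A * r = 2 * \<kappa>" using ka r by (auto simp: A_def)
    define X where "X = cball z0 r"
    have XU: "z \<in> UNIV \<times> {0<..}" if "z \<in> X" for z
    proof -
      have "\<bar>t0 - snd z\<bar> \<le> r" using that dist_snd_le[of z0 z] by (auto simp: X_def z0' dist_real_def)
      then have "0 < snd z" using r by linarith
      then show ?thesis by (cases z) simp
    qed
    have Wlin: "W z \<le> W z0 + (z - z0) \<bullet> G z0 + \<kappa> * norm (z - z0)" if z: "z \<in> X" for z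
    proof (cases "z = z0")
      case False
      have "norm (z - z0) \<le> r" using z by (simp add: X_def dist_norm norm_minus_commute)
      then have n: "norm (z - z0) < d1" "norm (z - z0) < d2" using r by auto
      have "W z - \<phi> z \<le> W z0 - \<phi> z0" using d1(2)[OF XU[OF z] False] n(1) by (simp add: dist_norm)
      then show ?thesis using d2(2)[OF n(2)] by (simp add: abs_le_iff)
    qed simp
    obtain v where v: "cell_solution F p (Hbar p) v" using corrector by blast
    note vl = corrector_properties[OF v order_refl]
    define osc where "osc = corrector_lip (norm p) * real CARD('n)"
    have osc: "\<bar>v x - v y\<bar> \<le> osc" for x y using vl(2)[of x y] vl(2)[of y x] by (simp add: osc_def abs_le_iff)
    \<comment> \<open>Convergence at \<open>z0\<close> and the uniform one-sided bound
      \<open>up\<close> yield an index for which the maximum over \<open>X\<close> lies in the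
      interior.\<close>
    have "(\<lambda>k. (W z0 - w k z0) + (c + osc) * eps k) \<longlonglongrightarrow> (W z0 - W z0) + (c + osc) * 0"
      by (intro tendsto_intros conv z0 eps(2))
    then have "(\<lambda>k. (W z0 - w k z0) + (c + osc) * eps k) \<longlonglongrightarrow> 0" by simp
    moreover have "0 < \<kappa> * r" using ka r by simp
    ultimately have "\<forall>\<^sub>F k in sequentially. (W z0 - w k z0) + (c + osc) * eps k < \<kappa> * r"
      by (rule order_tendstoD(2))
    then obtain k where k: "(W z0 - w k z0) + (c + osc) * eps k < \<kappa> * r" by (auto simp: eventually_sequentially)
    define e where "e = eps k"
    have e: "0 < e" using eps(1) by (simp add: e_def)
    define \<psi> where "\<psi> z = p \<bullet> fst z + e * v (fst z /\<^sub>R e) - Hbar p * snd z + 0" for z :: "(real ^ 'n) \<times> real"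
    \<comment> \<open>In time the planar wave has slope \<open>- Hbar p\<close>; adding
      \<open>3 * \<theta>\<close> turns it into \<open>q\<close>, the slope of the test function.
      The quadratic part exceeds the linearization error on the boundary of
      \<open>X\<close>.\<close>
    define \<zeta> where "\<zeta> z = z \<bullet> (0, 3 * \<theta>) + A * (norm (z - z0))\<^sup>2" for z :: "(real ^ 'n) \<times> real"
    define Z where "Z z = (0, 3 * \<theta>) + A *\<^sub>R (2 *\<^sub>R (z - z0))" for z :: "(real ^ 'n) \<times> real"
    have \<zeta>: "C1_with_gradient UNIV \<zeta> Z"
      unfolding \<zeta>_def Z_def by (intro C1_with_gradient_add C1_with_gradient_cmult C1_with_gradient_dist_square C1_with_gradient_inner)
    interpret s: hamiltonian "scaled e" a b m unfolding scaled_def using hamiltonian_scaled[OF e] .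
    have interior: "norm (z - z0) < r" if z: "z \<in> X" and max: "w k z0 - \<psi> z0 - \<zeta> z0 \<le> w k z - \<psi> z - \<zeta> z" for z
    proof (rule ccontr)
      assume "\<not> norm (z - z0) < r"
      then have nr: "norm (z - z0) = r" using z by (simp add: X_def dist_norm norm_minus_commute)
      have "w k z \<le> W z0 + (z - z0) \<bullet> G z0 + \<kappa> * r + c * e"
        using up[OF XU[OF z], of k] Wlin[OF z] nr by (simp add: e_def)
      moreover have "\<zeta> z - \<zeta> z0 = 3 * \<theta> * (snd z - t0) + 2 * \<kappa> * r"
        using nr A by (simp add: \<zeta>_def inner_prod_def z0' power2_eq_square algebra_simps)
      moreover have "(z - z0) \<bullet> G z0 = p \<bullet> (fst z - x0) + q * (snd z - t0)"
        by (simp add: inner_prod_def z0' p_def q_def inner_commute mult.commute)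
      moreover have "\<psi> z - \<psi> z0 = p \<bullet> (fst z - x0) + e * (v (fst z /\<^sub>R e) - v (x0 /\<^sub>R e)) - Hbar p * (snd z - t0)"
        by (simp add: \<psi>_def z0' inner_diff_right algebra_simps)
      moreover have "e * (v (fst z /\<^sub>R e) - v (x0 /\<^sub>R e)) \<ge> e * (- osc)"
        using osc[of "fst z /\<^sub>R e" "x0 /\<^sub>R e"] e by (intro mult_left_mono) auto
      moreover have "3 * \<theta> * (snd z - t0) = q * (snd z - t0) + Hbar p * (snd z - t0)"
        unfolding th(2)[symmetric] by (simp add: algebra_simps)
      ultimately show False using max k unfolding e_def[symmetric] by (simp add: algebra_simps)
    qed
    have z0X: "z0 \<in> X" using r by (simp add: X_def)
    show False
    proof (rule viscosity_doubling[where X = X and S = UNIV and u = "w k" and v = \<psi> and \<zeta> = \<zeta> and Z = Z and L = L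
          and F = "evolution_operator (scaled e)" and F' = "evolution_operator (scaled e)" and U = "UNIV \<times> {0<..}" and V = "UNIV \<times> {0<..}"])
      show "L-lipschitz_on X (w k)" using lip[of k] by (rule lipschitz_on_subset) (use XU in force)
      show "continuous_on (X \<inter> UNIV) \<psi>" unfolding \<psi>_def
        by (rule lipschitz_on_continuous_on[OF lipschitz_corrector_evolution(2)[OF vl(1) e]])
      have "viscosity_supersolution_on UNIV (\<lambda>y q. F y (p + q) - Hbar p) v" using v unfolding cell_solution_def by blast
      from corrector_evolution_supersolution[OF this e, of 0]
      show "viscosity_supersolution_on (UNIV \<times> {0<..}) (evolution_operator (scaled e)) \<psi>" unfolding scaled_def \<psi>_def .
    next
      fix z assume z: "z \<in> X \<inter> UNIV" and max: "\<And>y. y \<in> X \<inter> UNIV \<Longrightarrow> w k y - \<psi> y - \<zeta> y \<le> w k z - \<psi> z - \<zeta> z"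
      have n: "norm (z - z0) < r" by (rule interior) (use z max z0X in auto)
      have "ball z (r - norm (z - z0)) \<subseteq> X"
      proof
        fix y assume "y \<in> ball z (r - norm (z - z0))"
        then show "y \<in> X" using norm_triangle_ineq[of "y - z" "z - z0"] by (simp add: X_def dist_norm norm_minus_commute)
      qed
      moreover have "X \<subseteq> UNIV \<times> {0<..}" using XU by blast
      moreover have "0 < r - norm (z - z0)" using n by simp
      ultimately show "\<exists>e>0. ball z e \<subseteq> X \<inter> UNIV \<times> {0<..} \<and> ball z e \<inter> UNIV \<subseteq> UNIV \<times> {0<..}"
        by blast
    next
      fix z \<pi> assume z: "z \<in> X \<inter> UNIV" and max: "\<And>y. y \<in> X \<inter> UNIV \<Longrightarrow> w k y - \<psi> y - \<zeta> y \<le> w k z - \<psi> z - \<zeta> z"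
        and pi: "norm \<pi> \<le> 2 * L" and 1: "evolution_operator (scaled e) z \<pi> \<le> 0" and 2: "0 \<le> evolution_operator (scaled e) z (\<pi> - Z z)"
      have n: "norm (z - z0) < r" by (rule interior) (use z max z0X in auto)
      define y where "y = A *\<^sub>R (2 *\<^sub>R (z - z0))"
      have "norm y = 2 * A * norm (z - z0)" using A by (simp add: y_def)
      also have "\<dots> \<le> 2 * A * r" using n A by (intro mult_left_mono) auto
      finally have ny: "norm y \<le> 4 * \<kappa>" using A by simp
      have fy: "norm (fst y) \<le> 4 * \<kappa>" "\<bar>snd y\<bar> \<le> 4 * \<kappa>"
        using ny norm_fst_le[of "fst y" "snd y"] norm_snd_le[of "snd y" "fst y"] by simp_all
      have "norm (fst \<pi>) \<le> 2 * L" using pi norm_fst_le[of "fst \<pi>" "snd \<pi>"] by simp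
      from d(2)[OF this, of "fst (\<pi> - Z z)" "fst z /\<^sub>R e"]
      have "\<bar>F (fst z /\<^sub>R e) (fst (\<pi> - Z z)) - F (fst z /\<^sub>R e) (fst \<pi>)\<bar> \<le> \<theta>"
        using fy(1) ka(2) by (simp add: Z_def y_def)
      moreover have "snd (\<pi> - Z z) = snd \<pi> - 3 * \<theta> - snd y" by (simp add: Z_def y_def)
      ultimately show False using 1 2 fy(2) ka(3) th(1)
        unfolding evolution_operator_def scaled_def by linarith
    qed (use s.cont sub[of k] \<zeta> z0X in \<open>auto simp: X_def e_def continuous_evolution_operator\<close>)
  qed
qed

text \<open>Subtracting \<open>2 * c * eps k\<close> turns the halving inequality into monotonicity
  in \<open>k\<close>, since \<open>2 * c * eps k - 2 * c * eps (Suc k) = c * eps k\<close>. The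
  limit then exists, and it is approached from below up to a multiple of \<open>eps k\<close>, as
  \<open>limit_subsolution\<close> demands.\<close>

lemma (in homogenized) value_le_effective:
  assumes e: "0 < e" and u: "cauchy_solution (\<lambda>x p. Hbar p) g u" and g: "K-lipschitz_on UNIV g"
    and KR: "K \<le> R" and t: "0 \<le> t"
  shows "value_function (scaled e) R g (x, t) \<le> u (x, t) + 2 * (glue_cost + m K * glue_time) * e"
proof -
  define c where "c = glue_cost + m K * glue_time"
  define eps where "eps k = e / 2 ^ k" for k :: nat
  have eps: "0 < eps k" "eps (Suc k) = eps k / 2" for k using e by (auto simp: eps_def)
  have eps0: "eps \<longlonglongrightarrow> 0"
  proof -
    have "(\<lambda>k. e * (1 / 2) ^ k) \<longlonglongrightarrow> e * 0" by (intro tendsto_intros LIMSEQ_power_zero) simp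
    then show ?thesis unfolding eps_def by (simp add: power_divide)
  qed
  define w where "w k = value_function (scaled (eps k)) R g" for k
  define v where "v k z = w k z - 2 * c * eps k" for k z
  have ham: "hamiltonian (scaled (eps k)) a b m" for k unfolding scaled_def using hamiltonian_scaled[OF eps(1)] .
  define L where "L = R + 2 * m K"
  have lip: "L-lipschitz_on (UNIV \<times> {0..}) (w k)" for k
    unfolding w_def L_def by (rule hamiltonian.value_lipschitz[OF ham g KR])
  have K: "0 \<le> K" using lipschitz_on_nonneg[OF g] .
  have inc: "v k z \<le> v (Suc k) z" if "z \<in> UNIV \<times> {0..}" for k z
  proof -
    obtain y s where z: "z = (y, s)" by fastforce
    have "w k z \<le> w (Suc k) z + c * eps k"
      using value_halve[OF g KR eps(1), of s k y] that unfolding w_def c_def eps(2) z by auto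
    then show ?thesis unfolding v_def eps(2) by simp
  qed
  have c0: "0 \<le> c"
    using m_nonneg[OF K] a b by (simp add: c_def glue_cost_def glue_time_def Let_def)
  have bound: "v k z \<le> g (fst z)" if "z \<in> UNIV \<times> {0..}" for k z
  proof -
    have "w k z \<le> g (fst z)" using hamiltonian.value_upper[OF ham g KR, of "snd z" k "fst z"] that by (auto simp: w_def)
    moreover have "0 \<le> 2 * c * eps k" using c0 eps(1)[of k] by simp
    ultimately show ?thesis by (simp add: v_def)
  qed
  define W where "W z = (SUP k. v k z)" for z
  have bdd: "bdd_above (range (\<lambda>k. v k z))" if "z \<in> UNIV \<times> {0..}" for z
    using bound[OF that] by (intro bdd_aboveI[of _ "g (fst z)"]) auto
  have vW: "v k z \<le> W z" if "z \<in> UNIV \<times> {0..}" for k z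
    unfolding W_def by (rule cSUP_upper[OF _ bdd[OF that]]) simp
  have convv: "(\<lambda>k. v k z) \<longlonglongrightarrow> W z" if "z \<in> UNIV \<times> {0..}" for z
    unfolding W_def by (rule LIMSEQ_incseq_SUP[OF bdd[OF that]]) (use inc[OF that] in \<open>auto intro: incseq_SucI\<close>)
  have convw: "(\<lambda>k. w k z) \<longlonglongrightarrow> W z" if "z \<in> UNIV \<times> {0..}" for z
  proof -
    have "(\<lambda>k. v k z + 2 * c * eps k) \<longlonglongrightarrow> W z + 2 * c * 0" by (intro tendsto_intros convv[OF that] eps0)
    then show ?thesis by (simp add: v_def)
  qed
  have Wlip: "L-lipschitz_on (UNIV \<times> {0..}) W"
  proof (rule lipschitz_onI)
    fix z z' :: "(real ^ 'n) \<times> real" assume z: "z \<in> UNIV \<times> {0..}" "z' \<in> UNIV \<times> {0..}"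
    show "dist (W z) (W z') \<le> L * dist z z'"
    proof (rule tendsto_upperbound)
      show "(\<lambda>k. dist (w k z) (w k z')) \<longlonglongrightarrow> dist (W z) (W z')" by (intro tendsto_intros convw z)
      show "\<forall>\<^sub>F k in sequentially. dist (w k z) (w k z') \<le> L * dist z z'" using lipschitz_onD[OF lip z] by simp
    qed simp
  qed (use lipschitz_on_nonneg[OF lip] in blast)
  have sub: "viscosity_subsolution_on (UNIV \<times> {0<..}) (evolution_operator (\<lambda>x p. Hbar p)) W"
  proof (rule limit_subsolution[OF eps(1) eps0 lip])
    show "viscosity_subsolution_on (UNIV \<times> {0<..}) (evolution_operator (scaled (eps k))) (w k)" for k
      unfolding w_def by (rule hamiltonian.value_subsolution[OF ham g KR])
    show "(\<lambda>k. w k z) \<longlonglongrightarrow> W z" if "z \<in> UNIV \<times> {0<..}" for z using convw[of z] that by auto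
    show "w k z \<le> W z + 2 * c * eps k" if "z \<in> UNIV \<times> {0<..}" for k z
      using vW[of z k] that by (auto simp: v_def)
  qed
  have super: "viscosity_supersolution_on (UNIV \<times> {0<..}) (evolution_operator (\<lambda>x p. Hbar p)) u"
    and init: "\<And>x. u (x, 0) = g x" using u unfolding cauchy_solution_def by blast+
  obtain M where M: "M-lipschitz_on (UNIV \<times> {0..}) u" using u unfolding cauchy_solution_def by blast
  have "W (x, t) \<le> u (x, t)"
  proof (rule comparison_principle[OF Hbar_continuous_pair Hbar_UC closed_UNIV Wlip M sub super])
    show "W (y, 0) \<le> u (y, 0)" for y
      using LIMSEQ_le_const2[OF convv[of "(y, 0)"]] bound[of "(y, 0)"] init by auto
  qed (use t in auto)
  moreover have "v 0 (x, t) \<le> W (x, t)" using vW t by simp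
  moreover have "eps 0 = e" by (simp add: eps_def)
  ultimately show ?thesis by (simp add: v_def w_def c_def)
qed

section \<open>Accessibility of the exterior of a hole\<close>

inductive poly_path :: "'a::euclidean_space set \<Rightarrow> 'a \<Rightarrow> 'a \<Rightarrow> real \<Rightarrow> bool" for A x where
  poly_refl: "x \<in> A \<Longrightarrow> poly_path A x x 0"
| poly_step: "poly_path A x y l \<Longrightarrow> closed_segment y z \<subseteq> A \<Longrightarrow> poly_path A x z (l + norm (z - y))"

lemma poly_path_segment: "closed_segment x y \<subseteq> A \<Longrightarrow> poly_path A x y (norm (y - x))"
  using poly_step[OF poly_refl, of x A y] by auto

lemma poly_path_trans: assumes "poly_path A x y l" "poly_path A y z k" shows "poly_path A x z (l + k)"
  using assms(2)
proof induction
  case (poly_step z k w)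
  then show ?case using poly_path.poly_step[OF poly_step.IH poly_step.hyps(2)] by (simp add: add.assoc)
qed (use assms(1) in simp)

lemma poly_path_sym: "poly_path A x y l \<Longrightarrow> poly_path A y x l"
proof (induction rule: poly_path.induct)
  case (poly_step y l z)
  then show ?case using poly_path_trans[OF poly_path_segment[of z y A] poly_step.IH]
    by (simp add: closed_segment_commute norm_minus_commute add.commute)
qed (rule poly_refl)

lemma poly_path_mem: "poly_path A x y l \<Longrightarrow> x \<in> A \<and> y \<in> A"
  by (induction rule: poly_path.induct) auto

lemma poly_path_norm: "poly_path A x y l \<Longrightarrow> norm (y - x) \<le> l"
proof (induction rule: poly_path.induct)
  case (poly_step y l z)
  then show ?case using norm_triangle_ineq[of "z - y" "y - x"] by simp
qed simp

text \<open>All points of \<open>A\<close> near \<open>x0\<close> are joined to one base point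
  \<open>q\<close> by paths of bounded length; \<open>x0\<close> itself may lie on the boundary, and
  \<open>q\<close> away from it.\<close>

definition locally_accessible :: "'a::euclidean_space set \<Rightarrow> 'a \<Rightarrow> bool" where
  "locally_accessible A x0 \<longleftrightarrow> (\<exists>\<rho>>0. \<exists>q\<in>A. \<exists>c. \<forall>x\<in>ball x0 \<rho> \<inter> A. \<exists>l\<le>c. poly_path A x q l)"

lemma locally_accessible_open:
  assumes "open A" "x0 \<in> A" shows "locally_accessible A x0"
proof -
  obtain \<rho> where \<rho>: "\<rho> > 0" "ball x0 \<rho> \<subseteq> A" using assms openE by blast
  have "\<exists>l\<le>\<rho>. poly_path A x x0 l" if x: "x \<in> ball x0 \<rho> \<inter> A" for x
  proof (intro exI conjI)
    have "closed_segment x x0 \<subseteq> ball x0 \<rho>" using x \<rho>(1) by (intro closed_segment_subset) auto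
    then show "poly_path A x x0 (norm (x0 - x))" using \<rho>(2) by (intro poly_path_segment) blast
    show "norm (x0 - x) \<le> \<rho>" using x by (simp add: dist_norm)
  qed
  then show ?thesis using \<rho>(1) assms(2) unfolding locally_accessible_def by blast
qed

text \<open>Near \<open>x0\<close> the exterior is the region strictly below a graph. From any of
  its points one descends vertically by \<open>\<rho>\<close>, to a depth at which a straight
  connection to \<open>q\<close> stays below the graph by continuity.\<close>

lemma C1_boundary_exterior:
  fixes D :: "'a::euclidean_space set"
  assumes D: "open D" "has_C1_boundary D" and x0: "x0 \<in> frontier D"
  shows "locally_accessible (- closure D) x0" "x0 \<in> closure (- closure D)"
proof -
  obtain r e \<gamma> G where r: "r > 0" and e: "norm e = 1" and \<gamma>: "C1_with_gradient UNIV \<gamma> G"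
    and DB: "D \<inter> ball x0 r = {x \<in> ball x0 r. x \<bullet> e > \<gamma> (x - (x \<bullet> e) *\<^sub>R e)}"
    using D(2) x0 unfolding has_C1_boundary_def by blast
  have c\<gamma>: "continuous_on UNIV \<gamma>"
    by (rule C1_with_gradient_continuous(1)[OF \<gamma>])
  have ee: "e \<bullet> e = 1" using e by (simp add: norm_eq_1)
  define \<Gamma> where "\<Gamma> x = \<gamma> (x - (x \<bullet> e) *\<^sub>R e)" for x
  have c\<Gamma>: "continuous_on UNIV \<Gamma>" unfolding \<Gamma>_def by (intro continuous_on_compose2[OF c\<gamma>] continuous_intros) auto
  have shift: "\<Gamma> (x - s *\<^sub>R e) = \<Gamma> x" for x s by (simp add: \<Gamma>_def inner_diff_left ee algebra_simps)
  have Diff: "x \<in> D \<longleftrightarrow> x \<bullet> e > \<Gamma> x" if "x \<in> ball x0 r" for x 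
  proof -
    have "x \<in> D \<inter> ball x0 r \<longleftrightarrow> x \<in> {x \<in> ball x0 r. x \<bullet> e > \<gamma> (x - (x \<bullet> e) *\<^sub>R e)}" by (simp only: DB)
    then show ?thesis using that unfolding \<Gamma>_def by blast
  qed
  have below: "x \<in> - closure D" if "x \<in> ball x0 r" "x \<bullet> e < \<Gamma> x" for x
  proof -
    have "open {x. x \<bullet> e < \<Gamma> x}" by (intro open_Collect_less continuous_intros c\<Gamma>)
    then have "open (ball x0 r \<inter> {x. x \<bullet> e < \<Gamma> x})" by blast
    moreover have "(ball x0 r \<inter> {x. x \<bullet> e < \<Gamma> x}) \<inter> D = {}" using Diff by force
    ultimately have "(ball x0 r \<inter> {x. x \<bullet> e < \<Gamma> x}) \<inter> closure D = {}" using open_Int_closure_eq_empty by blast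
    then show ?thesis using that by blast
  qed
  have above: "x \<bullet> e < \<Gamma> x" if x: "x \<in> ball x0 r" "x \<in> - closure D" for x
  proof (rule ccontr)
    assume "\<not> x \<bullet> e < \<Gamma> x"
    then have ge: "\<Gamma> x \<le> x \<bullet> e" by simp
    have "open (ball x0 r \<inter> - closure D)" by blast
    then obtain s where s: "s > 0" "ball x s \<subseteq> ball x0 r \<inter> - closure D" using x openE by blast
    have y: "x + (s / 2) *\<^sub>R e \<in> ball x s" using s e by (simp add: dist_norm)
    have "\<Gamma> (x + (s / 2) *\<^sub>R e) = \<Gamma> x" using shift[of x "- (s / 2)"] by simp
    moreover have "(x + (s / 2) *\<^sub>R e) \<bullet> e = x \<bullet> e + s / 2" by (simp add: inner_add_left ee)
    ultimately have "x + (s / 2) *\<^sub>R e \<in> D" using Diff[of "x + (s / 2) *\<^sub>R e"] y s ge by auto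
    then show False using y s(2) closure_subset by blast
  qed
  have x0r: "x0 \<in> ball x0 r" using r by simp
  have x0D: "x0 \<in> closure D" "x0 \<notin> D" using x0 D(1) by (auto simp: frontier_def interior_open)
  have eq: "x0 \<bullet> e = \<Gamma> x0"
  proof -
    have "\<not> x0 \<bullet> e < \<Gamma> x0" using below[OF x0r] x0D by blast
    moreover have "\<not> x0 \<bullet> e > \<Gamma> x0" using Diff[OF x0r] x0D by blast
    ultimately show ?thesis by linarith
  qed
  have down: "x0 - s *\<^sub>R e \<in> - closure D" if "0 < s" "s < r" for s
    by (rule below) (use that e eq shift in \<open>auto simp: dist_norm inner_diff_left ee\<close>)
  define \<rho> where "\<rho> = r / 2"
  have \<rho>: "0 < \<rho>" using r by (simp add: \<rho>_def)
  have "isCont \<Gamma> x0" using c\<Gamma> by (simp add: continuous_on_eq_continuous_at)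
  then obtain d where d: "d > 0" "\<And>y. dist y x0 < d \<Longrightarrow> dist (\<Gamma> y) (\<Gamma> x0) < \<rho> / 4"
    using \<rho> unfolding continuous_at_eps_delta by (metis divide_pos_pos zero_less_numeral)
  define \<rho>' where "\<rho>' = min d (\<rho> / 4)"
  have \<rho>': "0 < \<rho>'" "\<rho>' \<le> d" "\<rho>' \<le> \<rho> / 4" using d \<rho> by (auto simp: \<rho>'_def)
  define q where "q = x0 - \<rho> *\<^sub>R e"
  have q: "q \<in> - closure D" unfolding q_def by (rule down) (use \<rho> r in \<open>auto simp: \<rho>_def\<close>)
  have "\<exists>l\<le>\<rho> + \<rho>'. poly_path (- closure D) x q l" if x: "x \<in> ball x0 \<rho>' \<inter> - closure D" for x
  proof -
    have nx: "norm (x - x0) < \<rho>'" using x by (simp add: dist_norm norm_minus_commute)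
    have xr: "x \<in> ball x0 r" using nx \<rho>' \<rho> by (simp add: dist_norm norm_minus_commute \<rho>_def)
    have lx: "x \<bullet> e < \<Gamma> x" using above[OF xr] x by blast
    have seg1: "closed_segment x (x - \<rho> *\<^sub>R e) \<subseteq> - closure D"
    proof
      fix y assume "y \<in> closed_segment x (x - \<rho> *\<^sub>R e)"
      then obtain u where u: "0 \<le> u" "u \<le> 1" "y = (1 - u) *\<^sub>R x + u *\<^sub>R (x - \<rho> *\<^sub>R e)" by (auto simp: closed_segment_def)
      have y: "y = x - (u * \<rho>) *\<^sub>R e" using u(3) by (simp add: algebra_simps)
      have u\<rho>: "0 \<le> u * \<rho>" "u * \<rho> \<le> \<rho>" using u \<rho> by (auto simp: mult_left_le_one_le)
      have "norm (y - x0) \<le> norm (x - x0) + norm ((u * \<rho>) *\<^sub>R e)" unfolding y using norm_triangle_ineq4[of "x - x0" "(u * \<rho>) *\<^sub>R e"] by (simp add: algebra_simps)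
      also have "\<dots> = norm (x - x0) + u * \<rho>" using u\<rho>(1) e by simp
      also have "\<dots> < r" using nx \<rho>'(3) u\<rho>(2) \<rho> \<rho>_def by linarith
      finally have "y \<in> ball x0 r" by (simp add: dist_norm norm_minus_commute)
      moreover have "y \<bullet> e < \<Gamma> y" unfolding y shift using lx u\<rho> by (simp add: inner_diff_left ee)
      ultimately show "y \<in> - closure D" by (rule below)
    qed
    have seg2: "closed_segment (x - \<rho> *\<^sub>R e) q \<subseteq> - closure D"
    proof
      fix y assume "y \<in> closed_segment (x - \<rho> *\<^sub>R e) q"
      then obtain u where u: "0 \<le> u" "u \<le> 1" "y = (1 - u) *\<^sub>R (x - \<rho> *\<^sub>R e) + u *\<^sub>R q" by (auto simp: closed_segment_def)
      define z where "z = x0 + (1 - u) *\<^sub>R (x - x0)"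
      have y: "y = z - \<rho> *\<^sub>R e" using u(3) by (simp add: z_def q_def algebra_simps)
      have "norm (z - x0) \<le> norm (x - x0)" using u by (simp add: z_def mult_left_le_one_le)
      then have nz: "norm (z - x0) < \<rho>'" using nx by simp
      have "norm (y - x0) \<le> norm (z - x0) + norm (\<rho> *\<^sub>R e)" unfolding y using norm_triangle_ineq4[of "z - x0" "\<rho> *\<^sub>R e"] by (simp add: algebra_simps)
      also have "\<dots> < r" using nz \<rho>' \<rho> e by (simp add: \<rho>_def)
      finally have yr: "y \<in> ball x0 r" by (simp add: dist_norm norm_minus_commute)
      have "dist (\<Gamma> z) (\<Gamma> x0) < \<rho> / 4" using nz \<rho>' by (intro d(2)) (simp add: dist_norm)
      then have "\<Gamma> x0 - \<rho> / 4 < \<Gamma> z" unfolding dist_real_def by linarith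
      moreover have "z \<bullet> e - x0 \<bullet> e \<le> norm (z - x0)" using norm_cauchy_schwarz[of "z - x0" e] e by (simp add: inner_diff_left)
      ultimately have "y \<bullet> e < \<Gamma> y" unfolding y shift using nz \<rho>' eq \<rho> by (simp add: inner_diff_left ee)
      then show "y \<in> - closure D" using yr by (intro below)
    qed
    have "poly_path (- closure D) x q (norm (x - \<rho> *\<^sub>R e - x) + norm (q - (x - \<rho> *\<^sub>R e)))"
      by (rule poly_path_trans[OF poly_path_segment[OF seg1] poly_path_segment[OF seg2]])
    moreover have "norm (x - \<rho> *\<^sub>R e - x) + norm (q - (x - \<rho> *\<^sub>R e)) \<le> \<rho> + \<rho>'"
      using \<rho> e nx by (simp add: q_def norm_minus_commute)
    ultimately show ?thesis by blast
  qed
  then show "locally_accessible (- closure D) x0" using \<rho>'(1) q unfolding locally_accessible_def by blast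
  show "x0 \<in> closure (- closure D)"
    unfolding closure_approachable
  proof (intro allI impI)
    fix t :: real assume "0 < t"
    define s where "s = min t r / 2"
    have s: "0 < s" "s < t" "s < r" using \<open>0 < t\<close> r by (auto simp: s_def min_def)
    then show "\<exists>y\<in>- closure D. dist y x0 < t" using down[OF s(1,3)] e by (intro bexI[of _ "x0 - s *\<^sub>R e"]) (auto simp: dist_norm)
  qed
qed

text \<open>Only one polygonal component of the exterior can reach a given boundary point, so connectedness of
  the boundary forces the exterior to be polygonally connected.\<close>
lemma exterior_connected:
  fixes D :: "'a::euclidean_space set"
  assumes D: "open D" "has_C1_boundary D" "connected (frontier D)" "D \<noteq> {}"
    and xy: "x \<in> - closure D" "y \<in> - closure D"
  shows "\<exists>l. poly_path (- closure D) x y l"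
proof (rule ccontr)
  let ?O = "- closure D"
  assume no: "\<not> ?thesis"
  define P where "P = {z \<in> ?O. \<exists>l. poly_path ?O x z l}"
  have loc: "locally_accessible ?O z" if "z \<in> ?O \<or> z \<in> frontier D" for z
    using that locally_accessible_open[of ?O z] C1_boundary_exterior(1)[OF D(1,2)] by blast
  have same: "\<exists>\<rho>>0. (\<forall>w\<in>ball z \<rho> \<inter> ?O. w \<in> P) \<or> (\<forall>w\<in>ball z \<rho> \<inter> ?O. w \<notin> P)" if z: "z \<in> ?O \<or> z \<in> frontier D" for z
  proof -
    obtain \<rho> q where q: "\<rho> > 0" "q \<in> ?O" "\<And>w. w \<in> ball z \<rho> \<inter> ?O \<Longrightarrow> \<exists>l. poly_path ?O w q l"
      using loc[OF z] unfolding locally_accessible_def by metis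
    have "w \<in> P \<longleftrightarrow> q \<in> P" if "w \<in> ball z \<rho> \<inter> ?O" for w
      using q(3)[OF that] that q(2) poly_path_trans poly_path_sym unfolding P_def by blast
    then show ?thesis using q(1) by blast
  qed
  \<comment> \<open>A union of polygonal classes whose closure avoids the frontier would be open and
    closed, hence everything, although \<open>D\<close> is not empty.\<close>
  have clopen: "closure S \<inter> frontier D \<noteq> {}" if S: "S = P \<or> S = ?O - P" "S \<noteq> {}" for S
  proof
    assume e: "closure S \<inter> frontier D = {}"
    have SO: "S \<subseteq> ?O" using S by (auto simp: P_def)
    have "closure S \<subseteq> S"
    proof
      fix z assume z: "z \<in> closure S"
      have "S \<inter> D = {}" using SO closure_subset by blast
      then have "closure S \<inter> D = {}" using D(1) open_Int_closure_eq_empty by blast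
      then have "z \<in> ?O" using z e D(1) by (auto simp: frontier_def interior_open)
      then obtain \<rho> where \<rho>: "\<rho> > 0" "(\<forall>w\<in>ball z \<rho> \<inter> ?O. w \<in> P) \<or> (\<forall>w\<in>ball z \<rho> \<inter> ?O. w \<notin> P)" using same by blast
      obtain w where w: "w \<in> S" "dist w z < \<rho>" using z \<rho>(1) closure_approachable by blast
      have "w \<in> ball z \<rho> \<inter> ?O" "z \<in> ball z \<rho> \<inter> ?O" using w SO \<open>z \<in> ?O\<close> \<rho>(1) by (auto simp: dist_commute)
      then show "z \<in> S" using \<rho>(2) w(1) S(1) \<open>z \<in> ?O\<close> by blast
    qed
    then have "closed S" using closure_subset_eq by blast
    moreover have "open S"
    proof (subst open_contains_ball, intro ballI)
      fix z assume z: "z \<in> S"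
      then have zO: "z \<in> ?O" using SO by blast
      obtain \<rho> where \<rho>: "\<rho> > 0" "(\<forall>w\<in>ball z \<rho> \<inter> ?O. w \<in> P) \<or> (\<forall>w\<in>ball z \<rho> \<inter> ?O. w \<notin> P)" using same zO by blast
      obtain s where s: "s > 0" "ball z s \<subseteq> ?O" using zO openE[of ?O z] by blast
      have "ball z (min \<rho> s) \<subseteq> S"
      proof
        fix w assume "w \<in> ball z (min \<rho> s)"
        then have "w \<in> ball z \<rho> \<inter> ?O" using s(2) by auto
        moreover have "z \<in> ball z \<rho> \<inter> ?O" using zO \<rho>(1) by simp
        ultimately show "w \<in> S" using \<rho>(2) z S(1) by blast
      qed
      then show "\<exists>e>0. ball z e \<subseteq> S" using \<rho>(1) s(1) by (intro exI[of _ "min \<rho> s"]) auto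
    qed
    ultimately have "S = UNIV" using clopen S(2) by blast
    then show False using SO D(4) closure_subset by blast
  qed
  have "x \<in> P" using xy poly_refl[of x ?O] by (auto simp: P_def)
  then have 1: "closure P \<inter> frontier D \<noteq> {}" by (intro clopen) auto
  have "y \<in> ?O - P" using xy no by (auto simp: P_def)
  then have 2: "closure (?O - P) \<inter> frontier D \<noteq> {}" by (intro clopen) auto
  have "frontier D \<subseteq> closure P \<union> closure (?O - P)"
  proof
    fix z assume "z \<in> frontier D"
    then have "z \<in> closure ?O" using C1_boundary_exterior(2)[OF D(1,2)] by blast
    moreover have "?O = P \<union> (?O - P)" by (auto simp: P_def)
    ultimately show "z \<in> closure P \<union> closure (?O - P)" using closure_Un[of P "?O - P"] by simp
  qed
  moreover have "closure P \<inter> closure (?O - P) \<inter> frontier D = {}"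
  proof (rule equals0I)
    fix z assume z: "z \<in> closure P \<inter> closure (?O - P) \<inter> frontier D"
    then obtain \<rho> where \<rho>: "\<rho> > 0" "(\<forall>w\<in>ball z \<rho> \<inter> ?O. w \<in> P) \<or> (\<forall>w\<in>ball z \<rho> \<inter> ?O. w \<notin> P)" using same by blast
    obtain w where w: "w \<in> P" "dist w z < \<rho>" using z \<rho>(1) closure_approachable by blast
    obtain w' where w': "w' \<in> ?O - P" "dist w' z < \<rho>" using z \<rho>(1) closure_approachable by blast
    have "w \<in> ball z \<rho> \<inter> ?O" "w' \<in> ball z \<rho> \<inter> ?O" using w w' by (auto simp: P_def dist_commute)
    then show False using \<rho>(2) w(1) w'(1) by blast
  qed
  ultimately show False using D(3) 1 2 unfolding connected_closed by (metis closed_closure inf_commute)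
qed

text \<open>Local length bounds hold near every point of the compact set \<open>Q - D\<close>,
  frontier points included; finitely many neighbourhoods cover it, and their base points are joined
  to \<open>q0\<close>.\<close>

lemma exterior_uniformly_accessible:
  fixes D :: "'a::euclidean_space set"
  assumes D: "open D" "has_C1_boundary D" "connected (frontier D)" "D \<noteq> {}"
    and Q: "compact Q" and q0: "q0 \<in> - closure D"
  shows "\<exists>c\<ge>0. \<forall>x\<in>Q \<inter> - closure D. \<exists>l\<le>c. poly_path (- closure D) x q0 l"
proof -
  let ?O = "- closure D"
  have "compact (Q - D)" using Q D(1) by (rule compact_diff)
  have "\<exists>\<rho>>0. \<exists>c. \<forall>x\<in>ball z \<rho> \<inter> ?O. \<exists>l\<le>c. poly_path ?O x q0 l" if z: "z \<in> Q - D" for z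
  proof -
    have "z \<in> ?O \<or> z \<in> frontier D" using z D(1) by (auto simp: frontier_def interior_open)
    then have "locally_accessible ?O z" using locally_accessible_open[of ?O z] C1_boundary_exterior(1)[OF D(1,2)] by blast
    then obtain \<rho> q c where q: "\<rho> > 0" "q \<in> ?O" "\<And>w. w \<in> ball z \<rho> \<inter> ?O \<Longrightarrow> \<exists>l\<le>c. poly_path ?O w q l"
      unfolding locally_accessible_def by blast
    obtain k where k: "poly_path ?O q q0 k" using exterior_connected[OF D q(2) q0] by blast
    have "\<exists>l\<le>c + k. poly_path ?O x q0 l" if "x \<in> ball z \<rho> \<inter> ?O" for x
      using q(3)[OF that] poly_path_trans[OF _ k] by (meson add_right_mono)
    then show ?thesis using q(1) by blast
  qed
  then obtain \<rho> c where \<rho>: "\<And>z. z \<in> Q - D \<Longrightarrow> \<rho> z > 0"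
    "\<And>z x. z \<in> Q - D \<Longrightarrow> x \<in> ball z (\<rho> z) \<inter> ?O \<Longrightarrow> \<exists>l\<le>c z. poly_path ?O x q0 l" by metis
  have "Q - D \<subseteq> (\<Union>z\<in>Q - D. ball z (\<rho> z))" using \<rho>(1) by force
  then obtain Z where Z: "Z \<subseteq> Q - D" "finite Z" "Q - D \<subseteq> (\<Union>z\<in>Z. ball z (\<rho> z))"
    using compactE_image[OF \<open>compact (Q - D)\<close>, of "Q - D" "\<lambda>z. ball z (\<rho> z)"] by (metis open_ball)
  define C where "C = Max (insert 0 (c ` Z))"
  have C: "0 \<le> C" "\<And>z. z \<in> Z \<Longrightarrow> c z \<le> C" using Z(2) by (auto simp: C_def)
  have "\<exists>l\<le>C. poly_path ?O x q0 l" if x: "x \<in> Q \<inter> ?O" for x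
  proof -
    have "x \<in> Q - D" using x closure_subset by blast
    then obtain z where z: "z \<in> Z" "x \<in> ball z (\<rho> z)" using Z(3) by blast
    then show ?thesis using \<rho>(2)[of z x] x Z(1) C(2)[OF z(1)] by (meson IntE IntI order_trans subsetD)
  qed
  then show ?thesis using C(1) by blast
qed

text \<open>The path is cut at the first segment that leaves the interior of \<open>Q\<close>, in a
  point where it meets the frontier; convexity keeps what remains of that segment inside
  \<open>Q\<close>.\<close>

lemma poly_path_exit:
  assumes "poly_path A x y l" and Q: "convex Q" "closed Q" and x: "x \<in> interior Q"
  shows "(y \<in> interior Q \<and> poly_path (A \<inter> Q) x y l) \<or> (\<exists>y'\<in>Q - interior Q. \<exists>l'\<le>l. poly_path (A \<inter> Q) x y' l')"
  using assms(1)
proof induction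
  case poly_refl
  then show ?case using x interior_subset poly_path.poly_refl[of x "A \<inter> Q"] by blast
next
  case (poly_step y l z)
  from poly_step.IH show ?case
  proof (elim disjE conjE bexE exE)
    assume y: "y \<in> interior Q" and p: "poly_path (A \<inter> Q) x y l"
    have yQ: "y \<in> Q" using y interior_subset by blast
    have extend: "poly_path (A \<inter> Q) x w (l + norm (w - y))" if "w \<in> Q" "w \<in> closed_segment y z" for w
    proof -
      have "closed_segment y w \<subseteq> Q" using Q(1) yQ that(1) by (rule closed_segment_subset[rotated -1])
      moreover have "closed_segment y w \<subseteq> closed_segment y z" using that(2) by (simp add: subset_closed_segment)
      ultimately show ?thesis using poly_step.hyps(2) by (intro poly_path.poly_step[OF p]) blast
    qed
    show ?thesis
    proof (cases "z \<in> interior Q")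
      case True
      then show ?thesis using extend[of z] interior_subset by auto
    next
      case False
      have "closed_segment y z \<inter> frontier (interior Q) \<noteq> {}"
        by (rule connected_Int_frontier) (use y False in auto)
      then obtain w where w: "w \<in> closed_segment y z" "w \<in> frontier (interior Q)" by blast
      have "w \<in> Q - interior Q"
        using w(2) Q(2) closure_minimal[OF interior_subset Q(2)] by (auto simp: frontier_def)
      moreover have "norm (w - y) \<le> norm (z - y)" using segment_bound1[OF w(1)] by simp
      ultimately show ?thesis using extend[of w] w(1) by (metis DiffD1 add_left_mono)
    qed
  next
    fix y' l' assume "y' \<in> Q - interior Q" "l' \<le> l" "poly_path (A \<inter> Q) x y' l'"
    moreover have "l \<le> l + norm (z - y)" by simp
    ultimately show ?thesis by (meson order_trans)
  qed
qed

section \<open>Detours around the holes\<close>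

definition cube :: "real ^ 'n \<Rightarrow> real \<Rightarrow> (real ^ 'n) set" where
  "cube c s = {x. \<forall>i. \<bar>x $ i - c $ i\<bar> < s}"

definition ccube :: "real ^ 'n \<Rightarrow> real \<Rightarrow> (real ^ 'n) set" where
  "ccube c s = {x. \<forall>i. \<bar>x $ i - c $ i\<bar> \<le> s}"

lemma cube_eq_box: "cube c s = box (c - vec s) (c + vec s)"
proof -
  have "\<bar>x $ i - c $ i\<bar> < s \<longleftrightarrow> c $ i - s < x $ i \<and> x $ i < c $ i + s" for x i by linarith
  then show ?thesis by (simp add: cube_def set_eq_iff mem_box_cart)
qed

lemma ccube_eq_cbox: "ccube c s = cbox (c - vec s) (c + vec s)"
proof -
  have "\<bar>x $ i - c $ i\<bar> \<le> s \<longleftrightarrow> c $ i - s \<le> x $ i \<and> x $ i \<le> c $ i + s" for x i by linarith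
  then show ?thesis by (simp add: ccube_def set_eq_iff mem_box_cart)
qed

lemma open_cube: "open (cube c s)" and closed_ccube: "closed (ccube c s)" and convex_ccube: "convex (ccube c s)"
  and compact_ccube: "compact (ccube c s)"
  by (simp_all add: cube_eq_box ccube_eq_cbox open_box closed_cbox convex_box compact_cbox)

lemma cube_subset_ccube: "cube c s \<subseteq> ccube c s"
  by (auto simp: cube_def ccube_def less_imp_le)

lemma cube_mono: "s \<le> s' \<Longrightarrow> cube c s \<subseteq> cube c s'"
  unfolding cube_def by (blast intro: less_le_trans)

lemma cube_affine:
  assumes "0 < q"
  shows "c + q *\<^sub>R z \<in> cube c (q * r) \<longleftrightarrow> z \<in> cube 0 r" "c + q *\<^sub>R z \<in> ccube c (q * r) \<longleftrightarrow> z \<in> ccube 0 r"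
proof -
  have "\<bar>q * z $ i\<bar> = q * \<bar>z $ i\<bar>" for i using assms by (simp add: abs_mult)
  then show "c + q *\<^sub>R z \<in> cube c (q * r) \<longleftrightarrow> z \<in> cube 0 r" "c + q *\<^sub>R z \<in> ccube c (q * r) \<longleftrightarrow> z \<in> ccube 0 r"
    using assms by (simp_all add: cube_def ccube_def)
qed

lemma closure_cube_subset: "closure (cube c s) \<subseteq> ccube c s"
  by (rule closure_minimal[OF cube_subset_ccube closed_ccube])

lemma norm_diff_ccube:
  assumes "x \<in> ccube c s" "y \<in> ccube (c :: real ^ 'n) s" shows "norm (x - y) \<le> 2 * s * real CARD('n)"
proof -
  have "norm (x - y) \<le> (\<Sum>i\<in>UNIV. \<bar>(x - y) $ i\<bar>)" by (rule norm_le_l1_cart)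
  also have "\<dots> \<le> (\<Sum>i\<in>(UNIV::'n set). 2 * s)"
  proof (rule sum_mono)
    fix i
    have "\<bar>x $ i - c $ i\<bar> \<le> s" "\<bar>y $ i - c $ i\<bar> \<le> s" using assms by (auto simp: ccube_def)
    then show "\<bar>(x - y) $ i\<bar> \<le> 2 * s" by simp
  qed
  finally show ?thesis by (simp add: mult.commute)
qed

text \<open>In some coordinate the centres are at least \<open>e\<close> apart, and the two
  half-sides take away at most \<open>e / 4\<close> each.\<close>

lemma ccube_gap:
  fixes k k' :: "real ^ 'n"
  assumes k: "k \<in> integer_points" "k' \<in> integer_points" "k \<noteq> k'" and s: "4 * s \<le> e" and e: "0 < e"
    and pq: "p \<in> ccube (e *\<^sub>R k) s" "q \<in> ccube (e *\<^sub>R k') s"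
  shows "e / 2 \<le> norm (p - q)"
proof -
  obtain i where i: "k $ i \<noteq> k' $ i" using k(3) by (auto simp: vec_eq_iff)
  have "k $ i - k' $ i \<in> \<int>" using k by (auto simp: integer_points_def)
  then have "1 \<le> \<bar>k $ i - k' $ i\<bar>" using i by (intro Ints_nonzero_abs_ge1) auto
  then have "e * 1 \<le> e * \<bar>k $ i - k' $ i\<bar>" using e by (intro mult_left_mono) auto
  also have "\<dots> = \<bar>e * k $ i - e * k' $ i\<bar>" using e by (simp add: abs_mult flip: right_diff_distrib)
  finally have "e \<le> \<bar>e * k $ i - e * k' $ i\<bar>" by simp
  moreover have "\<bar>p $ i - e * k $ i\<bar> \<le> s" "\<bar>q $ i - e * k' $ i\<bar> \<le> s" using pq by (auto simp: ccube_def)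
  moreover have "\<bar>e * k $ i - e * k' $ i\<bar> \<le> \<bar>p $ i - e * k $ i\<bar> + \<bar>q $ i - e * k' $ i\<bar> + \<bar>p $ i - q $ i\<bar>" by linarith
  ultimately have "e / 2 \<le> \<bar>(p - q) $ i\<bar>" using s unfolding vector_minus_component by linarith
  then show ?thesis using component_le_norm_cart[of "p - q" i] by linarith
qed

lemma first_entry:
  fixes B :: "'a::real_normed_vector set"
  assumes B: "open B" and z: "z \<notin> B" and r: "0 \<le> r" "z + r *\<^sub>R v \<in> B"
  shows "\<exists>s\<ge>0. s \<le> r \<and> z + s *\<^sub>R v \<in> closure B - B \<and> (\<forall>q. 0 \<le> q \<longrightarrow> q \<le> s \<longrightarrow> z + q *\<^sub>R v \<notin> B)"
proof -
  define Z where "Z = {q. 0 \<le> q \<and> z + q *\<^sub>R v \<in> B}"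
  have Z: "Z \<noteq> {}" "bdd_below Z" using r by (auto simp: Z_def intro: bdd_belowI[of _ 0])
  define s where "s = Inf Z"
  have s: "0 \<le> s" "s \<le> r" unfolding s_def using Z r by (auto simp: Z_def intro: cInf_greatest cInf_lower)
  have before: "z + q *\<^sub>R v \<notin> B" if "0 \<le> q" "q < s" for q
    using cInf_lower[OF _ Z(2), of q] that by (auto simp: Z_def s_def)
  have cont: "continuous_on UNIV (\<lambda>q. z + q *\<^sub>R v)" by (intro continuous_intros)
  have "s \<in> closure Z" unfolding s_def using Z by (rule closure_contains_Inf)
  moreover have "closure Z \<subseteq> (\<lambda>q. z + q *\<^sub>R v) -` closure B"
  proof (rule closure_minimal)
    show "Z \<subseteq> (\<lambda>q. z + q *\<^sub>R v) -` closure B" using closure_subset by (auto simp: Z_def)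
    show "closed ((\<lambda>q. z + q *\<^sub>R v) -` closure B)" using cont by (intro continuous_closed_vimage) (auto simp: continuous_on_eq_continuous_at)
  qed
  ultimately have cl: "z + s *\<^sub>R v \<in> closure B" by auto
  have nB: "z + s *\<^sub>R v \<notin> B"
  proof
    assume a: "z + s *\<^sub>R v \<in> B"
    then have "s \<noteq> 0" using z by auto
    then have s0: "0 < s" using s by simp
    have "open ((\<lambda>q. z + q *\<^sub>R v) -` B)" using B cont by (intro continuous_open_vimage) (auto simp: continuous_on_eq_continuous_at)
    then obtain d where d: "d > 0" "ball s d \<subseteq> (\<lambda>q. z + q *\<^sub>R v) -` B" using a openE by blast
    define q where "q = s - min s d / 2"
    have "q \<in> ball s d" "0 \<le> q" "q < s" using s0 d(1) by (auto simp: q_def dist_real_def min_def)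
    then show False using before[of q] d(2) by blast
  qed
  show ?thesis
  proof (intro exI conjI allI impI)
    fix q assume "0 \<le> q" "q \<le> s"
    then show "z + q *\<^sub>R v \<notin> B" using before[of q] nB by (cases "q = s") auto
  qed (use s cl nB in auto)
qed

text \<open>Dynamic programming along segments in \<Omega>, with time ranging over all reals: this
  is what detours require, and it survives the continuation of a solution to negative times.\<close>

locale moving = hamiltonian F a b m
  for F :: "real ^ 'n \<Rightarrow> real ^ 'n \<Rightarrow> real" and a b m +
  fixes U :: "real ^ 'n \<Rightarrow> real \<Rightarrow> real" and \<Omega> :: "(real ^ 'n) set" and R :: real
  assumes move: "0 < h \<Longrightarrow> segment_cost F R x v h l \<Longrightarrow> (\<And>r. 0 \<le> r \<Longrightarrow> r \<le> h \<Longrightarrow> x + r *\<^sub>R v \<in> \<Omega>) \<Longrightarrow>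
      U (x + h *\<^sub>R v) (t + h) \<le> U x t + h * l"
begin

lemma U_mono: assumes "x \<in> \<Omega>" "t \<le> t'" shows "U x t' \<le> U x t"
proof (cases "t = t'")
  case False
  have "segment_cost F R x 0 (t' - t) 0" by (auto simp: segment_cost_def nonneg)
  from move[OF _ this, of t] show ?thesis using assms False by simp
qed simp

lemma move_weak:
  assumes "0 \<le> h" "segment_cost F R x v h l" "\<And>r. 0 \<le> r \<Longrightarrow> r \<le> h \<Longrightarrow> x + r *\<^sub>R v \<in> \<Omega>"
  shows "U (x + h *\<^sub>R v) (t + h) \<le> U x t + h * l"
  using move[OF _ assms(2,3), of t] assms(1) by (cases "h = 0") auto

lemma slow_move:
  assumes seg: "closed_segment x y \<subseteq> \<Omega>" and n: "norm (y - x) \<le> a * h" and h: "0 < h"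
  shows "U y (t + h) \<le> U x t + b * h"
proof -
  define v where "v = (y - x) /\<^sub>R h"
  have hv: "h *\<^sub>R v = y - x" using h by (simp add: v_def)
  have "norm v = norm (y - x) / h" using h unfolding v_def norm_scaleR by (simp add: divide_inverse)
  then have v: "norm v \<le> a" using n h by (simp add: pos_divide_le_eq)
  have "x + r *\<^sub>R v \<in> \<Omega>" if r: "0 \<le> r" "r \<le> h" for r
  proof -
    have "r *\<^sub>R v = (r / h) *\<^sub>R (y - x)" using h unfolding hv[symmetric] by simp
    then have "x + r *\<^sub>R v = (1 - r / h) *\<^sub>R x + (r / h) *\<^sub>R y" by (simp add: algebra_simps)
    then have "x + r *\<^sub>R v \<in> closed_segment x y" using r h by (auto simp: closed_segment_def intro!: exI[of _ "r / h"])
    then show ?thesis using seg by blast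
  qed
  from move[OF h segment_cost_slow[OF v] this, of t] show ?thesis by (simp add: hv mult.commute)
qed

end

text \<open>The open cubes of half-side \<open>s\<close> around the lattice of width
  \<open>e\<close> contain everything outside \<Omega>, and by \<open>se\<close> they are well
  separated. \<open>K + 1\<close> is the momentum with which the length of paths will be
  measured.\<close>

locale cube_chase = moving F a b m U \<Omega> R
  for F :: "real ^ 'n \<Rightarrow> real ^ 'n \<Rightarrow> real" and a b m U \<Omega> R +
  fixes K e s :: real
  assumes dim: "2 \<le> CARD('n)" and K: "0 \<le> K" and KR: "K + 1 \<le> R" and s: "0 < s" and se: "4 * s \<le> e"
    and free: "(\<And>k. k \<in> integer_points \<Longrightarrow> x \<notin> cube (e *\<^sub>R k) s) \<Longrightarrow> x \<in> \<Omega>"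
begin

definition surface :: "real ^ 'n \<Rightarrow> (real ^ 'n) set" where
  "surface k = ccube (e *\<^sub>R k) s - cube (e *\<^sub>R k) s"

definition free_set :: "(real ^ 'n) set" where
  "free_set = {x. \<forall>k\<in>integer_points. x \<notin> cube (e *\<^sub>R k) s}"

definition face_time :: real where "face_time = 2 * s * real CARD('n) / a"

lemma e: "0 < e" using s se by linarith

lemma free_set_subset: "free_set \<subseteq> \<Omega>" by (auto simp: free_set_def intro: free)

lemma surface_subset: assumes "k \<in> integer_points" shows "surface k \<subseteq> free_set"
  unfolding free_set_def
proof (intro subsetI CollectI ballI notI)
  fix x k' assume x: "x \<in> surface k" "k' \<in> integer_points" "x \<in> cube (e *\<^sub>R k') s"
  then have "k \<noteq> k'" by (auto simp: surface_def)
  then have "e / 2 \<le> norm (x - x)"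
    using x cube_subset_ccube by (intro ccube_gap[OF assms x(2) _ se e]) (auto simp: surface_def)
  then show False using e by simp
qed

lemma face_time_pos: "0 < face_time"
  using s a by (simp add: face_time_def)

lemma segment_cost_nonneg: assumes "segment_cost F R x v h l" "0 \<le> h" shows "0 \<le> l"
proof -
  have "(0::real ^ 'n) \<bullet> v - F (x + 0 *\<^sub>R v) 0 \<le> l"
    using assms K KR unfolding segment_cost_def by (metis atLeastAtMost_iff norm_zero order_refl add_nonneg_nonneg order_trans zero_le_one)
  then show ?thesis by (simp add: zero)
qed

lemma face_move:
  assumes k: "k \<in> integer_points" and w: "w \<in> ccube (e *\<^sub>R k) s" "w' \<in> ccube (e *\<^sub>R k) s"
    and i: "w $ i = w' $ i" "\<bar>w $ i - e * k $ i\<bar> = s"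
  shows "U w' (t + face_time) \<le> U w t + b * face_time"
proof (rule slow_move)
  show "closed_segment w w' \<subseteq> \<Omega>"
  proof
    fix y assume y: "y \<in> closed_segment w w'"
    then have "y \<in> ccube (e *\<^sub>R k) s" using closed_segment_subset[OF w convex_ccube] by blast
    moreover obtain r where "y = (1 - r) *\<^sub>R w + r *\<^sub>R w'" using y by (auto simp: closed_segment_def)
    then have "y $ i = (1 - r) * w $ i + r * w' $ i" by (simp only: vector_add_component vector_scaleR_component real_scaleR_def)
    then have "y $ i = w $ i" using i(1) by (simp add: algebra_simps)
    then have "\<not> \<bar>y $ i - (e *\<^sub>R k) $ i\<bar> < s" using i(2) by simp
    then have "y \<notin> cube (e *\<^sub>R k) s" unfolding cube_def by blast
    ultimately show "y \<in> \<Omega>" using surface_subset[OF k] free_set_subset by (auto simp: surface_def)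
  qed
  show "norm (w' - w) \<le> a * face_time" using norm_diff_ccube[OF w(2,1)] a by (simp add: face_time_def)
qed (rule face_time_pos)

text \<open>At most three straight moves within faces are made. Setting coordinate \<open>l\<close>,
  different from the coordinate \<open>i\<close> of the first face, to an extremal value
  \<open>r\<close> stays on that face and reaches a face of direction \<open>l\<close>; a move
  within this one sets all other coordinates; the last move restores coordinate \<open>l\<close>.
  The existence of \<open>l\<close> is where dimension at least two enters.\<close>

lemma detour:
  assumes k: "k \<in> integer_points" and w: "w \<in> surface k" "w' \<in> surface k"
  shows "U w' (t + 3 * face_time) \<le> U w t + b * (3 * face_time)"
proof -
  let ?c = "e *\<^sub>R k"
  have cc: "w \<in> ccube ?c s" "w' \<in> ccube ?c s" using w by (auto simp: surface_def)
  have face: "\<exists>i. \<bar>w $ i - e * k $ i\<bar> = s" if "w \<in> surface k" for w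
  proof -
    have "\<not> (\<forall>i. \<bar>w $ i - e * k $ i\<bar> < s)" using that by (simp add: surface_def cube_def)
    then obtain i where "\<not> \<bar>w $ i - e * k $ i\<bar> < s" by blast
    moreover have "\<bar>w $ i - e * k $ i\<bar> \<le> s" using that by (auto simp: surface_def ccube_def)
    ultimately show ?thesis by (intro exI[of _ i]) linarith
  qed
  obtain i where i: "\<bar>w $ i - e * k $ i\<bar> = s" using face[OF w(1)] by blast
  obtain i' where i': "\<bar>w' $ i' - e * k $ i'\<bar> = s" using face[OF w(2)] by blast
  have "\<exists>j. j \<noteq> i"
  proof (rule ccontr)
    assume "\<nexists>j. j \<noteq> i"
    then have "(UNIV :: 'n set) = {i}" by auto
    then have "CARD('n) = card {i}" by (rule arg_cong)
    also have "\<dots> = 1" by simp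
    finally have "CARD('n) = 1" .
    then show False using dim by simp
  qed
  then obtain j where j: "j \<noteq> i" by blast
  define upd :: "real ^ 'n \<Rightarrow> 'n \<Rightarrow> real \<Rightarrow> real ^ 'n" where "upd x i r = (\<chi> l. if l = i then r else x $ l)" for x i r
  have upd: "upd x i r \<in> ccube ?c s" if "x \<in> ccube ?c s" "\<bar>r - e * k $ i\<bar> \<le> s" for x i r
    using that by (auto simp: upd_def ccube_def)
  have upd_nth: "upd x i r $ l = (if l = i then r else x $ l)" for x i r l by (simp add: upd_def)
  define r where "r = (if i' = i then e * k $ j + s else w' $ i')"
  define l where "l = (if i' = i then j else i')"
  have l: "l \<noteq> i" "\<bar>r - e * k $ l\<bar> = s" using j i' s by (auto simp: l_def r_def)
  have 1: "U (upd w l r) (t + face_time) \<le> U w t + b * face_time"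
    by (rule face_move[OF k cc(1) upd[OF cc(1)] _ i]) (use l in \<open>auto simp: upd_nth\<close>)
  have 2: "U (upd w' l r) (t + face_time + face_time) \<le> U (upd w l r) (t + face_time) + b * face_time"
    by (rule face_move[OF k upd[OF cc(1)] upd[OF cc(2)], of _ _ _ _ l]) (use l in \<open>auto simp: upd_nth\<close>)
  have 3: "U w' (t + face_time + face_time + face_time) \<le> U (upd w' l r) (t + face_time + face_time) + b * face_time"
    by (rule face_move[OF k upd[OF cc(2)] cc(2), of _ _ i']) (use l i' in \<open>auto simp: upd_nth l_def r_def split: if_splits\<close>)
  have "t + face_time + face_time + face_time = t + 3 * face_time" by simp
  then show ?thesis using 1 2 3 by (simp add: algebra_simps)
qed

text \<open>A step of length at most \<open>e / 4\<close> cannot bridge the gap \<open>e / 2\<close>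
  between different cubes.\<close>

lemma close_cubes:
  assumes k: "k \<in> integer_points" "k' \<in> integer_points" and v: "h * norm v \<le> e / 4"
    and r: "0 \<le> r" "r \<le> h" "0 \<le> r'" "r' \<le> h"
    and z: "z + r *\<^sub>R v \<in> ccube (e *\<^sub>R k) s" "z + r' *\<^sub>R v \<in> ccube (e *\<^sub>R k') s"
  shows "k = k'"
proof (rule ccontr)
  assume "k \<noteq> k'"
  from ccube_gap[OF k this se e z] have "e / 2 \<le> norm ((r - r') *\<^sub>R v)" by (simp add: algebra_simps)
  also have "\<dots> = \<bar>r - r'\<bar> * norm v" by simp
  also have "\<dots> \<le> h * norm v" using r by (intro mult_right_mono) auto
  finally show False using v e by linarith
qed

text \<open>Going backwards from the end of the segment finds the point \<open>w\<close> where the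
  cube is left for the last time. The bound \<open>B\<close> holds on the whole surface, so it holds
  at \<open>w\<close>; one waits there until the path arrives and follows it from then on.\<close>

lemma exit_move:
  assumes k: "k \<in> integer_points" and z': "z + h *\<^sub>R v \<in> free_set" and h: "0 \<le> h" "h * norm v \<le> e / 4"
    and seg: "segment_cost F R z v h l" and r: "0 \<le> r" "r \<le> h" "z + r *\<^sub>R v \<in> cube (e *\<^sub>R k) s"
    and B: "\<And>w. w \<in> surface k \<Longrightarrow> U w t \<le> B"
  shows "U (z + h *\<^sub>R v) (t + h) \<le> B + h * l"
proof -
  have l: "0 \<le> l" using segment_cost_nonneg[OF seg h(1)] .
  have z'n: "z + h *\<^sub>R v \<notin> cube (e *\<^sub>R k) s" using z' k by (auto simp: free_set_def)
  have "z + h *\<^sub>R v + (h - r) *\<^sub>R (- v) \<in> cube (e *\<^sub>R k) s" using r(3) by (simp add: algebra_simps)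
  from first_entry[OF open_cube z'n _ this] r obtain q where q: "0 \<le> q" "q \<le> h - r"
    "z + h *\<^sub>R v + q *\<^sub>R (- v) \<in> closure (cube (e *\<^sub>R k) s) - cube (e *\<^sub>R k) s"
    "\<And>p. 0 \<le> p \<Longrightarrow> p \<le> q \<Longrightarrow> z + h *\<^sub>R v + p *\<^sub>R (- v) \<notin> cube (e *\<^sub>R k) s" by auto
  define w where "w = z + (h - q) *\<^sub>R v"
  have w: "w = z + h *\<^sub>R v + q *\<^sub>R (- v)" by (simp add: w_def algebra_simps)
  have ws: "w \<in> surface k" using q(3) closure_cube_subset unfolding w surface_def by blast
  have "w + p *\<^sub>R v \<in> free_set" if p: "0 \<le> p" "p \<le> q" for p
    unfolding free_set_def
  proof (intro CollectI ballI notI)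
    fix k' assume k': "k' \<in> integer_points" "w + p *\<^sub>R v \<in> cube (e *\<^sub>R k') s"
    have "z + (h - q + p) *\<^sub>R v \<in> cube (e *\<^sub>R k') s" using k'(2) by (simp add: w_def algebra_simps)
    then have "k = k'" using r p q h cube_subset_ccube by (intro close_cubes[OF k k'(1) h(2), of r "h - q + p" z]) auto
    moreover have "z + h *\<^sub>R v + (q - p) *\<^sub>R (- v) \<notin> cube (e *\<^sub>R k) s" using p by (intro q(4)) auto
    ultimately show False using k'(2) by (simp add: w_def algebra_simps)
  qed
  moreover have "segment_cost F R w v (h - (h - q)) l"
    unfolding w_def by (rule segment_cost_split(2)[OF seg]) (use q r in auto)
  ultimately have "U (w + q *\<^sub>R v) (t + (h - q) + q) \<le> U w (t + (h - q)) + q * l"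
    using free_set_subset q by (intro move_weak) auto
  moreover have "U w (t + (h - q)) \<le> U w t" using ws surface_subset[OF k] free_set_subset q r by (intro U_mono) auto
  moreover have "q * l \<le> h * l" using q r l by (intro mult_right_mono) auto
  moreover have "w + q *\<^sub>R v = z + h *\<^sub>R v" by (simp add: w_def algebra_simps)
  ultimately show ?thesis using B[OF ws] by simp
qed

text \<open>\<open>N\<close> cubes have been visited, the last one at \<open>k\<close>. Each of them costs one lag \<open>\<tau>\<close> in time and one
  surcharge \<open>\<beta>\<close>; the number of visits is controlled by the distance travelled, because distinct cubes
  are at distance at least \<open>e / 2\<close>.\<close>

definition \<tau> :: real where "\<tau> = 3 * face_time"
definition \<beta> :: real where "\<beta> = b * \<tau> + K * (2 * s * real CARD('n))"

lemma \<tau>_pos: "0 < \<tau>" and \<beta>_nonneg: "0 \<le> \<beta>" and \<beta>_ge: "b * \<tau> \<le> \<beta>"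
  using face_time_pos b K s by (auto simp: \<tau>_def \<beta>_def)

text \<open>The bound is kept at all surface points of the last cube simultaneously, since the exit
  point of the path is not known on entry. \<open>q\<close> is the point where that cube was met
  first, and \<open>\<sigma>\<close> the head start granted to the follower. For
  \<open>N = 0\<close> the values of \<open>k\<close> and \<open>q\<close> are placeholders.\<close>

definition chasing :: "real \<Rightarrow> real \<Rightarrow> real \<Rightarrow> real ^ 'n \<Rightarrow> real \<Rightarrow> nat \<Rightarrow> real ^ 'n \<Rightarrow> real ^ 'n \<Rightarrow> bool" where
  "chasing M \<sigma> T z C N k q \<longleftrightarrow> k \<in> integer_points \<and>
     (N \<noteq> 0 \<longrightarrow> q \<in> ccube (e *\<^sub>R k) s \<and> (real N - 1) * (e / 2) + norm (z - q) \<le> (C + m (K + 1) * T) / (K + 1) \<and>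
        (\<forall>w\<in>surface k. U w (T - \<sigma> + real N * \<tau>) \<le> M + C + real N * \<beta>)) \<and>
     (z \<in> free_set \<longrightarrow> U z (T - \<sigma> + real N * \<tau>) \<le> M + C + real N * \<beta>) \<and>
     (\<forall>k'\<in>integer_points. z \<in> cube (e *\<^sub>R k') s \<longrightarrow> N \<noteq> 0 \<and> k' = k)"

text \<open>A short step meets at most one cube, which leaves three cases: no cube is met, and the
  step is copied; the last cube is met again, which costs nothing; or a new cube is met, which costs
  one detour and is paid for by the distance \<open>e / 2\<close> from the previous one.\<close>

lemma chasing_step:
  assumes ch: "chasing M \<sigma> T z C N k q" and T: "0 \<le> T" and C: "0 \<le> C"
    and h: "0 < h" "h * norm v \<le> e / 4" and seg: "segment_cost F R z v h l"
  shows "\<exists>N k q. chasing M \<sigma> (T + h) (z + h *\<^sub>R v) (C + h * l) N k q"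
proof -
  let ?V = "\<lambda>C T. (C + m (K + 1) * T) / (K + 1)" and ?z = "z + h *\<^sub>R v"
  have l: "0 \<le> l" using segment_cost_nonneg[OF seg] h by simp
  have hl: "0 \<le> h * l" using l h by simp
  have K1: "0 < K + 1" using K by simp
  have "(K + 1) * norm (?z - z) \<le> h * l + m (K + 1) * h"
    using K1 by (intro reach_cost_lower[OF reach_segment_cost[OF h(1) seg] _ KR]) simp
  then have "norm (?z - z) \<le> (h * l + m (K + 1) * h) / (K + 1)" using K1 by (simp add: pos_le_divide_eq mult.commute)
  then have V: "?V C T + h * norm v \<le> ?V (C + h * l) (T + h)"
    using h(1) K1 by (simp add: add_divide_distrib algebra_simps)
  have V0: "0 \<le> ?V C T" using C T m_nonneg[of "K + 1"] K1 by simp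
  have k: "k \<in> integer_points" using ch by (simp add: chasing_def)
  have later: "U w (T + h - \<sigma> + real N * \<tau>) \<le> B" if "U w t \<le> B" "w \<in> free_set" "t \<le> T + h - \<sigma> + real N * \<tau>" for w N B t
    using U_mono[of w t "T + h - \<sigma> + real N * \<tau>"] that free_set_subset by force
  show ?thesis
  proof (cases "\<exists>k'\<in>integer_points. \<exists>r. 0 \<le> r \<and> r \<le> h \<and> z + r *\<^sub>R v \<in> cube (e *\<^sub>R k') s")
    case False
    then have fr: "z + r *\<^sub>R v \<in> free_set" if "0 \<le> r" "r \<le> h" for r using that by (auto simp: free_set_def)
    have 1: "U ?z (T - \<sigma> + real N * \<tau> + h) \<le> U z (T - \<sigma> + real N * \<tau>) + h * l"
      using fr free_set_subset by (intro move[OF h(1) seg]) auto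
    have z: "U z (T - \<sigma> + real N * \<tau>) \<le> M + C + real N * \<beta>" using ch fr[of 0] h by (simp add: chasing_def)
    have "chasing M \<sigma> (T + h) ?z (C + h * l) N k q"
      unfolding chasing_def
    proof (intro conjI impI ballI k)
      assume N: "N \<noteq> 0"
      then show "q \<in> ccube (e *\<^sub>R k) s" using ch by (simp add: chasing_def)
      have "(real N - 1) * (e / 2) + norm (z - q) \<le> ?V C T" using N ch by (simp add: chasing_def)
      moreover have "norm (?z - q) \<le> norm (z - q) + h * norm v"
        using norm_triangle_ineq[of "z - q" "h *\<^sub>R v"] h by (simp add: algebra_simps)
      ultimately show "(real N - 1) * (e / 2) + norm (?z - q) \<le> ?V (C + h * l) (T + h)" using V by linarith
      fix w assume w: "w \<in> surface k"
      then have "U w (T - \<sigma> + real N * \<tau>) \<le> M + C + real N * \<beta>" using N ch by (simp add: chasing_def)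
      then have "U w (T - \<sigma> + real N * \<tau>) \<le> M + (C + h * l) + real N * \<beta>" using hl by simp
      then show "U w (T + h - \<sigma> + real N * \<tau>) \<le> M + (C + h * l) + real N * \<beta>"
        by (rule later) (use w surface_subset[OF k] h in auto)
    next
      show "U ?z (T + h - \<sigma> + real N * \<tau>) \<le> M + (C + h * l) + real N * \<beta>" using 1 z by (simp add: algebra_simps)
    next
      fix k' assume "k' \<in> integer_points" "?z \<in> cube (e *\<^sub>R k') s"
      then show "N \<noteq> 0" "k' = k" using fr[of h] h by (auto simp: free_set_def)
    qed
    then show ?thesis by blast
  next
    case True
    then obtain k' r where k': "k' \<in> integer_points" and r: "0 \<le> r" "r \<le> h" "z + r *\<^sub>R v \<in> cube (e *\<^sub>R k') s" by blast
    have only: "k'' = k'" if "k'' \<in> integer_points" "0 \<le> p" "p \<le> h" "z + p *\<^sub>R v \<in> ccube (e *\<^sub>R k'') s" for k'' p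
      using close_cubes[OF that(1) k' h(2) that(2,3) r(1,2) that(4)] r(3) cube_subset_ccube by blast
    have endin: "k'' = k'" if "k'' \<in> integer_points" "?z \<in> cube (e *\<^sub>R k'') s" for k''
      using only[OF that(1), of h] h that(2) cube_subset_ccube by auto
    show ?thesis
    proof (cases "N \<noteq> 0 \<and> k' = k")
      case True
      have B: "U w (T - \<sigma> + real N * \<tau>) \<le> M + C + real N * \<beta>" if "w \<in> surface k" for w
        using True that ch by (simp add: chasing_def)
      have "chasing M \<sigma> (T + h) ?z (C + h * l) N k q"
        unfolding chasing_def
      proof (intro conjI impI ballI k)
        show "q \<in> ccube (e *\<^sub>R k) s" using ch True by (simp add: chasing_def)
        have "(real N - 1) * (e / 2) + norm (z - q) \<le> ?V C T" using True ch by (simp add: chasing_def)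
        moreover have "norm (?z - q) \<le> norm (z - q) + h * norm v"
          using norm_triangle_ineq[of "z - q" "h *\<^sub>R v"] h by (simp add: algebra_simps)
        ultimately show "(real N - 1) * (e / 2) + norm (?z - q) \<le> ?V (C + h * l) (T + h)" using V by linarith
        fix w assume w: "w \<in> surface k"
        then have "U w (T - \<sigma> + real N * \<tau>) \<le> M + (C + h * l) + real N * \<beta>" using B[OF w] hl by simp
        then show "U w (T + h - \<sigma> + real N * \<tau>) \<le> M + (C + h * l) + real N * \<beta>"
          by (rule later) (use w surface_subset[OF k] h in auto)
      next
        assume "?z \<in> free_set"
        from exit_move[OF k this _ h(2) seg r(1,2) _ B] True h r(3)
        have "U ?z (T - \<sigma> + real N * \<tau> + h) \<le> M + C + real N * \<beta> + h * l" by simp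
        then show "U ?z (T + h - \<sigma> + real N * \<tau>) \<le> M + (C + h * l) + real N * \<beta>" by (simp add: algebra_simps)
      next
        fix k'' assume "k'' \<in> integer_points" "?z \<in> cube (e *\<^sub>R k'') s"
        then show "N \<noteq> 0" "k'' = k" using endin True by auto
      qed
      then show ?thesis by blast
    next
      case False
      have zf: "z \<notin> cube (e *\<^sub>R k'') s" if "k'' \<in> integer_points" for k''
      proof
        assume z: "z \<in> cube (e *\<^sub>R k'') s"
        then have "N \<noteq> 0" "k'' = k" using ch that by (auto simp: chasing_def)
        moreover have "k'' = k'" using only[OF that, of 0] h z cube_subset_ccube by auto
        ultimately show False using False by blast
      qed
      from first_entry[OF open_cube zf[OF k'] r(1,3)] obtain p where p: "0 \<le> p" "p \<le> r"
        "z + p *\<^sub>R v \<in> closure (cube (e *\<^sub>R k') s) - cube (e *\<^sub>R k') s"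
        "\<And>q. 0 \<le> q \<Longrightarrow> q \<le> p \<Longrightarrow> z + q *\<^sub>R v \<notin> cube (e *\<^sub>R k') s" by auto
      define w0 where "w0 = z + p *\<^sub>R v"
      have w0: "w0 \<in> surface k'" using p(3) closure_cube_subset unfolding w0_def surface_def by blast
      have w0c: "w0 \<in> ccube (e *\<^sub>R k') s" using w0 by (simp add: surface_def)
      have ph: "p \<le> h" using p r by linarith
      have seg1: "segment_cost F R z v p l" and seg2: "segment_cost F R w0 v (h - p) l"
        unfolding w0_def using segment_cost_split[OF seg p(1) ph] by auto
      have fr: "z + q *\<^sub>R v \<in> free_set" if q: "0 \<le> q" "q \<le> p" for q
        unfolding free_set_def
      proof (intro CollectI ballI notI)
        fix k'' assume k'': "k'' \<in> integer_points" "z + q *\<^sub>R v \<in> cube (e *\<^sub>R k'') s"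
        then have "k'' = k'" using only[of k'' q] q ph cube_subset_ccube by auto
        then show False using k''(2) p(4)[OF q] by simp
      qed
      have "z \<in> free_set" using fr[of 0] p by simp
      then have z: "U z (T - \<sigma> + real N * \<tau>) \<le> M + C + real N * \<beta>" using ch by (simp add: chasing_def)
      have "U w0 (T - \<sigma> + real N * \<tau> + p) \<le> U z (T - \<sigma> + real N * \<tau>) + p * l"
        unfolding w0_def using fr free_set_subset by (intro move_weak[OF p(1) seg1]) auto
      then have w0B: "U w0 (T - \<sigma> + real N * \<tau> + p) \<le> M + C + real N * \<beta> + p * l" using z by linarith
      define t where "t = T - \<sigma> + real N * \<tau> + p + \<tau>"
      have t: "t + (h - p) = T + h - \<sigma> + real (Suc N) * \<tau>" by (simp add: t_def algebra_simps)
      \<comment> \<open>The path is copied up to its entry point \<open>w0\<close>, and a single lag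
        \<open>\<tau>\<close> then serves every point of the surface.\<close>
      have B: "U w t \<le> M + C + real (Suc N) * \<beta> + p * l" if w: "w \<in> surface k'" for w
        using detour[OF k' w0 w, of "T - \<sigma> + real N * \<tau> + p"] w0B \<beta>_ge by (simp add: t_def \<tau>_def[symmetric] algebra_simps)
      have pl: "p * l + (h - p) * l = h * l" "0 \<le> (h - p) * l" using l ph by (simp_all add: left_diff_distrib mult_right_mono)
      have zw: "norm (?z - w0) = (h - p) * norm v" "norm (z - w0) = p * norm v"
        using p ph by (simp_all add: w0_def flip: scaleR_diff_left)
      have "chasing M \<sigma> (T + h) ?z (C + h * l) (Suc N) k' w0"
        unfolding chasing_def
      proof (intro conjI impI ballI k' w0c)
        show "(real (Suc N) - 1) * (e / 2) + norm (?z - w0) \<le> ?V (C + h * l) (T + h)"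
        proof (cases "N = 0")
          case True
          have "norm (?z - w0) \<le> h * norm v" unfolding zw using p by (intro mult_right_mono) auto
          then show ?thesis using True V V0 by simp
        next
          case N: False
          then have q: "q \<in> ccube (e *\<^sub>R k) s" "(real N - 1) * (e / 2) + norm (z - q) \<le> ?V C T" using ch by (auto simp: chasing_def)
          have "e / 2 \<le> norm (w0 - q)" using False N by (intro ccube_gap[OF k' k _ se e w0c q(1)]) auto
          moreover have "norm (w0 - q) \<le> norm (z - w0) + norm (z - q)" using norm_triangle_ineq4[of "z - q" "z - w0"] by simp
          moreover have "p * norm v + (h - p) * norm v = h * norm v" by (simp add: algebra_simps)
          moreover have "(real (Suc N) - 1) * (e / 2) = (real N - 1) * (e / 2) + e / 2" by (simp add: field_simps)
          ultimately show ?thesis using q(2) V zw by linarith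
        qed
      next
        fix w assume w: "w \<in> surface k'"
        have "U w t \<le> M + (C + h * l) + real (Suc N) * \<beta>" using B[OF w] pl by simp
        then show "U w (T + h - \<sigma> + real (Suc N) * \<tau>) \<le> M + (C + h * l) + real (Suc N) * \<beta>"
          by (rule later) (use w surface_subset[OF k'] t ph in auto)
      next
        assume zfree: "?z \<in> free_set"
        have eq: "w0 + (h - p) *\<^sub>R v = ?z" by (simp add: w0_def algebra_simps)
        have "(h - p) * norm v \<le> h * norm v" using p by (intro mult_right_mono) auto
        then have "(h - p) * norm v \<le> e / 4" using h by linarith
        moreover have "w0 + (r - p) *\<^sub>R v \<in> cube (e *\<^sub>R k') s" using r(3) by (simp add: w0_def algebra_simps)
        ultimately have "U (w0 + (h - p) *\<^sub>R v) (t + (h - p)) \<le> M + C + real (Suc N) * \<beta> + p * l + (h - p) * l"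
          using p ph r zfree B by (intro exit_move[OF k' _ _ _ seg2, of "r - p"]) (auto simp: eq)
        then show "U ?z (T + h - \<sigma> + real (Suc N) * \<tau>) \<le> M + (C + h * l) + real (Suc N) * \<beta>"
          unfolding eq t using pl by simp
      next
        fix k'' assume "k'' \<in> integer_points" "?z \<in> cube (e *\<^sub>R k'') s"
        then show "k'' = k'" by (rule endin)
      qed simp
      then show ?thesis by blast
    qed
  qed
qed

text \<open>If the path starts inside a cube, this counts as the first visit. There is no admissible
  motion from \<open>y\<close> in that case, so the bound on the surface has to be provided by the
  second part of \<open>init\<close>.\<close>

lemma chase:
  assumes r: "reach F R y T x C" and x: "x \<in> free_set"
    and init: "y \<in> free_set \<Longrightarrow> U y (- \<sigma>) \<le> M"
      "\<And>k w. k \<in> integer_points \<Longrightarrow> y \<in> cube (e *\<^sub>R k) s \<Longrightarrow> w \<in> surface k \<Longrightarrow> U w (\<tau> - \<sigma>) \<le> M + \<beta>"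
  shows "\<exists>N::nat. (real N - 1) * (e / 2) \<le> (C + m (K + 1) * T) / (K + 1) \<and> U x (T - \<sigma> + real N * \<tau>) \<le> M + C + real N * \<beta>"
proof -
  have start: "\<exists>N k q. chasing M \<sigma> 0 y 0 N k q"
  proof (cases "y \<in> free_set")
    case True
    have "(0::real ^ 'n) \<in> integer_points" by (simp add: integer_points_def)
    then have "chasing M \<sigma> 0 y 0 0 0 y" using True init(1) by (auto simp: chasing_def free_set_def)
    then show ?thesis by blast
  next
    case False
    then obtain k where k: "k \<in> integer_points" "y \<in> cube (e *\<^sub>R k) s" by (auto simp: free_set_def)
    have only: "k' = k" if "k' \<in> integer_points" "y \<in> cube (e *\<^sub>R k') s" for k'
      using close_cubes[OF that(1) k(1), of 0 0 0 0 y] that(2) k(2) e cube_subset_ccube by auto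
    have yc: "y \<in> ccube (e *\<^sub>R k) s" using k(2) cube_subset_ccube by blast
    have lag: "\<And>w. w \<in> surface k \<Longrightarrow> U w (0 - \<sigma> + real 1 * \<tau>) \<le> M + 0 + real 1 * \<beta>" using init(2)[OF k] by simp
    have "chasing M \<sigma> 0 y 0 1 k y"
      unfolding chasing_def using k(1) yc lag False only m_nonneg[of "K + 1"] K by (intro conjI ballI impI) simp_all
    then show ?thesis by blast
  qed
  have R: "0 \<le> R" using K KR by simp
  have "\<exists>N k q. chasing M \<sigma> T x C N k q"
  proof (rule reach_short_induct[where P = "\<lambda>z T C. \<exists>N k q. chasing M \<sigma> T z C N k q", OF r _ start])
    fix z T C v h l
    assume *: "\<exists>N k q. chasing M \<sigma> T z C N k q" "reach F R y T z C" "0 < h" "segment_cost F R z v h l" "h * (norm v + 1) \<le> e / 4"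
    have "h * norm v \<le> h * (norm v + 1)" using *(3) by simp
    then have "h * norm v \<le> e / 4" using *(5) by linarith
    then show "\<exists>N k q. chasing M \<sigma> (T + h) (z + h *\<^sub>R v) (C + h * l) N k q"
      using *(1) chasing_step[OF _ reach_time_nonneg[OF *(2)] reach_cost_nonneg[OF *(2) R] *(3) _ *(4)] by blast
  qed (use e in simp)
  then obtain N k q where ch: "chasing M \<sigma> T x C N k q" by blast
  have V0: "0 \<le> (C + m (K + 1) * T) / (K + 1)"
    using reach_time_nonneg[OF r] reach_cost_nonneg[OF r R] m_nonneg[of "K + 1"] K by simp
  have "(real N - 1) * (e / 2) \<le> (C + m (K + 1) * T) / (K + 1)"
  proof (cases "N = 0")
    case True then show ?thesis using V0 e by simp
  next
    case False
    then have "(real N - 1) * (e / 2) + norm (x - q) \<le> (C + m (K + 1) * T) / (K + 1)" using ch by (simp add: chasing_def)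
    then show ?thesis using norm_ge_zero[of "x - q"] by linarith
  qed
  moreover have "U x (T - \<sigma> + real N * \<tau>) \<le> M + C + real N * \<beta>" using ch x by (simp add: chasing_def)
  ultimately show ?thesis by blast
qed

end

section \<open>Upper bound for the state-constraint solution\<close>

locale constrained_subsolution = hamiltonian F a b m
  for F :: "real ^ 'n \<Rightarrow> real ^ 'n \<Rightarrow> real" and a b m +
  fixes \<Omega> :: "(real ^ 'n) set" and g :: "real ^ 'n \<Rightarrow> real" and u :: "(real ^ 'n) \<times> real \<Rightarrow> real" and K L R :: real
  assumes \<Omega>: "open \<Omega>" and g: "K-lipschitz_on UNIV g" and KR: "K + 1 \<le> R"
    and u: "L-lipschitz_on (\<Omega> \<times> {0..}) u" and LR: "L \<le> R"
    and sub: "viscosity_subsolution_on (\<Omega> \<times> {0<..}) (evolution_operator F) u"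
    and init: "x \<in> \<Omega> \<Longrightarrow> u (x, 0) = g x"
begin

text \<open>Below time \<open>0\<close> the solution is continued by a subsolution, so that the total time lost in detours can
  be granted before the start.\<close>
definition extended :: "real ^ 'n \<Rightarrow> real \<Rightarrow> real" where
  "extended x t = (if 0 \<le> t then u (x, t) else g x - m K * t)"

lemma KR': "K \<le> R" using KR by simp

lemma K0: "0 \<le> K" using lipschitz_on_nonneg[OF g] .

lemma extended_nonpos: "x \<in> \<Omega> \<Longrightarrow> t \<le> 0 \<Longrightarrow> extended x t = g x - m K * t"
  by (cases "t = 0") (auto simp: extended_def init)

text \<open>At negative times, \<open>reach_cost_lower\<close> with momentum \<open>K\<close> yields
  the inequality because \<open>g\<close> has Lipschitz constant \<open>K\<close>; a segment
  crossing time \<open>0\<close> is split there.\<close>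

lemma extended_move:
  assumes h: "0 < h" and seg: "segment_cost F R x v h l" and inO: "\<And>r. 0 \<le> r \<Longrightarrow> r \<le> h \<Longrightarrow> x + r *\<^sub>R v \<in> \<Omega>"
  shows "extended (x + h *\<^sub>R v) (t + h) \<le> extended x t + h * l"
proof -
  have pos: "extended (x + h *\<^sub>R v) (t + h) \<le> extended x t + h * l"
    if "0 \<le> t" "0 < h" "segment_cost F R x v h l" "\<And>r. 0 \<le> r \<Longrightarrow> r \<le> h \<Longrightarrow> x + r *\<^sub>R v \<in> \<Omega>" for x t h
    using subsolution_along_segment[OF cont \<Omega> R0[OF g KR'] u lipschitz_in_space[OF u LR] sub that(3,4,2,1)] that(1,2)
    by (simp add: extended_def)
  have neg: "extended (x + h *\<^sub>R v) (t + h) \<le> extended x t + h * l"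
    if "t + h \<le> 0" "0 < h" "segment_cost F R x v h l" "\<And>r. 0 \<le> r \<Longrightarrow> r \<le> h \<Longrightarrow> x + r *\<^sub>R v \<in> \<Omega>" for x t h
  proof -
    have "K * norm (x + h *\<^sub>R v - x) \<le> h * l + m K * h"
      by (rule reach_cost_lower[OF reach_segment_cost[OF that(2,3)] K0 KR'])
    then have "g (x + h *\<^sub>R v) \<le> g x + (h * l + m K * h)" using g_diff[OF g KR', of "x + h *\<^sub>R v" x] by simp
    then show ?thesis using extended_nonpos[of x t] extended_nonpos[of "x + h *\<^sub>R v" "t + h"] that(1,2) that(4)[of 0] that(4)[of h]
      by (simp add: algebra_simps)
  qed
  consider "0 \<le> t" | "t + h \<le> 0" | "t < 0" "0 < t + h" by linarith
  then show ?thesis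
  proof cases
    case 3
    define p where "p = - t"
    have p: "0 < p" "p < h" using 3 by (auto simp: p_def)
    have "segment_cost F R x v p l" "segment_cost F R (x + p *\<^sub>R v) v (h - p) l"
      using segment_cost_split[OF seg, of p] p by auto
    moreover have "x + p *\<^sub>R v + r *\<^sub>R v \<in> \<Omega>" if "0 \<le> r" "r \<le> h - p" for r
      using inO[of "p + r"] p that by (simp add: scaleR_add_left add.assoc)
    ultimately have "extended (x + p *\<^sub>R v + (h - p) *\<^sub>R v) (t + p + (h - p)) \<le> extended (x + p *\<^sub>R v) (t + p) + (h - p) * l"
      using p by (intro pos) (simp_all add: p_def)
    moreover have "extended (x + p *\<^sub>R v) (t + p) \<le> extended x t + p * l"
      using p segment_cost_split(1)[OF seg, of p] inO by (intro neg) (simp_all add: p_def)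
    moreover have "x + p *\<^sub>R v + (h - p) *\<^sub>R v = x + h *\<^sub>R v" by (simp add: algebra_simps)
    ultimately show ?thesis by (simp add: algebra_simps)
  qed (use pos neg h seg inO in auto)
qed

sublocale moving F a b m extended \<Omega> R
  by unfold_locales (rule extended_move)

text \<open>The price of visiting one cube, divided by its side: \<open>m K\<close> times the lag,
  for starting that much earlier, plus the surcharge \<open>\<beta>\<close>.\<close>

definition lag_cost :: real where "lag_cost = real CARD('n) * (3 * (m K + b) / a + K)"

lemma lag_cost_nonneg: "0 \<le> lag_cost"
  using K0 m_nonneg[OF K0] a b by (simp add: lag_cost_def)

text \<open>The action is at most \<open>K\<close> times the distance, up to
  \<open>\<kappa>\<close>, because waiting at \<open>x\<close> is a competitor. Measuring the
  distance with the larger momentum \<open>K + 1\<close> allows it to be absorbed, which bounds the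
  distance and then the action linearly in \<open>t\<close>.\<close>

lemma near_optimal:
  assumes t: "0 \<le> t" and \<kappa>: "0 < \<kappa>"
  shows "\<exists>y C. reach F R y t x C \<and> g y + C < value_function F R g (x, t) + \<kappa> \<and> (C + m (K + 1) * t) / (K + 1) \<le> m (K + 1) * t + \<kappa>"
proof -
  have "\<exists>y C. reach F R y t x C \<and> g y + C < value_function F R g (x, t) + \<kappa>"
  proof (rule ccontr)
    assume "\<not> ?thesis"
    then have "value_function F R g (x, t) + \<kappa> \<le> value_function F R g (x, t)"
      by (intro value_ge[OF g KR' t]) force
    then show False using \<kappa> by simp
  qed
  then obtain y C where y: "reach F R y t x C" "g y + C < value_function F R g (x, t) + \<kappa>" by blast
  have "value_function F R g (x, t) \<le> g x" by (rule value_upper[OF g KR' t])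
  then have 1: "C \<le> K * norm (x - y) + \<kappa>" using y(2) g_diff[OF g KR', of x y] by linarith
  have "(K + 1) * norm (x - y) \<le> C + m (K + 1) * t" by (rule reach_cost_lower[OF y(1) _ KR]) (use K0 in simp)
  then have "K * ((K + 1) * norm (x - y)) \<le> K * (C + m (K + 1) * t)" by (rule mult_left_mono) (rule K0)
  moreover have "(K + 1) * C \<le> (K + 1) * (K * norm (x - y) + \<kappa>)" using 1 K0 by (intro mult_left_mono) auto
  ultimately have "C + m (K + 1) * t \<le> (m (K + 1) * t + \<kappa>) * (K + 1)" by (simp add: algebra_simps)
  then show ?thesis using y K0 by (auto simp: pos_divide_le_eq)
qed

text \<open>A nearly optimal path is chased with a head start for all possible lags. The number of
  visits is at most of order \<open>1 + t / e\<close>, and each one costs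
  \<open>e * \<delta> * lag_cost\<close>.\<close>

lemma le_value_on_free_set:
  assumes dim: "2 \<le> CARD('n)" and e: "0 < e" and \<delta>: "0 < \<delta>" "\<delta> \<le> 1 / 2"
    and free: "\<And>x. (\<And>k. k \<in> integer_points \<Longrightarrow> x \<notin> cube (e *\<^sub>R k) (e * \<delta> / 2)) \<Longrightarrow> x \<in> \<Omega>"
    and x: "\<And>k. k \<in> integer_points \<Longrightarrow> x \<notin> cube (e *\<^sub>R k) (e * \<delta> / 2)" and t: "0 \<le> t"
  shows "u (x, t) \<le> value_function F R g (x, t) + \<delta> * (3 * e + 2 * m (K + 1) * t) * lag_cost"
proof (rule field_le_epsilon)
  fix \<kappa>' :: real assume "0 < \<kappa>'"
  define \<kappa> where "\<kappa> = min \<kappa>' e"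
  have \<kappa>: "0 < \<kappa>" "\<kappa> \<le> \<kappa>'" "\<kappa> \<le> e" using \<open>0 < \<kappa>'\<close> e by (auto simp: \<kappa>_def)
  interpret cc: cube_chase F a b m extended \<Omega> R K e "e * \<delta> / 2"
  proof unfold_locales
    show "4 * (e * \<delta> / 2) \<le> e" using e \<delta> by simp
  qed (use dim K0 KR e \<delta> free in auto)
  obtain y C where y: "reach F R y t x C" "g y + C < value_function F R g (x, t) + \<kappa>"
    "(C + m (K + 1) * t) / (K + 1) \<le> m (K + 1) * t + \<kappa>" using near_optimal[OF t \<kappa>(1)] by blast
  \<comment> \<open>\<open>(real N - 1) * (e / 2) \<le> m (K + 1) * t + e\<close> solved for
    \<open>N\<close>. The head start \<open>\<sigma>\<close> is fixed with this bound, before the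
    actual \<open>N\<close> is known; a surplus is spent waiting at the end.\<close>
  define N0 where "N0 = 3 + 2 * m (K + 1) * t / e"
  have mK: "0 \<le> m (K + 1)" "0 \<le> m K" using K0 by (auto intro!: m_nonneg)
  have N0: "1 \<le> N0" using mK t e by (simp add: N0_def)
  define \<sigma> where "\<sigma> = N0 * cc.\<tau>"
  have \<sigma>: "cc.\<tau> \<le> \<sigma>" "0 < \<sigma>" using N0 cc.\<tau>_pos by (auto simp: \<sigma>_def)
  have xf: "x \<in> cc.free_set" using x by (simp add: cc.free_set_def)
  have "\<exists>N::nat. (real N - 1) * (e / 2) \<le> (C + m (K + 1) * t) / (K + 1) \<and>
      extended x (t - \<sigma> + real N * cc.\<tau>) \<le> (g y + m K * \<sigma>) + C + real N * cc.\<beta>"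
  proof (rule cc.chase[OF y(1) xf])
    show "extended y (- \<sigma>) \<le> g y + m K * \<sigma>" using \<sigma> by (simp add: extended_def)
    fix k w assume k: "k \<in> integer_points" "y \<in> cube (e *\<^sub>R k) (e * \<delta> / 2)" "w \<in> cc.surface k"
    have "w \<in> \<Omega>" using k(3) cc.surface_subset[OF k(1)] cc.free_set_subset by blast
    then have "extended w (cc.\<tau> - \<sigma>) = g w - m K * (cc.\<tau> - \<sigma>)" using \<sigma> by (intro extended_nonpos) auto
    moreover have "g w - g y \<le> K * norm (w - y)" by (rule g_diff[OF g KR'])
    moreover have "K * norm (w - y) \<le> K * (2 * (e * \<delta> / 2) * real CARD('n))"
      using k cube_subset_ccube K0 by (intro mult_left_mono norm_diff_ccube) (auto simp: cc.surface_def)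
    moreover have "0 \<le> m K * cc.\<tau>" "0 \<le> b * cc.\<tau>" using mK cc.\<tau>_pos b by auto
    moreover have "m K * (cc.\<tau> - \<sigma>) = m K * cc.\<tau> - m K * \<sigma>" by (rule right_diff_distrib)
    ultimately show "extended w (cc.\<tau> - \<sigma>) \<le> g y + m K * \<sigma> + cc.\<beta>" unfolding cc.\<beta>_def by linarith
  qed
  then obtain N :: nat where N: "(real N - 1) * (e / 2) \<le> (C + m (K + 1) * t) / (K + 1)"
    "extended x (t - \<sigma> + real N * cc.\<tau>) \<le> (g y + m K * \<sigma>) + C + real N * cc.\<beta>" by blast
  have "(real N - 1) * (e / 2) \<le> m (K + 1) * t + e" using N(1) y(3) \<kappa>(3) by linarith
  then have NN: "real N \<le> N0" using e by (simp add: N0_def field_simps)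
  then have "real N * cc.\<tau> \<le> \<sigma>" unfolding \<sigma>_def using cc.\<tau>_pos by (intro mult_right_mono) auto
  then have "extended x t \<le> extended x (t - \<sigma> + real N * cc.\<tau>)" using U_mono xf cc.free_set_subset by auto
  also have "\<dots> \<le> (g y + m K * \<sigma>) + C + N0 * cc.\<beta>"
    using N(2) mult_right_mono[OF NN cc.\<beta>_nonneg] by linarith
  also have "\<dots> = g y + C + N0 * (m K * cc.\<tau> + cc.\<beta>)" by (simp add: \<sigma>_def algebra_simps)
  also have "m K * cc.\<tau> + cc.\<beta> = e * \<delta> * lag_cost"
    using a unfolding cc.\<beta>_def cc.\<tau>_def cc.face_time_def lag_cost_def by (simp add: field_simps)
  also have "N0 * (e * \<delta> * lag_cost) = \<delta> * (3 * e + 2 * m (K + 1) * t) * lag_cost"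
    using e by (simp add: N0_def field_simps)
  finally show "u (x, t) \<le> value_function F R g (x, t) + \<delta> * (3 * e + 2 * m (K + 1) * t) * lag_cost + \<kappa>'"
    using y(2) \<kappa>(2) t by (simp add: extended_def)
qed

lemma extended_along_path: "poly_path \<Omega> x y l \<Longrightarrow> extended y (t + l / a) \<le> extended x t + b * (l / a)"
proof (induction rule: poly_path.induct)
  case (poly_step y l z)
  show ?case
  proof (cases "z = y")
    case False
    have "extended z (t + l / a + norm (z - y) / a) \<le> extended y (t + l / a) + b * (norm (z - y) / a)"
      by (rule slow_move[OF poly_step.hyps(2)]) (use False a in auto)
    then show ?thesis using poly_step.IH by (simp add: add_divide_distrib algebra_simps)
  qed (use poly_step.IH in simp)
qed simp

text \<open>\<open>x\<close> is reached from \<open>x'\<close> at action \<open>b * h\<close>, and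
  the value function at \<open>x'\<close> is carried back to \<open>x\<close> at the same price. The
  terms with \<open>m K\<close> come from clipping the earlier time at \<open>0\<close> and from a
  time difference of at most \<open>2 * h\<close>.\<close>

lemma le_value_via_path:
  assumes path: "poly_path \<Omega> x' x l" and h: "l \<le> a * h" "0 < h" and t: "0 \<le> t"
    and E: "\<And>s. 0 \<le> s \<Longrightarrow> s \<le> t \<Longrightarrow> u (x', s) \<le> value_function F R g (x', s) + E"
  shows "u (x, t) \<le> value_function F R g (x, t) + E + (2 * b + 3 * m K) * h"
proof -
  let ?w = "value_function F R g"
  have xO: "x \<in> \<Omega>" "x' \<in> \<Omega>" using poly_path_mem[OF path] by auto
  have mK: "0 \<le> m K" using m_nonneg[OF K0] .
  have la: "l / a \<le> h" using h a by (simp add: pos_divide_le_eq mult.commute)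
  define t' where "t' = max (t - h) 0"
  have t': "0 \<le> t'" "t' \<le> t" "t + h - t' \<le> 2 * h" using t h by (auto simp: t'_def)
  have "extended x t \<le> extended x (t - h + l / a)" using la by (intro U_mono[OF xO(1)]) simp
  also have "\<dots> \<le> extended x' (t - h) + b * (l / a)" by (rule extended_along_path[OF path])
  also have "b * (l / a) \<le> b * h" using la b by (rule mult_left_mono)
  finally have 1: "u (x, t) \<le> extended x' (t - h) + b * h" using t by (simp add: extended_def)
  have 2: "extended x' (t - h) \<le> u (x', t') + m K * h"
  proof (cases "h \<le> t")
    case True then show ?thesis using mK h by (simp add: extended_def t'_def)
  next
    case False
    have "0 \<le> m K * t" using mK t by simp
    then show ?thesis using False extended_nonpos[OF xO(2), of "t - h"] init[OF xO(2)] by (simp add: t'_def algebra_simps)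
  qed
  have 3: "u (x', t') \<le> ?w (x', t') + E" by (rule E[OF t'(1,2)])
  have "?w (x', t') \<le> ?w (x', t' + (t + h - t')) + m K * (t + h - t')"
    using t' h by (intro value_time_lipschitz[OF g KR']) auto
  also have "m K * (t + h - t') \<le> m K * (2 * h)" using t'(3) mK by (rule mult_left_mono)
  finally have 4: "?w (x', t') \<le> ?w (x', t + h) + m K * (2 * h)" by simp
  have "norm (x' - x) \<le> a * h" using poly_path_norm[OF path] h(1) by (simp add: norm_minus_commute)
  from value_dpp[OF g KR' reach_slow[OF this h(2), of R] t] have 5: "?w (x', t + h) \<le> ?w (x, t) + b * h" .
  show ?thesis using 1 2 3 4 5 by (simp add: algebra_simps)
qed

end

lemma poly_path_affine:
  assumes "poly_path A x y l" and q: "0 \<le> q" and sub: "\<And>z. z \<in> A \<Longrightarrow> c + q *\<^sub>R z \<in> B"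
  shows "poly_path B (c + q *\<^sub>R x) (c + q *\<^sub>R y) (q * l)"
  using assms(1)
proof induction
  case poly_refl then show ?case using poly_path.poly_refl[OF sub] by simp
next
  case (poly_step y l z)
  have "closed_segment (c + q *\<^sub>R y) (c + q *\<^sub>R z) \<subseteq> B"
  proof
    fix w assume "w \<in> closed_segment (c + q *\<^sub>R y) (c + q *\<^sub>R z)"
    then obtain r where r: "0 \<le> r" "r \<le> 1" "w = (1 - r) *\<^sub>R (c + q *\<^sub>R y) + r *\<^sub>R (c + q *\<^sub>R z)" by (auto simp: closed_segment_def)
    have "w = c + q *\<^sub>R ((1 - r) *\<^sub>R y + r *\<^sub>R z)" using r(3) by (simp add: algebra_simps)
    moreover have "(1 - r) *\<^sub>R y + r *\<^sub>R z \<in> closed_segment y z" using r by (auto simp: closed_segment_def)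
    ultimately show "w \<in> B" using sub poly_step.hyps(2) by blast
  qed
  from poly_path.poly_step[OF poly_step.IH this]
  have "poly_path B (c + q *\<^sub>R x) (c + q *\<^sub>R z) (q * l + norm (q *\<^sub>R (z - y)))" by (simp add: scaleR_diff_right)
  then show ?case using q by (simp add: distrib_left)
qed

text \<open>All exterior points of the cell are joined by paths of bounded length to the corner
  \<open>vec (1 / 2)\<close>, which lies outside the open cell; each path is cut where it leaves the
  cell.\<close>

lemma exit_path_from_cell:
  fixes D :: "(real ^ 'n) set"
  assumes D: "open D" "has_C1_boundary D" "connected (frontier D)" "D \<noteq> {}" and DQ: "closure D \<subseteq> cube 0 (1 / 2)"
  shows "\<exists>c\<ge>0. \<forall>x\<in>cube 0 (1 / 2) - closure D. \<exists>y\<in>ccube 0 (1 / 2) - cube 0 (1 / 2). \<exists>l\<le>c.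
           poly_path (- closure D \<inter> ccube 0 (1 / 2)) x y l"
proof -
  let ?Q = "ccube (0 :: real ^ 'n) (1 / 2)" and ?q = "vec (1 / 2) :: real ^ 'n"
  have int: "interior ?Q = cube 0 (1 / 2)" by (simp add: ccube_eq_cbox cube_eq_box interior_cbox)
  have q: "?q \<notin> cube 0 (1 / 2)" by (simp add: cube_def)
  then have qD: "?q \<in> - closure D" using DQ by blast
  obtain c where c: "0 \<le> c" "\<And>x. x \<in> ?Q \<inter> - closure D \<Longrightarrow> \<exists>l\<le>c. poly_path (- closure D) x ?q l"
    using exterior_uniformly_accessible[OF D compact_ccube qD] by blast
  have "\<exists>y\<in>?Q - cube 0 (1 / 2). \<exists>l\<le>c. poly_path (- closure D \<inter> ?Q) x y l" if x: "x \<in> cube 0 (1 / 2) - closure D" for x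
  proof -
    have "x \<in> ?Q \<inter> - closure D" using x cube_subset_ccube by blast
    then obtain l where l: "l \<le> c" "poly_path (- closure D) x ?q l" using c(2) by blast
    have "x \<in> interior ?Q" unfolding int using x by simp
    from poly_path_exit[OF l(2) convex_ccube closed_ccube this] q l(1) show ?thesis unfolding int by (meson order_trans)
  qed
  then show ?thesis using c(1) by blast
qed

lemma mem_perforated:
  fixes x :: "real ^ 'n"
  assumes "0 < e"
  shows "x \<in> (\<lambda>x. e *\<^sub>R x) ` perforated_space D r \<longleftrightarrow> (\<forall>k\<in>integer_points. \<forall>z\<in>closure D. x \<noteq> e *\<^sub>R k + (e * r) *\<^sub>R z)"
proof -
  have eq: "x /\<^sub>R e = k + r *\<^sub>R z \<longleftrightarrow> x = e *\<^sub>R k + (e * r) *\<^sub>R z" for k z :: "real ^ 'n"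
  proof -
    have "x /\<^sub>R e = k + r *\<^sub>R z \<longleftrightarrow> e *\<^sub>R (x /\<^sub>R e) = e *\<^sub>R (k + r *\<^sub>R z)" using assms by (simp only: scaleR_cancel_left) auto
    then show ?thesis using assms by (simp add: scaleR_add_right)
  qed
  have "x \<in> (\<lambda>x. e *\<^sub>R x) ` perforated_space D r \<longleftrightarrow> x /\<^sub>R e \<in> perforated_space D r"
    using assms by (auto simp: image_iff intro!: bexI[of _ "x /\<^sub>R e"])
  also have "\<dots> \<longleftrightarrow> (\<forall>k\<in>integer_points. \<forall>z\<in>closure D. x /\<^sub>R e \<noteq> k + r *\<^sub>R z)" by (auto simp: perforated_space_def)
  finally show ?thesis unfolding eq .
qed

lemma open_perforated:
  assumes "compact (closure D)" "0 < e"
  shows "open ((\<lambda>x. e *\<^sub>R x) ` perforated_space D r)"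
proof -
  have "closed (integer_points :: (real ^ 'n) set)"
  proof -
    have "(integer_points :: (real ^ 'n) set) = (\<Inter>i. (\<lambda>x. x $ i) -` \<int>)" by (auto simp: integer_points_def)
    also have "closed \<dots>" by (intro closed_INT ballI continuous_closed_vimage closed_Ints) (auto intro: continuous_intros)
    finally show ?thesis .
  qed
  moreover have "compact ((\<lambda>x. r *\<^sub>R x) ` closure D)" using assms(1) by (rule compact_scaling)
  ultimately have "open (- (\<Union>k\<in>integer_points. \<Union>x\<in>(\<lambda>x. r *\<^sub>R x) ` closure D. {k + x}))" by (intro open_Compl closed_compact_sums)
  moreover have "perforated_space D r = - (\<Union>k\<in>integer_points. \<Union>x\<in>(\<lambda>x. r *\<^sub>R x) ` closure D. {k + x})"
    by (auto simp: perforated_space_def)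
  ultimately have "open (perforated_space D r)" by (simp only:)
  then show ?thesis using assms(2) by (intro open_scaling) auto
qed

lemma perforated_cell:
  fixes k :: "real ^ 'n"
  assumes e: "0 < e" and r: "0 < r" "r \<le> 1 / 2" and k: "k \<in> integer_points" and DQ: "closure D \<subseteq> cube 0 (1 / 2)"
    and z: "z \<in> ccube 0 (1 / 2)" "z \<notin> closure D"
  shows "e *\<^sub>R k + (e * r) *\<^sub>R z \<in> (\<lambda>x. e *\<^sub>R x) ` perforated_space D r"
  unfolding mem_perforated[OF e]
proof (intro ballI notI)
  fix k' z' :: "real ^ 'n" assume k': "k' \<in> integer_points" and z': "z' \<in> closure D"
    and eq: "e *\<^sub>R k + (e * r) *\<^sub>R z = e *\<^sub>R k' + (e * r) *\<^sub>R z'"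
  have cell: "e *\<^sub>R j + (e * r) *\<^sub>R y \<in> ccube (e *\<^sub>R j) (e * r / 2)" if "y \<in> ccube 0 (1 / 2)" for j y :: "real ^ 'n"
    using cube_affine(2)[of "e * r" "e *\<^sub>R j" y "1 / 2"] that e r by simp
  show False
  proof (cases "k' = k")
    case True
    then have "z = z'" using eq e r by simp
    then show False using z(2) z' by simp
  next
    case False
    have "e / 2 \<le> norm ((e *\<^sub>R k + (e * r) *\<^sub>R z) - (e *\<^sub>R k' + (e * r) *\<^sub>R z'))"
      using False z(1) z' DQ cube_subset_ccube e r by (intro ccube_gap[OF k k' _ _ e cell cell]) auto
    then show False using e unfolding eq by simp
  qed
qed

context constrained_subsolution
begin

text \<open>The side of the cubes may exceed the scale \<open>r\<close> of the holes; this freedom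
  covers \<open>r = 0\<close>.\<close>

lemma perforated_le_value_off_cubes:
  assumes dim: "2 \<le> CARD('n)" and e: "0 < e" and Om: "\<Omega> = (\<lambda>x. e *\<^sub>R x) ` perforated_space D r"
    and DQ: "closure D \<subseteq> cube 0 (1 / 2)" and r: "0 \<le> r" "r \<le> \<delta>" and \<delta>: "0 < \<delta>" "\<delta> \<le> 1 / 2"
    and x: "\<And>k. k \<in> integer_points \<Longrightarrow> x \<notin> cube (e *\<^sub>R k) (e * \<delta> / 2)" and t: "0 \<le> t"
  shows "u (x, t) \<le> value_function F R g (x, t) + \<delta> * (3 * e + 2 * m (K + 1) * t) * lag_cost"
proof (rule le_value_on_free_set[OF dim e \<delta> _ x t])
  fix y :: "real ^ 'n" assume y: "\<And>k. k \<in> integer_points \<Longrightarrow> y \<notin> cube (e *\<^sub>R k) (e * \<delta> / 2)"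
  show "y \<in> \<Omega>"
    unfolding Om mem_perforated[OF e]
  proof (intro ballI notI)
    fix k z :: "real ^ 'n" assume k: "k \<in> integer_points" and z: "z \<in> closure D" and eq: "y = e *\<^sub>R k + (e * r) *\<^sub>R z"
    have "e *\<^sub>R k + (e * \<delta>) *\<^sub>R ((r / \<delta>) *\<^sub>R z) \<in> cube (e *\<^sub>R k) ((e * \<delta>) * (1 / 2))"
    proof (subst cube_affine(1))
      have "r / \<delta> * \<bar>z $ i\<bar> < 1 / 2" for i
      proof -
        have "\<bar>z $ i\<bar> < 1 / 2" using z DQ by (auto simp: cube_def)
        moreover have "r / \<delta> * \<bar>z $ i\<bar> \<le> 1 * \<bar>z $ i\<bar>" using r \<delta> by (intro mult_right_mono) auto
        ultimately show ?thesis by linarith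
      qed
      then show "(r / \<delta>) *\<^sub>R z \<in> cube 0 (1 / 2)" using r \<delta> by (simp add: cube_def abs_mult)
    qed (use e \<delta> in simp)
    then have "y \<in> cube (e *\<^sub>R k) (e * \<delta> / 2)" using \<delta> by (simp add: eq)
    then show False using y[OF k] by simp
  qed
qed

text \<open>The holes are lattice points, from which \<open>x\<close> keeps a positive distance
  because \<open>0\<close> belongs to \<open>closure D\<close>. Cubes of every sufficiently small
  side avoid \<open>x\<close>, and the error is proportional to the side.\<close>

lemma perforated_le_value_degenerate:
  assumes dim: "2 \<le> CARD('n)" and e: "0 < e" and Om: "\<Omega> = (\<lambda>x. e *\<^sub>R x) ` perforated_space D 0"
    and D: "closure D \<subseteq> cube 0 (1 / 2)" "0 \<in> closure D" and x: "x \<in> \<Omega>" and t: "0 \<le> t"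
  shows "u (x, t) \<le> value_function F R g (x, t)"
proof -
  have "\<exists>\<delta>0>0. \<delta>0 \<le> 1 / 2 \<and> (\<forall>\<delta>. 0 < \<delta> \<longrightarrow> \<delta> \<le> \<delta>0 \<longrightarrow> (\<forall>k\<in>integer_points. x \<notin> cube (e *\<^sub>R k) (e * \<delta> / 2)))"
  proof (cases "\<exists>k\<in>integer_points. x \<in> cube (e *\<^sub>R k) (e / 4)")
    case True
    then obtain k where k: "k \<in> integer_points" "x \<in> cube (e *\<^sub>R k) (e / 4)" by blast
    have "x \<noteq> e *\<^sub>R k" using x k(1) D(2) unfolding Om mem_perforated[OF e] by fastforce
    then obtain i where i: "x $ i \<noteq> e * k $ i" by (auto simp: vec_eq_iff)
    define \<delta>0 where "\<delta>0 = min (1 / 2) (2 * \<bar>x $ i - e * k $ i\<bar> / e)"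
    have "x \<notin> cube (e *\<^sub>R k') (e * \<delta> / 2)" if \<delta>: "0 < \<delta>" "\<delta> \<le> \<delta>0" and k': "k' \<in> integer_points" for \<delta> k'
    proof
      assume xc: "x \<in> cube (e *\<^sub>R k') (e * \<delta> / 2)"
      have \<delta>2: "\<delta> \<le> 1 / 2" "\<delta> \<le> 2 * \<bar>x $ i - e * k $ i\<bar> / e" using \<delta>(2) by (auto simp: \<delta>0_def)
      show False
      proof (cases "k' = k")
        case True
        then have "\<bar>x $ i - e * k $ i\<bar> < e * \<delta> / 2" using xc by (simp add: cube_def)
        then show False using \<delta>2(2) e by (simp add: field_simps)
      next
        case False
        have "e * \<delta> / 2 \<le> e / 4" using \<delta>2(1) e by simp
        then have "x \<in> ccube (e *\<^sub>R k') (e / 4)" using xc cube_mono cube_subset_ccube by blast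
        then have "e / 2 \<le> norm (x - x)"
          using False k(2) cube_subset_ccube by (intro ccube_gap[OF k' k(1) False _ e]) auto
        then show False using e by simp
      qed
    qed
    moreover have "0 < \<delta>0" using i e by (simp add: \<delta>0_def)
    ultimately show ?thesis by (intro exI[of _ \<delta>0]) (auto simp: \<delta>0_def)
  next
    case False
    have "x \<notin> cube (e *\<^sub>R k) (e * \<delta> / 2)" if "\<delta> \<le> 1 / 2" "k \<in> integer_points" for \<delta> k
    proof
      assume xc: "x \<in> cube (e *\<^sub>R k) (e * \<delta> / 2)"
      have "e * \<delta> / 2 \<le> e / 4" using that(1) e by simp
      then have "x \<in> cube (e *\<^sub>R k) (e / 4)" using xc cube_mono by blast
      then show False using False that(2) by blast
    qed
    then show ?thesis by (intro exI[of _ "1 / 2"]) auto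
  qed
  then obtain \<delta>0 where \<delta>0: "0 < \<delta>0" "\<delta>0 \<le> 1 / 2"
    "\<And>\<delta> k. 0 < \<delta> \<Longrightarrow> \<delta> \<le> \<delta>0 \<Longrightarrow> k \<in> integer_points \<Longrightarrow> x \<notin> cube (e *\<^sub>R k) (e * \<delta> / 2)" by blast
  define X where "X = (3 * e + 2 * m (K + 1) * t) * lag_cost"
  have X: "0 \<le> X" unfolding X_def using e t m_nonneg[of "K + 1"] K0 lag_cost_nonneg by simp
  show ?thesis
  proof (rule field_le_epsilon)
    fix \<kappa> :: real assume \<kappa>: "0 < \<kappa>"
    define \<delta> where "\<delta> = min \<delta>0 (\<kappa> / (X + 1))"
    have \<delta>: "0 < \<delta>" "\<delta> \<le> \<delta>0" "\<delta> \<le> \<kappa> / (X + 1)" using \<delta>0 \<kappa> X by (auto simp: \<delta>_def)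
    have "\<delta> * (X + 1) \<le> \<kappa>" using \<delta>(3) X by (simp add: pos_le_divide_eq)
    then have "\<delta> * X \<le> \<kappa>" using \<delta>(1) by (simp add: algebra_simps)
    moreover have "u (x, t) \<le> value_function F R g (x, t) + \<delta> * X"
      using perforated_le_value_off_cubes[OF dim e Om D(1) order_refl _ \<delta>(1) _ \<delta>0(3)[OF \<delta>(1,2)] t] \<delta> \<delta>0(2)
      by (simp add: X_def mult.assoc)
    ultimately show "u (x, t) \<le> value_function F R g (x, t) + \<kappa>" by linarith
  qed
qed

text \<open>Off the cubes of side \<open>e * r\<close> the chase applies. Inside a cube
  \<open>x\<close> is joined to the surface by a rescaled path of
  \<open>exit_path_from_cell\<close>, for which the time \<open>e * (c + 1) / a\<close> is enough;
  the summand \<open>1\<close> keeps this time positive.\<close>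

lemma perforated_le_value:
  assumes dim: "2 \<le> CARD('n)" and e: "0 < e" and Om: "\<Omega> = (\<lambda>x. e *\<^sub>R x) ` perforated_space D r"
    and D: "closure D \<subseteq> cube 0 (1 / 2)" "0 \<in> closure D" and r: "0 \<le> r" "r \<le> 1 / 2"
    and c: "0 \<le> c" "\<And>z. z \<in> cube 0 (1 / 2) - closure D \<Longrightarrow> \<exists>y\<in>ccube 0 (1 / 2) - cube 0 (1 / 2). \<exists>l\<le>c.
           poly_path (- closure D \<inter> ccube 0 (1 / 2)) z y l"
    and x: "x \<in> \<Omega>" and t: "0 \<le> t"
  shows "u (x, t) \<le> value_function F R g (x, t) + r * (3 * e + 2 * m (K + 1) * t) * lag_cost + (2 * b + 3 * m K) * (e * (c + 1) / a)"
proof -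
  have mK: "0 \<le> m K" "0 \<le> m (K + 1)" using K0 by (auto intro!: m_nonneg)
  have E: "0 \<le> (2 * b + 3 * m K) * (e * (c + 1) / a)" using b mK e c(1) a by simp
  show ?thesis
  proof (cases "r = 0")
    case True
    then show ?thesis using perforated_le_value_degenerate[OF dim e Om[unfolded True] D x t] E by simp
  next
    case False
    then have r0: "0 < r" using r by simp
    have off: "u (y, s) \<le> value_function F R g (y, s) + r * (3 * e + 2 * m (K + 1) * t) * lag_cost"
      if y: "\<And>k. k \<in> integer_points \<Longrightarrow> y \<notin> cube (e *\<^sub>R k) (e * r / 2)" and s: "0 \<le> s" "s \<le> t" for y s
    proof -
      have "r * (3 * e + 2 * m (K + 1) * s) * lag_cost \<le> r * (3 * e + 2 * m (K + 1) * t) * lag_cost"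
        using r0 s mK lag_cost_nonneg by (intro mult_right_mono mult_left_mono add_left_mono) auto
      then show ?thesis using perforated_le_value_off_cubes[OF dim e Om D(1) r(1) order_refl r0 r(2) y s(1)] by linarith
    qed
    show ?thesis
    proof (cases "\<exists>k\<in>integer_points. x \<in> cube (e *\<^sub>R k) (e * r / 2)")
      case False
      then show ?thesis using off[of x t] t E by force
    next
      case True
      then obtain k where k: "k \<in> integer_points" "x \<in> cube (e *\<^sub>R k) (e * r / 2)" by blast
      define z where "z = (x - e *\<^sub>R k) /\<^sub>R (e * r)"
      have er: "0 < e * r" using e r0 by simp
      have xz: "x = e *\<^sub>R k + (e * r) *\<^sub>R z" 
      proof -
        have "e * r \<noteq> 0" using er by linarith
        then have "(e * r) * inverse (e * r) = 1" by (rule right_inverse)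
        then have "(e * r) *\<^sub>R z = x - e *\<^sub>R k" by (simp only: z_def scaleR_scaleR scaleR_one)
        then show ?thesis by simp
      qed
      have "z \<in> cube 0 (1 / 2)" using k(2) cube_affine(1)[OF er, of "e *\<^sub>R k" z "1 / 2"] unfolding xz by simp
      moreover have "z \<notin> closure D" using x k(1) xz unfolding Om mem_perforated[OF e] by blast
      ultimately obtain y l where y: "y \<in> ccube 0 (1 / 2)" "y \<notin> cube 0 (1 / 2)" and l: "l \<le> c"
        "poly_path (- closure D \<inter> ccube 0 (1 / 2)) z y l" using c(2)[of z] by blast
      define x' where "x' = e *\<^sub>R k + (e * r) *\<^sub>R y"
      have "poly_path \<Omega> x x' ((e * r) * l)"
        unfolding xz x'_def
        by (rule poly_path_affine[OF l(2)]) (use er perforated_cell[OF e r0 r(2) k(1) D(1)] in \<open>auto simp: Om\<close>)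
      then have path: "poly_path \<Omega> x' x ((e * r) * l)" by (rule poly_path_sym)
      have off': "x' \<notin> cube (e *\<^sub>R k') (e * r / 2)" if k': "k' \<in> integer_points" for k'
      proof
        assume xc: "x' \<in> cube (e *\<^sub>R k') (e * r / 2)"
        show False
        proof (cases "k' = k")
          case True
          then show False using xc y(2) cube_affine(1)[OF er, of "e *\<^sub>R k" y "1 / 2"] unfolding x'_def by simp
        next
          case False
          have "x' \<in> ccube (e *\<^sub>R k) (e * r / 2)" using y(1) cube_affine(2)[OF er, of "e *\<^sub>R k" y "1 / 2"] by (simp add: x'_def)
          then have "e / 2 \<le> norm (x' - x')"
            using xc cube_subset_ccube e r by (intro ccube_gap[OF k' k(1) False _ e]) auto
          then show False using e by simp
        qed
      qed
      define h where "h = e * (c + 1) / a"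
      have h: "0 < h" using e c(1) a by (simp add: h_def)
      have "e * r * l \<le> e * (r * c)" using l(1) e r0 by simp
      also have "r * c \<le> 1 * (c + 1)" using r c(1) by (intro mult_mono) auto
      then have "e * (r * c) \<le> e * (c + 1)" using e by simp
      finally have "e * r * l \<le> a * h" using a by (simp add: h_def)
      from le_value_via_path[OF path this h t off[OF off']] show ?thesis by (simp add: h_def)
    qed
  qed
qed

end

section \<open>Constants and the final estimate\<close>

lemma lipschitz_if_grad_Linf_norm:
  assumes "L-lipschitz_on UNIV g" "grad_Linf_norm g = ereal K"
  shows "K-lipschitz_on UNIV g"
proof (rule lipschitz_if_AE_onorm_le[OF assms(1)])
  have "AE x in lebesgue. (if g differentiable (at x) then ereal (onorm (frechet_derivative g (at x))) else 0) \<le> ereal K"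
    unfolding assms(2)[symmetric] grad_Linf_norm_def by (rule esssup_AE)
  then show "AE x in lebesgue. g differentiable (at x) \<longrightarrow> onorm (frechet_derivative g (at x)) \<le> K"
    by eventually_elim auto
qed

text \<open>Coercivity gives \<open>H \<ge> 1\<close> outside a ball of radius
  \<open>\<rho>\<close>; convexity along rays from the zero at the origin turns this into growth
  with slope \<open>1 / \<rho>\<close>. The uniform upper bound and modulus of continuity come from
  compactness of a period cell.\<close>

lemma periodic_hamiltonian_exists:
  fixes H :: "real ^ 'n \<Rightarrow> real ^ 'n \<Rightarrow> real"
  assumes cont: "continuous_on UNIV (\<lambda>(y, p). H y p)"
    and per: "\<And>p. integer_periodic (\<lambda>y. H y p)"
    and coercive: "filterlim (\<lambda>p. INF y. H y p) at_top at_infinity"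
    and conv: "\<And>y. convex_on UNIV (H y)"
    and min: "\<And>y. (\<forall>p. H y 0 \<le> H y p) \<and> H y 0 = 0"
  shows "\<exists>a b m. periodic_hamiltonian H a b m"
proof -
  let ?n = "real CARD('n)"
  have nonneg: "0 \<le> H y p" and zero: "H y 0 = 0" for y p using min[of y] by metis+
  have periodic: "H (y + k) p = H y p" if "k \<in> integer_points" for y k p
    using per[of p] that by (auto simp: integer_periodic_def)
  have cell: "\<exists>z\<in>cball 0 ?n. \<forall>p. H y p = H z p" for y
    using integer_points_translate[of y 0] periodic by (metis diff_zero dist_0_norm mem_cball)
  have "\<exists>M. \<forall>y p. norm p \<le> B \<longrightarrow> H y p \<le> M" for B
  proof -
    have "compact ((\<lambda>(y, p). H y p) ` (cball 0 ?n \<times> cball 0 B))"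
      by (intro compact_continuous_image continuous_on_subset[OF cont] compact_Times) auto
    then obtain M where M: "\<And>x. x \<in> (\<lambda>(y, p). H y p) ` (cball 0 ?n \<times> cball 0 B) \<Longrightarrow> norm x \<le> M"
      using compact_imp_bounded bounded_iff by metis
    have "H y p \<le> M" if "norm p \<le> B" for y p
    proof -
      obtain z where z: "z \<in> cball 0 ?n" "H y p = H z p" using cell by metis
      then show ?thesis using M[of "H z p"] that by force
    qed
    then show ?thesis by blast
  qed
  then obtain m where m: "\<And>B y p. norm p \<le> B \<Longrightarrow> H y p \<le> m B" by metis
  have "\<forall>\<^sub>F p in at_infinity. 1 \<le> (INF y. H y p)" using coercive by (simp add: filterlim_at_top)
  then obtain \<rho>' where \<rho>': "\<And>p. \<rho>' \<le> norm p \<Longrightarrow> 1 \<le> (INF y. H y p)" by (auto simp: eventually_at_infinity)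
  define \<rho> where "\<rho> = max \<rho>' 1"
  have \<rho>: "0 < \<rho>" "\<rho>' \<le> \<rho>" by (auto simp: \<rho>_def)
  have big: "1 \<le> H y p" if "\<rho> \<le> norm p" for y p
  proof -
    have "(INF y. H y p) \<le> H y p" using nonneg by (intro cINF_lower bdd_belowI2[of _ 0]) auto
    then show ?thesis using \<rho>'[of p] that \<rho>(2) by linarith
  qed
  have lower: "(1 / \<rho>) * norm p - 1 \<le> H y p" for y p
  proof (cases "\<rho> \<le> norm p")
    case True
    then have p: "0 < norm p" using \<rho> by linarith
    define c where "c = \<rho> / norm p"
    have c: "0 < c" "c \<le> 1" using True \<rho> p by (auto simp: c_def)
    have "norm (c *\<^sub>R p) = \<rho>" using p \<rho> by (simp add: c_def)
    then have "1 \<le> H y (c *\<^sub>R p)" by (intro big) simp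
    also have "\<dots> \<le> (1 - c) * H y 0 + c * H y p" using convex_onD[OF conv, of c 0 p y] c by simp
    finally have "1 \<le> c * H y p" by (simp add: zero)
    then have "(1 / \<rho>) * norm p \<le> H y p" using p \<rho> by (simp add: c_def field_simps)
    then show ?thesis by linarith
  next
    case False
    then have "(1 / \<rho>) * norm p \<le> 1" using \<rho> by (simp add: field_simps)
    then show ?thesis using nonneg[of y p] by linarith
  qed
  have "\<exists>d>0. \<forall>y p q. norm p \<le> B \<longrightarrow> norm (q - p) \<le> d \<longrightarrow> \<bar>H y q - H y p\<bar> \<le> e" if e: "0 < e" for B e
  proof -
    have "uniformly_continuous_on (cball 0 ?n \<times> cball 0 (B + 1)) (\<lambda>(y, p). H y p)"
      by (intro compact_uniformly_continuous continuous_on_subset[OF cont] compact_Times) auto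
    then obtain d where d: "d > 0" "\<And>w w'. w \<in> cball 0 ?n \<times> cball 0 (B + 1) \<Longrightarrow> w' \<in> cball 0 ?n \<times> cball 0 (B + 1) \<Longrightarrow>
        dist w' w < d \<Longrightarrow> dist ((\<lambda>(y, p). H y p) w') ((\<lambda>(y, p). H y p) w) < e"
      using e unfolding uniformly_continuous_on_def by metis
    have "\<bar>H y q - H y p\<bar> \<le> e" if pq: "norm p \<le> B" "norm (q - p) \<le> min (d / 2) 1" for y p q
    proof -
      obtain z where z: "z \<in> cball 0 ?n" "H y p = H z p" "H y q = H z q" using cell by metis
      have "norm q \<le> norm p + norm (q - p)" using norm_triangle_sub by blast
      then have "norm q \<le> B + 1" using pq by simp
      moreover have "dist (z, q) (z, p) < d" using pq d(1) by (simp add: dist_Pair_Pair dist_norm)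
      ultimately have "dist ((\<lambda>(y, p). H y p) (z, q)) ((\<lambda>(y, p). H y p) (z, p)) < e" using pq z(1) by (intro d(2)) auto
      then show ?thesis unfolding z(2,3) by (simp add: dist_real_def)
    qed
    then show ?thesis using d(1) by (intro exI[of _ "min (d / 2) 1"]) auto
  qed
  then have "periodic_hamiltonian H (1 / \<rho>) 1 m"
    using cont zero nonneg conv m lower \<rho>(1) periodic by unfold_locales auto
  then show ?thesis by blast
qed

context homogenized
begin

definition perforation_const :: "real \<Rightarrow> real \<Rightarrow> real" where
  "perforation_const c K = (let lag = real CARD('n) * (3 * (m K + b) / a + K)
     in (3 + 2 * m (K + 1)) * lag + (2 * b + 3 * m K) * (c + 1) / a)"

text \<open>The oscillatory solution is identified with the value function, for which both
  homogenization bounds and the chase are available.\<close>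

lemma perforated_solution_bounds:
  assumes dim: "2 \<le> CARD('n)" and D: "compact (closure D)" "closure D \<subseteq> cube 0 (1 / 2)" "0 \<in> closure D"
    and c: "0 \<le> c" "\<And>z. z \<in> cube 0 (1 / 2) - closure D \<Longrightarrow> \<exists>y\<in>ccube 0 (1 / 2) - cube 0 (1 / 2). \<exists>l\<le>c.
           poly_path (- closure D \<inter> ccube 0 (1 / 2)) z y l"
    and g: "K-lipschitz_on UNIV g" and e: "0 < e" and r: "0 \<le> r" "r \<le> 1 / 2"
    and Om: "\<Omega> = (\<lambda>x. e *\<^sub>R x) ` perforated_space D r"
    and u: "state_constraint_solution \<Omega> (\<lambda>x p. F (x /\<^sub>R e) p) g u"
    and v: "cauchy_solution (\<lambda>x p. F (x /\<^sub>R e) p) g v"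
    and w: "cauchy_solution (\<lambda>x p. Hbar p) g w"
    and x: "x \<in> closure \<Omega>" and t: "0 \<le> t"
  shows "w (x, t) - corrector_lip K * real CARD('n) * e \<le> v (x, t)"
    "v (x, t) \<le> w (x, t) + 2 * (glue_cost + m K * glue_time) * e"
    "v (x, t) \<le> u (x, t)"
    "u (x, t) \<le> v (x, t) + perforation_const c K * (e + r * t)"
proof -
  interpret s: hamiltonian "scaled e" a b m unfolding scaled_def using hamiltonian_scaled[OF e] .
  have K0: "0 \<le> K" using lipschitz_on_nonneg[OF g] .
  obtain Lu where Lu: "Lu-lipschitz_on (closure \<Omega> \<times> {0..}) u" using u unfolding state_constraint_solution_def by blast
  have u': "viscosity_subsolution_on (\<Omega> \<times> {0<..}) (evolution_operator (scaled e)) u"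
    "viscosity_supersolution_on (closure \<Omega> \<times> {0<..}) (evolution_operator (scaled e)) u"
    "\<And>x. x \<in> closure \<Omega> \<Longrightarrow> u (x, 0) = g x"
    using u unfolding state_constraint_solution_def scaled_def by blast+
  obtain Lv where Lv: "Lv-lipschitz_on (UNIV \<times> {0..}) v" using v unfolding cauchy_solution_def by blast
  have v': "viscosity_subsolution_on (UNIV \<times> {0<..}) (evolution_operator (scaled e)) v"
    "viscosity_supersolution_on (UNIV \<times> {0<..}) (evolution_operator (scaled e)) v" "\<And>x. v (x, 0) = g x"
    using v unfolding cauchy_solution_def scaled_def by blast+
  \<comment> \<open>The cutoff is chosen after the solutions and above their Lipschitz constants;
    the final bounds do not contain it.\<close>
  define R where "R = Max {Lu, Lv, K + 1, K + corrector_lip K}"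
  have R: "Lu \<le> R" "Lv \<le> R" "K + 1 \<le> R" "K + corrector_lip K \<le> R" "K \<le> R"
  proof -
    show "Lu \<le> R" "Lv \<le> R" "K + 1 \<le> R" "K + corrector_lip K \<le> R" by (simp_all add: R_def)
    then show "K \<le> R" by linarith
  qed
  let ?val = "value_function (scaled e) R g"
  have val: "v (x, t) = ?val (x, t)" for x
  proof (rule antisym)
    show "v (x, t) \<le> ?val (x, t)" by (rule s.subsolution_le_value[OF g R(5) Lv R(2) v'(1) _ t]) (simp add: v'(3))
    show "?val (x, t) \<le> v (x, t)"
      by (rule s.value_le_supersolution[OF g R(5) closed_UNIV Lv v'(2) _ UNIV_I t]) (simp add: v'(3))
  qed
  show "w (x, t) - corrector_lip K * real CARD('n) * e \<le> v (x, t)"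
    using effective_le_value[OF e w g R(4) t, of x] unfolding val by linarith
  show "v (x, t) \<le> w (x, t) + 2 * (glue_cost + m K * glue_time) * e"
    using value_le_effective[OF e w g R(5) t, of x] unfolding val .
  show "v (x, t) \<le> u (x, t)"
    by (rule comparison_principle[OF s.cont s.UC closed_closure Lv Lu v'(1) u'(2) _ x t]) (use u'(3) v'(3) in auto)
  interpret p: constrained_subsolution "scaled e" a b m \<Omega> g u K Lu R
  proof unfold_locales
    show "open \<Omega>" unfolding Om by (rule open_perforated[OF D(1) e])
    show "Lu-lipschitz_on (\<Omega> \<times> {0..}) u" by (rule lipschitz_on_subset[OF Lu]) (use closure_subset in auto)
    show "u (x, 0) = g x" if "x \<in> \<Omega>" for x using u'(3) closure_subset that by blast
  qed (rule g R u'(1))+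
  have inside: "u (x, t) - v (x, t) \<le> perforation_const c K * (e + r * t)" if "x \<in> \<Omega>" for x
  proof -
    have mK: "0 \<le> m K" "0 \<le> m (K + 1)" using K0 by (auto intro!: m_nonneg)
    define A where "A = p.lag_cost"
    define B where "B = (2 * b + 3 * m K) * (c + 1) / a"
    have AB: "0 \<le> A" "0 \<le> B" using p.lag_cost_nonneg b mK c(1) a by (auto simp: A_def B_def)
    have "u (x, t) - v (x, t) \<le> r * (3 * e + 2 * m (K + 1) * t) * A + B * e"
      using p.perforated_le_value[OF dim e Om D(2,3) r c that t] by (simp add: val A_def B_def ac_simps)
    also have "r * (3 * e + 2 * m (K + 1) * t) \<le> (3 + 2 * m (K + 1)) * (e + r * t)"
    proof -
      have "r * (3 * e) \<le> 1 * (3 * e)" using r e by (intro mult_right_mono) auto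
      moreover have "0 \<le> r * t" "0 \<le> m (K + 1) * e" using r t mK e by auto
      ultimately show ?thesis by (simp add: algebra_simps)
    qed
    then have "r * (3 * e + 2 * m (K + 1) * t) * A \<le> (3 + 2 * m (K + 1)) * (e + r * t) * A" using AB(1) by (rule mult_right_mono)
    also have "B * e \<le> B * (e + r * t)" using AB r t by (intro mult_left_mono) auto
    finally show ?thesis
      unfolding perforation_const_def Let_def p.lag_cost_def[symmetric] A_def[symmetric] B_def[symmetric] by (simp add: algebra_simps)
  qed
  \<comment> \<open>The chase treats points of the open set \<Omega>; its boundary is reached by
    continuity.\<close>
  have "continuous_on (closure \<Omega>) (\<lambda>x. u (x, t))"
    by (rule continuous_on_compose2[OF lipschitz_on_continuous_on[OF Lu]]) (use t in \<open>auto intro!: continuous_intros\<close>)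
  moreover have "continuous_on (closure \<Omega>) (\<lambda>x. v (x, t))"
    by (rule continuous_on_compose2[OF lipschitz_on_continuous_on[OF Lv]]) (use t in \<open>auto intro!: continuous_intros\<close>)
  ultimately have "continuous_on (closure \<Omega>) (\<lambda>x. u (x, t) - v (x, t))" by (rule continuous_on_diff)
  from continuous_le_on_closure[OF this x inside] show "u (x, t) \<le> v (x, t) + perforation_const c K * (e + r * t)" by linarith
qed

end

theorem theorem1p2:
  fixes H :: "real ^ 'n \<Rightarrow> real ^ 'n \<Rightarrow> real"
    and Hbar :: "real ^ 'n \<Rightarrow> real"
    and D :: "(real ^ 'n) set"
    and K :: real
  assumes dim: "CARD('n) \<ge> 2"
    and A1_cont: "continuous_on UNIV (\<lambda>(y, p). H y p)"
    and A1_per: "\<And>p. integer_periodic (\<lambda>y. H y p)"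
    and A2: "filterlim (\<lambda>p. INF y. H y p) at_top at_infinity"
    and A3: "\<And>y. convex_on UNIV (H y)"
    and A5: "\<And>y. (\<forall>p. H y 0 \<le> H y p) \<and> H y 0 = 0"
    and D_open: "open D"
    and D_conn: "connected D"
    and D_zero: "0 \<in> D"
    and D_compactly_contained: "compact (closure D)" "closure D \<subseteq> {x. \<forall>i. - 1 / 2 < x $ i \<and> x $ i < 1 / 2}"
    and D_bdry: "has_C1_boundary D" "connected (frontier D)"
    and Hbar: "is_effective_hamiltonian H Hbar"
  shows "\<exists>C>0. \<exists>C'\<ge>C.
    (\<forall>(g :: real ^ 'n \<Rightarrow> real) (\<eta> :: real \<Rightarrow> real)
       (u :: real \<Rightarrow> (real ^ 'n) \<times> real \<Rightarrow> real)
       (u_per :: real \<Rightarrow> (real ^ 'n) \<times> real \<Rightarrow> real)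
       (u_eff :: (real ^ 'n) \<times> real \<Rightarrow> real).
      bounded (range g) \<and> uniformly_continuous_on UNIV g \<and> (\<exists>L. L-lipschitz_on UNIV g) \<and>
      grad_Linf_norm g = ereal K \<and>
      (\<forall>\<epsilon>\<in>{0..<1/2}. \<eta> \<epsilon> \<in> {0..<1/2}) \<and> (\<eta> \<longlongrightarrow> 0) (at 0 within {0..<1/2}) \<and>
      (\<forall>\<epsilon>\<in>{0<..<1/2}.
         state_constraint_solution (perforated_domain D \<eta> \<epsilon>) (\<lambda>x p. H (x /\<^sub>R \<epsilon>) p) g (u \<epsilon>) \<and>
         cauchy_solution (\<lambda>x p. H (x /\<^sub>R \<epsilon>) p) g (u_per \<epsilon>)) \<and>
      cauchy_solution (\<lambda>x p. Hbar p) g u_eff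
      \<longrightarrow>
      (\<forall>\<epsilon>\<in>{0<..<1/2}. \<forall>x\<in>closure (perforated_domain D \<eta> \<epsilon>). \<forall>t\<ge>0.
         u_eff (x, t) - C * \<epsilon> \<le> u_per \<epsilon> (x, t) \<and>
         u_per \<epsilon> (x, t) \<le> u \<epsilon> (x, t) \<and>
         u \<epsilon> (x, t) \<le> u_per \<epsilon> (x, t) + C * (\<epsilon> + \<eta> \<epsilon> * t) \<and>
         u_per \<epsilon> (x, t) + C * (\<epsilon> + \<eta> \<epsilon> * t) \<le> u_eff (x, t) + C' * (\<epsilon> + \<eta> \<epsilon> * t) \<and>
         \<bar>u \<epsilon> (x, t) - u_eff (x, t)\<bar> \<le> C * (\<epsilon> + \<eta> \<epsilon> * t)))"
proof -
  obtain a b m where "periodic_hamiltonian H a b m"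
    using periodic_hamiltonian_exists[OF A1_cont A1_per A2 A3 A5] by blast
  then interpret homogenized H a b m Hbar by (simp add: homogenized_def homogenized_axioms_def Hbar)
  have "\<bar>y\<bar> < 1 / 2 \<longleftrightarrow> - 1 / 2 < y \<and> y < 1 / 2" for y :: real by linarith
  then have DQ: "closure D \<subseteq> cube 0 (1 / 2)" using D_compactly_contained(2) by (simp add: cube_def)
  have D0: "0 \<in> closure D" using D_zero closure_subset by blast
  obtain c where c: "0 \<le> c" "\<And>z. z \<in> cube 0 (1 / 2) - closure D \<Longrightarrow> \<exists>y\<in>ccube 0 (1 / 2) - cube 0 (1 / 2). \<exists>l\<le>c.
           poly_path (- closure D \<inter> ccube 0 (1 / 2)) z y l"
    using exit_path_from_cell[OF D_open D_bdry _ DQ] D_zero by blast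
  define C1 where "C1 = \<bar>corrector_lip K * real CARD('n)\<bar>"
  define C2 where "C2 = \<bar>2 * (glue_cost + m K * glue_time)\<bar>"
  define C3 where "C3 = \<bar>perforation_const c K\<bar>"
  \<comment> \<open>\<open>C\<close> dominates the sum of the errors, so one constant serves all
    bounds including the one for \<open>u - u_eff\<close>. In the last link of the chain the
    oscillatory solution is replaced by the effective one, which costs at most
    \<open>C2 * \<epsilon>\<close>; hence the larger constant \<open>C + C2\<close> there.\<close>
  define C where "C = 1 + C1 + C2 + C3"
  have C: "0 \<le> C1" "0 \<le> C2" "0 \<le> C3" "0 < C" by (simp_all add: C_def C1_def C2_def C3_def add_pos_nonneg)
  show ?thesis
  proof (rule exI[of _ C], rule conjI, rule C(4), rule exI[of _ "C + C2"], intro conjI allI impI ballI; (elim conjE)?)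
    show "C \<le> C + C2" using C by simp
  next
    fix g :: "real ^ 'n \<Rightarrow> real" and \<eta> :: "real \<Rightarrow> real" and u u_per :: "real \<Rightarrow> (real ^ 'n) \<times> real \<Rightarrow> real"
      and u_eff :: "(real ^ 'n) \<times> real \<Rightarrow> real" and \<epsilon> t :: real and x
    assume lip: "\<exists>L. L-lipschitz_on UNIV g" and grad: "grad_Linf_norm g = ereal K"
      and \<eta>: "\<forall>\<epsilon>\<in>{0..<1/2}. \<eta> \<epsilon> \<in> {0..<1/2}"
      and sol: "\<forall>\<epsilon>\<in>{0<..<1/2}. state_constraint_solution (perforated_domain D \<eta> \<epsilon>) (\<lambda>x p. H (x /\<^sub>R \<epsilon>) p) g (u \<epsilon>) \<and>
         cauchy_solution (\<lambda>x p. H (x /\<^sub>R \<epsilon>) p) g (u_per \<epsilon>)"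
      and eff: "cauchy_solution (\<lambda>x p. Hbar p) g u_eff" and \<epsilon>: "\<epsilon> \<in> {0<..<1/2}"
      and x: "x \<in> closure (perforated_domain D \<eta> \<epsilon>)" and t: "0 \<le> t"
    have g: "K-lipschitz_on UNIV g" using lip lipschitz_if_grad_Linf_norm[OF _ grad] by blast
    have e: "0 < \<epsilon>" and r: "0 \<le> \<eta> \<epsilon>" "\<eta> \<epsilon> \<le> 1 / 2" using \<epsilon> \<eta> by (auto dest!: bspec[of _ _ \<epsilon>])
    have rt: "0 \<le> \<eta> \<epsilon> * t" using r t by simp
    have sc: "state_constraint_solution (perforated_domain D \<eta> \<epsilon>) (\<lambda>x p. H (x /\<^sub>R \<epsilon>) p) g (u \<epsilon>)"
      and cs: "cauchy_solution (\<lambda>x p. H (x /\<^sub>R \<epsilon>) p) g (u_per \<epsilon>)" using sol \<epsilon> by blast+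
    note bd = perforated_solution_bounds[OF dim D_compactly_contained(1) DQ D0 c g e r perforated_domain_def sc cs eff x t]
    have le: "corrector_lip K * real CARD('n) * \<epsilon> \<le> C1 * \<epsilon>" "2 * (glue_cost + m K * glue_time) * \<epsilon> \<le> C2 * \<epsilon>"
      "perforation_const c K * (\<epsilon> + \<eta> \<epsilon> * t) \<le> C3 * (\<epsilon> + \<eta> \<epsilon> * t)"
      using e rt by (auto intro!: mult_right_mono simp: C1_def C2_def C3_def)
    have pos: "0 \<le> C1 * \<epsilon>" "0 \<le> C2 * \<epsilon>" "0 \<le> C3 * \<epsilon>" "0 \<le> C1 * (\<eta> \<epsilon> * t)" "0 \<le> C2 * (\<eta> \<epsilon> * t)" "0 \<le> C3 * (\<eta> \<epsilon> * t)"
      using C e rt by auto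
    have C\<epsilon>: "C * \<epsilon> = \<epsilon> + C1 * \<epsilon> + C2 * \<epsilon> + C3 * \<epsilon>"
      "C * (\<epsilon> + \<eta> \<epsilon> * t) = \<epsilon> + \<eta> \<epsilon> * t + C1 * \<epsilon> + C2 * \<epsilon> + C3 * \<epsilon> + C1 * (\<eta> \<epsilon> * t) + C2 * (\<eta> \<epsilon> * t) + C3 * (\<eta> \<epsilon> * t)"
      "C3 * (\<epsilon> + \<eta> \<epsilon> * t) = C3 * \<epsilon> + C3 * (\<eta> \<epsilon> * t)"
      "(C + C2) * (\<epsilon> + \<eta> \<epsilon> * t) = C * (\<epsilon> + \<eta> \<epsilon> * t) + C2 * \<epsilon> + C2 * (\<eta> \<epsilon> * t)"
      by (simp_all add: C_def algebra_simps)
    note all = bd le pos C\<epsilon> e rt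
    show "u_eff (x, t) - C * \<epsilon> \<le> u_per \<epsilon> (x, t)" using all by linarith
    show "u_per \<epsilon> (x, t) \<le> u \<epsilon> (x, t)" by (rule bd(3))
    show "u \<epsilon> (x, t) \<le> u_per \<epsilon> (x, t) + C * (\<epsilon> + \<eta> \<epsilon> * t)" using all by linarith
    show "u_per \<epsilon> (x, t) + C * (\<epsilon> + \<eta> \<epsilon> * t) \<le> u_eff (x, t) + (C + C2) * (\<epsilon> + \<eta> \<epsilon> * t)" using all by linarith
    show "\<bar>u \<epsilon> (x, t) - u_eff (x, t)\<bar> \<le> C * (\<epsilon> + \<eta> \<epsilon> * t)" unfolding abs_le_iff using all by linarith
  qed
qed

end
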